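(* Let $\mu_0\in\mathcal{M}$ satisfy $$\int_{\mathbb{R}^d\times E}w(y)\mu_0(dx,dy)<\infty,\qquad \mu_0(dx,dy)\le dx\otimes\mu_0^*(dy)$$ for some measure $\mu_0^*$ on $E$ for which $w$ is integrable. Set $T=\zeta(\mu_0)$ and let $(\mu_t)_{t<T}$ be the maximal strong solution to the coagulation-diffusion equation starting from $\mu_0$. Then $(\mu_t)_{t<T}$ is also the minimal non-negative solution $(\nu_t)_{t<T}$ to the equation $$\nu_t=P^\mu_{t0}\mu_0+\int_0^tP^\mu_{ts}K^+(\nu_s)ds,\qquad t<T.$$ Moreover, if $\mu_0$ has integer mass distribution, then so does $(\mu_t)_{t<T}$ (that is, so does $\mu_t$ for all $t<T$). Further, if $\mu_0$ has absolutely continuous mass distribution, then so does $(\mu_t)_{t<T}$.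
   Context: Setting. Fix $d\ge1$. $(E,\mathcal{E})$ is a standard measurable space, with measurable functions $m:E\to(0,\infty)$ (mass) and $a:E\to(0,\infty)$ (diffusivity). $K$ is a finite kernel on $E\times E\times\mathcal{E}$: $K(\cdot,\cdot,A)$ is a finite non-negative measurable function for each $A\in\mathcal{E}$ and $K(y,y',\cdot)$ is a measure for all $y,y'$. $K$ is symmetric in its first two arguments and mass-preserving: $m(z)=m(y)+m(y')$ for $K(y,y',\cdot)$-a.e. $z$, for all $y,y'$. A function $f$ on $E$ is locally bounded if it is bounded on $m^{-1}(B)$ for all compact $B\subseteq(0,\infty)$; it is $K$-decreasing if for all $y,y'$, $f(z)\le f(y)$ for $K(y,y',\cdot)$-a.e. $z$. A continuous function $\phi:(0,\infty)\to(0,\infty)$ is given with $\phi(\lambda m)\le\lambda\phi(m)$ for all $\lambda\ge1$, $m>0$, and $w(y)=a(y)^{d/2}\phi(m(y))$. Standing assumptions: $a$ is locally bounded and $K$-decreasing; $a^{-1}$ is locally bounded; $w$ is uniformly positive (bounded below by a positive constant); $K(y,y',E)\le w(y)w(y')$ for all $y,y'\in E$. State space. $\mathcal{M}$ is the set of finite measures $\mu$ on $\mathbb{R}^d\times E$ whose first marginal $B\mapsto\mu(B\times E)$ is absolutely continuous with respect to Lebesgue measure. Then $\mu(B\times A)=\int_B\mu(x,A)dx$ for a kernel $\mu(x,dy)$ on $\mathbb{R}^d\times\mathcal{E}$, unique for a.a. $x$. Write $\langle f,\mu\rangle$ for the function $x\mapsto\int_E f(y)\mu(x,dy)$ (defined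 a.e.), and $\|\cdot\|_p$ for the $L^p(\mathbb{R}^d)$-norm. A process $(\mu_t)_{t<T}$ in $\mathcal{M}$ (with $T\in(0,\infty]$ and $t\in[0,T)$) is a family in $\mathcal{M}$ with $t\mapsto\mu_t(B\times A)$ measurable for all Borel $B$ and $A\in\mathcal{E}$. For $\mu\in\mathcal{M}$ define measures $$K^+(\mu)(B\times A)=\tfrac12\int_{B\times E\times E}K(y,y',A)\mu(x,dy)\mu(x,dy')dx,\quad K^-(\mu)(B\times A)=\int_{B\times A\times E}K(y,y',E)\mu(x,dy)\mu(x,dy')dx.$$ With $p(t,x,x')=(2\pi t)^{-d/2}\exp\{-|x-x'|^2/2t\}$, for a measure $\mu$ on $\mathbb{R}^d\times E$ and $t>0$, $P_t\mu$ is the measure $P_t\mu(B\times A)=\int_B P_t\mu(x',A)dx'$ with $P_t\mu(x',A)=\int_{\mathbb{R}^d\times A}p(a(y)t,x,x')\mu(dx,dy)$, and $P_0\mu=\mu$. Solutions. The coagulation-diffusion equation is formally $\dot\mu_t=\frac12a\Delta\mu_t+K^+(\mu_t)-K^-(\mu_t)$. A process $(\mu_t)_{t<T}$ in $\mathcal{M}$ is a solution if (1) $\mu_t+\int_0^tP_{t-s}K^-(\mu_s)ds=P_t\mu_0+\int_0^tP_{t-s}K^+(\mu_s)ds$ for $t\in(0,T)$; (2) $\int w(y)\mu_0(dx,dy)<\infty$ and $\mu_0(dx,dy)\le dx\otimes\mu_0^*(dy)$ for some measure $\mu_0^*$ on $E$ for which $w$ is integrable; (3) $\int_0^t\int_Ew^R(y)P_{t-s}K^+(\mu_s)(x,dy)ds<\infty$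 for a.a. $x\in\mathbb{R}^d$, all $R\in(0,\infty)$ and $t<T$, where $w^R(y)=a(y)^{d/2}m(y)1_{\{m(y)\le R\}}$. It is a strong solution if (1) and (2) hold together with $\sup_{s\le t}\|\langle w,\mu_s\rangle\|_1<\infty$ and $\int_0^t\|\langle w^2,\mu_s\rangle\|_\infty ds<\infty$ for all $t<T$. Maximal strong solution. For $\mu_0$ as in the claim there exist $\zeta(\mu_0)\in[\langle w^2,\mu_0^*\rangle^{-1},\infty]$ (with $\infty^{-1}=0$) and a strong solution $(\mu_t)_{t<\zeta(\mu_0)}$ starting from $\mu_0$, such that, for any other solution $(\nu_t)_{t<T}$ starting from $\mu_0$: if $T\le\zeta(\mu_0)$ then $\nu_t=\mu_t$ for all $t<T$; if $T>\zeta(\mu_0)$ then $(\nu_t)_{t<T}$ is not strong. These properties determine $\zeta(\mu_0)$ and $(\mu_t)_{t<\zeta(\mu_0)}$, which is called the maximal strong solution. (If $\zeta(\mu_0)=0$ the family is empty and assertions about it are vacuous.) Propagator. Given the process $(\mu_t)_{t<T}$, let $c_t(x,y)=\int_EK(y,y',E)\mu_t(x,dy')$. $P^\mu_{ts}$ ($0\le s\le t<T$) is the propagator associated to $\frac12a(y)\Delta-c_t(\cdot,y)$: $P^\mu_{ss}\nu=\nu$ and, for $s<t$, $$P^\mu_{ts}\nu(dx',dy)=\int_{x\in\mathbb{R}^d}\nu(dx,dy)\,p(a(y)(t-s),x,x')\left(\int_{C([s,t],\mathbb{R}^d)}\exp\Big\{-\int_s^tc_\tau(\omega_\tau,y)d\tau\Big\}\beta^{s,x;t,x'}_{a(y)}(d\omega)\right)dx',$$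 with $\beta^{s,x;t,x'}_{a}$ the law of the Brownian bridge of diffusivity $a$ (generator $\frac12a\Delta$) from $x$ at time $s$ to $x'$ at time $t$. The minimal non-negative solution of the equation $\nu_t=P^\mu_{t0}\mu_0+\int_0^tP^\mu_{ts}K^+(\nu_s)ds$, $t<T$, is given by $\nu_t=\lim_{k\to\infty}\nu^k_t$ (increasing limit), where $\nu^0_t=P^\mu_{t0}\mu_0$ and $\nu^{k+1}_t=P^\mu_{t0}\mu_0+\int_0^tP^\mu_{ts}K^+(\nu^k_s)ds$ for $k\ge0$. Mass distributions. A measure $\mu$ on $\mathbb{R}^d\times E$ has integer mass distribution if it is supported on $\mathbb{R}^d\times m^{-1}(\mathbb{N})$. It has absolutely continuous mass distribution if there is a kernel $\rho$ on $(0,\infty)\times(\mathcal{B}(\mathbb{R}^d)\otimes\mathcal{E})$ such that, for all $r\in(0,\infty)$, $m(y)=r$ for $\rho(r,\cdot)$-almost all $(x,y)$, and $\mu(dx,dy)=\int_{(0,\infty)}\rho(r,dx,dy)dr$ with $dr$ Lebesgue measure. A process has one of these properties if all its members do. *)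

theory Defs
  imports "HOL-Probability.Probability"
begin

text \<open>
  Conventions. The space $\mathbb{R}^d$ is a type \<open>'v::euclidean_space\<close> with \<open>d = DIM('v)\<close>.
  A measurable space is given by a value of type \<open>'a measure\<close>, of which only \<open>space\<close> and \<open>sets\<close>
  matter. Masses, kernels and time integrals take values in \<open>[0,\<infinity>]\<close> and are of type \<open>ennreal\<close>.
  A process $(\mu_t)_{t<T}$ is a function of a real argument which is only looked at on
  \<open>lifetime T\<close>.
\<close>

section \<open>Measures and kernels\<close>

definition standard_measurable_space :: "'e measure \<Rightarrow> bool" where
  \<comment> \<open>measurably isomorphic to a Borel subset of the real line\<close>
  "standard_measurable_space E \<longleftrightarrow>
    (\<exists>A::real set. A \<in> sets borel \<and>
      (\<exists>f g. f \<in> measurable E (restrict_space borel A) \<and>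
             g \<in> measurable (restrict_space borel A) E \<and>
             (\<forall>y\<in>space E. g (f y) = y) \<and> (\<forall>r\<in>A. f (g r) = r)))"

definition kernel :: "'a measure \<Rightarrow> 'b measure \<Rightarrow> ('a \<Rightarrow> 'b measure) \<Rightarrow> bool" where
  "kernel M N \<kappa> \<longleftrightarrow>
    (\<forall>x\<in>space M. sets (\<kappa> x) = sets N) \<and>
    (\<forall>A\<in>sets N. (\<lambda>x. emeasure (\<kappa> x) A) \<in> borel_measurable M)"

definition finite_kernel :: "'a measure \<Rightarrow> 'b measure \<Rightarrow> ('a \<Rightarrow> 'b measure) \<Rightarrow> bool" where
  "finite_kernel M N \<kappa> \<longleftrightarrow> kernel M N \<kappa> \<and> (\<forall>x\<in>space M. finite_measure (\<kappa> x))"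

definition measure_by :: "'a measure \<Rightarrow> ('a set \<Rightarrow> ennreal) \<Rightarrow> 'a measure" where
  \<comment> \<open>takes the values \<open>f\<close> when \<open>f\<close> is countably additive (the case in all uses below) and is zero
    otherwise\<close>
  "measure_by M f = measure_of (space M) (sets M) f"

section \<open>The coagulation-diffusion model\<close>

definition weight :: "nat \<Rightarrow> ('e \<Rightarrow> real) \<Rightarrow> ('e \<Rightarrow> real) \<Rightarrow> (real \<Rightarrow> real) \<Rightarrow> 'e \<Rightarrow> real" where
  "weight d m a \<phi> y = a y powr (real d / 2) * \<phi> (m y)"

definition capped_weight :: "nat \<Rightarrow> ('e \<Rightarrow> real) \<Rightarrow> ('e \<Rightarrow> real) \<Rightarrow> real \<Rightarrow> 'e \<Rightarrow> real" where
  "capped_weight d m a R y = a y powr (real d / 2) * m y * (if m y \<le> R then 1 else 0)"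

definition locally_bounded :: "'e measure \<Rightarrow> ('e \<Rightarrow> real) \<Rightarrow> ('e \<Rightarrow> real) \<Rightarrow> bool" where
  "locally_bounded E m f \<longleftrightarrow>
    (\<forall>B. compact B \<and> B \<subseteq> {0<..} \<longrightarrow> bounded (f ` (m -` B \<inter> space E)))"

definition K_decreasing ::
    "'e measure \<Rightarrow> ('e \<Rightarrow> 'e \<Rightarrow> 'e measure) \<Rightarrow> ('e \<Rightarrow> real) \<Rightarrow> bool" where
  "K_decreasing E K f \<longleftrightarrow> (\<forall>y\<in>space E. \<forall>y'\<in>space E. AE z in K y y'. f z \<le> f y)"

locale coagulation_diffusion =
  fixes d :: nat
    and E :: "'e measure"
    and m a :: "'e \<Rightarrow> real"
    and K :: "'e \<Rightarrow> 'e \<Rightarrow> 'e measure"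
    and \<phi> :: "real \<Rightarrow> real"
  assumes d_ge_1: "1 \<le> d"
    and standard: "standard_measurable_space E"
    and m_measurable: "m \<in> borel_measurable E"
    and m_pos: "\<And>y. y \<in> space E \<Longrightarrow> 0 < m y"
    and a_measurable: "a \<in> borel_measurable E"
    and a_pos: "\<And>y. y \<in> space E \<Longrightarrow> 0 < a y"
    and K_kernel: "finite_kernel (E \<Otimes>\<^sub>M E) E (\<lambda>(y, y'). K y y')"
    and K_symmetric: "\<And>y y'. y \<in> space E \<Longrightarrow> y' \<in> space E \<Longrightarrow> K y y' = K y' y"
    and K_mass_preserving:
      "\<And>y y'. y \<in> space E \<Longrightarrow> y' \<in> space E \<Longrightarrow> AE z in K y y'. m z = m y + m y'"
    and \<phi>_continuous: "continuous_on {0<..} \<phi>"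
    and \<phi>_pos: "\<And>r. 0 < r \<Longrightarrow> 0 < \<phi> r"
    and \<phi>_sublinear: "\<And>l r. 1 \<le> l \<Longrightarrow> 0 < r \<Longrightarrow> \<phi> (l * r) \<le> l * \<phi> r"
    and a_locally_bounded: "locally_bounded E m a"
    and a_decreasing: "K_decreasing E K a"
    and inverse_a_locally_bounded: "locally_bounded E m (\<lambda>y. inverse (a y))"
    and weight_uniformly_positive: "\<exists>c>0. \<forall>y\<in>space E. c \<le> weight d m a \<phi> y"
    and K_bound: "\<And>y y'. y \<in> space E \<Longrightarrow> y' \<in> space E \<Longrightarrow>
      emeasure (K y y') (space E) \<le> ennreal (weight d m a \<phi> y * weight d m a \<phi> y')"

section \<open>State space and processes\<close>

definition states :: "'e measure \<Rightarrow> ('v::euclidean_space \<times> 'e) measure set" where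
  "states E = {\<mu>. sets \<mu> = sets (borel \<Otimes>\<^sub>M E) \<and> finite_measure \<mu> \<and>
                  absolutely_continuous lborel (distr \<mu> borel fst)}"

definition disintegrates ::
    "'e measure \<Rightarrow> ('v::euclidean_space \<times> 'e) measure \<Rightarrow> ('v \<Rightarrow> 'e measure) \<Rightarrow> bool" where
  "disintegrates E \<mu> \<kappa> \<longleftrightarrow> finite_kernel borel E \<kappa> \<and>
    (\<forall>B\<in>sets borel. \<forall>A\<in>sets E.
       emeasure \<mu> (B \<times> A) = (\<integral>\<^sup>+x\<in>B. emeasure (\<kappa> x) A \<partial>lborel))"

definition fibre :: "'e measure \<Rightarrow> ('v::euclidean_space \<times> 'e) measure \<Rightarrow> 'v \<Rightarrow> 'e measure" where
  \<comment> \<open>the kernel $\mu(x,dy)$: a choice is made, but any two choices agree for almost all \<open>x\<close>\<close>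
  "fibre E \<mu> = (SOME \<kappa>. disintegrates E \<mu> \<kappa>)"

definition bracket ::
    "'e measure \<Rightarrow> ('e \<Rightarrow> ennreal) \<Rightarrow> ('v::euclidean_space \<times> 'e) measure \<Rightarrow> 'v \<Rightarrow> ennreal" where
  "bracket E f \<mu> x = (\<integral>\<^sup>+y. f y \<partial>fibre E \<mu> x)"

definition lifetime :: "ennreal \<Rightarrow> real set" where
  "lifetime T = {t. 0 \<le> t \<and> ennreal t < T}"

definition process ::
    "'e measure \<Rightarrow> ennreal \<Rightarrow> (real \<Rightarrow> ('v::euclidean_space \<times> 'e) measure) \<Rightarrow> bool" where
  "process E T \<mu> \<longleftrightarrow> (\<forall>t\<in>lifetime T. \<mu> t \<in> states E) \<and>
    (\<forall>B\<in>sets borel. \<forall>A\<in>sets E.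
       (\<lambda>t. emeasure (\<mu> t) (B \<times> A)) \<in> borel_measurable (restrict_space borel (lifetime T)))"

definition process_fibre ::
    "'e measure \<Rightarrow> ennreal \<Rightarrow> (real \<Rightarrow> ('v::euclidean_space \<times> 'e) measure)
      \<Rightarrow> real \<Rightarrow> 'v \<Rightarrow> 'e measure" where
  \<comment> \<open>A version of $\mu_t(x,dy)$ that is jointly measurable in \<open>(t,x)\<close>. Choosing \<open>fibre E (\<mu> t)\<close>
    separately for each \<open>t\<close> would not suffice for integrals in time along a path.\<close>
  "process_fibre E T \<mu> = (SOME \<kappa>.
     finite_kernel (borel \<Otimes>\<^sub>M borel) E (\<lambda>(t, x). \<kappa> t x) \<and>
     (\<forall>t\<in>lifetime T. disintegrates E (\<mu> t) (\<kappa> t)))"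

section \<open>Coagulation and diffusion operators\<close>

definition K_plus ::
    "'e measure \<Rightarrow> ('e \<Rightarrow> 'e \<Rightarrow> 'e measure) \<Rightarrow> ('v::euclidean_space \<times> 'e) measure
      \<Rightarrow> ('v \<times> 'e) measure" where
  "K_plus E K \<mu> = measure_by (borel \<Otimes>\<^sub>M E) (\<lambda>S.
     (1 / 2) * (\<integral>\<^sup>+x. (\<integral>\<^sup>+y. (\<integral>\<^sup>+y'. emeasure (K y y') (Pair x -` S)
        \<partial>fibre E \<mu> x) \<partial>fibre E \<mu> x) \<partial>lborel))"

definition K_minus ::
    "'e measure \<Rightarrow> ('e \<Rightarrow> 'e \<Rightarrow> 'e measure) \<Rightarrow> ('v::euclidean_space \<times> 'e) measure
      \<Rightarrow> ('v \<times> 'e) measure" where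
  "K_minus E K \<mu> = measure_by (borel \<Otimes>\<^sub>M E) (\<lambda>S.
     (\<integral>\<^sup>+x. (\<integral>\<^sup>+y. (\<integral>\<^sup>+y'. emeasure (K y y') (space E) * indicator S (x, y)
        \<partial>fibre E \<mu> x) \<partial>fibre E \<mu> x) \<partial>lborel))"

definition heat_kernel :: "real \<Rightarrow> 'v::euclidean_space \<Rightarrow> 'v \<Rightarrow> real" where
  "heat_kernel t x x' =
     (2 * pi * t) powr (- real DIM('v) / 2) * exp (- (norm (x - x'))\<^sup>2 / (2 * t))"

definition heat_fibre ::
    "'e measure \<Rightarrow> ('e \<Rightarrow> real) \<Rightarrow> real \<Rightarrow> ('v::euclidean_space \<times> 'e) measure
      \<Rightarrow> 'v \<Rightarrow> 'e measure" where
  \<comment> \<open>the measure $P_t\mu(x',dy)$, for $t>0$\<close>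
  "heat_fibre E a t \<mu> x' = distr (density \<mu> (\<lambda>(x, y). ennreal (heat_kernel (a y * t) x x'))) E snd"

definition heat_flow ::
    "'e measure \<Rightarrow> ('e \<Rightarrow> real) \<Rightarrow> real \<Rightarrow> ('v::euclidean_space \<times> 'e) measure
      \<Rightarrow> ('v \<times> 'e) measure" where
  "heat_flow E a t \<mu> =
     (if t = 0 then \<mu>
      else measure_by (borel \<Otimes>\<^sub>M E) (\<lambda>S.
        \<integral>\<^sup>+x'. emeasure (heat_fibre E a t \<mu> x') (Pair x' -` S) \<partial>lborel))"

section \<open>Solutions\<close>

definition dominated ::
    "'e measure \<Rightarrow> ('e \<Rightarrow> real) \<Rightarrow> ('v::euclidean_space \<times> 'e) measure \<Rightarrow> 'e measure \<Rightarrow> bool" where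
  \<comment> \<open>$\mu_0(dx,dy) \le dx \otimes \mu_0^*(dy)$, where \<open>w\<close> is integrable for $\mu_0^*$\<close>
  "dominated E w \<mu>0 \<mu>s \<longleftrightarrow> sets \<mu>s = sets E \<and> (\<integral>\<^sup>+y. ennreal (w y) \<partial>\<mu>s) < \<infinity> \<and>
    (\<forall>S\<in>sets (borel \<Otimes>\<^sub>M E). emeasure \<mu>0 S \<le> emeasure (lborel \<Otimes>\<^sub>M \<mu>s) S)"

definition initial_condition ::
    "'e measure \<Rightarrow> ('e \<Rightarrow> real) \<Rightarrow> ('v::euclidean_space \<times> 'e) measure \<Rightarrow> bool" where
  "initial_condition E w \<mu>0 \<longleftrightarrow>
    (\<integral>\<^sup>+z. ennreal (w (snd z)) \<partial>\<mu>0) < \<infinity> \<and> (\<exists>\<mu>s. dominated E w \<mu>0 \<mu>s)"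

definition mild_equation ::
    "'e measure \<Rightarrow> ('e \<Rightarrow> real) \<Rightarrow> ('e \<Rightarrow> 'e \<Rightarrow> 'e measure) \<Rightarrow> ennreal
      \<Rightarrow> (real \<Rightarrow> ('v::euclidean_space \<times> 'e) measure) \<Rightarrow> bool" where
  "mild_equation E a K T \<mu> \<longleftrightarrow>
    (\<forall>t\<in>lifetime T - {0}. \<forall>S\<in>sets (borel \<Otimes>\<^sub>M E).
       emeasure (\<mu> t) S +
         (\<integral>\<^sup>+s\<in>{0..t}. emeasure (heat_flow E a (t - s) (K_minus E K (\<mu> s))) S \<partial>lborel) =
       emeasure (heat_flow E a t (\<mu> 0)) S +
         (\<integral>\<^sup>+s\<in>{0..t}. emeasure (heat_flow E a (t - s) (K_plus E K (\<mu> s))) S \<partial>lborel))"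

definition solution ::
    "'e measure \<Rightarrow> ('e \<Rightarrow> real) \<Rightarrow> ('e \<Rightarrow> real) \<Rightarrow> ('e \<Rightarrow> 'e \<Rightarrow> 'e measure) \<Rightarrow> (real \<Rightarrow> real)
      \<Rightarrow> ennreal \<Rightarrow> (real \<Rightarrow> ('v::euclidean_space \<times> 'e) measure) \<Rightarrow> bool" where
  "solution E m a K \<phi> T \<mu> \<longleftrightarrow>
    0 < T \<and> process E T \<mu> \<and> mild_equation E a K T \<mu> \<and>
    initial_condition E (weight DIM('v) m a \<phi>) (\<mu> 0) \<and>
    (\<forall>R>0. \<forall>t\<in>lifetime T. AE x in lborel.
       (\<integral>\<^sup>+s\<in>{0..t}. (\<integral>\<^sup>+y. ennreal (capped_weight DIM('v) m a R y)
          \<partial>heat_fibre E a (t - s) (K_plus E K (\<mu> s)) x) \<partial>lborel) < \<infinity>)"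

definition strong_solution ::
    "'e measure \<Rightarrow> ('e \<Rightarrow> real) \<Rightarrow> ('e \<Rightarrow> real) \<Rightarrow> ('e \<Rightarrow> 'e \<Rightarrow> 'e measure) \<Rightarrow> (real \<Rightarrow> real)
      \<Rightarrow> ennreal \<Rightarrow> (real \<Rightarrow> ('v::euclidean_space \<times> 'e) measure) \<Rightarrow> bool" where
  "strong_solution E m a K \<phi> T \<mu> \<longleftrightarrow>
    0 < T \<and> process E T \<mu> \<and> mild_equation E a K T \<mu> \<and>
    initial_condition E (weight DIM('v) m a \<phi>) (\<mu> 0) \<and>
    (\<forall>t\<in>lifetime T.
       (SUP s\<in>{0..t}. \<integral>\<^sup>+x. bracket E (\<lambda>y. ennreal (weight DIM('v) m a \<phi> y)) (\<mu> s) x \<partial>lborel) < \<infinity> \<and>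
       (\<integral>\<^sup>+s\<in>{0..t}. esssup lborel
          (bracket E (\<lambda>y. ennreal ((weight DIM('v) m a \<phi> y)\<^sup>2)) (\<mu> s)) \<partial>lborel) < \<infinity>)"

definition maximal_strong_solution ::
    "'e measure \<Rightarrow> ('e \<Rightarrow> real) \<Rightarrow> ('e \<Rightarrow> real) \<Rightarrow> ('e \<Rightarrow> 'e \<Rightarrow> 'e measure) \<Rightarrow> (real \<Rightarrow> real)
      \<Rightarrow> ('v::euclidean_space \<times> 'e) measure \<Rightarrow> ennreal \<Rightarrow> (real \<Rightarrow> ('v \<times> 'e) measure) \<Rightarrow> bool" where
  \<comment> \<open>\<open>\<zeta>\<close> and $(\mu_t)_{t<\zeta}$ are determined by this property. When \<open>\<zeta> = 0\<close>
    the process is empty.\<close>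
  "maximal_strong_solution E m a K \<phi> \<mu>0 \<zeta> \<mu> \<longleftrightarrow>
    (\<forall>\<mu>s. dominated E (weight DIM('v) m a \<phi>) \<mu>0 \<mu>s \<longrightarrow>
       inverse (\<integral>\<^sup>+y. ennreal ((weight DIM('v) m a \<phi> y)\<^sup>2) \<partial>\<mu>s) \<le> \<zeta>) \<and>
    (0 < \<zeta> \<longrightarrow> strong_solution E m a K \<phi> \<zeta> \<mu> \<and> \<mu> 0 = \<mu>0) \<and>
    (\<forall>T \<nu>. solution E m a K \<phi> T \<nu> \<and> \<nu> 0 = \<mu>0 \<longrightarrow>
       (T \<le> \<zeta> \<longrightarrow> (\<forall>t\<in>lifetime T. \<nu> t = \<mu> t)) \<and>
       (\<zeta> < T \<longrightarrow> \<not> strong_solution E m a K \<phi> T \<nu>))"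

section \<open>Brownian bridge\<close>

definition path_space :: "real \<Rightarrow> real \<Rightarrow> (real \<Rightarrow> 'v::euclidean_space) measure" where
  \<comment> \<open>$C([s,t],\mathbb{R}^d)$ with the \<open>\<sigma>\<close>-algebra generated by the evaluations; elements of the
    product space are \<open>undefined\<close> outside \<open>{s..t}\<close>\<close>
  "path_space s t = restrict_space (PiM {s..t} (\<lambda>_. borel)) {\<omega>. continuous_on {s..t} \<omega>}"

primrec pinned_mass ::
    "real \<Rightarrow> real \<Rightarrow> 'v::euclidean_space \<Rightarrow> real \<Rightarrow> 'v \<Rightarrow> (real \<times> 'v set) list \<Rightarrow> ennreal" where
  \<comment> \<open>$\int_{A_1}\dots\int_{A_n} p(\alpha(r_1-s),x,z_1)\, p(\alpha(r_2-r_1),z_1,z_2) \cdots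
    p(\alpha(t-r_n),z_n,x')\, dz_n \dots dz_1$ for the list of the pairs $(r_i,A_i)$\<close>
  "pinned_mass s \<alpha> x t x' [] = ennreal (heat_kernel (\<alpha> * (t - s)) x x')"
| "pinned_mass s \<alpha> x t x' (rA # L) =
     (\<integral>\<^sup>+z\<in>snd rA. ennreal (heat_kernel (\<alpha> * (fst rA - s)) x z) * pinned_mass (fst rA) \<alpha> z t x' L
       \<partial>lborel)"

definition is_bridge_law ::
    "real \<Rightarrow> real \<Rightarrow> 'v::euclidean_space \<Rightarrow> real \<Rightarrow> 'v \<Rightarrow> (real \<Rightarrow> 'v) measure \<Rightarrow> bool" where
  \<comment> \<open>The finite-dimensional distributions of Brownian motion of diffusivity \<open>\<alpha>\<close> from \<open>x\<close> at time
    \<open>s\<close>, conditioned to be at \<open>x'\<close> at time \<open>t\<close>. The empty list gives total mass one.\<close>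
  "is_bridge_law \<alpha> s x t x' B \<longleftrightarrow>
    sets B = sets (path_space s t) \<and>
    (AE \<omega> in B. \<omega> s = x \<and> \<omega> t = x') \<and>
    (\<forall>L. sorted_wrt (<) (map fst L) \<and> (\<forall>(r, A)\<in>set L. s < r \<and> r < t \<and> A \<in> sets borel) \<longrightarrow>
       ennreal (heat_kernel (\<alpha> * (t - s)) x x') *
         emeasure B {\<omega>\<in>space B. \<forall>(r, A)\<in>set L. \<omega> r \<in> A} = pinned_mass s \<alpha> x t x' L)"

definition bridge_law ::
    "real \<Rightarrow> real \<Rightarrow> 'v::euclidean_space \<Rightarrow> real \<Rightarrow> 'v \<Rightarrow> (real \<Rightarrow> 'v) measure" where
  "bridge_law \<alpha> s x t x' = (THE B. is_bridge_law \<alpha> s x t x' B)"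

section \<open>The propagator and the minimal solution\<close>

definition coag_rate ::
    "'e measure \<Rightarrow> ('e \<Rightarrow> 'e \<Rightarrow> 'e measure) \<Rightarrow> ennreal
      \<Rightarrow> (real \<Rightarrow> ('v::euclidean_space \<times> 'e) measure) \<Rightarrow> real \<Rightarrow> 'v \<Rightarrow> 'e \<Rightarrow> ennreal" where
  "coag_rate E K T \<mu> t x y = (\<integral>\<^sup>+y'. emeasure (K y y') (space E) \<partial>process_fibre E T \<mu> t x)"

definition exp_neg :: "ennreal \<Rightarrow> ennreal" where
  "exp_neg r = (if r = \<infinity> then 0 else ennreal (exp (- enn2real r)))"

definition propagator ::
    "'e measure \<Rightarrow> ('e \<Rightarrow> real) \<Rightarrow> ('e \<Rightarrow> 'e \<Rightarrow> 'e measure) \<Rightarrow> ennreal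
      \<Rightarrow> (real \<Rightarrow> ('v::euclidean_space \<times> 'e) measure) \<Rightarrow> real \<Rightarrow> real
      \<Rightarrow> ('v \<times> 'e) measure \<Rightarrow> ('v \<times> 'e) measure" where
  "propagator E a K T \<mu> t s \<nu> =
     (if s = t then \<nu>
      else measure_by (borel \<Otimes>\<^sub>M E) (\<lambda>S.
        \<integral>\<^sup>+x'. (\<integral>\<^sup>+(x, y). indicator S (x', y) * ennreal (heat_kernel (a y * (t - s)) x x') *
          (\<integral>\<^sup>+\<omega>. exp_neg (\<integral>\<^sup>+\<tau>\<in>{s..t}. coag_rate E K T \<mu> \<tau> (\<omega> \<tau>) y \<partial>lborel)
             \<partial>bridge_law (a y) s x t x') \<partial>\<nu>) \<partial>lborel))"

definition propagator_rhs ::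
    "'e measure \<Rightarrow> ('e \<Rightarrow> real) \<Rightarrow> ('e \<Rightarrow> 'e \<Rightarrow> 'e measure) \<Rightarrow> ennreal
      \<Rightarrow> (real \<Rightarrow> ('v::euclidean_space \<times> 'e) measure) \<Rightarrow> ('v \<times> 'e) measure
      \<Rightarrow> (real \<Rightarrow> ('v \<times> 'e) measure) \<Rightarrow> real \<Rightarrow> ('v \<times> 'e) measure" where
  \<comment> \<open>$P^\mu_{t0}\mu_0 + \int_0^t P^\mu_{ts} K^+(\nu_s)\,ds$\<close>
  "propagator_rhs E a K T \<mu> \<mu>0 \<nu> t = measure_by (borel \<Otimes>\<^sub>M E) (\<lambda>S.
     emeasure (propagator E a K T \<mu> t 0 \<mu>0) S +
     (\<integral>\<^sup>+s\<in>{0..t}. emeasure (propagator E a K T \<mu> t s (K_plus E K (\<nu> s))) S \<partial>lborel))"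

primrec propagator_iterate ::
    "'e measure \<Rightarrow> ('e \<Rightarrow> real) \<Rightarrow> ('e \<Rightarrow> 'e \<Rightarrow> 'e measure) \<Rightarrow> ennreal
      \<Rightarrow> (real \<Rightarrow> ('v::euclidean_space \<times> 'e) measure) \<Rightarrow> ('v \<times> 'e) measure
      \<Rightarrow> nat \<Rightarrow> real \<Rightarrow> ('v \<times> 'e) measure" where
  "propagator_iterate E a K T \<mu> \<mu>0 0 = (\<lambda>t. propagator E a K T \<mu> t 0 \<mu>0)"
| "propagator_iterate E a K T \<mu> \<mu>0 (Suc k) =
     propagator_rhs E a K T \<mu> \<mu>0 (propagator_iterate E a K T \<mu> \<mu>0 k)"

definition propagator_solution ::
    "'e measure \<Rightarrow> ('e \<Rightarrow> real) \<Rightarrow> ('e \<Rightarrow> 'e \<Rightarrow> 'e measure) \<Rightarrow> ennreal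
      \<Rightarrow> (real \<Rightarrow> ('v::euclidean_space \<times> 'e) measure) \<Rightarrow> ('v \<times> 'e) measure
      \<Rightarrow> (real \<Rightarrow> ('v \<times> 'e) measure) \<Rightarrow> bool" where
  "propagator_solution E a K T \<mu> \<mu>0 \<nu> \<longleftrightarrow>
    process E T \<nu> \<and> (\<forall>t\<in>lifetime T. \<nu> t = propagator_rhs E a K T \<mu> \<mu>0 \<nu> t)"

definition minimal_propagator_solution ::
    "'e measure \<Rightarrow> ('e \<Rightarrow> real) \<Rightarrow> ('e \<Rightarrow> 'e \<Rightarrow> 'e measure) \<Rightarrow> ennreal
      \<Rightarrow> (real \<Rightarrow> ('v::euclidean_space \<times> 'e) measure) \<Rightarrow> ('v \<times> 'e) measure
      \<Rightarrow> (real \<Rightarrow> ('v \<times> 'e) measure) \<Rightarrow> bool" where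
  \<comment> \<open>a solution, below every other one, and the increasing limit of the iterates\<close>
  "minimal_propagator_solution E a K T \<mu> \<mu>0 \<nu> \<longleftrightarrow>
    propagator_solution E a K T \<mu> \<mu>0 \<nu> \<and>
    (\<forall>\<nu>'. propagator_solution E a K T \<mu> \<mu>0 \<nu>' \<longrightarrow>
       (\<forall>t\<in>lifetime T. \<forall>S\<in>sets (borel \<Otimes>\<^sub>M E). emeasure (\<nu> t) S \<le> emeasure (\<nu>' t) S)) \<and>
    (\<forall>t\<in>lifetime T. \<forall>S\<in>sets (borel \<Otimes>\<^sub>M E).
       incseq (\<lambda>k. emeasure (propagator_iterate E a K T \<mu> \<mu>0 k t) S) \<and>
       (\<lambda>k. emeasure (propagator_iterate E a K T \<mu> \<mu>0 k t) S) \<longlonglongrightarrow> emeasure (\<nu> t) S)"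

section \<open>Mass distributions\<close>

definition integer_mass_distribution ::
    "('e \<Rightarrow> real) \<Rightarrow> ('v::euclidean_space \<times> 'e) measure \<Rightarrow> bool" where
  "integer_mass_distribution m \<mu> \<longleftrightarrow> (AE z in \<mu>. m (snd z) \<in> \<nat>)"

definition ac_mass_distribution ::
    "'e measure \<Rightarrow> ('e \<Rightarrow> real) \<Rightarrow> ('v::euclidean_space \<times> 'e) measure \<Rightarrow> bool" where
  "ac_mass_distribution E m \<mu> \<longleftrightarrow>
    (\<exists>\<rho>. kernel (restrict_space borel {0<..}) (borel \<Otimes>\<^sub>M E) \<rho> \<and>
         (\<forall>r>0. AE z in \<rho> r. m (snd z) = r) \<and>
         (\<forall>S\<in>sets (borel \<Otimes>\<^sub>M E).
            emeasure \<mu> S = (\<integral>\<^sup>+r\<in>{0<..}. emeasure (\<rho> r) S \<partial>lborel)))"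

end

theory Submission
  imports Defs
begin

text \<open>
The proof compares three measure-valued families: the strong solution \<open>\<mu>\<close>, the map
\<open>\<nu> \<mapsto> rhs \<nu>\<close> that sends a process to the right-hand side of the propagator equation,
and the iterates of that map from the zero process.

The propagator kills a Brownian particle of type \<open>y\<close> at rate \<open>c\<close>, the rate at which \<open>\<mu>\<close> makes it
coagulate. The Feynman-Kac identity (\<open>feynman_kac\<close>), integrated against the sources, becomes a
Duhamel formula (\<open>evolve_duhamel\<close>): \<open>rhs \<nu>\<close>, plus the heat flow of the mass that it loses at rate
\<open>c\<close>, equals the heat flow of the initial state and of \<open>K\<^sup>+(\<nu>)\<close>. For \<open>\<nu> = \<mu>\<close> the same identity, with
\<open>\<mu>\<close> in place of \<open>rhs \<mu>\<close>, is the mild equation. The difference of \<open>\<mu>\<close> and \<open>rhs \<mu>\<close> thus satisfies a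
homogeneous linear Volterra inequality on the set of particles of bounded weight, and vanishes
there by Gronwall's lemma (\<open>strong_solution_fixed_point\<close>).

Since \<open>K\<^sup>+\<close> is monotone, the iterates increase and stay below every solution of the propagator
equation, in particular below \<open>\<mu>\<close>. Minimality is therefore the statement that they exhaust \<open>\<mu>\<close>.
The weight \<open>w\<close> is subadditive in a coagulation, because \<open>\<phi>\<close> is sublinear and \<open>a\<close> decreases. Hence the
weight gained by \<open>\<mu>\<close> beyond that gained by an iterate is paid for by the weight it loses, up to
\<open>\<parallel>\<langle>w\<^sup>2, \<mu>\<rangle>\<parallel>\<^sub>\<infinity>\<close> times the missing weight (\<open>gained_inequality\<close>). In the limit the missing weight
satisfies Gronwall's inequality and is zero (\<open>deficit_zero\<close>); \<open>w\<close> is bounded below, so nothing is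
missing at all (\<open>approx_limit\<close>).

Statements about masses pass through the iterates, since a set that is null for every iterate is
null for \<open>\<mu>\<close>. Integer masses are stable under addition. For absolutely continuous masses the stable
property is that the joint law of position and mass has a density: diffusion makes it
so at positive times, and coagulation at one point adds two masses, of which one has a density
(\<open>ac_law_gain\<close>). Disintegration over position and mass then gives the kernel.

Two constructions prepare this. A process has a version of its fibres that is jointly
measurable in time and space, and Brownian bridges exist, depend measurably on their end points, and
have the Markov property. Measures that are only given by their values on sets are handled through
the integral they define, as positive functionals that commute with increasing limits.
\<close>
section \<open>Notation\<close>

text \<open>Nonnegative integrals, their measurability and product measures occur in almost every line; the short
forms \<open>INT+x. f d/M\<close>, \<open>Bm M\<close> and \<open>M >< N\<close> keep these lines readable.\<close>

syntax
 "_nnI" :: "pttrn => ennreal => 'a measure => ennreal" ("INT+(2 _./ _)/ d'/_" [60,61] 110)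
 "_nnIs" :: "pttrn => 'a set => 'a measure => ennreal => ennreal" ("(INT+((_)\<in>(_)./ _)/d'/_)" [0,0,0,110] 10)
translations
 "INT+x. f d/M" => "CONST nn_integral M (%x. f)"
 "INT+x\<in>A. f d/M" => "CONST set_nn_integral M A (%x. f)"

notation pair_measure (infixr "><" 80)
abbreviation "Bm M == borel_measurable M"
abbreviation "Em == emeasure"
abbreviation "Ind == indicator"
abbreviation "hk t x y == ennreal (heat_kernel t x y)"

section \<open>Positive functionals and kernels\<close>

text \<open>A set function of the form \<open>S \<mapsto> \<Phi> (Ind S)\<close> is a measure with integral \<open>\<Phi>\<close> as soon as \<open>\<Phi>\<close> has these
four properties. They are stable under sums, integrals and composition with kernels, which proves
countable additivity for all measures below at once.\<close>

definition positive_functional :: "'a measure => (('a => ennreal) => ennreal) => bool" where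
 "positive_functional M \<Phi> \<longleftrightarrow>
  (\<forall>f\<in>Bm M. \<forall>g\<in>Bm M. (\<forall>x\<in>space M. f x = g x) \<longrightarrow> \<Phi> f = \<Phi> g) &
  (\<forall>c. \<forall>f\<in>Bm M. \<Phi> (%x. c * f x) = c * \<Phi> f) &
  (\<forall>f\<in>Bm M. \<forall>g\<in>Bm M. \<Phi> (%x. f x + g x) = \<Phi> f + \<Phi> g) &
  (\<forall>F. (\<forall>n::nat. F n : Bm M) \<longrightarrow> incseq F \<longrightarrow>
   \<Phi> (%x. SUP n. F n x) = (SUP n. \<Phi> (F n)))"

lemma positive_functionalI:
 assumes "!!f g. f : Bm M ==> g : Bm M ==> (!!x. x : space M ==> f x = g x) ==> \<Phi> f = \<Phi> g"
  and "!!c f. f : Bm M ==> \<Phi> (%x. c * f x) = c * \<Phi> f"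
  and "!!f g. f : Bm M ==> g : Bm M ==> \<Phi> (%x. f x + g x) = \<Phi> f + \<Phi> g"
  and "!!F. (!!n::nat. F n : Bm M) ==> incseq F ==> \<Phi> (%x. SUP n. F n x) = (SUP n. \<Phi> (F n))"
 shows "positive_functional M \<Phi>"
 using assms unfolding positive_functional_def by blast

lemma sets_measure_by[simp, measurable_cong]: "sets (measure_by N f) = sets N"
 by (simp add: measure_by_def)

context
 fixes M :: "'a measure" and \<Phi>
 assumes \<Phi>: "positive_functional M \<Phi>"
begin

lemma positive_functional_cong:
 "f : Bm M ==> g : Bm M ==> (!!x. x : space M ==> f x = g x) ==> \<Phi> f = \<Phi> g"
 using \<Phi> unfolding positive_functional_def by blast

lemma positive_functional_cmult: "f : Bm M ==> \<Phi> (%x. c * f x) = c * \<Phi> f"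
 using \<Phi> unfolding positive_functional_def by blast

lemma positive_functional_add:
 "f : Bm M ==> g : Bm M ==> \<Phi> (%x. f x + g x) = \<Phi> f + \<Phi> g"
 using \<Phi> unfolding positive_functional_def by blast

lemma positive_functional_SUP:
 "(!!n::nat. F n : Bm M) ==> incseq F ==> \<Phi> (%x. SUP n. F n x) = (SUP n. \<Phi> (F n))"
 using \<Phi> unfolding positive_functional_def by blast

lemma positive_functional_zero: "\<Phi> (%x. 0) = 0"
 using positive_functional_cmult[of "%x. 0" 0] by simp

lemma positive_functional_mono:
 assumes [measurable]: "f : Bm M" "g : Bm M"
  and le: "!!x. x : space M ==> f x <= g x"
 shows "\<Phi> f <= \<Phi> g"
proof -
 have "\<Phi> (%x. SUP n::nat. (if n = 0 then min (f x) (g x) else g x)) = (SUP n. \<Phi> (%x. if n = (0::nat) then min (f x) (g x) else g x))"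
  by (rule positive_functional_SUP) (auto simp: incseq_def le_fun_def intro!: measurable_If)
 also have "(%x. SUP n::nat. (if n = 0 then min (f x) (g x) else g x)) = g"
 proof (intro ext antisym SUP_least)
  show "g x <= (SUP n::nat. if n = 0 then min (f x) (g x) else g x)" for x
   by (rule SUP_upper2[of 1]) auto
 qed auto
 finally have eq: "\<Phi> g = (SUP n. \<Phi> (%x. if n = (0::nat) then min (f x) (g x) else g x))" .
 have "\<Phi> (%x. min (f x) (g x)) <= \<Phi> g"
  unfolding eq by (rule SUP_upper2[of 0]) auto
 moreover have "\<Phi> (%x. min (f x) (g x)) = \<Phi> f"
  by (rule positive_functional_cong) (auto simp: le min_absorb1)
 ultimately show ?thesis by simp
qed

lemma positive_functional_suminf:
 assumes [measurable]: "!!n::nat. F n : Bm M"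
 shows "\<Phi> (%x. \<Sum>n. F n x) = (\<Sum>n. \<Phi> (F n))"
proof -
 have *: "\<Phi> (%x. \<Sum>i<n. F i x) = (\<Sum>i<n. \<Phi> (F i))" for n
  by (induction n) (auto simp: positive_functional_zero positive_functional_add)
 have "\<Phi> (%x. \<Sum>n. F n x) = \<Phi> (%x. SUP n. \<Sum>i<n. F i x)"
  by (simp add: suminf_eq_SUP)
 also have "... = (SUP n. \<Phi> (%x. \<Sum>i<n. F i x))"
  by (rule positive_functional_SUP) (auto simp: incseq_def le_fun_def intro!: sum_mono2)
 also have "... = (\<Sum>n. \<Phi> (F n))"
  by (simp add: * suminf_eq_SUP)
 finally show ?thesis .
qed

lemma emeasure_measure_by_functional:
 assumes "S : sets M"
 shows "Em (measure_by M (%S. \<Phi> (Ind S))) S = \<Phi> (Ind S)"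
 unfolding measure_by_def
proof (rule emeasure_measure_of_sigma)
 show "positive (sets M) (%S. \<Phi> (Ind S))"
  using positive_functional_zero by (simp add: positive_def indicator_def[abs_def])
 show "countably_additive (sets M) (%S. \<Phi> (Ind S))"
 proof (rule countably_additiveI)
  fix A :: "nat => 'a set" assume A: "range A \<subseteq> sets M" "disjoint_family A"
  then have "\<Phi> (%x. \<Sum>n. Ind (A n) x) = (\<Sum>n. \<Phi> (Ind (A n)))"
   by (intro positive_functional_suminf) auto
  moreover have "(%x. \<Sum>n. Ind (A n) x :: ennreal) = Ind (\<Union>n. A n)"
   using A by (intro ext suminf_indicator)
  ultimately show "(\<Sum>n. \<Phi> (Ind (A n))) = \<Phi> (Ind (\<Union>n. A n))" by simp
 qed
qed (use assms in \<open>auto simp: sets.sigma_algebra_axioms\<close>)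

end

lemma positive_functional_le_if_le_on_sets:
 assumes \<Phi>: "positive_functional M \<Phi>" and \<Psi>: "positive_functional M \<Psi>"
  and le: "!!S. S : sets M ==> \<Phi> (Ind S) <= \<Psi> (Ind S)"
  and f: "f : Bm M"
 shows "\<Phi> f <= \<Psi> f"
 using f
proof (induction rule: borel_measurable_induct)
 case (cong f g)
 then show ?case
  using positive_functional_cong[OF \<Phi>, of f g] positive_functional_cong[OF \<Psi>, of f g] by simp
next
 case (set A)
 then show ?case by (rule le)
next
 case (mult u c)
 then show ?case
  by (simp add: positive_functional_cmult[OF \<Phi>] positive_functional_cmult[OF \<Psi>] mult_left_mono)
next
 case (add u v)
 then show ?case
  by (simp add: positive_functional_add[OF \<Phi>] positive_functional_add[OF \<Psi>] add_mono)
next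
 case (seq U)
 have "\<Phi> (%x. SUP i. U i x) <= \<Psi> (%x. SUP i. U i x)"
  unfolding positive_functional_SUP[OF \<Phi> seq(1) seq(3)] positive_functional_SUP[OF \<Psi> seq(1) seq(3)]
  using seq by (intro SUP_mono) blast
 also have "(%x. SUP i. U i x) = (SUP i. U i)" by (intro ext) (simp add: image_comp)
 finally show ?case .
qed

lemma positive_functional_eq_if_eq_on_sets:
 assumes \<Phi>: "positive_functional M \<Phi>" and \<Psi>: "positive_functional M \<Psi>"
  and "!!S. S : sets M ==> \<Phi> (Ind S) = \<Psi> (Ind S)"
  and "f : Bm M"
 shows "\<Phi> f = \<Psi> f"
 using positive_functional_le_if_le_on_sets[OF \<Phi> \<Psi>, of f] positive_functional_le_if_le_on_sets[OF \<Psi> \<Phi>, of f] assms(3,4)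
 by (simp add: antisym)

lemma positive_functional_nn_integral:
 assumes s: "sets N = sets M"
 shows "positive_functional M (%f. INT+x. f x d/N)"
proof (rule positive_functionalI)
 note [measurable_cong] = s
 have sp: "space N = space M" using s by (rule sets_eq_imp_space_eq)
 { fix f g :: "'a => ennreal" assume "!!x. x : space M ==> f x = g x"
  then show "integral\<^sup>N N f = integral\<^sup>N N g"
   by (intro nn_integral_cong) (simp add: sp) }
 { fix c and f :: "'a => ennreal" assume "f : Bm M"
  then show "(INT+ x. c * f x d/N) = c * integral\<^sup>N N f"
   by (intro nn_integral_cmult) measurable }
 { fix f g :: "'a => ennreal" assume [measurable]: "f : Bm M" "g : Bm M"
  show "(INT+ x. f x + g x d/N) = integral\<^sup>N N f + integral\<^sup>N N g"
   by (intro nn_integral_add) measurable }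
 { fix F :: "nat => 'a => ennreal" assume [measurable]: "!!n::nat. F n : Bm M" and "incseq F"
  then show "(INT+ x. (SUP n. F n x) d/N) = (SUP n. integral\<^sup>N N (F n))"
   by (intro nn_integral_monotone_convergence_SUP) measurable }
qed

lemma nn_integral_measure_by_functional:
 assumes \<Phi>: "positive_functional M \<Phi>" and f: "f : Bm M"
 shows "(INT+x. f x d/measure_by M (%S. \<Phi> (Ind S))) = \<Phi> f"
 by (rule positive_functional_eq_if_eq_on_sets[OF positive_functional_nn_integral \<Phi> _ f])
  (auto simp: emeasure_measure_by_functional[OF \<Phi>])

lemma measure_by_cong: "(!!S. S : sets M ==> f S = g S) ==> measure_by M f = measure_by M g"
 unfolding measure_by_def by (rule measure_of_eq) (auto simp: sets.space_closed sets.sigma_sets_eq)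

lemma measure_by_emeasure:
 assumes "sets N = sets M"
 shows "measure_by M (Em N) = N"
 using measure_of_of_measure[of N] sets_eq_imp_space_eq[OF assms] assms
 by (simp add: measure_by_def)

lemma positive_functional_compose:
 assumes \<Phi>: "positive_functional N \<Phi>"
  and A: "!!w. w : space N ==> positive_functional M (%f. A f w)"
  and [measurable]: "!!f. f : Bm M ==> A f : Bm N"
 shows "positive_functional M (%f. \<Phi> (A f))"
proof (rule positive_functionalI)
 fix f g :: "_ => ennreal" assume [measurable]: "f : Bm M" "g : Bm M"
 { assume "!!x. x : space M ==> f x = g x"
  then show "\<Phi> (A f) = \<Phi> (A g)"
   by (intro positive_functional_cong[OF \<Phi>]) (auto intro!: positive_functional_cong[OF A]) }
 { have "\<Phi> (A (%x. f x + g x)) = \<Phi> (%w. A f w + A g w)"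
   by (intro positive_functional_cong[OF \<Phi>]) (auto intro!: positive_functional_add[OF A])
  then show "\<Phi> (A (%x. f x + g x)) = \<Phi> (A f) + \<Phi> (A g)"
   by (simp add: positive_functional_add[OF \<Phi>]) }
 { fix c
  have "\<Phi> (A (%x. c * f x)) = \<Phi> (%w. c * A f w)"
   by (intro positive_functional_cong[OF \<Phi>]) (auto intro!: positive_functional_cmult[OF A])
  then show "\<Phi> (A (%x. c * f x)) = c * \<Phi> (A f)"
   by (simp add: positive_functional_cmult[OF \<Phi>]) }
next
 fix F :: "nat => _ => ennreal" assume [measurable]: "!!n. F n : Bm M" and "incseq F"
 have mono: "A (F i) w <= A (F j) w" if "i <= j" "w : space N" for i j w
  using \<open>incseq F\<close> that by (intro positive_functional_mono[OF A]) (auto simp: incseq_def le_fun_def)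
 define B where "B n w = (if w : space N then A (F n) w else 0)" for n w
 have [measurable]: "B n : Bm N" for n
  by (subst measurable_cong[of _ _ "A (F n)"]) (auto simp: B_def)
 have "\<Phi> (A (%x. SUP n. F n x)) = \<Phi> (%w. SUP n. B n w)"
 proof (rule positive_functional_cong[OF \<Phi>])
  show "A (%x. SUP n. F n x) : Bm N" "(%w. SUP n. B n w) : Bm N"
   by measurable
  show "A (%x. SUP n. F n x) w = (SUP n. B n w)" if "w : space N" for w
   using positive_functional_SUP[OF A[OF that], of F] that \<open>incseq F\<close> by (simp add: B_def)
 qed
 also have "... = (SUP n. \<Phi> (B n))"
  by (intro positive_functional_SUP[OF \<Phi>]) (auto simp: incseq_def le_fun_def mono B_def)
 also have "... = (SUP n. \<Phi> (A (F n)))"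
  by (intro SUP_cong refl positive_functional_cong[OF \<Phi>]) (auto simp: B_def)
 finally show "\<Phi> (A (%x. SUP n. F n x)) = (SUP n. \<Phi> (A (F n)))" .
qed

lemma positive_functional_integral:
 assumes "!!w. w : space L ==> positive_functional M (\<Phi> w)"
  and "!!f. f : Bm M ==> (%w. \<Phi> w f) : Bm L"
 shows "positive_functional M (%f. INT+w. \<Phi> w f d/L)"
 by (rule positive_functional_compose[OF positive_functional_nn_integral[OF refl, of L], of M "%f w. \<Phi> w f"])
  (use assms in auto)

lemma positive_functional_scale:
 assumes "positive_functional M \<Phi>"
 shows "positive_functional M (%f. c * \<Phi> f)"
proof (rule positive_functionalI)
 fix f g :: "_ => ennreal" assume "f : Bm M" "g : Bm M" "!!x. x : space M ==> f x = g x"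
 then show "c * \<Phi> f = c * \<Phi> g" using positive_functional_cong[OF assms, of f g] by simp
qed (simp_all add: positive_functional_add[OF assms] positive_functional_cmult[OF assms] positive_functional_SUP[OF assms]
   SUP_mult_left_ennreal distrib_left mult.left_commute)

lemma positive_functional_plus:
 assumes \<Phi>: "positive_functional M \<Phi>" and \<Psi>: "positive_functional M \<Psi>"
 shows "positive_functional M (%f. \<Phi> f + \<Psi> f)"
proof (rule positive_functionalI)
 fix F :: "nat => _ => ennreal" assume F: "!!n. F n : Bm M" "incseq F"
 have "mono (%n. \<Phi> (F n))" "mono (%n. \<Psi> (F n))"
  using F by (auto intro!: monoI positive_functional_mono[OF \<Phi>] positive_functional_mono[OF \<Psi>] simp: incseq_def le_fun_def)
 then show "\<Phi> (%x. SUP n. F n x) + \<Psi> (%x. SUP n. F n x) = (SUP n. \<Phi> (F n) + \<Psi> (F n))"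
  using F by (simp add: positive_functional_SUP[OF \<Phi>] positive_functional_SUP[OF \<Psi>] ennreal_SUP_add)
next
 fix f g :: "_ => ennreal" assume "f : Bm M" "g : Bm M" "!!x. x : space M ==> f x = g x"
 then show "\<Phi> f + \<Psi> f = \<Phi> g + \<Psi> g"
  using positive_functional_cong[OF \<Phi>, of f g] positive_functional_cong[OF \<Psi>, of f g] by simp
qed (simp_all add: positive_functional_add[OF \<Phi>] positive_functional_add[OF \<Psi>] positive_functional_cmult[OF \<Phi>]
  positive_functional_cmult[OF \<Psi>] distrib_left ac_simps)

lemma finite_kernel_sets: "finite_kernel M N \<k> ==> x : space M ==> sets (\<k> x) = sets N"
 by (simp add: finite_kernel_def kernel_def)

lemma finite_kernel_space: "finite_kernel M N \<k> ==> x : space M ==> space (\<k> x) = space N"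
 by (rule sets_eq_imp_space_eq) (rule finite_kernel_sets)

lemma finite_kernel_finite: "finite_kernel M N \<k> ==> x : space M ==> finite_measure (\<k> x)"
 by (simp add: finite_kernel_def)

lemma finite_kernel_emeasure:
 "finite_kernel M N \<k> ==> A : sets N ==> (%x. Em (\<k> x) A) : Bm M"
 by (simp add: finite_kernel_def kernel_def)

lemma finite_kernel_compose:
 assumes "finite_kernel M N \<k>" and g: "g : measurable L M"
 shows "finite_kernel L N (%w. \<k> (g w))"
 using assms measurable_compose[OF g] measurable_space[OF g]
 unfolding finite_kernel_def kernel_def by auto

lemma measurable_kernel_integral_Pair:
 assumes \<k>: "finite_kernel M N \<k>" and f: "f : Bm (M >< N)"
 shows "(%x. INT+y. f (x, y) d/\<k> x) : Bm M"
 using f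
proof (induction rule: borel_measurable_induct)
 case (cong f g)
 then show ?case
  by (subst measurable_cong[of _ _ "%x. INT+y. g (x, y) d/\<k> x"])
   (auto intro!: nn_integral_cong simp: space_pair_measure finite_kernel_space[OF \<k>])
next
 case (set A)
 have "(%x. Em (\<k> x) (Pair x -` A)) : Bm M"
  using Int_stable_pair_measure_generator pair_measure_closed set unfolding sets_pair_measure
 proof (induction A rule: sigma_sets_induct_disjoint)
  case (basic A)
  then obtain a b where A: "A = a \<times> b" and ab: "a : sets M" "b : sets N" by auto
  have "(%x. Em (\<k> x) b * Ind a x) : Bm M"
   using finite_kernel_emeasure[OF \<k> ab(2)] ab by auto
  then show ?case
   by (subst measurable_cong[of _ _ "%x. Em (\<k> x) b * Ind a x"]) (auto simp: A indicator_def)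
 next
  case empty then show ?case by simp
 next
  case (compl A)
  have A: "A : sets (M >< N)" using compl by (simp add: sets_pair_measure)
  have eq: "Em (\<k> x) (Pair x -` (space M \<times> space N - A)) = Em (\<k> x) (space N) - Em (\<k> x) (Pair x -` A)"
   if x: "x : space M" for x
  proof -
   have "Pair x -` (space M \<times> space N - A) = space (\<k> x) - Pair x -` A"
    using x by (auto simp: finite_kernel_space[OF \<k>])
   moreover have "Em (\<k> x) (Pair x -` A) \<noteq> \<infinity>"
    using finite_measure.emeasure_finite[OF finite_kernel_finite[OF \<k> x]] by simp
   moreover have "Pair x -` A : sets (\<k> x)"
    using sets_Pair1[OF A] by (simp add: finite_kernel_sets[OF \<k> x])
   ultimately show ?thesis
    using emeasure_compl[of "Pair x -` A" "\<k> x"] finite_kernel_space[OF \<k> x] by simp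
  qed
  have "(%x. Em (\<k> x) (space N) - Em (\<k> x) (Pair x -` A)) : Bm M"
   using compl(2) finite_kernel_emeasure[OF \<k> sets.top] by simp
  then show ?case
   by (subst measurable_cong[OF eq]) auto
 next
  case (union A)
  have A: "range A \<subseteq> sets (M >< N)" using union by (simp add: sets_pair_measure)
  have eq: "Em (\<k> x) (Pair x -` (\<Union>n. A n)) = (\<Sum>n. Em (\<k> x) (Pair x -` A n))"
   if x: "x : space M" for x
   unfolding vimage_UN using A union(1)
   by (intro suminf_emeasure[symmetric])
    (auto simp: finite_kernel_sets[OF \<k> x] disjoint_family_on_def intro!: sets_Pair1)
  show ?case
   using union by (subst measurable_cong[OF eq]) auto
 qed
 moreover have "(INT+y. Ind A (x, y) d/\<k> x) = Em (\<k> x) (Pair x -` A)" if "x : space M" for x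
 proof -
  have "(INT+y. Ind A (x, y) d/\<k> x) = (INT+y. Ind (Pair x -` A) y d/\<k> x)"
   by (simp add: indicator_def)
  also have "... = Em (\<k> x) (Pair x -` A)"
   using set that by (intro nn_integral_indicator) (auto simp: finite_kernel_sets[OF \<k>] intro: sets_Pair1)
  finally show ?thesis .
 qed
 ultimately show ?case by (subst measurable_cong) auto
next
 case (mult u c)
 then show ?case
  by (subst measurable_cong[of _ _ "%x. c * (INT+y. u (x, y) d/\<k> x)"])
   (auto intro!: nn_integral_cmult simp: measurable_cong_sets[OF finite_kernel_sets[OF \<k>] refl])
next
 case (add u v)
 then show ?case
  by (subst measurable_cong[of _ _ "%x. (INT+y. v (x, y) d/\<k> x) + (INT+y. u (x, y) d/\<k> x)"])
   (auto intro!: nn_integral_add simp: measurable_cong_sets[OF finite_kernel_sets[OF \<k>] refl])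
next
 case (seq U)
 have "(INT+y. (SUP i. U i) (x, y) d/\<k> x) = (SUP i. INT+y. U i (x, y) d/\<k> x)" if x: "x : space M" for x
  unfolding SUP_apply using seq x
  by (intro nn_integral_monotone_convergence_SUP)
   (auto simp: incseq_def le_fun_def measurable_cong_sets[OF finite_kernel_sets[OF \<k>] refl])
 then have *: "(%x. INT+y. (SUP i. U i) (x, y) d/\<k> x) : Bm M \<longleftrightarrow>
   (%x. SUP i. INT+y. U i (x, y) d/\<k> x) : Bm M"
  by (rule measurable_cong)
 show ?case unfolding * using seq.IH by (intro borel_measurable_SUP) auto
qed

lemma measurable_kernel_integral:
 assumes \<k>: "finite_kernel M N \<k>" and g: "g : measurable L M"
  and f: "(%(w, y). f w y) : Bm (L >< N)"
 shows "(%w. INT+y. f w y d/\<k> (g w)) : Bm L"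
 using measurable_kernel_integral_Pair[OF finite_kernel_compose[OF \<k> g] f] by simp

section \<open>Disintegration of processes\<close>

lemma AE_le_if_set_integrals_le:
 fixes f g :: "'a => ennreal"
 assumes [measurable]: "f : Bm M" "g : Bm M"
  and le: "!!B. B : sets M ==> (INT+x\<in>B. f x d/M) <= (INT+x\<in>B. g x d/M)"
  and fin: "(INT+x. g x d/M) < \<infinity>"
 shows "AE x in M. f x <= g x"
proof -
 define B where "B = {x : space M. g x < f x}"
 have [measurable]: "B : sets M" unfolding B_def by measurable
 have finB: "(INT+x. g x * Ind B x d/M) < \<infinity>"
  by (rule le_less_trans[OF nn_integral_mono fin]) (auto simp: indicator_def)
 have "(INT+x. f x * Ind B x - g x * Ind B x d/M)
   = (INT+x. f x * Ind B x d/M) - (INT+x. g x * Ind B x d/M)"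
  using finB by (intro nn_integral_diff) (auto simp: indicator_def B_def less_imp_le)
 also have "... = 0"
  using le[of B] finB by (simp add: diff_eq_0_iff_ennreal le_less_trans)
 finally have "AE x in M. f x * Ind B x - g x * Ind B x = 0"
  by (subst (asm) nn_integral_0_iff_AE) auto
 with AE_space show ?thesis
 proof eventually_elim
  case (elim x)
  then show ?case
   by (cases "x : B") (auto simp: B_def diff_eq_0_iff_ennreal not_less)
 qed
qed

text \<open>Averages over shrinking cubes converge to the density at almost every point by Lebesgue
differentiation. The averages are jointly measurable in the parameter and the point, hence so is
their limit.\<close>

lemma parametric_density:
 fixes h :: "'t => 'v::euclidean_space measure"
 assumes h: "finite_kernel L borel h"
  and ac: "!!t. t : space L ==> absolutely_continuous lborel (h t)"
 shows "\<exists>D. (%(t, x). D t x) : Bm (L >< borel) &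
  (\<forall>t\<in>space L. \<forall>B\<in>sets borel. Em (h t) B = (INT+x\<in>B. D t x d/lborel))"
proof -
 define cube :: "nat => 'v => 'v set" where
  "cube n x = cbox x (x + (1 / real (Suc n)) *\<^sub>R One)" for n x
 define D where "D t x = liminf (%n. ennreal (real (Suc n) ^ DIM('v)) * Em (h t) (cube n x))" for t x
 define S where "S n = {p :: 'v \<times> 'v. snd p : cube n (fst p)}" for n
 have S[measurable]: "S n : sets (borel >< borel)" for n
 proof -
  have "{p : space (borel >< borel :: ('v \<times> 'v) measure).
    \<forall>i\<in>Basis. fst p \<bullet> i <= snd p \<bullet> i & snd p \<bullet> i <= fst p \<bullet> i + 1 / real (Suc n)} : sets (borel >< borel)"
   by measurable
  then show ?thesis
   by (simp add: S_def cube_def mem_box space_pair_measure inner_add_left)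
 qed
 have [measurable]: "(%w. Em (h (fst w)) (cube n (snd w))) : Bm (L >< borel)" for n
 proof -
  have "(%w. INT+z. Ind (S n) (snd w, z) d/h (fst w)) : Bm (L >< borel)"
   by (rule measurable_kernel_integral[OF h]) measurable
  moreover have "(INT+z. Ind (S n) (snd w, z) d/h (fst w)) = Em (h (fst w)) (cube n (snd w))"
   if "w : space (L >< borel)" for w
  proof -
   have "(INT+z. Ind (S n) (snd w, z) d/h (fst w)) = (INT+z. Ind (cube n (snd w)) z d/h (fst w))"
    by (simp add: S_def indicator_def)
   also have "... = Em (h (fst w)) (cube n (snd w))"
    using that by (intro nn_integral_indicator)
     (auto simp: finite_kernel_sets[OF h] space_pair_measure cube_def)
   finally show ?thesis .
  qed
  ultimately show ?thesis by (subst measurable_cong[symmetric])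
 qed
 have "(%(t, x). D t x) : Bm (L >< borel)"
  unfolding D_def split_beta' by measurable
 moreover have "Em (h t) B = (INT+x\<in>B. D t x d/lborel)" if t: "t : space L" and B: "B : sets borel" for t B
 proof -
  interpret finite_measure "h t" by (rule finite_kernel_finite[OF h t])
  have sets_h: "sets (h t) = sets lborel" using finite_kernel_sets[OF h t] by simp
  obtain f where f[measurable]: "f : Bm lborel" and hf: "density lborel f = h t"
   using sigma_finite_measure.Radon_Nikodym[OF sigma_finite_lborel ac[OF t] sets_h] by auto
  have h_eq: "Em (h t) B = (INT+x\<in>B. f x d/lborel)" if "B : sets borel" for B
   using that by (subst hf[symmetric]) (simp add: emeasure_density)
  have "(INT+x. f x d/lborel) = Em (h t) UNIV" by (subst h_eq) auto
  also have "... < \<infinity>" by (metis emeasure_finite infinity_ennreal_def less_top)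
  finally have fin: "(INT+x. f x d/lborel) < \<infinity>" .
  then have AEfin: "AE x in lborel. f x \<noteq> \<infinity>" by (intro nn_integral_PInf_AE) auto
  define f' where "f' x = enn2real (f x)" for x
  have [measurable]: "f' : Bm lborel" unfolding f'_def by measurable
  have f_f': "AE x in lborel. f x = ennreal (f' x)"
   using AEfin by eventually_elim (simp add: f'_def less_top)
  have int: "integrable lborel f'"
  proof (rule integrableI_nonneg)
   have "(INT+x. ennreal (f' x) d/lborel) = (INT+x. f x d/lborel)"
    using f_f' by (intro nn_integral_cong_AE) auto
   then show "(INT+x. ennreal (f' x) d/lborel) < \<infinity>" using fin by simp
  qed (auto simp: f'_def)
  have si: "set_integrable lborel (cbox a b) f'" for a b
   using int unfolding set_integrable_def by (rule integrable_mult_indicator[rotated]) auto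
  have cube_eq: "Em (h t) (cbox a b) = ennreal (integral (cbox a b) f')" for a b
  proof -
   have "Em (h t) (cbox a b) = (INT+x. ennreal (Ind (cbox a b) x *\<^sub>R f' x) d/lborel)"
    by (subst h_eq, simp, intro nn_integral_cong_AE)
     (use f_f' in eventually_elim, auto simp: indicator_def)
   also have "... = ennreal (LINT x:cbox a b|lborel. f' x)"
    unfolding set_lebesgue_integral_def using si[of a b]
    by (intro nn_integral_eq_integral) (auto simp: set_integrable_def f'_def)
   also have "... = ennreal (integral (cbox a b) f')"
    using set_borel_integral_eq_integral(2)[OF si] by simp
   finally show ?thesis .
  qed
  have "f' integrable_on cbox a b" for a b
   using set_borel_integral_eq_integral(1)[OF si] .
  then obtain N where N: "negligible N" and lim:
   "!!x e. [|x \<notin> N; 0 < e|] ==> \<exists>d>0. \<forall>h. 0 < h & h < d \<longrightarrow>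
     norm (integral (cbox x (x + h *\<^sub>R One)) f' /\<^sub>R h ^ DIM('v) - f' x) < e"
   using integrable_ccontinuous_explicit[of f'] by metis
  have D_eq: "D t x = ennreal (f' x)" if x: "x \<notin> N" for x
  proof -
   have "(%n. integral (cube n x) f' /\<^sub>R (1 / real (Suc n)) ^ DIM('v)) \<longlonglongrightarrow> f' x"
   proof (rule LIMSEQ_I)
    fix e :: real assume "0 < e"
    then obtain d where d: "0 < d" "!!h. 0 < h ==> h < d ==>
      norm (integral (cbox x (x + h *\<^sub>R One)) f' /\<^sub>R h ^ DIM('v) - f' x) < e"
     using lim[OF x] by metis
    obtain n0 where "1 / real (Suc n0) < d" using nat_approx_posE[OF d(1)] by metis
    then have "1 / real (Suc n) < d" if "n0 <= n" for n
     using that by (smt (verit, best) frac_le of_nat_0_less_iff of_nat_le_iff zero_less_Suc Suc_le_mono)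
    then show "\<exists>n0. \<forall>n\<ge>n0. norm (integral (cube n x) f' /\<^sub>R (1 / real (Suc n)) ^ DIM('v) - f' x) < e"
     unfolding cube_def by (intro exI[of _ n0] allI impI d(2)) auto
   qed
   then have "(%n. ennreal (integral (cube n x) f' /\<^sub>R (1 / real (Suc n)) ^ DIM('v))) \<longlonglongrightarrow> ennreal (f' x)"
    by (rule tendsto_ennrealI)
   also have "(%n. ennreal (integral (cube n x) f' /\<^sub>R (1 / real (Suc n)) ^ DIM('v)))
     = (%n. ennreal (real (Suc n) ^ DIM('v)) * Em (h t) (cube n x))"
    by (intro ext) (simp add: cube_def cube_eq ennreal_mult'[symmetric] power_one_over divide_simps del: of_nat_Suc)
   finally show ?thesis unfolding D_def by (intro lim_imp_Liminf) auto
  qed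
  have "AE x in lebesgue. x \<notin> N"
   using N unfolding negligible_iff_null_sets by (rule AE_not_in)
  then have "AE x in lborel. x \<notin> N" by (simp add: AE_completion_iff)
  then have "AE x in lborel. D t x = f x"
   using f_f' by eventually_elim (simp add: D_eq)
  then have "(INT+x\<in>B. D t x d/lborel) = (INT+x\<in>B. f x d/lborel)"
   by (intro nn_integral_cong_AE) auto
  then show ?thesis by (simp add: h_eq[OF B])
 qed
 ultimately show ?thesis by blast
qed

lemma finite_kernelI_generator:
 assumes sets: "!!x. x : space M ==> sets (\<k> x) = sets N"
  and fin: "!!x. x : space M ==> finite_measure (\<k> x)"
  and G: "Int_stable G" "G \<subseteq> Pow (space N)" "sets N = sigma_sets (space N) G"
  and meas: "!!A. A : G ==> (%x. Em (\<k> x) A) : Bm M"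
  and total: "(%x. Em (\<k> x) (space N)) : Bm M"
 shows "finite_kernel M N \<k>"
proof -
 have "(%x. Em (\<k> x) A) : Bm M" if "A : sets N" for A
  using G(1,2) that unfolding G(3)
 proof (induction A rule: sigma_sets_induct_disjoint)
  case (basic A) then show ?case by (rule meas)
 next
  case empty then show ?case by simp
 next
  case (compl A)
  have eq: "Em (\<k> x) (space N - A) = Em (\<k> x) (space N) - Em (\<k> x) A" if x: "x : space M" for x
   using emeasure_compl[of A "\<k> x"] compl(1) finite_measure.emeasure_finite[OF fin[OF x]]
   by (simp add: sets[OF x] sets_eq_imp_space_eq[OF sets[OF x]] G(3))
  show ?case
   using total compl(2) by (subst measurable_cong[OF eq]) auto
 next
  case (union A)
  have eq: "Em (\<k> x) (\<Union>n. A n) = (\<Sum>n. Em (\<k> x) (A n))" if x: "x : space M" for x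
   using union(1,2) by (intro suminf_emeasure[symmetric]) (auto simp: sets[OF x] G(3))
  show ?case
   using union(3) by (subst measurable_cong[OF eq]) auto
 qed
 then show ?thesis using sets fin by (simp add: finite_kernel_def kernel_def)
qed

lemma finite_kernel_pairI:
 assumes sets: "!!x. x : space M ==> sets (\<k> x) = sets (N1 >< N2)"
  and fin: "!!x. x : space M ==> finite_measure (\<k> x)"
  and meas: "!!A B. A : sets N1 ==> B : sets N2 ==> (%x. Em (\<k> x) (A \<times> B)) : Bm M"
 shows "finite_kernel M (N1 >< N2) \<k>"
proof (rule finite_kernelI_generator[OF sets fin])
 show "Int_stable {a \<times> b |a b. a : sets N1 & b : sets N2}"
  by (rule Int_stable_pair_measure_generator)
 show "{a \<times> b |a b. a : sets N1 & b : sets N2} \<subseteq> Pow (space (N1 >< N2))"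
  using pair_measure_closed[of N1 N2] by (simp add: space_pair_measure)
qed (auto simp: sets_pair_measure space_pair_measure intro!: meas)

text \<open>The densities of the measures of \<open>{..q}\<close>, for rational \<open>q\<close>, form a distribution function at almost
every point. Where they do not, the fibre is set to zero; joint measurability survives because
only countably many conditions are involved.\<close>

lemma parametric_disintegration_real:
 fixes h :: "'t => ('v::euclidean_space \<times> real) measure"
 assumes h: "finite_kernel L (borel >< borel) h"
  and ac: "!!t. t : space L ==> absolutely_continuous lborel (distr (h t) borel fst)"
 shows "\<exists>\<k>. finite_kernel (L >< borel) (borel :: real measure) \<k> &
  (\<forall>t\<in>space L. \<forall>B\<in>sets borel. \<forall>A\<in>sets borel.
   Em (h t) (B \<times> A) = (INT+x\<in>B. Em (\<k> (t, x)) A d/lborel))"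
proof -
 have sets_h: "sets (h t) = sets (borel >< borel)" if "t : space L" for t
  using finite_kernel_sets[OF h that] .
 note space_h = sets_eq_imp_space_eq[OF sets_h]
 have fin_h: "Em (h t) X < \<infinity>" if "t : space L" for t X
  using finite_measure.emeasure_finite[OF finite_kernel_finite[OF h that]] by (simp add: less_top)
 have "\<exists>D. (%(t, x). D t x) : Bm (L >< borel) &
  (\<forall>t\<in>space L. \<forall>B\<in>sets borel. Em (h t) (B \<times> A) = (INT+x\<in>B. D t x d/lborel))"
  if A[measurable]: "A : sets borel" for A
 proof -
  define hA where "hA t = distr (density (h t) (%p. Ind A (snd p))) borel fst" for t
  have hA: "Em (hA t) B = Em (h t) (B \<times> A)" if t: "t : space L" and B[measurable]: "B : sets borel" for t B
  proof -
   note [measurable_cong] = sets_h[OF t]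
   have "Em (hA t) B = (INT+p. Ind A (snd p) * Ind (fst -` B \<inter> space (h t)) p d/h t)"
    unfolding hA_def by (simp add: emeasure_distr emeasure_density)
   also have "... = (INT+p. Ind (B \<times> A) p d/h t)"
    by (intro nn_integral_cong) (auto simp: indicator_def)
   also have "... = Em (h t) (B \<times> A)"
    by (intro nn_integral_indicator) measurable
   finally show ?thesis .
  qed
  have "finite_kernel L borel hA"
   unfolding finite_kernel_def kernel_def
  proof (intro conjI ballI)
   show "sets (hA t) = sets borel" for t by (simp add: hA_def)
   show "(%t. Em (hA t) B) : Bm L" if "B : sets borel" for B
    using that finite_kernel_emeasure[OF h, of "B \<times> A"] by (subst measurable_cong[OF hA]) auto
   show "finite_measure (hA t)" if "t : space L" for t
    using hA[OF that, of UNIV] fin_h[OF that, of "UNIV \<times> A"]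
    by (intro finite_measureI) (simp add: hA_def less_top)
  qed
  moreover have "absolutely_continuous lborel (hA t)" if t: "t : space L" for t
   unfolding absolutely_continuous_def
  proof
   fix B :: "'v set" assume B: "B : null_sets lborel"
   then have [measurable]: "B : sets borel" by auto
   note [measurable_cong] = sets_h[OF t]
   have "Em (distr (h t) borel fst) B = 0"
    using ac[OF t] B by (auto simp: absolutely_continuous_def)
   then have "Em (h t) (B \<times> UNIV) = 0"
    by (subst (asm) emeasure_distr) (auto simp: space_h[OF t] space_pair_measure vimage_fst)
   then have "Em (h t) (B \<times> A) = 0"
    using emeasure_mono[of "B \<times> A" "B \<times> UNIV" "h t"] by (auto simp: sets_h[OF t])
   then show "B : null_sets (hA t)"
    using hA[OF t, of B] by (intro null_setsI) (auto simp: hA_def)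
  qed
  ultimately obtain D where D: "(%(t, x). D t x) : Bm (L >< borel)"
   "\<forall>t\<in>space L. \<forall>B\<in>sets borel. Em (hA t) B = (INT+x\<in>B. D t x d/lborel)"
   using parametric_density[of L hA] by blast
  then show ?thesis using hA by auto
 qed
 then obtain D where D_meas: "!!A. A : sets borel ==> (%(t, x). D A t x) : Bm (L >< borel)"
  and D: "!!A t B. A : sets borel ==> t : space L ==> B : sets borel ==>
   Em (h t) (B \<times> A) = (INT+x\<in>B. D A t x d/lborel)"
  by metis
 define G where "G q = D {..real_of_rat q}" for q
 define H where "H = D UNIV"
 have [measurable]: "(%w. G q (fst w) (snd w)) : Bm (L >< borel)" for q
  using D_meas[of "{..real_of_rat q}"] by (simp add: G_def split_beta')
 have [measurable]: "(%w. H (fst w) (snd w)) : Bm (L >< borel)"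
  using D_meas[of UNIV] by (simp add: H_def split_beta')
 define nice where "nice t x \<longleftrightarrow> (\<forall>q q'. q <= q' \<longrightarrow> G q t x <= G q' t x) & (\<forall>q. G q t x <= H t x) &
   H t x < \<infinity> & (INF n. G (- of_nat n) t x) = 0" for t x
 have [measurable]: "Measurable.pred (L >< borel) (%w. nice (fst w) (snd w))"
  unfolding nice_def by measurable
 have Gt[measurable]: "G q t : Bm borel" "H t : Bm borel" if "t : space L" for q t
  using measurable_compose[OF measurable_Pair1'[OF that], of "%w. G q (fst w) (snd w)"]
   measurable_compose[OF measurable_Pair1'[OF that], of "%w. H (fst w) (snd w)"] by simp_all
 have D_t: "D A t : Bm borel" if "t : space L" "A : sets borel" for A t
  using measurable_compose[OF measurable_Pair1'[OF that(1)], OF D_meas[OF that(2)]] by simp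
 have D_fin: "(INT+x. D A t x d/lborel) < \<infinity>" if "t : space L" "A : sets borel" for A t
  using D[OF that(2,1), of UNIV] fin_h[OF that(1), of "UNIV \<times> A"] by simp
 have D_mono: "AE x in lborel. D A t x <= D A' t x"
  if "t : space L" "A : sets borel" "A' : sets borel" "A \<subseteq> A'" for A A' t
 proof (rule AE_le_if_set_integrals_le)
  fix B :: "'v set" assume "B : sets lborel"
  then have B: "B : sets borel" by simp
  show "(INT+x\<in>B. D A t x d/lborel) <= (INT+x\<in>B. D A' t x d/lborel)"
   unfolding D[OF that(2,1) B, symmetric] D[OF that(3,1) B, symmetric]
   using that B by (intro emeasure_mono) (auto simp: sets_h)
 qed (use that D_t D_fin in auto)
 have AE_nice: "AE x in lborel. nice t x" if t: "t : space L" for t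
 proof -
  have 1: "AE x in lborel. \<forall>q q'. q <= q' \<longrightarrow> G q t x <= G q' t x"
   unfolding AE_all_countable
  proof (intro allI)
   fix q q' :: rat
   show "AE x in lborel. q <= q' \<longrightarrow> G q t x <= G q' t x"
    by (cases "q <= q'") (auto simp: G_def of_rat_less_eq intro!: D_mono[OF t])
  qed
  have 2: "AE x in lborel. \<forall>q. G q t x <= H t x"
   unfolding AE_all_countable by (auto simp: G_def H_def intro!: D_mono[OF t])
  have 3: "AE x in lborel. H t x \<noteq> \<infinity>"
   using D_fin[OF t, of UNIV] Gt(2)[OF t] by (intro nn_integral_PInf_AE) (auto simp: H_def)
  have "(INT+x. (INF n. G (- of_nat n) t x) d/lborel) = (INF n. INT+x. G (- of_nat n) t x d/lborel)"
  proof (rule nn_integral_monotone_convergence_INF_AE')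
   show "AE x in lborel. G (- of_nat (Suc n)) t x <= G (- of_nat n) t x" for n
    using 1 by eventually_elim auto
   show "(INT+x. G (- of_nat 0) t x d/lborel) < \<infinity>"
    unfolding G_def by (rule D_fin[OF t]) simp
  qed (use Gt t in auto)
  also have "... = (INF n. Em (h t) (UNIV \<times> {..- real n}))"
   using D[OF _ t, of "{..- real n}" UNIV for n] by (simp add: G_def of_rat_minus)
  also have "... = Em (h t) (\<Inter>n. UNIV \<times> {..- real n})"
   using fin_h[OF t] by (intro INF_emeasure_decseq) (auto simp: sets_h[OF t] decseq_def less_top)
  also have "(\<Inter>n. UNIV \<times> {..- real n}) = ({} :: ('v \<times> real) set)"
  proof -
   have "\<exists>n. \<not> r <= - real n" for r :: real
    using reals_Archimedean2[of "-r"] by (metis le_minus_iff not_le)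
   then show ?thesis by auto
  qed
  finally have "(INT+x. (INF n. G (- of_nat n) t x) d/lborel) = 0" by simp
  then have "AE x in lborel. (INF n. G (- of_nat n) t x) = 0"
   using Gt(1)[OF t] by (subst (asm) nn_integral_0_iff_AE) auto
  with 1 2 3 show ?thesis
   by eventually_elim (auto simp: nice_def less_top)
 qed
 \<comment> \<open>dyadic rationals decreasing to \<open>r\<close>\<close>
 define dy :: "nat => real => rat" where "dy n r = of_int (\<lfloor>2 ^ n * r\<rfloor> + 1) / 2 ^ n" for n r
 have dy_real: "real_of_rat (dy n r) = (of_int \<lfloor>2 ^ n * r\<rfloor> + 1) / 2 ^ n" for n r
  by (simp add: dy_def of_rat_divide of_rat_add of_rat_power)
 have dy_gt: "r < real_of_rat (dy n r)" for n r
  unfolding dy_real by (simp add: field_simps) linarith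
 have dy_le: "real_of_rat (dy n r) <= r + 1 / 2 ^ n" for n r
  unfolding dy_real by (simp add: field_simps)
 have dy_mono: "dy n r <= dy n r'" if "r <= r'" for n r r'
  unfolding dy_def by (intro divide_right_mono) (auto intro!: floor_mono that)
 have dy_Suc: "dy (Suc n) r <= dy n r" for n r
 proof -
  have "\<lfloor>2 ^ Suc n * r\<rfloor> + 1 <= 2 * (\<lfloor>2 ^ n * r\<rfloor> + 1)"
   by (simp add: mult.assoc) linarith
  then have "(of_int (\<lfloor>2 ^ Suc n * r\<rfloor> + 1) :: rat) <= of_int (2 * (\<lfloor>2 ^ n * r\<rfloor> + 1))"
   by (simp only: of_int_le_iff)
  moreover have "dy n r = of_int (2 * (\<lfloor>2 ^ n * r\<rfloor> + 1)) / 2 ^ Suc n"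
   by (simp add: dy_def field_simps)
  moreover have "dy (Suc n) r = of_int (\<lfloor>2 ^ Suc n * r\<rfloor> + 1) / 2 ^ Suc n"
   by (simp only: dy_def)
  ultimately show ?thesis by (simp only:) (rule divide_right_mono, simp_all)
 qed
 have dy_dec: "decseq (%n. dy n r)" for r using dy_Suc by (rule decseq_SucI)
 have dy_small: "\<exists>n. real_of_rat (dy n r) < q" if "r < q" for r q
 proof -
  obtain n where "(1/2::real) ^ n < q - r" using real_arch_pow_inv[of "q - r" "1/2"] \<open>r < q\<close> by auto
  then have "real_of_rat (dy n r) < q" using dy_le[of n r] by (simp add: power_one_over)
  then show ?thesis ..
 qed
 define F where "F t x r = (if nice t x then enn2real (INF n. G (dy n r) t x) else 0)" for t x r
 have F_eq: "ennreal (F t x r) = (INF n. G (dy n r) t x)" if "nice t x" for t x r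
 proof -
  have "(INF n. G (dy n r) t x) <= H t x" using that by (auto intro!: INF_lower2 simp: nice_def)
  then have "(INF n. G (dy n r) t x) < top" using that by (auto simp: nice_def)
  then show ?thesis using that by (simp add: F_def)
 qed
 have F_nonneg: "0 <= F t x r" for t x r by (simp add: F_def)
 have F_mono: "F t x r <= F t x r'" if "r <= r'" for t x r r'
 proof (cases "nice t x")
  case True
  have "ennreal (F t x r) <= ennreal (F t x r')"
   unfolding F_eq[OF True] using True dy_mono[OF that] by (intro INF_mono) (auto simp: nice_def)
  then show ?thesis using F_nonneg by (simp add: ennreal_le_iff)
 qed (simp add: F_def)
 have F_cont: "continuous (at_right r) (F t x)" for t x r
 proof (cases "nice t x")
  case True
  show ?thesis
  proof (subst continuous_at_right_real_increasing, rule F_mono, assumption, intro allI impI)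
   fix e :: real assume "0 < e"
   then have "(INF n. G (dy n r) t x) < ennreal (F t x r + e)"
    unfolding F_eq[OF True, symmetric] using F_nonneg by (intro ennreal_lessI) (auto intro: add_nonneg_pos)
   then obtain n where n: "G (dy n r) t x < ennreal (F t x r + e)" by (auto simp: INF_less_iff)
   define \<delta> where "\<delta> = (real_of_rat (dy n r) - r) / 2"
   have "\<delta> > 0" "r + \<delta> < real_of_rat (dy n r)" using dy_gt[of r n] by (auto simp: \<delta>_def field_simps)
   then obtain k where "real_of_rat (dy k (r + \<delta>)) < real_of_rat (dy n r)" using dy_small by blast
   then have "G (dy k (r + \<delta>)) t x <= G (dy n r) t x" using True by (auto simp: nice_def of_rat_less)
   then have "ennreal (F t x (r + \<delta>)) < ennreal (F t x r + e)"
    unfolding F_eq[OF True] using n by (intro le_less_trans[OF _ n]) (auto intro: INF_lower2)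
   then have "F t x (r + \<delta>) - F t x r < e" using F_nonneg[of t x "r + \<delta>"] by (simp add: ennreal_less_iff)
   then show "\<exists>\<delta>>0. F t x (r + \<delta>) - F t x r < e" using \<open>\<delta> > 0\<close> by auto
  qed
 qed (simp add: F_def[abs_def])
 define \<k> where "\<k> w = interval_measure (F (fst w) (snd w))" for w
 have \<k>_atMost: "Em (\<k> (t, x)) {..r} = ennreal (F t x r)" for t x r
 proof -
  have "(%n. F t x (- real n)) \<longlonglongrightarrow> 0"
  proof (cases "nice t x")
   case True
   have "(%n. G (- of_nat n) t x) \<longlonglongrightarrow> (INF n. G (- of_nat n) t x)"
    using True by (intro LIMSEQ_INF) (auto simp: decseq_def nice_def)
   then have *: "(%n. G (- of_nat n) t x) \<longlonglongrightarrow> 0" using True by (simp add: nice_def)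
   have "(%n. ennreal (F t x (- real (Suc n)))) \<longlonglongrightarrow> 0"
   proof (rule tendsto_sandwich[OF _ _ tendsto_const *])
    show "\<forall>\<^sub>F n in sequentially. ennreal (F t x (- real (Suc n))) <= G (- of_nat n) t x"
    proof (rule always_eventually, rule allI)
     fix n
     have "\<lfloor>- real (Suc n)\<rfloor> = - int (Suc n)" by linarith
     then have "dy 0 (- real (Suc n)) = - of_nat n" by (simp add: dy_def del: of_nat_Suc)
     then show "ennreal (F t x (- real (Suc n))) <= G (- of_nat n) t x"
      unfolding F_eq[OF True] by (intro INF_lower2[of 0]) simp_all
    qed
   qed auto
   then have "(%n. F t x (- real (Suc n))) \<longlonglongrightarrow> 0"
    using F_nonneg by (simp add: tendsto_ennreal_iff[of _ _ 0, simplified] flip: ennreal_0)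
   then show ?thesis using LIMSEQ_imp_Suc[of "%n. F t x (- real n)"] by simp
  qed (simp add: F_def)
  then have "(%n. ennreal (F t x r - F t x (- real n))) \<longlonglongrightarrow> ennreal (F t x r - 0)"
   by (intro tendsto_intros tendsto_ennrealI)
  moreover have "(%n. Em (\<k> (t, x)) {- real n<..r}) \<longlonglongrightarrow> Em (\<k> (t, x)) (\<Union>n. {- real n<..r})"
   by (intro Lim_emeasure_incseq) (auto simp: \<k>_def incseq_def)
  moreover have "(\<Union>n. {- real n<..r}) = {..r}"
  proof -
   have "\<exists>n. - real n < s" for s :: real
    using reals_Archimedean2[of "-s"] by (metis minus_less_iff)
   then show ?thesis by auto
  qed
  moreover have "\<forall>\<^sub>F n in sequentially. Em (\<k> (t, x)) {- real n<..r} = ennreal (F t x r - F t x (- real n))"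
  proof -
   obtain n0 where "- r < real n0" using reals_Archimedean2 by blast
   then show ?thesis
    unfolding \<k>_def by (intro eventually_sequentiallyI[of n0])
     (auto intro!: emeasure_interval_measure_Ioc F_mono F_cont)
  qed
  ultimately show ?thesis
   by (auto intro: LIMSEQ_unique dest: tendsto_cong)
 qed
 have UN_atMost: "(\<Union>n. {..real n}) = UNIV"
  using real_arch_simple by auto
 have \<k>_finite: "finite_measure (\<k> (t, x))" for t x
 proof (rule finite_measureI)
  have "Em (\<k> (t, x)) (\<Union>n. {..real n}) = (SUP n. Em (\<k> (t, x)) {..real n})"
   by (intro SUP_emeasure_incseq[symmetric]) (auto simp: \<k>_def incseq_def)
  also have "... <= (if nice t x then H t x else 0)"
  proof (rule SUP_least)
   fix n
   show "Em (\<k> (t, x)) {..real n} <= (if nice t x then H t x else 0)"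
   proof (cases "nice t x")
    case True
    then show ?thesis unfolding \<k>_atMost using F_eq[OF True] by (auto intro!: INF_lower2 simp: nice_def)
   qed (simp add: \<k>_atMost F_def)
  qed
  also have "... < top" by (auto simp: nice_def)
  finally show "Em (\<k> (t, x)) (space (\<k> (t, x))) \<noteq> \<infinity>"
   using UN_atMost by (simp add: \<k>_def)
 qed
 have int_stable: "Int_stable (range (%a::real. {..a}))"
  by (auto simp: Int_stable_def)
 have sets_gen: "sets borel = sigma_sets UNIV (range (%a::real. {..a}))"
  unfolding borel_eq_atMost by simp
 have kernel: "finite_kernel (L >< borel) (borel :: real measure) \<k>"
 proof (rule finite_kernelI_generator[where G = "range (%a. {..a})"])
  show "finite_measure (\<k> w)" for w using \<k>_finite[of "fst w" "snd w"] by simp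
  have meas: "(%w. Em (\<k> w) {..r}) : Bm (L >< borel)" for r
  proof -
   have "Em (\<k> w) {..r} = (if nice (fst w) (snd w) then (INF n. G (dy n r) (fst w) (snd w)) else 0)" for w
    using \<k>_atMost[of "fst w" "snd w" r] F_eq[of "fst w" "snd w" r] by (simp add: F_def)
   then show ?thesis by simp
  qed
  then show "(%w. Em (\<k> w) A) : Bm (L >< borel)" if "A : range (%a. {..a})" for A
   using that by auto
  have "Em (\<k> w) (space borel) = (SUP n. Em (\<k> w) {..real n})" for w
   by (subst SUP_emeasure_incseq) (auto simp: \<k>_def incseq_def UN_atMost[simplified])
  then show "(%w. Em (\<k> w) (space borel)) : Bm (L >< borel)"
   using meas by simp
 qed (use int_stable sets_gen in \<open>auto simp: \<k>_def\<close>)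
 have "Em (h t) (B \<times> A) = (INT+x\<in>B. Em (\<k> (t, x)) A d/lborel)"
  if t: "t : space L" and B[measurable]: "B : sets borel" and A: "A : sets borel" for t B A
 proof -
  note [measurable_cong] = sets_h[OF t]
  have k_t: "finite_kernel borel borel (%x. \<k> (t, x))"
   by (rule finite_kernel_compose[OF kernel]) (use t in auto)
  define \<Phi> where "\<Phi> f = (INT+x. Ind B x * (INT+y. f y d/\<k> (t, x)) d/lborel)" for f
  have \<Phi>: "positive_functional borel \<Phi>"
   unfolding \<Phi>_def
  proof (rule positive_functional_integral)
   show "positive_functional borel (%f. Ind B x * integral\<^sup>N (\<k> (t, x)) f)" for x
    by (intro positive_functional_scale positive_functional_nn_integral) (simp add: \<k>_def)
   show "(%x. Ind B x * integral\<^sup>N (\<k> (t, x)) f) : Bm lborel"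
    if "f : Bm borel" for f
    using measurable_kernel_integral[OF k_t, of id borel "%w. f"] that by simp
  qed
  define N1 where "N1 = measure_by borel (%S. \<Phi> (Ind S))"
  have N1: "Em N1 S = (INT+x\<in>B. Em (\<k> (t, x)) S d/lborel)" if "S : sets borel" for S
   unfolding N1_def using that
   by (subst emeasure_measure_by_functional[OF \<Phi> that]) (simp add: \<Phi>_def \<k>_def mult.commute)
  define N2 where "N2 = distr (density (h t) (%p. Ind B (fst p))) borel snd"
  have N2: "Em N2 S = Em (h t) (B \<times> S)" if [measurable]: "S : sets borel" for S
  proof -
   have "Em N2 S = (INT+p. Ind B (fst p) * Ind (snd -` S \<inter> space (h t)) p d/h t)"
    unfolding N2_def by (simp add: emeasure_distr emeasure_density)
   also have "... = (INT+p. Ind (B \<times> S) p d/h t)"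
    by (intro nn_integral_cong) (auto simp: indicator_def)
   also have "... = Em (h t) (B \<times> S)"
    by (intro nn_integral_indicator) measurable
   finally show ?thesis .
  qed
  have "N1 = N2"
  proof (rule measure_eqI_generator_eq[OF int_stable, where \<Omega> = UNIV and A = "%n. {..real n}"])
   have eq: "Em N1 {..r} = Em N2 {..r}" for r
   proof -
    have "Em N1 {..r} = (INT+x\<in>B. Em (\<k> (t, x)) {..r} d/lborel)" by (rule N1) simp
    also have "... = (INT+x. (INF n. G (dy n r) t x * Ind B x) d/lborel)"
     using AE_nice[OF t]
     by (intro nn_integral_cong_AE, eventually_elim) (auto simp: \<k>_atMost F_eq indicator_def)
    also have "... = (INF n. INT+x\<in>B. G (dy n r) t x d/lborel)"
    proof (rule nn_integral_monotone_convergence_INF_AE')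
     show "AE x in lborel. G (dy (Suc n) r) t x * Ind B x <= G (dy n r) t x * Ind B x" for n
      using AE_nice[OF t] by eventually_elim (use dy_Suc in \<open>auto simp: nice_def indicator_def\<close>)
     have "(INT+x\<in>B. G (dy 0 r) t x d/lborel) = Em (h t) (B \<times> {..real_of_rat (dy 0 r)})"
      unfolding G_def using t by (subst D) auto
     then show "(INT+x\<in>B. G (dy 0 r) t x d/lborel) < \<infinity>" using fin_h[OF t] by simp
    qed (use Gt[OF t] in measurable)
    also have "... = (INF n. Em (h t) (B \<times> {..real_of_rat (dy n r)}))"
     unfolding G_def using t by (subst D) auto
    also have "... = Em (h t) (\<Inter>n. B \<times> {..real_of_rat (dy n r)})"
    proof (rule INF_emeasure_decseq)
     show "decseq (%n. B \<times> {..real_of_rat (dy n r)})"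
      using dy_dec[of r] by (auto simp: decseq_def of_rat_less_eq intro: order_trans)
    qed (use fin_h[OF t] in \<open>auto simp: less_top\<close>)
    also have "(\<Inter>n. B \<times> {..real_of_rat (dy n r)}) = B \<times> {..r}"
    proof -
     have "(\<forall>n. b <= real_of_rat (dy n r)) \<longleftrightarrow> b <= r" for b
     proof
      assume "\<forall>n. b <= real_of_rat (dy n r)"
      then show "b <= r" using dy_small[of r b] by (meson not_le)
     qed (use dy_gt[of r] in \<open>auto intro: order_trans less_imp_le\<close>)
     then show ?thesis by auto
    qed
    also have "Em (h t) (B \<times> {..r}) = Em N2 {..r}" by (simp add: N2)
    finally show ?thesis .
   qed
   show "!!X. X : range (%a. {..a}) ==> Em N1 X = Em N2 X" using eq by auto
   show "Em N1 {..real n} \<noteq> \<infinity>" for n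
    unfolding eq using fin_h[OF t] by (simp add: N2 less_top)
  qed (use sets_gen UN_atMost in \<open>auto simp: N1_def N2_def\<close>)
  then show ?thesis using N1[OF A] N2[OF A] by simp
 qed
 with kernel show ?thesis by blast
qed

lemma parametric_disintegration:
 fixes h :: "'t => ('v::euclidean_space \<times> 'e) measure"
 assumes E: "standard_measurable_space E"
  and h: "finite_kernel L (borel >< E) h"
  and ac: "!!t. t : space L ==> absolutely_continuous lborel (distr (h t) borel fst)"
 shows "\<exists>\<k>. finite_kernel (L >< borel) E \<k> &
  (\<forall>t\<in>space L. \<forall>B\<in>sets borel. \<forall>A\<in>sets E.
   Em (h t) (B \<times> A) = (INT+x\<in>B. Em (\<k> (t, x)) A d/lborel))"
proof -
 obtain A f g where A: "A : sets (borel :: real measure)"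
  and f: "f : measurable E (restrict_space borel A)" and g: "g : measurable (restrict_space borel A) E"
  and gf: "!!y. y : space E ==> g (f y) = y"
  using E unfolding standard_measurable_space_def by blast
 have f_borel[measurable]: "f : Bm E"
  using f by (rule measurable_restrict_space2_iff[THEN iffD1, THEN conjunct1])
 have f_A: "f y : A" if "y : space E" for y
  using measurable_space[OF f that] by (simp add: space_restrict_space)
 have sets_h: "sets (h t) = sets (borel >< E)" if "t : space L" for t
  using finite_kernel_sets[OF h that] .
 note space_h = sets_eq_imp_space_eq[OF sets_h]
 define h' where "h' t = distr (h t) (borel >< borel) (%p. (fst p, f (snd p)))" for t
 have meas: "(%p. (fst p, f (snd p))) : measurable (h t) (borel >< borel)" if "t : space L" for t
 proof -
  note [measurable_cong] = sets_h[OF that]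
  show ?thesis by measurable
 qed
 have h'_eq: "Em (h' t) (B \<times> C) = Em (h t) (B \<times> (f -` C \<inter> space E))"
  if "t : space L" "B : sets borel" "C : sets borel" for t B C
 proof -
  have "(%p. (fst p, f (snd p))) -` (B \<times> C) \<inter> space (h t) = B \<times> (f -` C \<inter> space E)"
   by (auto simp: space_h[OF that(1)] space_pair_measure)
  then show ?thesis
   unfolding h'_def using that by (subst emeasure_distr[OF meas[OF that(1)]]) auto
 qed
 have k': "finite_kernel L (borel >< borel) h'"
 proof (rule finite_kernel_pairI)
  show "sets (h' t) = sets (borel >< borel)" for t by (simp add: h'_def)
  show "finite_measure (h' t)" if "t : space L" for t
   unfolding h'_def by (rule finite_measure.finite_measure_distr[OF finite_kernel_finite[OF h that] meas[OF that]])
  show "(%t. Em (h' t) (B \<times> C)) : Bm L" if "B : sets borel" "C : sets borel" for B C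
   using that finite_kernel_emeasure[OF h, of "B \<times> (f -` C \<inter> space E)"]
   by (subst measurable_cong[OF h'_eq]) (auto intro: measurable_sets)
 qed
 have ac': "absolutely_continuous lborel (distr (h' t) borel fst)" if t: "t : space L" for t
 proof -
  note [measurable_cong] = sets_h[OF t]
  have "distr (h' t) borel fst = distr (h t) borel fst"
   unfolding h'_def by (subst distr_distr) (auto simp: comp_def)
  then show ?thesis using ac[OF t] by simp
 qed
 obtain \<k> where \<k>: "finite_kernel (L >< borel) (borel :: real measure) \<k>"
  and \<k>_eq: "!!t B C. t : space L ==> B : sets borel ==> C : sets borel ==>
   Em (h' t) (B \<times> C) = (INT+x\<in>B. Em (\<k> (t, x)) C d/lborel)"
  using parametric_disintegration_real[OF k' ac'] by blast
 define \<k>' where "\<k>' w = distr (restrict_space (\<k> w) A) E g" for w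
 have g_sets: "g -` C \<inter> A : sets borel" if "C : sets E" for C
  using measurable_sets[OF g that] A by (auto simp: sets_restrict_space_iff space_restrict_space)
 have \<k>'_eq: "Em (\<k>' w) C = Em (\<k> w) (g -` C \<inter> A)" if w: "w : space (L >< borel)" and C: "C : sets E" for w C
 proof -
  note s = finite_kernel_sets[OF \<k> w]
  have "g : measurable (restrict_space (\<k> w) A) E"
   using g by (simp cong: measurable_cong_sets add: sets_restrict_space_cong[OF s] measurable_cong_sets[OF sets_restrict_space_cong[OF s] refl])
  then show ?thesis
   unfolding \<k>'_def using C A s sets_eq_imp_space_eq[OF s]
   by (simp add: emeasure_distr space_restrict_space emeasure_restrict_space)
 qed
 have "finite_kernel (L >< borel) E \<k>'"
  unfolding finite_kernel_def kernel_def
 proof (intro conjI ballI)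
  show "sets (\<k>' w) = sets E" for w by (simp add: \<k>'_def)
  show "(%w. Em (\<k>' w) C) : Bm (L >< borel)" if "C : sets E" for C
   using finite_kernel_emeasure[OF \<k> g_sets[OF that]] that by (subst measurable_cong[OF \<k>'_eq]) auto
  show "finite_measure (\<k>' w)" if w: "w : space (L >< borel)" for w
  proof (rule finite_measureI)
   show "Em (\<k>' w) (space (\<k>' w)) \<noteq> \<infinity>"
    using finite_measure.emeasure_finite[OF finite_kernel_finite[OF \<k> w]] \<k>'_eq[OF w sets.top]
    by (simp add: \<k>'_def)
  qed
 qed
 moreover have "Em (h t) (B \<times> C) = (INT+x\<in>B. Em (\<k>' (t, x)) C d/lborel)"
  if t: "t : space L" and B: "B : sets borel" and C: "C : sets E" for t B C
 proof -
  have "f -` (g -` C \<inter> A) \<inter> space E = C"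
   using gf f_A sets.sets_into_space[OF C] by auto
  then have "Em (h t) (B \<times> C) = Em (h' t) (B \<times> (g -` C \<inter> A))"
   using h'_eq[OF t B g_sets[OF C]] by simp
  also have "... = (INT+x\<in>B. Em (\<k>' (t, x)) C d/lborel)"
   unfolding \<k>_eq[OF t B g_sets[OF C]] using t
   by (intro nn_integral_cong) (simp add: \<k>'_eq[OF _ C] space_pair_measure)
  finally show ?thesis .
 qed
 ultimately show ?thesis by blast
qed

lemma lifetime_borel[measurable]: "lifetime T : sets borel"
proof -
 have "lifetime T = {t : space borel. 0 <= t & ennreal t < T}" by (simp add: lifetime_def)
 also have "... : sets borel" by measurable
 finally show ?thesis .
qed

lemma states_sets: "\<mu> : states E ==> sets \<mu> = sets (borel >< E)"
 and states_finite: "\<mu> : states E ==> finite_measure \<mu>"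
 by (simp_all add: states_def)

lemma process_fibre:
 fixes \<mu> :: "real => ('v::euclidean_space \<times> 'e) measure"
 assumes E: "standard_measurable_space E" and \<mu>: "process E T \<mu>"
 shows "finite_kernel (borel >< borel) E (%(t, x). process_fibre E T \<mu> t x)"
  and "!!t. t : lifetime T ==> disintegrates E (\<mu> t) (process_fibre E T \<mu> t)"
proof -
 let ?L = "restrict_space borel (lifetime T)"
 have L: "space ?L = lifetime T" by (simp add: space_restrict_space)
 have states: "\<mu> t : states E" if "t : lifetime T" for t
  using \<mu> that by (simp add: process_def)
 have "finite_kernel ?L (borel >< E) \<mu>"
  using \<mu> by (intro finite_kernel_pairI) (auto simp: process_def L states_sets states_finite)
 moreover have "absolutely_continuous lborel (distr (\<mu> t) borel fst)" if "t : space ?L" for t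
  using states[of t] that by (simp add: L states_def)
 ultimately obtain \<k> where \<k>: "finite_kernel (?L >< borel) E \<k>"
  and eq: "!!t B A. t : lifetime T ==> B : sets borel ==> A : sets E ==>
   Em (\<mu> t) (B \<times> A) = (INT+x\<in>B. Em (\<k> (t, x)) A d/lborel)"
  using parametric_disintegration[OF E, of ?L \<mu>] by (auto simp: L)
 define \<k>' where "\<k>' t x = (if t : lifetime T then \<k> (t, x) else null_measure E)" for t x
 have sets': "sets (\<k>' t x) = sets E" and fin': "finite_measure (\<k>' t x)" for t x
  using finite_kernel_sets[OF \<k>, of "(t, x)"] finite_kernel_finite[OF \<k>, of "(t, x)"]
  by (auto simp: \<k>'_def space_pair_measure L intro!: finite_measureI)
 have "finite_kernel (borel >< borel) E (%(t, x). \<k>' t x)"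
  unfolding finite_kernel_def kernel_def
 proof (intro conjI ballI)
  fix A assume A: "A : sets E"
  have id: "(%w. (fst w, snd w)) : measurable (restrict_space (borel >< borel) {w. fst w : lifetime T}) (?L >< (borel :: 'v measure))"
   by (intro measurable_Pair measurable_restrict_space2 measurable_restrict_space1) (auto simp: space_restrict_space)
  have "(%w. if fst w : lifetime T then Em (\<k> w) A else 0) : Bm (borel >< (borel :: 'v measure))"
  proof (subst measurable_If_restrict_space_iff)
   show "{x : space (borel >< (borel :: 'v measure)). fst x : lifetime T} : sets (borel >< borel)"
    by measurable
   show "(%w. Em (\<k> w) A) : Bm (restrict_space (borel >< borel) {w. fst w : lifetime T}) &
    (%w. 0::ennreal) : Bm (restrict_space (borel >< borel) {w. fst w \<notin> lifetime T})"
    using measurable_compose[OF id finite_kernel_emeasure[OF \<k> A]] by simp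
  qed
  then show "(%w. Em (case w of (t, x) => \<k>' t x) A) : Bm (borel >< borel)"
   by (rule measurable_cong[THEN iffD1, rotated]) (auto simp: \<k>'_def split: prod.split)
 qed (auto simp: sets' fin' split: prod.split)
 moreover have "disintegrates E (\<mu> t) (\<k>' t)" if t: "t : lifetime T" for t
  unfolding disintegrates_def
 proof (intro conjI ballI)
  show "finite_kernel borel E (\<k>' t)"
   using finite_kernel_compose[OF calculation, of "%x. (t, x)" borel] by simp
  show "Em (\<mu> t) (B \<times> A) = (INT+x\<in>B. Em (\<k>' t x) A d/lborel)"
   if "B : sets borel" "A : sets E" for A B
   using eq[OF t that] t by (simp add: \<k>'_def)
 qed
 ultimately have "\<exists>\<k>. finite_kernel (borel >< borel) E (%(t, x). \<k> t x) &
  (\<forall>t\<in>lifetime T. disintegrates E (\<mu> t) (\<k> t))" by blast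
 from someI_ex[OF this]
 show "finite_kernel (borel >< borel) E (%(t, x). process_fibre E T \<mu> t x)"
  and "!!t. t : lifetime T ==> disintegrates E (\<mu> t) (process_fibre E T \<mu> t)"
  unfolding process_fibre_def by auto
qed

lemma disintegrates_fibre:
 assumes "standard_measurable_space E" "\<mu> : states E"
 shows "disintegrates E \<mu> (fibre E \<mu>)"
proof -
 have "process E \<infinity> (%_. \<mu>)" using assms by (simp add: process_def)
 from process_fibre(2)[OF assms(1) this, of 0] have "\<exists>\<k>. disintegrates E \<mu> \<k>"
  by (auto simp: lifetime_def)
 then show ?thesis unfolding fibre_def by (rule someI_ex)
qed

lemma disintegrates_nn_integral:
 fixes \<mu> :: "('v::euclidean_space \<times> 'e) measure"
 assumes \<k>: "disintegrates E \<mu> \<k>" and sets: "sets \<mu> = sets (borel >< E)" and fin: "finite_measure \<mu>"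
  and f: "f : Bm (borel >< E)"
 shows "(INT+p. f p d/\<mu>) = (INT+x. INT+y. f (x, y) d/\<k> x d/lborel)"
proof -
 have k: "finite_kernel borel E \<k>" using \<k> by (simp add: disintegrates_def)
 have k_meas[measurable]: "(%x. INT+y. g (x, y) d/\<k> x) : Bm borel"
  if "g : Bm (borel >< E)" for g
  using measurable_kernel_integral[OF k measurable_ident_sets[OF refl], of "%x y. g (x, y)"] that by simp
 define \<Phi> where "\<Phi> f = (INT+x. INT+y. f (x, y) d/\<k> x d/lborel)" for f
 have \<Phi>: "positive_functional (borel >< E) \<Phi>"
  unfolding \<Phi>_def
 proof (rule positive_functional_integral)
  fix x :: 'v
  show "positive_functional (borel >< E) (%f. INT+y. f (x, y) d/\<k> x)"
   by (rule positive_functional_compose[OF positive_functional_nn_integral[OF finite_kernel_sets[OF k, of x]], of _ "%f y. f (x, y)"])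
    (auto intro!: positive_functionalI simp: space_pair_measure)
 qed (use k_meas in simp)
 define N where "N = measure_by (borel >< E) (%S. \<Phi> (Ind S))"
 have N: "Em N (B \<times> A) = Em \<mu> (B \<times> A)" if "B : sets borel" "A : sets E" for A B
 proof -
  have "Em N (B \<times> A) = (INT+x. INT+y. Ind (B \<times> A) (x, y) d/\<k> x d/lborel)"
   unfolding N_def using that by (subst emeasure_measure_by_functional[OF \<Phi>]) (auto simp: \<Phi>_def)
  also have "... = (INT+x\<in>B. Em (\<k> x) A d/lborel)"
  proof (rule nn_integral_cong)
   fix x :: 'v
   have "(INT+y. Ind (B \<times> A) (x, y) d/\<k> x) = (INT+y. Ind B x * Ind A y d/\<k> x)"
    by (simp add: indicator_times)
   also have "... = Ind B x * Em (\<k> x) A"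
    using that finite_kernel_sets[OF k, of x] by (subst nn_integral_cmult) (simp_all add: borel_measurable_indicator)
   finally show "(INT+y. Ind (B \<times> A) (x, y) d/\<k> x) = Em (\<k> x) A * Ind B x"
    by (simp add: mult.commute)
  qed
  also have "... = Em \<mu> (B \<times> A)" using \<k> that by (simp add: disintegrates_def)
  finally show ?thesis .
 qed
 have "N = \<mu>"
 proof (rule measure_eqI_generator_eq[OF Int_stable_pair_measure_generator[of borel E], where \<Omega> = "UNIV \<times> space E" and A = "%_. UNIV \<times> space E"])
  show "Em N (UNIV \<times> space E) \<noteq> \<infinity>"
   using N[of UNIV "space E"] finite_measure.emeasure_finite[OF fin] by simp
  show "range (%_::nat. UNIV \<times> space E) \<subseteq> {a \<times> b |a b. a : sets borel & b : sets E}"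
   by (intro image_subsetI CollectI exI[of _ UNIV] exI[of _ "space E"]) simp
 qed (use N pair_measure_closed[of borel E] in \<open>auto simp: N_def sets sets_pair_measure\<close>)
 then have "(INT+p. f p d/\<mu>) = \<Phi> f"
  using nn_integral_measure_by_functional[OF \<Phi> f] by (simp add: N_def)
 then show ?thesis by (simp add: \<Phi>_def)
qed

text \<open>Fibres are unique almost everywhere, so they are additive almost everywhere; one exceptional set
serves all test functions because a standard space has a countable generator.\<close>

lemma AE_fibre_add:
 fixes \<mu> :: "('v::euclidean_space \<times> 'e) measure"
 assumes E: "standard_measurable_space E"
  and d: "disintegrates E \<nu> \<k>\<nu>" "disintegrates E \<pi> \<k>\<pi>" "disintegrates E \<mu> \<k>"
  and fin: "finite_measure \<mu>"
  and add: "!!B A. B : sets borel ==> A : sets E ==>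
   Em \<mu> (B \<times> A) = Em \<nu> (B \<times> A) + Em \<pi> (B \<times> A)"
 shows "AE x in lborel. \<forall>f\<in>Bm E.
  (INT+y. f y d/\<k> x) = (INT+y. f y d/\<k>\<nu> x) + (INT+y. f y d/\<k>\<pi> x)"
proof -
 obtain A0 i g where A0: "A0 : sets (borel :: real measure)"
  and i: "i : measurable E (restrict_space borel A0)" and g: "g : measurable (restrict_space borel A0) E"
  and gi: "!!y. y : space E ==> g (i y) = y"
  using E unfolding standard_measurable_space_def by blast
 have i_borel[measurable]: "i : Bm E"
  using i by (rule measurable_restrict_space2_iff[THEN iffD1, THEN conjunct1])
 have i_A: "i y : A0" if "y : space E" for y
  using measurable_space[OF i that] by (simp add: space_restrict_space)
 define G where "G = range (%q::rat. i -` {..real_of_rat q} \<inter> space E)"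
 have sets_E: "sets E = sigma_sets (space E) G"
 proof -
  let ?R = "range (%q::rat. {..real_of_rat q})"
  have s1: "sets borel = sigma_sets UNIV ?R"
  proof -
   have "{..a} : sigma_sets UNIV ?R" for a :: real
   proof -
    have "\<exists>q::rat. a < real_of_rat q & real_of_rat q < b" if "a < b" for b
     using of_rat_dense[OF that] by blast
    then have "{..a} = (\<Inter>q\<in>{q::rat. a < real_of_rat q}. {..real_of_rat q})"
     by (auto intro: less_imp_le order_trans) (meson not_le)
    moreover have "{q::rat. a < real_of_rat q} \<noteq> {}"
     using of_rat_dense[of a "a + 1"] by auto
    moreover have "(\<Inter>q\<in>{q::rat. a < real_of_rat q}. {..real_of_rat q}) : sigma_sets UNIV ?R"
    proof -
     interpret sigma_algebra UNIV "sigma_sets UNIV ?R" by (rule sigma_algebra_sigma_sets) auto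
     show ?thesis using calculation(2) by (intro countable_INT') auto
    qed
    ultimately show ?thesis by simp
   qed
   then have "sigma_sets UNIV (range (%a::real. {..a})) \<subseteq> sigma_sets UNIV ?R"
    by (intro sigma_sets_mono) auto
   moreover have "sets (borel :: real measure) = sigma_sets UNIV (range (%a::real. {..a}))"
    unfolding borel_eq_atMost by simp
   moreover have "sigma_sets UNIV ?R \<subseteq> sets borel"
    by (rule sets.sigma_sets_subset[of _ borel, simplified]) auto
   ultimately show ?thesis by auto
  qed
  have s2: "sigma_sets (space E) G = {i -` A \<inter> space E |A. A : sigma_sets UNIV ?R}"
   unfolding G_def by (subst sigma_sets_vimage_commute) (auto intro!: arg_cong2[where f=sigma_sets])
  have s3: "sets E = {i -` A \<inter> space E |A. A : sets borel}"
  proof (intro equalityI subsetI)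
   fix S assume S: "S : sets E"
   have "i -` (g -` S \<inter> A0) \<inter> space E = S"
    using gi i_A sets.sets_into_space[OF S] by auto
   moreover have "g -` S \<inter> A0 : sets borel"
    using measurable_sets[OF g S] A0 by (auto simp: sets_restrict_space_iff space_restrict_space)
   ultimately show "S : {i -` A \<inter> space E |A. A : sets borel}" by blast
  qed auto
  show ?thesis unfolding s2 s1[symmetric] by (rule s3)
 qed
 have G_sets: "G \<subseteq> sets E" unfolding sets_E by (auto intro: sigma_sets.Basic)
 have k: "finite_kernel borel E \<k>" "finite_kernel borel E \<k>\<nu>" "finite_kernel borel E \<k>\<pi>"
  using d by (simp_all add: disintegrates_def)
 have AE1: "AE x in lborel. Em (\<k> x) A = Em (\<k>\<nu> x) A + Em (\<k>\<pi> x) A" if A: "A : sets E" for A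
 proof -
  note [measurable] = finite_kernel_emeasure[OF k(1) A] finite_kernel_emeasure[OF k(2) A] finite_kernel_emeasure[OF k(3) A]
  have eq: "(INT+x\<in>B. Em (\<k> x) A d/lborel) = (INT+x\<in>B. (Em (\<k>\<nu> x) A + Em (\<k>\<pi> x) A) d/lborel)"
   if [measurable]: "B : sets borel" for B
  proof -
   have "(INT+x\<in>B. Em (\<k> x) A d/lborel) = (INT+x\<in>B. Em (\<k>\<nu> x) A d/lborel) + (INT+x\<in>B. Em (\<k>\<pi> x) A d/lborel)"
   proof -
    have "Em \<mu> (B \<times> A) = (INT+x\<in>B. Em (\<k> x) A d/lborel)"
     "Em \<nu> (B \<times> A) = (INT+x\<in>B. Em (\<k>\<nu> x) A d/lborel)"
     "Em \<pi> (B \<times> A) = (INT+x\<in>B. Em (\<k>\<pi> x) A d/lborel)"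
     using d that A unfolding disintegrates_def by blast+
    then show ?thesis using add[OF that A] by metis
   qed
   also have "... = (INT+x\<in>B. (Em (\<k>\<nu> x) A + Em (\<k>\<pi> x) A) d/lborel)"
    unfolding distrib_right by (rule nn_integral_add[symmetric]) measurable
   finally show ?thesis .
  qed
  have fin1: "(INT+x. Em (\<k> x) A d/lborel) < \<infinity>"
  proof -
   have "Em \<mu> (UNIV \<times> A) = (INT+x\<in>UNIV. Em (\<k> x) A d/lborel)"
    using d(3) A by (auto simp: disintegrates_def)
   then show ?thesis using finite_measure.emeasure_finite[OF fin, of "UNIV \<times> A"] by (simp add: less_top)
  qed
  have "AE x in lborel. Em (\<k> x) A <= Em (\<k>\<nu> x) A + Em (\<k>\<pi> x) A"
   using eq fin1 eq[of UNIV] by (intro AE_le_if_set_integrals_le) auto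
  moreover have "AE x in lborel. Em (\<k>\<nu> x) A + Em (\<k>\<pi> x) A <= Em (\<k> x) A"
   using eq fin1 by (intro AE_le_if_set_integrals_le) auto
  ultimately show ?thesis by eventually_elim auto
 qed
 have "AE x in lborel. \<forall>q. Em (\<k> x) (i -` {..real_of_rat q} \<inter> space E) =
   Em (\<k>\<nu> x) (i -` {..real_of_rat q} \<inter> space E) + Em (\<k>\<pi> x) (i -` {..real_of_rat q} \<inter> space E)"
  unfolding AE_all_countable by (intro allI AE1) measurable
 then show ?thesis
 proof eventually_elim
  case (elim x)
  define \<Phi> where "\<Phi> f = (INT+y. f y d/\<k>\<nu> x) + (INT+y. f y d/\<k>\<pi> x)" for f
  have \<Phi>: "positive_functional E \<Phi>"
   unfolding \<Phi>_def by (intro positive_functional_plus positive_functional_nn_integral)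
    (auto simp: finite_kernel_sets[OF k(2)] finite_kernel_sets[OF k(3)])
  define N where "N = measure_by E (%S. \<Phi> (Ind S))"
  have N: "Em N A = Em (\<k>\<nu> x) A + Em (\<k>\<pi> x) A" if "A : sets E" for A
   unfolding N_def using that
   by (subst emeasure_measure_by_functional[OF \<Phi> that]) (simp add: \<Phi>_def finite_kernel_sets[OF k(2)] finite_kernel_sets[OF k(3)])
  have "\<k> x = N"
  proof (rule measure_eqI_generator_eq[where E = G and \<Omega> = "space E" and A = "%n. i -` {..real_of_rat (of_nat n)} \<inter> space E"])
   show "Int_stable G"
    unfolding G_def Int_stable_def
   proof safe
    fix q q' :: rat
    have "i -` {..real_of_rat q} \<inter> space E \<inter> (i -` {..real_of_rat q'} \<inter> space E) = i -` {..real_of_rat (min q q')} \<inter> space E"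
    proof -
     have "real_of_rat (min q q') = min (real_of_rat q) (real_of_rat q')"
      by (simp add: min_def of_rat_less_eq)
     then show ?thesis by auto
    qed
    then show "i -` {..real_of_rat q} \<inter> space E \<inter> (i -` {..real_of_rat q'} \<inter> space E) : range (%q. i -` {..real_of_rat q} \<inter> space E)"
     by (rule range_eqI)
   qed
   show "Em (\<k> x) X = Em N X" if "X : G" for X
    using that elim G_sets N by (auto simp: G_def subset_eq)
   show "(\<Union>n. i -` {..real_of_rat (of_nat n)} \<inter> space E) = space E"
    using real_arch_simple by auto
   show "Em (\<k> x) (i -` {..real_of_rat (of_nat n)} \<inter> space E) \<noteq> \<infinity>" for n
    using finite_measure.emeasure_finite[OF finite_kernel_finite[OF k(1)]] by simp
   show "sets (\<k> x) = sigma_sets (space E) G" "sets N = sigma_sets (space E) G"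
    by (simp_all add: finite_kernel_sets[OF k(1)] N_def sets_E[symmetric])
   show "range (%n. i -` {..real_of_rat (of_nat n)} \<inter> space E) \<subseteq> G"
    unfolding G_def by blast
  qed (auto simp: G_def)
  then show ?case
   using nn_integral_measure_by_functional[OF \<Phi>] by (auto simp: N_def \<Phi>_def)
 qed
qed

section \<open>Gaussian densities\<close>

lemma borel_measurable_heat_kernel[measurable (raw)]:
 assumes [measurable]: "f : Bm M" "g : measurable M borel" "h : measurable M borel"
 shows "(%w. heat_kernel (f w) (g w) (h w :: 'v::euclidean_space)) : Bm M"
 unfolding heat_kernel_def by measurable

lemma heat_kernel_nonneg[simp]: "0 <= heat_kernel t x y"
 by (simp add: heat_kernel_def)

lemma heat_kernel_pos: "0 < t ==> 0 < heat_kernel t x y"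
 by (simp add: heat_kernel_def)

lemma heat_kernel_le:
 fixes x y :: "'v::euclidean_space"
 assumes "0 < \<delta>" "\<delta> <= t"
 shows "heat_kernel t x y <= (2 * pi * \<delta>) powr (- real DIM('v) / 2)"
proof -
 have "(2 * pi * t) powr (- real DIM('v) / 2) <= (2 * pi * \<delta>) powr (- real DIM('v) / 2)"
  using assms by (intro powr_mono2') auto
 moreover have "exp (- (norm (x - y))\<^sup>2 / (2 * t)) <= 1" using assms by simp
 ultimately show ?thesis
  unfolding heat_kernel_def using mult_mono[of "(2 * pi * t) powr (- real DIM('v) / 2)" "(2 * pi * \<delta>) powr (- real DIM('v) / 2)" "exp (- (norm (x - y))\<^sup>2 / (2 * t))" 1] by simp
qed

lemma nn_integral_heat_kernel:
 fixes x :: "'v::euclidean_space"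
 assumes t: "0 < t"
 shows "(INT+y. (hk t x y) d/lborel) = 1"
proof -
 have eq: "heat_kernel t x y = (\<Prod>b\<in>Basis. normal_density (x \<bullet> b) (sqrt t) (y \<bullet> b))" for y :: 'v
 proof -
  have "(\<Prod>b\<in>(Basis :: 'v set). 1 / sqrt (2 * pi * t)) = (2 * pi * t) powr (- real DIM('v) / 2)"
  proof -
   have "1 / sqrt (2 * pi * t) = (2 * pi * t) powr (- 1 / 2)"
    using t by (simp add: powr_minus_divide powr_half_sqrt)
   then have "(\<Prod>b\<in>(Basis :: 'v set). 1 / sqrt (2 * pi * t)) = ((2 * pi * t) powr (- 1 / 2)) powr (real DIM('v))"
    using t by (simp add: powr_realpow)
   then show ?thesis by (simp add: powr_powr)
  qed
  moreover have "(norm (x - y))\<^sup>2 = (\<Sum>b\<in>Basis. (y \<bullet> b - x \<bullet> b)\<^sup>2)"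
   unfolding power2_norm_eq_inner by (subst euclidean_inner) (simp add: inner_diff_left power2_eq_square algebra_simps)
  ultimately show ?thesis
   using t unfolding heat_kernel_def normal_density_def prod.distrib
   by (simp add: exp_sum[symmetric] sum_divide_distrib sum_negf)
 qed
 have "(INT+y. (hk t x y) d/lborel)
   = (INT+y. (\<Prod>b\<in>Basis. ennreal (normal_density (x \<bullet> b) (sqrt t) (y \<bullet> b))) d/lborel)"
  by (simp add: eq prod_ennreal)
 also have "... = (\<Prod>b\<in>(Basis :: 'v set). INT+r. ennreal (normal_density (x \<bullet> b) (sqrt t) r) d/lborel)"
  by (rule nn_integral_lborel_prod) auto
 also have "... = 1"
 proof (intro prod.neutral ballI)
  fix b :: 'v
  interpret prob_space "density lborel (%r. ennreal (normal_density (x \<bullet> b) (sqrt t) r))"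
   using t by (intro prob_space_normal_density) simp
  show "(INT+r. ennreal (normal_density (x \<bullet> b) (sqrt t) r) d/lborel) = 1"
   using emeasure_space_1 by (simp add: emeasure_density)
 qed
 finally show ?thesis .
qed

lemma heat_kernel_mult:
 fixes x y z :: "'v::euclidean_space"
 assumes s: "0 < s" and t: "0 < t"
 shows "heat_kernel s x z * heat_kernel t z y =
  heat_kernel (s + t) x y * heat_kernel (s * t / (s + t)) (x + (s / (s + t)) *\<^sub>R (y - x)) z"
proof -
 define u v where "u = z - x" and "v = y - x"
 have 1: "(2 * pi * s) powr c * (2 * pi * t) powr c = (2 * pi * (s + t)) powr c * (2 * pi * (s * t / (s + t))) powr c" for c
  using s t by (simp add: powr_mult powr_divide)
 have "(norm (x - z))\<^sup>2 / (2 * s) + (norm (z - y))\<^sup>2 / (2 * t)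
   = (u \<bullet> u) / (2 * s) + (u \<bullet> u - 2 * (u \<bullet> v) + v \<bullet> v) / (2 * t)"
 proof -
  have "(norm (x - z))\<^sup>2 = u \<bullet> u" by (simp add: u_def norm_minus_commute[of x] power2_norm_eq_inner)
  moreover have "(norm (z - y))\<^sup>2 = (u - v) \<bullet> (u - v)" by (simp add: u_def v_def power2_norm_eq_inner)
  ultimately show ?thesis by (simp add: inner_diff inner_commute)
 qed
 also have "... = (v \<bullet> v) / (2 * (s + t)) + ((s / (s + t))\<^sup>2 * (v \<bullet> v) - 2 * (s / (s + t)) * (u \<bullet> v) + u \<bullet> u) / (2 * (s * t / (s + t)))"
 proof -
  define A B C w where "A = u \<bullet> u" and "B = u \<bullet> v" and "C = v \<bullet> v" and "w = s + t"
  have w: "0 < w" using s t by (simp add: w_def)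
  have "((s / w)\<^sup>2 * C - 2 * (s / w) * B + A) / (2 * (s * t / w)) = s * C / (2 * w * t) - B / t + A * w / (2 * s * t)"
   using s t w by (simp add: field_simps power2_eq_square)
  moreover have "C / (2 * w) + s * C / (2 * w * t) = C / (2 * t)"
   using s t by (simp add: w_def divide_simps) (simp add: algebra_simps)
  moreover have "A / (2 * s) + (A - 2 * B + C) / (2 * t) = A * w / (2 * s * t) - B / t + C / (2 * t)"
   using s t by (simp add: w_def field_simps)
  ultimately show ?thesis unfolding A_def[symmetric] B_def[symmetric] C_def[symmetric] w_def[symmetric] by linarith
 qed
 also have "... = (norm (x - y))\<^sup>2 / (2 * (s + t)) + (norm (x + (s / (s + t)) *\<^sub>R (y - x) - z))\<^sup>2 / (2 * (s * t / (s + t)))"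
 proof -
  have "(norm (x - y))\<^sup>2 = v \<bullet> v" by (simp add: v_def norm_minus_commute[of x] power2_norm_eq_inner)
  moreover have "x + (s / (s + t)) *\<^sub>R (y - x) - z = (s / (s + t)) *\<^sub>R v - u"
   by (simp add: u_def v_def)
  moreover have "(norm (c *\<^sub>R v - u))\<^sup>2 = c\<^sup>2 * (v \<bullet> v) - 2 * c * (u \<bullet> v) + u \<bullet> u" for c
   unfolding power2_norm_eq_inner by (simp add: inner_diff inner_commute power2_eq_square algebra_simps)
  ultimately show ?thesis by simp
 qed
 finally have 2: "(norm (x - z))\<^sup>2 / (2 * s) + (norm (z - y))\<^sup>2 / (2 * t) =
  (norm (x - y))\<^sup>2 / (2 * (s + t)) + (norm (x + (s / (s + t)) *\<^sub>R (y - x) - z))\<^sup>2 / (2 * (s * t / (s + t)))" .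
 define c where "c = - real DIM('v) / 2"
 have "heat_kernel s x z * heat_kernel t z y
   = ((2 * pi * s) powr c * (2 * pi * t) powr c) * exp (- ((norm (x - z))\<^sup>2 / (2 * s) + (norm (z - y))\<^sup>2 / (2 * t)))"
  unfolding heat_kernel_def c_def minus_add_distrib exp_add by (simp add: mult_ac)
 also have "... = heat_kernel (s + t) x y * heat_kernel (s * t / (s + t)) (x + (s / (s + t)) *\<^sub>R (y - x)) z"
  unfolding heat_kernel_def 1 2 c_def[symmetric] minus_add_distrib exp_add by (simp add: mult_ac)
 finally show ?thesis .
qed

lemma heat_kernel_chapman_kolmogorov:
 fixes x y :: "'v::euclidean_space"
 assumes "0 < s" "0 < t"
 shows "(INT+z. (hk s x z) * (hk t z y) d/lborel) = (hk (s + t) x y)"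
 using assms
 by (simp add: ennreal_mult'[symmetric] heat_kernel_mult)
  (simp add: ennreal_mult' nn_integral_cmult nn_integral_heat_kernel)

definition standard_gaussian :: "'v::euclidean_space measure" where
 "standard_gaussian = density lborel (%z. (hk 1 0 z))"

lemma sets_standard_gaussian[simp, measurable_cong]: "sets standard_gaussian = sets borel"
 by (simp add: standard_gaussian_def)

lemma space_standard_gaussian[simp]: "space standard_gaussian = UNIV"
 by (simp add: standard_gaussian_def)

lemma prob_space_standard_gaussian: "prob_space (standard_gaussian :: 'v::euclidean_space measure)"
 by (rule prob_spaceI) (simp add: standard_gaussian_def emeasure_density nn_integral_heat_kernel)

lemma nn_integral_heat_kernel_gaussian:
 fixes x :: "'v::euclidean_space"
 assumes t: "0 < t" and [measurable]: "f : Bm borel"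
 shows "(INT+z. (hk t x z) * f z d/lborel) = (INT+g. f (x + sqrt t *\<^sub>R g) d/standard_gaussian)"
proof -
 have eq: "ennreal (sqrt t ^ DIM('v)) * (hk t x (x + sqrt t *\<^sub>R g)) = (hk 1 0 g)" for g
 proof -
  have "sqrt t ^ DIM('v) = t powr (real DIM('v) / 2)"
   using t by (simp add: powr_half_sqrt[symmetric] powr_realpow[symmetric] powr_powr)
  moreover have "t powr (real DIM('v) / 2) * (2 * pi * t) powr (- real DIM('v) / 2) = (2 * pi) powr (- real DIM('v) / 2)"
   using t by (simp add: powr_mult powr_minus field_simps)
  moreover have "(norm (x - (x + sqrt t *\<^sub>R g)))\<^sup>2 / (2 * t) = (norm (0 - g))\<^sup>2 / (2 * 1)"
   using t by (simp add: power_mult_distrib)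
  ultimately have "sqrt t ^ DIM('v) * heat_kernel t x (x + sqrt t *\<^sub>R g) = heat_kernel 1 0 g"
   unfolding heat_kernel_def by (simp add: mult.assoc[symmetric])
  then show ?thesis using t by (simp add: ennreal_mult'[symmetric])
 qed
 have "(INT+z. (hk t x z) * f z d/lborel) =
  (INT+z. (hk t x z) * f z d/density (distr lborel borel (%g. x + sqrt t *\<^sub>R g)) (%_. \<bar>sqrt t\<bar> ^ DIM('v)))"
  using t by (subst lborel_affine[of "sqrt t" x]) auto
 also have "... = (INT+g. ennreal (sqrt t ^ DIM('v)) * ((hk t x (x + sqrt t *\<^sub>R g)) * f (x + sqrt t *\<^sub>R g)) d/lborel)"
  using t by (simp add: nn_integral_density nn_integral_distr)
 also have "... = (INT+g. f (x + sqrt t *\<^sub>R g) d/standard_gaussian)"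
  unfolding mult.assoc[symmetric] eq by (simp add: standard_gaussian_def nn_integral_density)
 finally show ?thesis .
qed

text \<open>Gaussian decay outweighs the number \<open>2 ^ n\<close> of nodes in level \<open>n\<close> of the tree below, as Borel-Cantelli
requires.\<close>

lemma standard_gaussian_tail:
 assumes r: "0 <= r"
 shows "Em (standard_gaussian :: 'v::euclidean_space measure) {z. r < norm z} <= ennreal (2 powr (real DIM('v) / 2) * exp (- r\<^sup>2 / 4))"
proof -
 have le: "heat_kernel 1 0 z * Ind {z. r < norm z} z <= 2 powr (real DIM('v) / 2) * exp (- r\<^sup>2 / 4) * heat_kernel 2 0 z" for z :: 'v
 proof (cases "r < norm z")
  case True
  have "r\<^sup>2 <= (norm z)\<^sup>2" using True r by (intro power_mono) auto
  then have "exp (- (norm z)\<^sup>2 / 2) <= exp (- r\<^sup>2 / 4) * exp (- (norm z)\<^sup>2 / 4)"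
   unfolding exp_add[symmetric] by (simp add: field_simps)
  moreover have "(2 * pi * 1) powr (- real DIM('v) / 2) = 2 powr (real DIM('v) / 2) * (2 * pi * 2) powr (- real DIM('v) / 2)"
   by (simp add: powr_mult powr_minus field_simps powr_add[symmetric])
  ultimately show ?thesis using True
   unfolding heat_kernel_def by (simp add: mult_ac mult_left_mono)
 qed (simp add: heat_kernel_def)
 have "Em standard_gaussian {z :: 'v. r < norm z} = (INT+z. ennreal (heat_kernel 1 0 z * Ind {z. r < norm z} z) d/(lborel :: 'v measure))"
  by (simp add: standard_gaussian_def emeasure_density ennreal_mult' ennreal_indicator)
 also have "... <= (INT+z. ennreal (2 powr (real DIM('v) / 2) * exp (- r\<^sup>2 / 4)) * (hk 2 0 z) d/(lborel :: 'v measure))"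
  using le by (auto simp: ennreal_mult'[symmetric] intro!: nn_integral_mono ennreal_leI)
 also have "... = ennreal (2 powr (real DIM('v) / 2) * exp (- r\<^sup>2 / 4))"
  by (subst nn_integral_cmult) (auto simp: nn_integral_heat_kernel)
 finally show ?thesis .
qed

section \<open>Pinned expectations\<close>

primrec pinned_integral ::
  "real => 'v::euclidean_space => real => 'v => (real \<times> ('v => ennreal)) list => ennreal" where
 "pinned_integral s x t x' [] = (hk (t - s) x x')"
| "pinned_integral s x t x' (rf # L) =
  (INT+z. (hk (fst rf - s) x z) * (snd rf z * pinned_integral (fst rf) z t x' L) d/lborel)"

lemma pinned_mass_eq_pinned_integral:
 "pinned_mass s \<alpha> x t x' L = pinned_integral (\<alpha> * s) x (\<alpha> * t) x' (map (%rA. (\<alpha> * fst rA, Ind (snd rA))) L)"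
 by (induction L arbitrary: s x) (simp_all add: right_diff_distrib mult_ac)

lemma borel_measurable_pinned_integral_pair:
 assumes "!!rf. rf : set L ==> snd rf : Bm borel"
 shows "(%p. pinned_integral s (fst p) t (snd p :: 'v::euclidean_space) L) : Bm (borel >< borel)"
 using assms
proof (induction L arbitrary: s)
 case (Cons rf L)
 have [measurable]: "snd rf : Bm borel" using Cons.prems(1) by simp
 have IH: "(%p. pinned_integral (fst rf) (fst p) t (snd p :: 'v) L) : Bm (borel >< borel)"
  using Cons by auto
 have [measurable]: "(%q. pinned_integral (fst rf) (snd q) t (snd (fst q) :: 'v) L) : Bm ((borel >< borel) >< borel)"
 proof -
  have "(%q. (snd q, snd (fst q))) : measurable ((borel >< borel) >< borel) (borel >< (borel :: 'v measure))"
   by measurable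
  from measurable_compose[OF this IH] show ?thesis by simp
 qed
 show ?case by simp
qed simp

lemma borel_measurable_pinned_integral[measurable (raw)]:
 assumes "!!rf. rf : set L ==> snd rf : Bm borel"
  and [measurable]: "g : measurable M borel" "h : measurable M borel"
 shows "(%w. pinned_integral s (g w) t (h w :: 'v::euclidean_space) L) : Bm M"
proof -
 have "(%w. (g w, h w)) : measurable M (borel >< borel)" by measurable
 from measurable_compose[OF this borel_measurable_pinned_integral_pair[OF assms(1), of L s t]] show ?thesis by simp
qed

lemma pinned_integral_append:
 fixes x :: "'v::euclidean_space"
 assumes "!!rf. rf : set (L1 @ (r, f) # L2) ==> snd rf : Bm borel"
 shows "pinned_integral s x t x' (L1 @ (r, f) # L2) =
  (INT+z. f z * (pinned_integral s x r z L1 * pinned_integral r z t x' L2) d/lborel)"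
 using assms
proof (induction L1 arbitrary: s x)
 case Nil
 then show ?case by (simp add: mult_ac)
next
 case (Cons rf L1)
 have [measurable]: "snd rf : Bm borel" "f : Bm borel"
  "!!rf. rf : set L1 ==> snd rf : Bm borel" "!!rf. rf : set L2 ==> snd rf : Bm borel"
  using Cons.prems by fastforce+
 have "pinned_integral s x t x' ((rf # L1) @ (r, f) # L2) =
  (INT+z1. INT+z. (hk (fst rf - s) x z1) * (snd rf z1 * (f z * (pinned_integral (fst rf) z1 r z L1 * pinned_integral r z t x' L2))) d/lborel d/lborel)"
  using Cons by (simp add: nn_integral_cmult)
 also have "... = (INT+z. INT+z1. (hk (fst rf - s) x z1) * (snd rf z1 * (f z * (pinned_integral (fst rf) z1 r z L1 * pinned_integral r z t x' L2))) d/lborel d/lborel)"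
  by (rule lborel_pair.Fubini'[symmetric]) measurable
 also have "... = (INT+z. INT+z1. (f z * pinned_integral r z t x' L2) * ((hk (fst rf - s) x z1) * (snd rf z1 * pinned_integral (fst rf) z1 r z L1)) d/lborel d/lborel)"
  by (simp add: mult_ac)
 also have "... = (INT+z. (f z * pinned_integral r z t x' L2) * pinned_integral s x r z (rf # L1) d/lborel)"
  by (simp add: nn_integral_cmult)
 finally show ?case by (simp add: mult_ac)
qed

lemma pinned_integral_drop:
 fixes x :: "'v::euclidean_space"
 assumes "!!rf. rf : set L ==> snd rf : Bm borel"
  and "sorted_wrt (<) (s # r # map fst L @ [t])"
 shows "pinned_integral s x t x' ((r, %_. 1) # L) = pinned_integral s x t x' L"
proof (cases L)
 case Nil
 then show ?thesis using assms heat_kernel_chapman_kolmogorov[of "r - s" "t - r" x x'] by simp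
next
 case (Cons rf L')
 have [measurable]: "snd rf : Bm borel" "!!rf. rf : set L' ==> snd rf : Bm borel"
  using assms(1) by (auto simp: Cons)
 have r: "s < r" "r < fst rf" using assms(2) by (auto simp: Cons)
 have "pinned_integral s x t x' ((r, %_. 1) # L) =
  (INT+z. INT+z1. ((hk (r - s) x z) * (hk (fst rf - r) z z1)) * (snd rf z1 * pinned_integral (fst rf) z1 t x' L') d/lborel d/lborel)"
  by (simp add: Cons nn_integral_cmult mult.assoc)
 also have "... = (INT+z1. INT+z. ((hk (r - s) x z) * (hk (fst rf - r) z z1)) * (snd rf z1 * pinned_integral (fst rf) z1 t x' L') d/lborel d/lborel)"
  by (rule lborel_pair.Fubini'[symmetric]) measurable
 also have "... = pinned_integral s x t x' L"
  using heat_kernel_chapman_kolmogorov[of "r - s" "fst rf - r" x] r by (simp add: Cons nn_integral_multc)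
 finally show ?thesis .
qed

lemma pinned_integral_filter:
 fixes x :: "'v::euclidean_space"
 assumes "!!rf. rf : set L ==> snd rf : Bm borel"
  and "sorted_wrt (<) (s # map fst L @ [t])"
  and "!!rf. rf : set L ==> \<not> P rf ==> snd rf = (%_. 1)"
 shows "pinned_integral s x t x' L = pinned_integral s x t x' (filter P L)"
 using assms
proof (induction L arbitrary: s x)
 case (Cons rf L)
 have IH: "pinned_integral (fst rf) z t x' L = pinned_integral (fst rf) z t x' (filter P L)" for z
  using Cons.prems by (intro Cons.IH) auto
 show ?case
 proof (cases "P rf")
  case True then show ?thesis using IH by simp
 next
  case False
  then have "rf = (fst rf, %_. 1)" using Cons.prems(3)[of rf] by (simp add: prod_eq_iff)
  then have "pinned_integral s x t x' (rf # L) = pinned_integral s x t x' ((fst rf, %_. 1) # L)" by simp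
  also have "... = pinned_integral s x t x' L"
   using Cons.prems by (intro pinned_integral_drop) auto
  also have "... = pinned_integral s x t x' (filter P L)"
   using Cons.prems by (intro Cons.IH) auto
  finally show ?thesis using False by simp
 qed
qed simp

lemma pinned_integral_le:
 fixes x :: "'v::euclidean_space"
 assumes "!!rf z. rf : set L ==> snd rf z <= 1"
  and "sorted_wrt (<) (s # map fst L)" "!!r. r : set (s # map fst L) ==> r <= t - \<delta>" "0 < \<delta>"
 shows "pinned_integral s x t x' L <= ennreal ((2 * pi * \<delta>) powr (- real DIM('v) / 2))"
 using assms
proof (induction L arbitrary: s x)
 case Nil
 then show ?case using heat_kernel_le[of \<delta> "t - s" x x'] by (auto intro!: ennreal_leI)
next
 case (Cons rf L)
 let ?B = "ennreal ((2 * pi * \<delta>) powr (- real DIM('v) / 2))"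
 have IH: "pinned_integral (fst rf) z t x' L <= ?B" for z
  using Cons.prems by (intro Cons.IH) auto
 have "pinned_integral s x t x' (rf # L) <= (INT+z. (hk (fst rf - s) x z) * ?B d/lborel)"
 proof -
  have "snd rf z * pinned_integral (fst rf) z t x' L <= ?B" for z
   using mult_mono[OF Cons.prems(1)[of rf z] IH[of z]] by simp
  then show ?thesis by (auto intro!: nn_integral_mono mult_left_mono)
 qed
 also have "... = ?B"
  using Cons.prems by (simp add: nn_integral_multc nn_integral_heat_kernel)
 finally show ?case .
qed

section \<open>The standard Brownian bridge\<close>

text \<open>Independent standard Gaussians indexed by the finite binary words: one for the midpoint of every
dyadic interval, as in Levy's construction.\<close>

definition gaussian_tree :: "(bool list => 'v::euclidean_space) measure" where
 "gaussian_tree = PiM UNIV (%_. standard_gaussian)"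

lemma space_gaussian_tree[simp]: "space gaussian_tree = UNIV"
 by (simp add: gaussian_tree_def space_PiM PiE_UNIV_domain)

lemma sets_gaussian_tree[measurable_cong]: "sets gaussian_tree = sets (PiM UNIV (%_. borel))"
 unfolding gaussian_tree_def by (rule sets_PiM_cong) simp_all

lemma prob_space_gaussian_tree: "prob_space (gaussian_tree :: (bool list => 'v::euclidean_space) measure)"
 unfolding gaussian_tree_def by (rule prob_space_PiM) (rule prob_space_standard_gaussian)

lemma measurable_gaussian_tree_component[measurable]: "(%\<xi>. \<xi> p) : measurable gaussian_tree borel"
 by measurable

definition graft :: "'v => (bool list => 'v) => (bool list => 'v) => bool list => 'v" where
 "graft g \<xi> \<xi>' p = (case p of [] => g | b # p' => if b then \<xi>' p' else \<xi> p')"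

lemma graft_simps[simp]: "graft g \<xi> \<xi>' [] = g" "graft g \<xi> \<xi>' (False # p) = \<xi> p" "graft g \<xi> \<xi>' (True # p) = \<xi>' p"
 by (simp_all add: graft_def)

lemma measurable_graft[measurable]:
 "(%w. graft (fst w) (fst (snd w)) (snd (snd w))) : measurable (standard_gaussian >< (gaussian_tree >< gaussian_tree)) (gaussian_tree :: (bool list => 'v::euclidean_space) measure)"
 unfolding gaussian_tree_def
proof (rule measurable_PiM_single')
 fix p :: "bool list"
 let ?P = "PiM UNIV (%_::bool list. standard_gaussian :: 'v measure)"
 show "(%w. graft (fst w) (fst (snd w)) (snd (snd w)) p) : measurable (standard_gaussian >< (?P >< ?P)) standard_gaussian"
  by (cases p) (simp_all add: graft_def)
qed (auto simp: PiE_UNIV_domain)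

lemma gaussian_tree_graft:
 "distr (standard_gaussian >< (gaussian_tree >< gaussian_tree)) gaussian_tree
  (%w. graft (fst w) (fst (snd w)) (snd (snd w))) = (gaussian_tree :: (bool list => 'v::euclidean_space) measure)"
 (is "?D = _")
proof -
 let ?N = "standard_gaussian :: 'v measure" and ?Q = "gaussian_tree :: (bool list => 'v) measure"
 interpret N: prob_space ?N by (rule prob_space_standard_gaussian)
 interpret Q: prob_space ?Q by (rule prob_space_gaussian_tree)
 interpret QQ: pair_prob_space ?Q ?Q ..
 interpret NQQ: pair_prob_space ?N "?Q >< ?Q" ..
 interpret P: product_prob_space "%_::bool list. ?N" UNIV
  by (simp add: product_prob_space_def product_prob_space_axioms_def product_sigma_finite_def
    prob_space_standard_gaussian prob_space_imp_sigma_finite)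
 have cyl: "Em ?Q {\<xi>. \<forall>p\<in>J. \<xi> p : X p} = (\<Prod>p\<in>J. Em ?N (X p))"
  if "finite J" "!!p. p : J ==> X p : sets borel" for J X
 proof -
  have "{\<xi>. \<forall>p\<in>J. \<xi> p : X p} = prod_emb UNIV (%_. ?N) J (Pi\<^sub>E J X)"
   by (auto simp: prod_emb_def PiE_UNIV_domain restrict_PiE_iff)
  then show ?thesis
   unfolding gaussian_tree_def using that by (simp add: P.emeasure_PiM_emb)
 qed
 show ?thesis
  unfolding gaussian_tree_def
 proof (rule measure_eqI_PiM_infinite)
  fix X :: "bool list => 'v set" and J :: "bool list set"
  assume J: "finite J" and X: "!!p. p : J ==> X p : sets ?N"
  define JF JT where "JF = {p. False # p : J}" and "JT = {p. True # p : J}"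
  have finJ: "finite JF" "finite JT"
   using finite_vimageI[OF J, of "Cons False"] finite_vimageI[OF J, of "Cons True"]
   by (auto simp: JF_def JT_def vimage_def)
  have J_eq: "J = (J \<inter> {[]}) \<union> (Cons False ` JF \<union> Cons True ` JT)"
  proof (intro set_eqI)
   fix p show "p : J \<longleftrightarrow> p : (J \<inter> {[]}) \<union> (Cons False ` JF \<union> Cons True ` JT)"
   proof (cases p)
    case (Cons b q)
    then show ?thesis by (cases b) (auto simp: JF_def JT_def image_iff)
   qed (auto simp: JF_def JT_def)
  qed
  let ?X0 = "if [] : J then X [] else UNIV"
  have emb: "prod_emb UNIV (%_. ?N) J (Pi\<^sub>E J X) = {\<xi>. \<forall>p\<in>J. \<xi> p : X p}"
   by (auto simp: prod_emb_def PiE_UNIV_domain restrict_PiE_iff)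
  let ?A = "?X0 \<times> ({\<xi>. \<forall>p\<in>JF. \<xi> p : X (False # p)} \<times> {\<xi>. \<forall>p\<in>JT. \<xi> p : X (True # p)})"
  have s: "{\<xi>. \<forall>p\<in>J. \<xi> p : X p} : sets ?Q" if "finite J" "!!p. p : J ==> X p : sets borel" for J and X :: "bool list => 'v set"
  proof -
   have "{\<xi> : space ?Q. \<forall>p\<in>J. \<xi> p : X p} : sets ?Q"
    using that by measurable
   then show ?thesis by simp
  qed
  have pre: "(%w. graft (fst w) (fst (snd w)) (snd (snd w))) -` {\<xi>. \<forall>p\<in>J. \<xi> p : X p} \<inter> space (?N >< (?Q >< ?Q)) = ?A"
  proof -
   have ball: "(\<forall>p\<in>J. Q p) \<longleftrightarrow> (([] : J \<longrightarrow> Q []) & (\<forall>p\<in>JF. Q (False # p)) & (\<forall>p\<in>JT. Q (True # p)))" for Q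
    by (subst J_eq) auto
   show ?thesis unfolding ball by (auto simp: space_pair_measure)
  qed
  have "Em ?D {\<xi>. \<forall>p\<in>J. \<xi> p : X p} = Em (?N >< (?Q >< ?Q)) ?A"
   using X by (subst emeasure_distr[OF measurable_graft s[OF J]]) (simp_all only: pre sets_standard_gaussian)
  also have "... = Em ?N ?X0 * (Em ?Q {\<xi>. \<forall>p\<in>JF. \<xi> p : X (False # p)} * Em ?Q {\<xi>. \<forall>p\<in>JT. \<xi> p : X (True # p)})"
  proof -
   have "{\<xi>. \<forall>p\<in>JF. \<xi> p : X (False # p)} : sets ?Q" "{\<xi>. \<forall>p\<in>JT. \<xi> p : X (True # p)} : sets ?Q"
    by (rule s[OF finJ(1)], use X in \<open>simp add: JF_def\<close>) (rule s[OF finJ(2)], use X in \<open>simp add: JT_def\<close>)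
   moreover have "?X0 : sets ?N" using X by auto
   ultimately show ?thesis
    by (simp add: QQ.P.emeasure_pair_measure_Times Q.emeasure_pair_measure_Times)
  qed
  also have "... = Em ?N ?X0 * ((\<Prod>p\<in>JF. Em ?N (X (False # p))) * (\<Prod>p\<in>JT. Em ?N (X (True # p))))"
  proof -
   have c1: "Em ?Q {\<xi>. \<forall>p\<in>JF. \<xi> p : X (False # p)} = (\<Prod>p\<in>JF. Em ?N (X (False # p)))"
    by (rule cyl[OF finJ(1)]) (use X in \<open>simp add: JF_def\<close>)
   have c2: "Em ?Q {\<xi>. \<forall>p\<in>JT. \<xi> p : X (True # p)} = (\<Prod>p\<in>JT. Em ?N (X (True # p)))"
    by (rule cyl[OF finJ(2)]) (use X in \<open>simp add: JT_def\<close>)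
   show ?thesis unfolding c1 c2 by (rule refl)
  qed
  also have "... = (\<Prod>p\<in>J. Em ?N (X p))"
  proof -
   have "(\<Prod>p\<in>J. Em ?N (X p)) = (\<Prod>p\<in>J \<inter> {[]}. Em ?N (X p)) * ((\<Prod>p\<in>Cons False ` JF. Em ?N (X p)) * (\<Prod>p\<in>Cons True ` JT. Em ?N (X p)))"
    using finJ J by (subst J_eq) (subst prod.union_disjoint | auto)+
   also have "(\<Prod>p\<in>J \<inter> {[]}. Em ?N (X p)) = Em ?N ?X0"
    using N.emeasure_space_1 by (cases "[] : J") auto
   finally show ?thesis by (simp add: prod.reindex)
  qed
  also have "... = Em ?Q {\<xi>. \<forall>p\<in>J. \<xi> p : X p}"
   using X by (subst cyl[OF J]) auto
  finally show "Em (distr (?N >< (PiM UNIV (%_. ?N) >< PiM UNIV (%_. ?N))) (PiM UNIV (%_. ?N)) (%w. graft (fst w) (fst (snd w)) (snd (snd w)))) (prod_emb UNIV (%_. ?N) J (Pi\<^sub>E J X)) =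
   Em (PiM UNIV (%_. ?N)) (prod_emb UNIV (%_. ?N) J (Pi\<^sub>E J X))"
   unfolding emb gaussian_tree_def by simp
 next
  show "finite_measure (distr (?N >< (PiM UNIV (%_. ?N) >< PiM UNIV (%_. ?N))) (PiM UNIV (%_. ?N)) (%w. graft (fst w) (fst (snd w)) (snd (snd w))))"
   using NQQ.P.finite_measure_distr[OF measurable_graft] by (simp add: gaussian_tree_def)
 qed simp_all
qed

lemma nn_integral_gaussian_tree:
 fixes F :: "(bool list => 'v::euclidean_space) => ennreal"
 assumes [measurable]: "F : Bm gaussian_tree"
 shows "(INT+\<xi>. F \<xi> d/gaussian_tree) = (INT+g. INT+\<xi>. INT+\<xi>'. F (graft g \<xi> \<xi>') d/gaussian_tree d/gaussian_tree d/standard_gaussian)"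
proof -
 let ?N = "standard_gaussian :: 'v measure" and ?Q = "gaussian_tree :: (bool list => 'v) measure"
 interpret N: prob_space ?N by (rule prob_space_standard_gaussian)
 interpret Q: prob_space ?Q by (rule prob_space_gaussian_tree)
 interpret QQ: pair_prob_space ?Q ?Q ..
 have "(INT+\<xi>. F \<xi> d/?Q) = (INT+w. F (graft (fst w) (fst (snd w)) (snd (snd w))) d/(?N >< (?Q >< ?Q)))"
  by (subst gaussian_tree_graft[symmetric]) (rule nn_integral_distr, measurable)
 also have "... = (INT+g. INT+w. F (graft g (fst w) (snd w)) d/(?Q >< ?Q) d/?N)"
  by (subst QQ.P.nn_integral_fst[symmetric]) auto
 also have "... = (INT+g. INT+\<xi>. INT+\<xi>'. F (graft g \<xi> \<xi>') d/?Q d/?Q d/?N)"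
 proof (intro nn_integral_cong)
  fix g :: 'v
  have "(%w. graft g (fst w) (snd w)) : measurable (?Q >< ?Q) ?Q"
   using measurable_compose[OF _ measurable_graft, of "%w. (g, w)" "?Q >< ?Q"] by simp
  then show "(INT+w. F (graft g (fst w) (snd w)) d/(?Q >< ?Q)) = (INT+\<xi>. INT+\<xi>'. F (graft g \<xi> \<xi>') d/?Q d/?Q)"
   by (subst Q.nn_integral_fst[symmetric]) (auto intro: measurable_compose)
 qed
 finally show ?thesis .
qed

definition tent :: "real => real" where "tent u = 1 - \<bar>2 * u - 1\<bar>"

primrec bridge_approx :: "nat => (bool list => 'v::euclidean_space) => real => 'v" where
 "bridge_approx 0 \<xi> u = 0"
| "bridge_approx (Suc n) \<xi> u = (tent u / 2) *\<^sub>R \<xi> [] + (1 / sqrt 2) *\<^sub>R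
  (if u <= 1 / 2 then bridge_approx n (%p. \<xi> (False # p)) (2 * u)
   else bridge_approx n (%p. \<xi> (True # p)) (2 * u - 1))"

lemma bridge_approx_ends[simp]: "bridge_approx n \<xi> 0 = 0" "bridge_approx n \<xi> 1 = 0"
 by (induction n arbitrary: \<xi>) (simp_all add: tent_def)

lemma continuous_bridge_approx: "continuous_on {0..1} (bridge_approx n \<xi>)"
proof (induction n arbitrary: \<xi>)
 case (Suc n)
 have *: "continuous_on ({0..1/2} \<union> {1/2..1}) (%u. if u <= 1 / 2 then bridge_approx n (%p. \<xi> (False # p)) (2 * u)
   else bridge_approx n (%p. \<xi> (True # p)) (2 * u - 1))"
 proof (rule continuous_on_If)
  show "continuous_on {0..1/2} (%u. bridge_approx n (%p. \<xi> (False # p)) (2 * u))"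
   by (rule continuous_on_compose2[OF Suc]) (auto intro!: continuous_intros)
  show "continuous_on {1/2..1} (%u. bridge_approx n (%p. \<xi> (True # p)) (2 * u - 1))"
   by (rule continuous_on_compose2[OF Suc]) (auto intro!: continuous_intros)
  show "bridge_approx n (%p. \<xi> (False # p)) (2 * u) = bridge_approx n (%p. \<xi> (True # p)) (2 * u - 1)"
   if "u : {0..1/2}" "\<not> u <= 1/2" for u using that by auto
  show "bridge_approx n (%p. \<xi> (False # p)) (2 * u) = bridge_approx n (%p. \<xi> (True # p)) (2 * u - 1)"
   if "u : {1/2..1}" "u <= 1/2" for u
  proof -
   have "2 * u = 1" "2 * u - 1 = 0" using that by auto
   then show ?thesis by (simp only: bridge_approx_ends)
  qed
 qed auto
 have **: "{0..1/2} \<union> {1/2..1} = {0..1::real}" by auto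
 show ?case
  unfolding bridge_approx.simps tent_def
  by (intro continuous_intros *[unfolded **]) auto
qed simp

lemma measurable_bridge_approx[measurable]:
 "(%w. bridge_approx n (fst w) (snd w)) : measurable (gaussian_tree >< borel) (borel :: 'v::euclidean_space measure)"
proof (induction n)
 case (Suc n)
 have sub: "(%\<xi> p. \<xi> (b # p)) : measurable gaussian_tree (gaussian_tree :: (bool list => 'v) measure)" for b
  unfolding measurable_cong_sets[OF refl sets_gaussian_tree]
  by (rule measurable_PiM_single') (auto simp: PiE_UNIV_domain)
 have m[measurable]: "(%w. bridge_approx n (%p. fst w (b # p)) (c * snd w - e)) : measurable (gaussian_tree >< borel) (borel :: 'v measure)" for b c e
 proof -
  have "(%w. ((%p. fst w (b # p)), c * snd w - e)) : measurable (gaussian_tree >< borel) ((gaussian_tree :: (bool list => 'v) measure) >< borel)"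
   by (intro measurable_Pair measurable_compose[OF measurable_fst sub]) simp
  from measurable_compose[OF this Suc.IH] show ?thesis by simp
 qed
 have [measurable]: "(%w. bridge_approx n (%p. fst w (False # p)) (2 * snd w)) : measurable (gaussian_tree >< borel) (borel :: 'v measure)"
  using m[of False 2 0] by simp
 show ?case unfolding bridge_approx.simps tent_def by measurable
qed simp

lemma measurable_bridge_approx_compose[measurable (raw)]:
 assumes [measurable]: "f : measurable M gaussian_tree" "g : Bm M"
 shows "(%w. bridge_approx n (f w) (g w)) : measurable M (borel :: 'v::euclidean_space measure)"
proof -
 have "(%w. (f w, g w)) : measurable M (gaussian_tree >< borel)" by measurable
 from measurable_compose[OF this measurable_bridge_approx] show ?thesis by simp
qed

text \<open>Given its midpoint, a bridge consists of two independent bridges of half the length. This is the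
induction step, and it holds exactly at the dyadic times of the level reached.\<close>

lemma bridge_approx_law:
 fixes x x' :: "'v::euclidean_space" and f :: "nat => 'v => ennreal"
 assumes st: "s < t" and [measurable]: "!!k. f k : Bm borel"
 shows "(hk (t - s) x x') *
   (INT+\<xi>. (\<Prod>k\<in>{1..<2^n}. f k (x + (real k / 2^n) *\<^sub>R (x' - x) + sqrt (t - s) *\<^sub>R bridge_approx n \<xi> (real k / 2^n))) d/gaussian_tree)
  = pinned_integral s x t x' (map (%k. (s + (t - s) * (real k / 2^n), f k)) [1..<2^n])"
 using assms
proof (induction n arbitrary: s t x x' f)
 case 0
 interpret prob_space "gaussian_tree :: (bool list => 'v) measure" by (rule prob_space_gaussian_tree)
 show ?case using emeasure_space_1 by simp
next
 case (Suc n)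
 note [measurable] = Suc.prems(2)
 define N where "N = (2::nat)^n"
 have N: "1 <= N" "real N = 2^n" "(2::nat)^Suc n = N + N" by (simp_all add: N_def)
 define r where "r = s + (t - s) / 2"
 define \<sigma> where "\<sigma> = sqrt (t - s)"
 define Z where "Z g = x + (1/2) *\<^sub>R (x' - x) + sqrt ((t - s) / 4) *\<^sub>R g" for g
 define P where "P \<xi> k = x + (real k / 2^Suc n) *\<^sub>R (x' - x) + \<sigma> *\<^sub>R bridge_approx (Suc n) \<xi> (real k / 2^Suc n)" for \<xi> k
 define P1 where "P1 z \<xi> k = x + (real k / 2^n) *\<^sub>R (z - x) + sqrt (r - s) *\<^sub>R bridge_approx n \<xi> (real k / 2^n)" for z \<xi> k
 define P2 where "P2 z \<xi> k = z + (real k / 2^n) *\<^sub>R (x' - z) + sqrt (t - r) *\<^sub>R bridge_approx n \<xi> (real k / 2^n)" for z \<xi> k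
 have sr: "s < r" "r < t" "r - s = (t - s) / 2" "t - r = (t - s) / 2" using Suc.prems(1) by (simp_all add: r_def field_simps)
 have sq4: "sqrt ((t - s) / 4) = \<sigma> / 2" by (simp add: \<sigma>_def real_sqrt_divide)
 have sq2: "sqrt ((t - s) / 2) = \<sigma> * (1 / sqrt 2)" by (simp add: \<sigma>_def real_sqrt_divide)
 have PL: "P (graft g \<xi> \<xi>') k = P1 (Z g) \<xi> k" if "k < N" for g \<xi> \<xi>' k
 proof -
  have le: "real k / 2^Suc n <= 1/2" using that N(2) by (simp add: field_simps)
  have te: "tent (real k / 2^Suc n) = real k / 2^n" using le by (simp add: tent_def field_simps)
  have 2: "2 * (real k / 2^Suc n) = real k / 2^n" by simp
  show ?thesis
   unfolding P_def P1_def Z_def bridge_approx.simps if_P[OF le] te 2 sr sq2 sq4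
   by (simp add: scaleR_add_right scaleR_diff_right field_simps)
 qed
 have PM: "P (graft g \<xi> \<xi>') N = Z g" for g \<xi> \<xi>'
 proof -
  have e: "real N / 2^Suc n = 1/2" using N(2) by simp
  show ?thesis
   unfolding P_def Z_def bridge_approx.simps e sq4 by (simp add: tent_def)
 qed
 have midpoint_algebra: "x + e *\<^sub>R (x' - x) + \<sigma> *\<^sub>R (((1 - c) / 2) *\<^sub>R g) = Z g + c *\<^sub>R (x' - Z g)"
  if "e = 1/2 + (1/2) * c" for e c g
 proof -
  define y y' h \<tau> where "y = (1/2) *\<^sub>R x" and "y' = (1/2) *\<^sub>R x'" and "h = c / 2" and "\<tau> = \<sigma> / 2"
  have 1: "x = y + y" "x' = y' + y'" by (simp_all add: y_def y'_def scaleR_left_distrib[symmetric])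
  have 2: "\<sigma> * ((1 - c) / 2) = \<tau> * (1 - (h + h))" "c = h + h" by (simp_all add: \<tau>_def h_def)
  have hh: "(h * 2) *\<^sub>R v = h *\<^sub>R v + h *\<^sub>R v" for v :: 'v
   by (simp only: mult_2_right scaleR_left_distrib)
  have 3: "(1/2) *\<^sub>R (x' - x) = y' - y" by (simp add: y_def y'_def scaleR_diff_right)
  have 4: "e *\<^sub>R (x' - x) = (y' - y) + h *\<^sub>R (x' - x)"
   unfolding that h_def 3[symmetric] by (simp add: scaleR_left_distrib)
  show ?thesis
   unfolding Z_def sq4 scaleR_scaleR 2(1) 4 3 \<tau>_def[symmetric] unfolding 1 unfolding 2(2)
   by (simp add: algebra_simps) (simp add: hh)
 qed
 have PR: "P (graft g \<xi> \<xi>') (N + k) = P2 (Z g) \<xi>' k" if "0 < k" "k < N" for g \<xi> \<xi>' k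
 proof -
  have e: "real (N + k) / 2^Suc n = 1/2 + real k / 2^Suc n" using N(2) by (simp add: field_simps)
  have le: "\<not> 1/2 + real k / 2^Suc n <= 1/2" using that by (simp add: not_le)
  have k: "real k / 2^Suc n < 1/2" using that N(2) by (simp add: field_simps)
  have te: "tent (1/2 + real k / 2^Suc n) = 1 - real k / 2^n" using k by (simp add: tent_def field_simps)
  have 2: "2 * (1/2 + real k / 2^Suc n) - 1 = real k / 2^n" by (simp add: field_simps)
  have 3: "real k / 2^Suc n = (1/2) * (real k / 2^n)" by simp
  show ?thesis
   unfolding P_def P2_def Z_def bridge_approx.simps e if_not_P[OF le] te 2 sr sq2 sq4
   unfolding 3 add.assoc[symmetric]
   using midpoint_algebra[of "1/2 + (1/2) * (real k / 2^n)" "real k / 2^n" g, unfolded Z_def sq4]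
   by (simp add: scaleR_add_right add.assoc)
 qed
 have split: "{1..<2^Suc n} = insert N ({1..<N} \<union> (+) N ` {1..<N})"
  using N by (auto simp: image_iff)
 have prod_split: "(\<Prod>k\<in>{1..<2^Suc n}. h k) = h N * ((\<Prod>k\<in>{1..<N}. h k) * (\<Prod>k\<in>{1..<N}. h (N + k)))" for h :: "nat => ennreal"
 proof -
  have 1: "prod h ((+) N ` {1..<N}) = (\<Prod>k\<in>{1..<N}. h (N + k))"
   by (subst prod.reindex) (simp_all add: comp_def)
  have 2: "prod h ({1..<N} \<union> (+) N ` {1..<N}) = prod h {1..<N} * prod h ((+) N ` {1..<N})"
   by (rule prod.union_disjoint) auto
  show ?thesis unfolding split 1[symmetric] 2[symmetric] by (rule prod.insert) auto
 qed
 define I1 where "I1 z = (INT+\<xi>. (\<Prod>k\<in>{1..<N}. f k (P1 z \<xi> k)) d/gaussian_tree)" for z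
 define I2 where "I2 z = (INT+\<xi>. (\<Prod>k\<in>{1..<N}. f (N + k) (P2 z \<xi> k)) d/gaussian_tree)" for z
 interpret Q: prob_space "gaussian_tree :: (bool list => 'v) measure" by (rule prob_space_gaussian_tree)
 have [measurable]: "(%\<xi>. P \<xi> k) : measurable gaussian_tree borel" "(%w. P1 (fst w) (snd w) k) : measurable (borel >< gaussian_tree) borel"
  "(%w. P2 (fst w) (snd w) k) : measurable (borel >< gaussian_tree) borel" for k
  unfolding P_def P1_def P2_def by measurable
 have [measurable]: "(%\<xi>. P1 z \<xi> k) : measurable gaussian_tree borel" "(%\<xi>. P2 z \<xi> k) : measurable gaussian_tree borel" for k z
  unfolding P1_def P2_def by measurable
 have [measurable]: "I1 : Bm borel" "I2 : Bm borel"
  unfolding I1_def I2_def by measurable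
 have J: "(INT+\<xi>. (\<Prod>k\<in>{1..<2^Suc n}. f k (P \<xi> k)) d/gaussian_tree) = (INT+g. f N (Z g) * (I1 (Z g) * I2 (Z g)) d/standard_gaussian)"
 proof -
  have "(INT+\<xi>. (\<Prod>k\<in>{1..<2^Suc n}. f k (P \<xi> k)) d/gaussian_tree) =
   (INT+g. INT+\<xi>. INT+\<xi>'. f N (Z g) * ((\<Prod>k\<in>{1..<N}. f k (P1 (Z g) \<xi> k)) * (\<Prod>k\<in>{1..<N}. f (N + k) (P2 (Z g) \<xi>' k))) d/gaussian_tree d/gaussian_tree d/standard_gaussian)"
  proof -
   have eq: "(\<Prod>k\<in>{1..<2^Suc n}. f k (P (graft g \<xi> \<xi>') k)) =
    f N (Z g) * ((\<Prod>k\<in>{1..<N}. f k (P1 (Z g) \<xi> k)) * (\<Prod>k\<in>{1..<N}. f (N + k) (P2 (Z g) \<xi>' k)))" for g \<xi> \<xi>'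
    unfolding prod_split PM by (intro arg_cong2[where f="(*)"] refl prod.cong) (simp_all add: PL PR)
   show ?thesis unfolding eq[symmetric] by (rule nn_integral_gaussian_tree) measurable
  qed
  also have "... = (INT+g. f N (Z g) * (I1 (Z g) * I2 (Z g)) d/standard_gaussian)"
   unfolding I1_def I2_def by (intro nn_integral_cong) (simp add: nn_integral_cmult nn_integral_multc)
  finally show ?thesis .
 qed
 have IH1: "(hk (r - s) x z) * I1 z = pinned_integral s x r z (map (%k. (s + (r - s) * (real k / 2^n), f k)) [1..<N])" for z
  unfolding I1_def P1_def N_def by (rule Suc.IH[OF sr(1)]) simp
 have IH2: "(hk (t - r) z x') * I2 z = pinned_integral r z t x' (map (%k. (r + (t - r) * (real k / 2^n), f (N + k))) [1..<N])" for z
  unfolding I2_def P2_def N_def by (rule Suc.IH[OF sr(2)]) simp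
 have upt: "[1..<2^Suc n] = [1..<N] @ N # map (%k. N + k) [1..<N]"
 proof -
  have "[1..<N + N] = [1..<N] @ [N..<N + N]" using N(1) by (metis upt_add_eq_append le_add1)
  also have "[N..<N + N] = N # [N + 1..<N + N]" using N(1) by (simp add: upt_conv_Cons)
  also have "[N + 1..<N + N] = map (%k. N + k) [1..<N]"
   by (rule nth_equalityI) auto
  finally show ?thesis unfolding N(3) .
 qed
 have "(hk (t - s) x x') * (INT+\<xi>. (\<Prod>k\<in>{1..<2^Suc n}. f k (P \<xi> k)) d/gaussian_tree)
   = (hk (t - s) x x') * (INT+z. (hk ((t - s) / 4) (x + (1/2) *\<^sub>R (x' - x)) z) * (f N z * (I1 z * I2 z)) d/lborel)"
  unfolding J Z_def using Suc.prems(1) by (subst nn_integral_heat_kernel_gaussian) auto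
 also have "... = (INT+z. ((hk (t - s) x x') * (hk ((t - s) / 4) (x + (1/2) *\<^sub>R (x' - x)) z)) * (f N z * (I1 z * I2 z)) d/lborel)"
  by (subst nn_integral_cmult[symmetric]) (auto simp: mult.assoc)
 also have "... = (INT+z. ((hk (r - s) x z) * (hk (t - r) z x')) * (f N z * (I1 z * I2 z)) d/lborel)"
 proof -
  have "heat_kernel (t - s) x x' * heat_kernel ((t - s) / 4) (x + (1/2) *\<^sub>R (x' - x)) z = heat_kernel (r - s) x z * heat_kernel (t - r) z x'" for z
  proof -
   have 1: "r - s + (t - r) = t - s" "(r - s) * (t - r) / (t - s) = (t - s) / 4" "(r - s) / (t - s) = 1 / 2"
    using Suc.prems(1) unfolding sr by (simp_all add: field_simps power2_eq_square)
   show ?thesis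
    using heat_kernel_mult[of "r - s" "t - r" x z x', unfolded 1] sr(1,2) by simp
  qed
  then show ?thesis by (simp add: ennreal_mult'[symmetric])
 qed
 also have "... = (INT+z. f N z * (((hk (r - s) x z) * I1 z) * ((hk (t - r) z x') * I2 z)) d/lborel)"
  by (simp add: mult_ac)
 also have "... = pinned_integral s x t x' (map (%k. (s + (r - s) * (real k / 2^n), f k)) [1..<N] @ (r, f N) #
   map (%k. (r + (t - r) * (real k / 2^n), f (N + k))) [1..<N])"
  unfolding IH1 IH2 by (rule pinned_integral_append[symmetric]) auto
 also have "map (%k. (s + (r - s) * (real k / 2^n), f k)) [1..<N] @ (r, f N) #
   map (%k. (r + (t - r) * (real k / 2^n), f (N + k))) [1..<N] = map (%k. (s + (t - s) * (real k / 2^Suc n), f k)) [1..<2^Suc n]"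
  unfolding upt sr using N(2) by (simp add: comp_def r_def field_simps)
 finally show ?case unfolding P_def \<sigma>_def .
qed

lemma bridge_approx_Suc_diff:
 fixes \<xi> :: "bool list => 'v::euclidean_space"
 assumes "!!p. length p = n ==> norm (\<xi> p) <= M" "0 <= u" "u <= 1"
 shows "norm (bridge_approx (Suc n) \<xi> u - bridge_approx n \<xi> u) <= (1/2) * (1 / sqrt 2) ^ n * M"
 using assms
proof (induction n arbitrary: \<xi> u)
 case 0
 have t: "0 <= tent u" "tent u <= 1" using 0 by (auto simp: tent_def)
 have "norm (\<xi> []) <= M" using 0 by simp
 then have "tent u * norm (\<xi> []) <= 1 * M" using t by (intro mult_mono) auto
 then show ?case using t by simp
next
 case (Suc n)
 let ?\<xi> = "%b p. \<xi> (b # p)"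
 have IH: "norm (bridge_approx (Suc n) (?\<xi> b) v - bridge_approx n (?\<xi> b) v) <= (1/2) * (1 / sqrt 2) ^ n * M" if "0 <= v" "v <= 1" for b v
  using Suc.prems that by (intro Suc.IH) auto
 have "bridge_approx (Suc (Suc n)) \<xi> u - bridge_approx (Suc n) \<xi> u = (1 / sqrt 2) *\<^sub>R
  (if u <= 1/2 then bridge_approx (Suc n) (?\<xi> False) (2 * u) - bridge_approx n (?\<xi> False) (2 * u)
  else bridge_approx (Suc n) (?\<xi> True) (2 * u - 1) - bridge_approx n (?\<xi> True) (2 * u - 1))"
  unfolding bridge_approx.simps(2)[of "Suc n"] bridge_approx.simps(2)[of n \<xi>]
  by (simp add: scaleR_diff_right del: bridge_approx.simps)
 then have "norm (bridge_approx (Suc (Suc n)) \<xi> u - bridge_approx (Suc n) \<xi> u) = (1 / sqrt 2) *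
  norm (if u <= 1/2 then bridge_approx (Suc n) (?\<xi> False) (2 * u) - bridge_approx n (?\<xi> False) (2 * u)
  else bridge_approx (Suc n) (?\<xi> True) (2 * u - 1) - bridge_approx n (?\<xi> True) (2 * u - 1))"
  by simp
 also have "... <= (1 / sqrt 2) * ((1/2) * (1 / sqrt 2) ^ n * M)"
  using IH[of "2 * u" False] IH[of "2 * u - 1" True] Suc.prems(2,3) by (intro mult_left_mono) auto
 finally show ?case by (simp add: mult_ac)
qed

definition tame :: "(bool list => 'v::euclidean_space) => bool" where
 "tame \<xi> \<longleftrightarrow> (\<exists>n0. \<forall>n\<ge>n0. \<forall>p. length p = n \<longrightarrow> norm (\<xi> p) <= 2 * real (Suc n))"

lemma finite_bool_lists: "finite {p :: bool list. length p = n}" "card {p :: bool list. length p = n} = 2 ^ n"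
 using finite_lists_length_eq[of "UNIV :: bool set" n] card_lists_length_eq[of "UNIV :: bool set" n] by simp_all

lemma measurable_tame[measurable]: "Measurable.pred gaussian_tree (tame :: (bool list => 'v::euclidean_space) => bool)"
proof -
 have "Measurable.pred gaussian_tree (%\<xi> :: bool list => 'v. \<exists>n0. \<forall>n. n0 <= n \<longrightarrow> (\<forall>p. length p = n \<longrightarrow> norm (\<xi> p) <= 2 * real (Suc n)))"
  by measurable
 then show ?thesis unfolding tame_def[abs_def] by simp
qed

text \<open>By Borel-Cantelli and the Gaussian tail bound, the largest increment of level \<open>n\<close> is eventually
of an order that is summable after scaling, so the approximations converge uniformly.\<close>

lemma AE_tame: "AE \<xi> in gaussian_tree. tame (\<xi> :: bool list => 'v::euclidean_space)"
proof -
 let ?Q = "gaussian_tree :: (bool list => 'v) measure"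
 interpret prob_space ?Q by (rule prob_space_gaussian_tree)
 define C where "C = (2::real) powr (real DIM('v) / 2)"
 define A where "A n = {\<xi> : space ?Q. \<exists>p\<in>{p. length p = n}. 2 * real (Suc n) < norm (\<xi> p)}" for n
 have sets_A: "A n : sets ?Q" for n
  unfolding A_def using finite_bool_lists(1)[of n] by measurable
 have le: "measure ?Q (A n) <= C * (2 * exp (- 1)) ^ n" for n
 proof -
  have comp: "Em ?Q {\<xi> : space ?Q. 2 * real (Suc n) < norm (\<xi> p)} <= ennreal (C * exp (- 1) ^ n)" for p
  proof -
   interpret P: product_prob_space "%_::bool list. standard_gaussian :: 'v measure" UNIV
    by (simp add: product_prob_space_def product_prob_space_axioms_def product_sigma_finite_def
      prob_space_standard_gaussian prob_space_imp_sigma_finite)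
   have "distr ?Q standard_gaussian (%\<xi>. \<xi> p) = standard_gaussian"
    unfolding gaussian_tree_def by (rule P.PiM_component) simp
   then have "Em standard_gaussian {z :: 'v. 2 * real (Suc n) < norm z} = Em (distr ?Q standard_gaussian (%\<xi>. \<xi> p)) {z. 2 * real (Suc n) < norm z}"
    by simp
   also have "... = Em ?Q {\<xi> : space ?Q. 2 * real (Suc n) < norm (\<xi> p)}"
    by (subst emeasure_distr) (auto intro!: arg_cong[where f="Em ?Q"])
   finally have "Em ?Q {\<xi> : space ?Q. 2 * real (Suc n) < norm (\<xi> p)} <= ennreal (C * exp (- (2 * real (Suc n))\<^sup>2 / 4))"
    using standard_gaussian_tail[of "2 * real (Suc n)", where 'v='v] by (simp add: C_def)
   also have "... <= ennreal (C * exp (- 1) ^ n)"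
   proof -
    have "real n * 1 <= real (Suc n) * real (Suc n)" by (intro mult_mono) auto
    then have "- (2 * real (Suc n))\<^sup>2 / 4 <= - real n" by (simp add: power2_eq_square algebra_simps) (rule order_trans[of _ 0], simp_all)
    moreover have "exp (- 1) ^ n = exp (- real n)" by (simp add: exp_of_nat_mult[symmetric])
    ultimately show ?thesis by (auto intro!: ennreal_leI mult_left_mono simp: C_def simp del: of_nat_Suc)
   qed
   finally show ?thesis .
  qed
  have "A n = (\<Union>p\<in>{p. length p = n}. {\<xi> : space ?Q. 2 * real (Suc n) < norm (\<xi> p)})"
   by (auto simp: A_def)
  moreover have "{\<xi> : space ?Q. 2 * real (Suc n) < norm (\<xi> p)} : sets ?Q" for p
   by measurable
  ultimately have "Em ?Q (A n) <= (\<Sum>p\<in>{p. length p = n}. Em ?Q {\<xi> : space ?Q. 2 * real (Suc n) < norm (\<xi> p)})"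
   using finite_bool_lists(1)[of n] by (simp only:) (rule emeasure_subadditive_finite, blast+)
  also have "... <= (\<Sum>p\<in>{p :: bool list. length p = n}. ennreal (C * exp (- 1) ^ n))"
   by (intro sum_mono comp)
  also have "... = ennreal (C * (2 * exp (- 1)) ^ n)"
  proof -
   have "ennreal (2 ^ n) * ennreal (C * exp (- 1) ^ n) = ennreal (C * (2 * exp (- 1)) ^ n)"
    by (subst ennreal_mult[symmetric]) (auto simp: C_def power_mult_distrib mult_ac)
   then show ?thesis by (simp add: finite_bool_lists ennreal_power[symmetric])
  qed
  finally show ?thesis by (simp add: emeasure_eq_measure C_def ennreal_le_iff)
 qed
 have "2 * exp (- 1) < (1::real)"
 proof -
  have "2 < exp (1::real)" using exp_lower_Taylor_quadratic[of 1] by simp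
  then show ?thesis by (simp add: exp_minus field_simps)
 qed
 then have "summable (%n. C * (2 * exp (- 1)) ^ n)"
  by (intro summable_mult summable_geometric) auto
 then have "summable (%n. measure ?Q (A n))"
  by (rule summable_comparison_test'[where N=0]) (use le in auto)
 then have "AE \<xi> in ?Q. eventually (%n. \<xi> : space ?Q - A n) sequentially"
  by (intro borel_cantelli_AE1 sets_A) (auto simp: less_top[symmetric])
 then show ?thesis
  by eventually_elim (auto simp: tame_def eventually_sequentially A_def not_less)
qed

definition bridge :: "(bool list => 'v::euclidean_space) => real => 'v" where
 "bridge \<xi> u = (if tame \<xi> & 0 <= u & u <= 1 then lim (%n. bridge_approx n \<xi> u) else 0)"

lemma uniform_limit_bridge:
 fixes \<xi> :: "bool list => 'v::euclidean_space"
 assumes "tame \<xi>"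
 shows "uniform_limit {0..1} (%n. bridge_approx n \<xi>) (bridge \<xi>) sequentially"
proof -
 let ?d = "%n u. bridge_approx (Suc n) \<xi> u - bridge_approx n \<xi> u"
 obtain n0 where n0: "!!n p. n0 <= n ==> length p = n ==> norm (\<xi> p) <= 2 * real (Suc n)"
  using assms unfolding tame_def by blast
 have "uniform_limit {0..1} (%n u. \<Sum>i<n. ?d i u) (%u. suminf (%i. ?d i u)) sequentially"
 proof (rule Weierstrass_m_test_ev)
  show "\<forall>\<^sub>F n in sequentially. \<forall>u\<in>{0..1}. norm (?d n u) <= real (Suc n) * (1 / sqrt 2) ^ n"
  proof (rule eventually_sequentiallyI[of n0], intro ballI)
   fix n u assume "n0 <= n" "u : {0..1::real}"
   then have "norm (?d n u) <= (1/2) * (1 / sqrt 2) ^ n * (2 * real (Suc n))"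
    by (intro bridge_approx_Suc_diff n0) auto
   then show "norm (?d n u) <= real (Suc n) * (1 / sqrt 2) ^ n" by (simp add: mult_ac del: bridge_approx.simps of_nat_Suc)
  qed
  show "summable (%n. real (Suc n) * (1 / sqrt 2) ^ n)"
   using geometric_deriv_sums[of "1 / sqrt 2 :: real"] by (auto simp: sums_iff)
 qed
 moreover have "(\<Sum>i<n. ?d i u) = bridge_approx n \<xi> u" for n u
  using sum_lessThan_telescope[of "%i. bridge_approx i \<xi> u" n] by simp
 ultimately have u: "uniform_limit {0..1} (%n. bridge_approx n \<xi>) (%u. suminf (%i. ?d i u)) sequentially"
  by (simp only:)
 have "bridge \<xi> u = suminf (%i. ?d i u)" if "u : {0..1}" for u
  using tendsto_uniform_limitI[OF u that] assms that by (simp add: bridge_def limI del: bridge_approx.simps)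
 then have "uniform_limit {0..1} (%n. bridge_approx n \<xi>) (bridge \<xi>) sequentially \<longleftrightarrow>
   uniform_limit {0..1} (%n. bridge_approx n \<xi>) (%u. suminf (%i. ?d i u)) sequentially"
  by (intro uniform_limit_cong') auto
 then show ?thesis using u by (simp only:)
qed

lemma continuous_bridge: "continuous_on {0..1} (bridge \<xi>)"
proof (cases "tame \<xi>")
 case True
 show ?thesis
  by (rule uniform_limit_theorem[OF _ uniform_limit_bridge[OF True]])
   (auto intro!: always_eventually continuous_bridge_approx)
next
 case False
 then have "bridge \<xi> = (%_. 0)" by (auto simp: bridge_def)
 then show ?thesis by simp
qed

lemma bridge_ends[simp]: "bridge \<xi> 0 = 0" "bridge \<xi> 1 = 0"
 by (simp_all add: bridge_def limI)

lemma measurable_bridge[measurable]: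
 "(%w. bridge (fst w) (snd w)) : measurable (gaussian_tree >< borel) (borel :: 'v::euclidean_space measure)"
 unfolding bridge_def
proof (rule measurable_If)
 show "(%w. lim (%n. bridge_approx n (fst w) (snd w))) : measurable (gaussian_tree >< borel) (borel :: 'v measure)"
  by (rule borel_measurable_lim_metric) (rule measurable_bridge_approx)
 show "{w : space (gaussian_tree >< borel). tame (fst w :: bool list => 'v) & 0 <= snd w & snd w <= (1::real)} : sets (gaussian_tree >< borel)"
  by measurable
qed simp

lemma measurable_bridge_compose[measurable (raw)]:
 assumes [measurable]: "f : measurable M gaussian_tree" "g : Bm M"
 shows "(%w. bridge (f w) (g w)) : measurable M (borel :: 'v::euclidean_space measure)"
proof -
 have "(%w. (f w, g w)) : measurable M (gaussian_tree >< borel)" by measurable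
 from measurable_compose[OF this measurable_bridge] show ?thesis by simp
qed

lemma tendsto_pinned_integral:
 fixes x :: "'v::euclidean_space" and F :: "'i => 'v => real"
 assumes "!!i. i : set I ==> continuous_on UNIV (F i)" "!!i z. i : set I ==> 0 <= F i z & F i z <= 1"
  and "!!n. sorted_wrt (<) (\<sigma> n # map (\<rho> n) I)" "!!n r. r : set (\<sigma> n # map (\<rho> n) I) ==> r <= t - \<delta>" "0 < \<delta>"
  and "sorted_wrt (<) (s # map \<rho>' I)" "\<sigma> \<longlonglongrightarrow> s" "y \<longlonglongrightarrow> x" "!!i. i : set I ==> (%n. \<rho> n i) \<longlonglongrightarrow> \<rho>' i"
 shows "(%n. pinned_integral (\<sigma> n) (y n) t x' (map (%i. (\<rho> n i, %z. ennreal (F i z))) I))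
  \<longlonglongrightarrow> pinned_integral s x t x' (map (%i. (\<rho>' i, %z. ennreal (F i z))) I)"
 using assms
proof (induction I arbitrary: s x \<sigma> y)
 case Nil
 have "s <= t - \<delta>"
  using Nil.prems(4,7) by (intro LIMSEQ_le_const2[of \<sigma> s]) auto
 then have pos: "0 < t - s" using Nil.prems(5) by simp
 show ?case
  unfolding pinned_integral.simps list.map heat_kernel_def
  using pos by (intro tendsto_ennrealI tendsto_intros Nil.prems) auto
next
 case (Cons i I)
 let ?B = "(2 * pi * \<delta>) powr (- real DIM('v) / 2)"
 let ?L = "%n. map (%i. (\<rho> n i, %z. ennreal (F i z))) I" and ?L' = "map (%i. (\<rho>' i, %z. ennreal (F i z))) I"
 have F_meas: "F j : Bm borel" if "j : set (i # I)" for j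
  using Cons.prems(1)[OF that] by (rule borel_measurable_continuous_onI)
 have [measurable]: "F i : Bm borel" using F_meas by simp
 have L_meas: "snd rf : Bm borel" if "rf : set (?L n) \<or> rf : set ?L'" for rf n
  using that F_meas by auto
 have lim_le: "\<rho>' j <= t - \<delta>" if "j : set (i # I)" for j
  using Cons.prems(4,9) that by (intro LIMSEQ_le_const2[of "%n. \<rho> n j" "\<rho>' j"]) auto
 have pos: "0 < \<rho> n i - \<sigma> n" for n using Cons.prems(3)[of n] by simp
 have pos': "0 < \<rho>' i - s" using Cons.prems(6) by simp
 define h where "h n g = y n + sqrt (\<rho> n i - \<sigma> n) *\<^sub>R g" for n g
 define h' where "h' g = x + sqrt (\<rho>' i - s) *\<^sub>R g" for g
 have h_lim: "(%n. h n g) \<longlonglongrightarrow> h' g" for g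
  unfolding h_def h'_def using Cons.prems by (intro tendsto_intros) auto
 have bound: "pinned_integral (\<rho> n i) z t x' (?L n) <= ennreal ?B" for n z
  using Cons.prems(2,5) Cons.prems(3)[of n] Cons.prems(4)[of _ n]
  by (intro pinned_integral_le) (auto simp: comp_def ennreal_le_1)
 have bound': "pinned_integral (\<rho>' i) z t x' ?L' <= ennreal ?B" for z
  using Cons.prems(2,5,6) lim_le by (intro pinned_integral_le) (auto simp: comp_def ennreal_le_1)
 have IH: "(%n. pinned_integral (\<rho> n i) (h n g) t x' (?L n)) \<longlonglongrightarrow> pinned_integral (\<rho>' i) (h' g) t x' ?L'" for g
 proof (rule Cons.IH)
  show "sorted_wrt (<) (\<rho> n i # map (\<rho> n) I)" for n using Cons.prems(3)[of n] by simp
  show "r <= t - \<delta>" if "r : set (\<rho> n i # map (\<rho> n) I)" for n r using Cons.prems(4)[of r n] that by simp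
  show "sorted_wrt (<) (\<rho>' i # map \<rho>' I)" using Cons.prems(6) by simp
 qed (use Cons.prems h_lim in auto)
 have h_meas: "h n : measurable standard_gaussian borel" "h' : measurable standard_gaussian borel" for n
  unfolding h_def h'_def measurable_cong_sets[OF sets_standard_gaussian refl]
  by (intro borel_measurable_continuous_onI continuous_intros)+
 have G: "(%z. ennreal (F i z) * pinned_integral (\<rho> n i) z t x' (?L n)) : Bm borel"
  "(%z. ennreal (F i z) * pinned_integral (\<rho>' i) z t x' ?L') : Bm borel" for n
 proof -
  have "(%z. pinned_integral (\<rho> n i) z t x' (?L n)) : Bm borel"
   by (rule borel_measurable_pinned_integral, rule L_meas[of _ n], simp_all)
  then show "(%z. ennreal (F i z) * pinned_integral (\<rho> n i) z t x' (?L n)) : Bm borel" by measurable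
  have "(%z. pinned_integral (\<rho>' i) z t x' ?L') : Bm borel"
   by (rule borel_measurable_pinned_integral, rule L_meas, simp_all)
  then show "(%z. ennreal (F i z) * pinned_integral (\<rho>' i) z t x' ?L') : Bm borel" by measurable
 qed
 have "(%n. INT+g. ennreal (F i (h n g)) * pinned_integral (\<rho> n i) (h n g) t x' (?L n) d/standard_gaussian)
  \<longlonglongrightarrow> (INT+g. ennreal (F i (h' g)) * pinned_integral (\<rho>' i) (h' g) t x' ?L' d/standard_gaussian)"
 proof (rule nn_integral_dominated_convergence[where w="%_. ennreal ?B"])
  show "(%g. ennreal (F i (h n g)) * pinned_integral (\<rho> n i) (h n g) t x' (?L n)) : Bm standard_gaussian" for n
   by (rule measurable_compose[OF h_meas(1) G(1)])
  show "(%g. ennreal (F i (h' g)) * pinned_integral (\<rho>' i) (h' g) t x' ?L') : Bm standard_gaussian"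
   by (rule measurable_compose[OF h_meas(2) G(2)])
  show "AE g in standard_gaussian. ennreal (F i (h n g)) * pinned_integral (\<rho> n i) (h n g) t x' (?L n) <= ennreal ?B" for n
  proof (rule AE_I2)
   fix g
   have "ennreal (F i (h n g)) * pinned_integral (\<rho> n i) (h n g) t x' (?L n) <= 1 * ennreal ?B"
    using Cons.prems(2) by (intro mult_mono bound) (auto simp: ennreal_le_1)
   then show "ennreal (F i (h n g)) * pinned_integral (\<rho> n i) (h n g) t x' (?L n) <= ennreal ?B" by simp
  qed
  interpret prob_space "standard_gaussian :: 'v measure" by (rule prob_space_standard_gaussian)
  show "(INT+g. ennreal ?B d/(standard_gaussian :: 'v measure)) < \<infinity>"
   using emeasure_space_1 by simp
  show "AE g in standard_gaussian. (%n. ennreal (F i (h n g)) * pinned_integral (\<rho> n i) (h n g) t x' (?L n))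
   \<longlonglongrightarrow> ennreal (F i (h' g)) * pinned_integral (\<rho>' i) (h' g) t x' ?L'"
  proof (rule AE_I2, rule tendsto_mult_ennreal)
   fix g
   show "(%n. ennreal (F i (h n g))) \<longlonglongrightarrow> ennreal (F i (h' g))"
    using Cons.prems(1)[of i] h_lim[of g]
    by (intro tendsto_ennrealI) (auto simp: continuous_on_def intro: continuous_on_tendsto_compose[of UNIV "F i"])
   show "\<not> (ennreal (F i (h' g)) = 0 & pinned_integral (\<rho>' i) (h' g) t x' ?L' = \<infinity> \<or> ennreal (F i (h' g)) = \<infinity> & pinned_integral (\<rho>' i) (h' g) t x' ?L' = 0)"
    using bound'[of "h' g"] by (auto simp: top_unique)
  qed (rule IH)
 qed simp_all
 then show ?case
  using nn_integral_heat_kernel_gaussian[OF pos G(1)] nn_integral_heat_kernel_gaussian[OF pos' G(2)]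
  unfolding h_def h'_def by simp
qed

lemma bridge_approx_marginals:
 fixes x x' :: "'v::euclidean_space" and F :: "'i => 'v => ennreal" and \<k> :: "'i => nat"
 assumes st: "s < t" and sorted: "sorted_wrt (<) (0 # map \<k> I @ [2 ^ n])"
  and F: "!!i. i : set I ==> F i : Bm borel"
 shows "(hk (t - s) x x') *
   (INT+\<xi>. (\<Prod>i\<in>set I. F i (x + (real (\<k> i) / 2^n) *\<^sub>R (x' - x) + sqrt (t - s) *\<^sub>R bridge_approx n \<xi> (real (\<k> i) / 2^n))) d/gaussian_tree)
  = pinned_integral s x t x' (map (%i. (s + (t - s) * (real (\<k> i) / 2^n), F i)) I)"
proof -
 have sorted_\<k>: "sorted_wrt (<) (map \<k> I)" using sorted by (simp add: sorted_wrt_append)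
 then have "distinct (map \<k> I)" by (simp add: strict_sorted_iff)
 then have inj: "inj_on \<k> (set I)" and dist: "distinct I" by (auto simp: distinct_map)
 have \<k>_range: "\<k> i : {1..<2^n}" if "i : set I" for i
  using sorted that by (auto simp: sorted_wrt_append Suc_le_eq)
 define f where "f k = (if k : \<k> ` set I then F (inv_into (set I) \<k> k) else (%_. 1))" for k
 have f_\<k>: "f (\<k> i) = F i" if "i : set I" for i
  using that inj by (simp add: f_def)
 have f_meas: "f k : Bm borel" for k
  unfolding f_def using F inj by (auto simp: inv_into_into)
 define \<tau> where "\<tau> k = s + (t - s) * (real k / 2^n)" for k
 have \<tau>_mono: "\<tau> k < \<tau> k'" if "k < k'" for k k'
  unfolding \<tau>_def using st that by (auto intro!: mult_strict_left_mono divide_strict_right_mono)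
 have \<tau>_inj: "inj \<tau>" by (rule linorder_injI) (use \<tau>_mono in force)
 define p where "p \<xi> k = x + (real k / 2^n) *\<^sub>R (x' - x) + sqrt (t - s) *\<^sub>R bridge_approx n \<xi> (real k / 2^n)" for \<xi> k
 have "(\<Prod>k\<in>{1..<2^n}. f k (p \<xi> k)) = (\<Prod>i\<in>set I. F i (p \<xi> (\<k> i)))" for \<xi>
 proof -
  have "(\<Prod>k\<in>{1..<2^n}. f k (p \<xi> k)) = (\<Prod>k\<in>\<k> ` set I. f k (p \<xi> k))"
   using \<k>_range by (intro prod.mono_neutral_right) (auto simp: f_def)
  also have "... = (\<Prod>i\<in>set I. F i (p \<xi> (\<k> i)))"
   using inj by (subst prod.reindex) (auto simp: f_\<k> intro!: prod.cong)
  finally show ?thesis .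
 qed
 then have "(hk (t - s) x x') * (INT+\<xi>. (\<Prod>i\<in>set I. F i (p \<xi> (\<k> i))) d/gaussian_tree)
   = pinned_integral s x t x' (map (%k. (\<tau> k, f k)) [1..<2^n])"
  using bridge_approx_law[OF st, of f x x' n] f_meas by (simp add: p_def \<tau>_def)
 also have "... = pinned_integral s x t x' (filter (%rf. fst rf : \<tau> ` \<k> ` set I) (map (%k. (\<tau> k, f k)) [1..<2^n]))"
 proof (rule pinned_integral_filter)
  have "sorted_wrt (<) (map \<tau> [1..<2^n])"
   unfolding sorted_wrt_map by (rule sorted_wrt_mono_rel[OF _ sorted_wrt_upt]) (auto intro: \<tau>_mono)
  moreover have "s < \<tau> k" "\<tau> k < t" if "k : {1..<2^n}" for k
  proof -
   show "s < \<tau> k" using \<tau>_mono[of 0 k] that by (simp add: \<tau>_def)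
   show "\<tau> k < t" using \<tau>_mono[of k "2^n"] that by (simp add: \<tau>_def)
  qed
  ultimately show "sorted_wrt (<) (s # map fst (map (%k. (\<tau> k, f k)) [1..<2^n]) @ [t])"
   using st by (auto simp: sorted_wrt_append comp_def)
  show "snd rf = (%_. 1)" if "rf : set (map (%k. (\<tau> k, f k)) [1..<2^n])" "fst rf \<notin> \<tau> ` \<k> ` set I" for rf
   using that by (auto simp: f_def)
 qed (use f_meas in auto)
 also have "filter (%rf. fst rf : \<tau> ` \<k> ` set I) (map (%k. (\<tau> k, f k)) [1..<2^n]) = map (%k. (\<tau> k, f k)) (map \<k> I)"
 proof -
  have "filter (%k. k : \<k> ` set I) [1..<2^n] = map \<k> I"
  proof (rule strict_sorted_equal[symmetric])
   have "sorted_wrt (<) [1..<2^n]" by (rule sorted_wrt_upt)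
   then show "sorted_wrt (<) (filter (%k. k : \<k> ` set I) [1..<2^n])" by (rule sorted_wrt_filter)
   show "set (map \<k> I) = set (filter (%k. k : \<k> ` set I) [1..<2^n])" using \<k>_range by auto
  qed (rule sorted_\<k>)
  moreover have "(\<tau> k : \<tau> ` \<k> ` set I) = (k : \<k> ` set I)" for k
   using \<tau>_inj by (rule inj_image_mem_iff)
  ultimately show ?thesis by (simp add: filter_map comp_def)
 qed
 also have "map (%k. (\<tau> k, f k)) (map \<k> I) = map (%i. (\<tau> (\<k> i), F i)) I"
  using f_\<k> by simp
 finally show ?thesis by (simp add: p_def \<tau>_def)
qed

lemma eventually_sorted_dyadic_floor:
 "sorted_wrt (<) us ==> \<forall>\<^sub>F n in sequentially. sorted_wrt (<) (map (%u::real. \<lfloor>2 ^ n * u\<rfloor>) us)"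
proof (induction us)
 case (Cons u us)
 have "\<forall>\<^sub>F n in sequentially. \<lfloor>2 ^ n * u\<rfloor> < \<lfloor>2 ^ n * v\<rfloor>" if v: "v : set us" for v
 proof -
  have "u < v" using Cons.prems v by simp
  then obtain n0 where n0: "(1/2::real) ^ n0 < v - u" using real_arch_pow_inv[of "v - u" "1/2"] by auto
  show ?thesis
  proof (rule eventually_sequentiallyI[of n0])
   fix n assume "n0 <= n"
   then have "(1/2::real) ^ n <= (1/2) ^ n0" by (intro power_decreasing) auto
   then have "(1/2) ^ n < v - u" using n0 by linarith
   then have "2 ^ n * (1/2) ^ n < 2 ^ n * (v - u)" by (intro mult_strict_left_mono) auto
   then have "2 ^ n * u + 1 < 2 ^ n * v" by (simp add: power_mult_distrib[symmetric] right_diff_distrib)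
   then show "\<lfloor>2 ^ n * u\<rfloor> < \<lfloor>2 ^ n * v\<rfloor>" by linarith
  qed
 qed
 then have "\<forall>\<^sub>F n in sequentially. \<forall>v\<in>set us. \<lfloor>2 ^ n * u\<rfloor> < \<lfloor>2 ^ n * v\<rfloor>"
  by (intro eventually_ball_finite) auto
 moreover have "\<forall>\<^sub>F n in sequentially. sorted_wrt (<) (map (%u::real. \<lfloor>2 ^ n * u\<rfloor>) us)"
  using Cons by simp
 ultimately show ?case by eventually_elim simp
qed simp

lemma dyadic_floor_tendsto: "(%n. of_int \<lfloor>2 ^ n * u\<rfloor> / 2 ^ n) \<longlonglongrightarrow> (u::real)"
proof (rule tendsto_sandwich)
 show "\<forall>\<^sub>F n in sequentially. u - (1/2) ^ n <= of_int \<lfloor>2 ^ n * u\<rfloor> / 2 ^ n"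
 proof (rule always_eventually, rule allI)
  fix n
  have "2 ^ n * u - 1 <= of_int \<lfloor>2 ^ n * u\<rfloor>" by linarith
  then have "(2 ^ n * u - 1) / 2 ^ n <= of_int \<lfloor>2 ^ n * u\<rfloor> / 2 ^ n" by (rule divide_right_mono) simp
  then show "u - (1/2) ^ n <= of_int \<lfloor>2 ^ n * u\<rfloor> / 2 ^ n" by (simp add: diff_divide_distrib power_one_over)
 qed
 show "\<forall>\<^sub>F n in sequentially. of_int \<lfloor>2 ^ n * u\<rfloor> / 2 ^ n <= u"
  by (auto simp: field_simps)
 have "(%n. u - (1/2) ^ n) \<longlonglongrightarrow> u - 0"
  by (intro tendsto_intros LIMSEQ_power_zero) auto
 then show "(%n. u - (1/2) ^ n) \<longlonglongrightarrow> u" by simp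
qed simp

lemma bridge_marginals_continuous:
 fixes x x' :: "'v::euclidean_space" and F :: "'i => 'v => real" and u :: "'i => real"
 assumes st: "s < t" and sorted: "sorted_wrt (<) (0 # map u I @ [1])"
  and cont: "!!i. i : set I ==> continuous_on UNIV (F i)" and F: "!!i z. i : set I ==> 0 <= F i z & F i z <= 1"
 shows "(hk (t - s) x x') *
   (INT+\<xi>. (\<Prod>i\<in>set I. ennreal (F i (x + u i *\<^sub>R (x' - x) + sqrt (t - s) *\<^sub>R bridge \<xi> (u i)))) d/gaussian_tree)
  = pinned_integral s x t x' (map (%i. (s + (t - s) * u i, %z. ennreal (F i z))) I)"
proof -
 let ?Q = "gaussian_tree :: (bool list => 'v) measure"
 interpret prob_space ?Q by (rule prob_space_gaussian_tree)
 have u01: "0 < u i" "u i < 1" if "i : set I" for i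
  using sorted that by (auto simp: sorted_wrt_append)
 have "sorted_wrt (<) (0 # map u I)" using sorted by (auto simp: sorted_wrt_append)
 from eventually_sorted_dyadic_floor[OF this] obtain n0 where
  n0: "!!n. n0 <= n ==> sorted_wrt (<) (0 # map (%i. \<lfloor>2 ^ n * u i\<rfloor>) I)"
  by (auto simp: eventually_sequentially comp_def)
 define \<k> where "\<k> n i = nat \<lfloor>2 ^ (n + n0) * u i\<rfloor>" for n i
 define v where "v n i = real (\<k> n i) / 2 ^ (n + n0)" for n i
 have floor_pos: "0 < \<lfloor>2 ^ (n + n0) * u i\<rfloor>" if "i : set I" for n i
  using n0[of "n + n0"] that by auto
 have v_eq: "v n i = of_int \<lfloor>2 ^ (n + n0) * u i\<rfloor> / 2 ^ (n + n0)" if "i : set I" for n i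
  using floor_pos[OF that, of n] by (simp add: v_def \<k>_def)
 have v_le: "v n i <= u i" if "i : set I" for n i
  unfolding v_eq[OF that] by (simp add: field_simps)
 have v_nonneg: "0 <= v n i" for n i by (simp add: v_def)
 have v_lim: "(%n. v n i) \<longlonglongrightarrow> u i" if "i : set I" for i
  unfolding v_eq[OF that] using LIMSEQ_ignore_initial_segment[OF dyadic_floor_tendsto[of "u i"]] .
 have sorted_\<k>: "sorted_wrt (<) (0 # map (\<k> n) I @ [2 ^ (n + n0)])" for n
 proof -
  have "\<k> n i < 2 ^ (n + n0)" if "i : set I" for i
  proof -
   have "real (\<k> n i) / 2 ^ (n + n0) < 1" using v_le[OF that, of n] u01[OF that] unfolding v_def by linarith
   then have "real (\<k> n i) < 2 ^ (n + n0)" by simp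
   then show ?thesis by (metis of_nat_less_iff of_nat_numeral of_nat_power)
  qed
  moreover have "sorted_wrt (<) (map (\<k> n) I)"
   using n0[of "n + n0"] floor_pos[of _ n] unfolding sorted_wrt_map \<k>_def
   by (auto simp: sorted_wrt_map elim!: sorted_wrt_mono_rel[rotated])
  ultimately show ?thesis
   using floor_pos[of _ n] by (auto simp: sorted_wrt_append \<k>_def)
 qed
 define p where "p n \<xi> i = x + v n i *\<^sub>R (x' - x) + sqrt (t - s) *\<^sub>R bridge_approx (n + n0) \<xi> (v n i)" for n \<xi> i
 define p' where "p' \<xi> i = x + u i *\<^sub>R (x' - x) + sqrt (t - s) *\<^sub>R bridge \<xi> (u i)" for \<xi> i
 have F_meas: "F i : Bm borel" if "i : set I" for i
  using cont[OF that] by (rule borel_measurable_continuous_onI)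
 have law: "(hk (t - s) x x') * (INT+\<xi>. (\<Prod>i\<in>set I. ennreal (F i (p n \<xi> i))) d/?Q)
  = pinned_integral s x t x' (map (%i. (s + (t - s) * v n i, %z. ennreal (F i z))) I)" for n
  using bridge_approx_marginals[OF st sorted_\<k>[of n], of "%i z. ennreal (F i z)" x x'] F_meas
  by (simp add: p_def v_def)
 have p_lim: "(%n. p n \<xi> i) \<longlonglongrightarrow> p' \<xi> i" if "tame \<xi>" "i : set I" for \<xi> i
 proof -
  have b: "(%n. bridge_approx (n + n0) \<xi> (v n i)) \<longlonglongrightarrow> bridge \<xi> (u i)"
  proof -
   have ul: "uniform_limit {0..1} (%n. bridge_approx (n + n0) \<xi>) (bridge \<xi>) sequentially"
    using uniform_limit_bridge[OF that(1)] unfolding uniform_limit_sequentially_iff by (meson trans_le_add1)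
   have vin: "v n i : {0..1}" for n using v_nonneg[of n i] v_le[OF that(2), of n] u01[OF that(2)] by auto
   have "(%n. bridge \<xi> (v n i)) \<longlonglongrightarrow> bridge \<xi> (u i)"
    using continuous_on_tendsto_compose[OF continuous_bridge[of \<xi>] v_lim[OF that(2)]] u01[OF that(2)] vin by auto
   moreover have "(%n. bridge_approx (n + n0) \<xi> (v n i) - bridge \<xi> (v n i)) \<longlonglongrightarrow> 0"
   proof (rule LIMSEQ_I)
    fix e :: real assume "0 < e"
    then obtain N where "!!n u. N <= n ==> u : {0..1} ==> dist (bridge_approx (n + n0) \<xi> u) (bridge \<xi> u) < e"
     using ul unfolding uniform_limit_sequentially_iff by meson
    then show "\<exists>N. \<forall>n\<ge>N. norm (bridge_approx (n + n0) \<xi> (v n i) - bridge \<xi> (v n i) - 0) < e"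
     using vin by (auto simp: dist_norm)
   qed
   ultimately have "(%n. (bridge_approx (n + n0) \<xi> (v n i) - bridge \<xi> (v n i)) + bridge \<xi> (v n i)) \<longlonglongrightarrow> 0 + bridge \<xi> (u i)"
    by (intro tendsto_add)
   then show ?thesis by simp
  qed
  show ?thesis unfolding p_def p'_def by (intro tendsto_intros b v_lim that)
 qed
 have prod_le: "(\<Prod>i\<in>set I. ennreal (F i (q i))) <= 1" for q
  using F by (intro prod_le_1) (auto simp: ennreal_le_1)
 have meas_p: "(%\<xi>. p n \<xi> i) : measurable ?Q borel" "(%\<xi>. p' \<xi> i) : measurable ?Q borel" for n i
  unfolding p_def p'_def by measurable
 have prod_meas: "(%\<xi>. \<Prod>i\<in>set I. ennreal (F i (p n \<xi> i))) : Bm ?Q"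
  "(%\<xi>. \<Prod>i\<in>set I. ennreal (F i (p' \<xi> i))) : Bm ?Q" for n
  by (intro borel_measurable_prod_ennreal measurable_compose[OF measurable_compose[OF meas_p(1) F_meas] measurable_ennreal], assumption)
   (intro borel_measurable_prod_ennreal measurable_compose[OF measurable_compose[OF meas_p(2) F_meas] measurable_ennreal], assumption)
 have "(%n. INT+\<xi>. (\<Prod>i\<in>set I. ennreal (F i (p n \<xi> i))) d/?Q) \<longlonglongrightarrow> (INT+\<xi>. (\<Prod>i\<in>set I. ennreal (F i (p' \<xi> i))) d/?Q)"
 proof (rule nn_integral_dominated_convergence[where w="%_. 1"])
  show "AE \<xi> in ?Q. (%n. \<Prod>i\<in>set I. ennreal (F i (p n \<xi> i))) \<longlonglongrightarrow> (\<Prod>i\<in>set I. ennreal (F i (p' \<xi> i)))"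
   using AE_tame
  proof eventually_elim
   case (elim \<xi>)
   have "(%n. \<Prod>i\<in>set I. F i (p n \<xi> i)) \<longlonglongrightarrow> (\<Prod>i\<in>set I. F i (p' \<xi> i))"
    using p_lim[OF elim] cont by (intro tendsto_prod) (auto intro: continuous_on_tendsto_compose[of UNIV])
   then have "(%n. ennreal (\<Prod>i\<in>set I. F i (p n \<xi> i))) \<longlonglongrightarrow> ennreal (\<Prod>i\<in>set I. F i (p' \<xi> i))"
    by (rule tendsto_ennrealI)
   then show ?case using F by (simp add: prod_ennreal)
  qed
 qed (use prod_meas prod_le emeasure_space_1 in auto)
 then have lim1: "(%n. (hk (t - s) x x') * (INT+\<xi>. (\<Prod>i\<in>set I. ennreal (F i (p n \<xi> i))) d/?Q)) \<longlonglongrightarrow>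
   (hk (t - s) x x') * (INT+\<xi>. (\<Prod>i\<in>set I. ennreal (F i (p' \<xi> i))) d/?Q)"
  using heat_kernel_pos[of "t - s" x x'] st by (intro tendsto_mult_ennreal tendsto_const) auto
 define \<delta> where "\<delta> = (t - s) * (1 - Max (insert 0 (u ` set I)))"
 have Max: "Max (insert 0 (u ` set I)) < 1" using u01 by (subst Max_less_iff) auto
 have \<delta>: "0 < \<delta>" using st Max by (simp add: \<delta>_def)
 have le_\<delta>: "s + (t - s) * w <= t - \<delta>" if "w <= Max (insert 0 (u ` set I))" for w
 proof -
  have "(t - s) * w <= (t - s) * Max (insert 0 (u ` set I))" using that st by (intro mult_left_mono) auto
  then show ?thesis by (simp add: \<delta>_def right_diff_distrib)
 qed
 have lim2: "(%n. pinned_integral s x t x' (map (%i. (s + (t - s) * v n i, %z. ennreal (F i z))) I))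
  \<longlonglongrightarrow> pinned_integral s x t x' (map (%i. (s + (t - s) * u i, %z. ennreal (F i z))) I)"
 proof (rule tendsto_pinned_integral[where \<delta>=\<delta>])
  have 1: "sorted_wrt (<) (s # map (%i. s + (t - s) * c i) I)" if "sorted_wrt (<) (map c I)" "!!i. i : set I ==> 0 < c i" for c
   using that st unfolding sorted_wrt_map by (auto simp: sorted_wrt_map elim!: sorted_wrt_mono_rel[rotated])
  show "sorted_wrt (<) (s # map (%i. s + (t - s) * v n i) I)" for n
  proof (rule 1)
   show "sorted_wrt (<) (map (v n) I)"
    using sorted_\<k>[of n] unfolding sorted_wrt_map v_def
    by (auto simp: sorted_wrt_append sorted_wrt_map divide_strict_right_mono elim!: sorted_wrt_mono_rel[rotated])
   show "0 < v n i" if "i : set I" for i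
    using sorted_\<k>[of n] that by (auto simp: sorted_wrt_append v_def)
  qed
  show "sorted_wrt (<) (s # map (%i. s + (t - s) * u i) I)"
   using sorted u01 by (intro 1) (auto simp: sorted_wrt_append)
  show "r <= t - \<delta>" if r: "r : set (s # map (%i. s + (t - s) * v n i) I)" for n r
  proof (cases "r = s")
   case True then show ?thesis using le_\<delta>[of 0] by simp
  next
   case False
   then obtain i where i: "i : set I" "r = s + (t - s) * v n i" using r by auto
   then show ?thesis using v_le[of i n] by (auto intro!: le_\<delta> order_trans[OF v_le[of i n]])
  qed
  show "(%n. s + (t - s) * v n i) \<longlonglongrightarrow> s + (t - s) * u i" if "i : set I" for i
   by (intro tendsto_intros v_lim that)
 qed (use cont F \<delta> in auto)
 show ?thesis
  using LIMSEQ_unique[OF lim1[unfolded law] lim2] by (simp add: p'_def)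
qed

text \<open>The passage from dyadic to real times only preserves integrals of bounded continuous functions;
these determine a measure, since open sets are increasing limits of such functions.\<close>

lemma finite_measure_eqI_continuous:
 fixes M N :: "'a::metric_space measure"
 assumes sets: "sets M = sets borel" "sets N = sets borel" and fin: "finite_measure M"
  and eq: "!!f :: 'a => real. continuous_on UNIV f ==> (!!z. 0 <= f z & f z <= 1) ==>
   (INT+z. ennreal (f z) d/M) = (INT+z. ennreal (f z) d/N)"
 shows "M = N"
proof (rule measure_eqI_generator_eq[where \<Omega>=UNIV and E="{S. open S}" and A="%_. UNIV"])
 note [measurable_cong] = sets
 show "Em M U = Em N U" if "U : {S. open S}" for U
 proof -
  define f where "f k z = (if - U = {} then 1 else min 1 (real k * infdist z (- U)))" for k z
  have cont: "continuous_on UNIV (f k)" for k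
   unfolding f_def by (cases "- U = {}") (auto intro!: continuous_intros simp: min_def[symmetric])
  have f01: "0 <= f k z & f k z <= 1" for k z by (auto simp: f_def infdist_nonneg)
  have [measurable]: "f k : Bm borel" for k
   using cont by (rule borel_measurable_continuous_onI)
  have inc: "incseq (%k z. ennreal (f k z))"
   by (auto simp: incseq_def le_fun_def f_def intro!: ennreal_leI min.mono mult_right_mono infdist_nonneg)
  have ind: "Ind U z = (SUP k. ennreal (f k z))" for z
  proof (cases "z : U")
   case True
   have "\<exists>k. f k z = 1"
   proof (cases "- U = {}")
    case False
    have "0 < infdist z (- U)"
     using True False that by (simp add: infdist_pos_not_in_closed closed_open)
    then obtain k :: nat where "1 / infdist z (- U) < real k" using reals_Archimedean2 by blast
    then have "1 <= real k * infdist z (- U)" using \<open>0 < infdist z (- U)\<close> by (simp add: field_simps)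
    then show ?thesis using False by (auto simp: f_def intro!: exI[of _ k])
   qed (simp add: f_def)
   then obtain k where k: "f k z = 1" ..
   have "(SUP k. ennreal (f k z)) = 1"
    using f01 k by (intro antisym SUP_least) (auto simp: ennreal_le_1 intro!: SUP_upper2[of k])
   then show ?thesis using True by simp
  next
   case False
   then have "f k z = 0" for k by (auto simp: f_def)
   then show ?thesis using False by simp
  qed
  have "Em L U = (SUP k. INT+z. ennreal (f k z) d/L)" if L: "sets L = sets borel" for L :: "'a measure"
  proof -
   note [measurable_cong] = L
   have "Em L U = (INT+z. Ind U z d/L)" using \<open>U : {S. open S}\<close> L by simp
   also have "... = (INT+z. (SUP k. ennreal (f k z)) d/L)" by (simp add: ind)
   also have "... = (SUP k. INT+z. ennreal (f k z) d/L)"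
    by (rule nn_integral_monotone_convergence_SUP[OF inc]) measurable
   finally show ?thesis .
  qed
  then show ?thesis using eq[OF cont f01] sets by simp
 qed
 show "Em M UNIV \<noteq> \<infinity>" using finite_measure.emeasure_finite[OF fin] by simp
qed (auto simp: Int_stable_def sets borel_def)

text \<open>Dyadic times approximate real ones; paths are continuous and so are the pinned integrals.\<close>

lemma bridge_marginals:
 fixes x x' :: "'v::euclidean_space" and F :: "'i => 'v => ennreal" and u :: "'i => real"
 assumes st: "s < t" and sorted: "sorted_wrt (<) (0 # map u I @ [1])"
  and F: "!!i. i : set I ==> F i : Bm borel" "!!i z. i : set I ==> F i z <= 1"
 shows "(hk (t - s) x x') *
   (INT+\<xi>. (\<Prod>i\<in>set I. F i (x + u i *\<^sub>R (x' - x) + sqrt (t - s) *\<^sub>R bridge \<xi> (u i))) d/gaussian_tree)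
  = pinned_integral s x t x' (map (%i. (s + (t - s) * u i, F i)) I)"
proof -
 let ?Q = "gaussian_tree :: (bool list => 'v) measure"
 interpret prob_space ?Q by (rule prob_space_gaussian_tree)
 have "sorted_wrt (<) (map u I)" using sorted by (simp add: sorted_wrt_append)
 then have "distinct (map u I)" by (simp add: strict_sorted_iff)
 then have dist: "distinct I" by (simp add: distinct_map)
 define p where "p i \<xi> = x + u i *\<^sub>R (x' - x) + sqrt (t - s) *\<^sub>R bridge \<xi> (u i)" for \<xi> i
 have [measurable]: "p i : measurable ?Q borel" for i unfolding p_def by measurable
 define \<rho> where "\<rho> i = s + (t - s) * u i" for i
 define h where "h = (hk (t - s) x x')"
 have h_fin: "h < \<infinity>" by (simp add: h_def)
 have "h * (INT+\<xi>. (\<Prod>i\<in>set I. F i (p i \<xi>)) d/?Q) = pinned_integral s x t x' (map (%i. (\<rho> i, F i)) I)"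
  if "finite J" "J \<subseteq> set I" "!!i. i : set I ==> F i : Bm borel & (\<forall>z. F i z <= 1)"
   "!!i. i : set I - J ==> \<exists>f. continuous_on UNIV f & (\<forall>z. 0 <= f z & f z <= 1) & F i = (%z. ennreal (f z))" for J F
  using that
 proof (induction J arbitrary: F rule: finite_induct)
  case empty
  then have "\<forall>i\<in>set I. \<exists>f. continuous_on UNIV f & (\<forall>z. 0 <= f z & f z <= 1) & F i = (%z. ennreal (f z))"
   by auto
  then obtain f where f: "\<forall>i\<in>set I. continuous_on UNIV (f i) & (\<forall>z. 0 <= f i z & f i z <= 1) & F i = (%z. ennreal (f i z))"
   by metis
  have "h * (INT+\<xi>. (\<Prod>i\<in>set I. ennreal (f i (p i \<xi>))) d/?Q) = pinned_integral s x t x' (map (%i. (\<rho> i, %z. ennreal (f i z))) I)"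
   unfolding h_def p_def \<rho>_def using f by (intro bridge_marginals_continuous[OF st sorted]) auto
  moreover have "(\<Prod>i\<in>set I. ennreal (f i (p i \<xi>))) = (\<Prod>i\<in>set I. F i (p i \<xi>))" for \<xi>
   using f by (intro prod.cong) auto
  moreover have "map (%i. (\<rho> i, %z. ennreal (f i z))) I = map (%i. (\<rho> i, F i)) I"
   using f by (intro map_cong) auto
  ultimately show ?case by simp
 next
  case (insert j J)
  have j: "j : set I" using insert.prems by simp
  then obtain I1 I2 where I: "I = I1 @ j # I2" by (meson split_list)
  have jI: "j \<notin> set I1" "j \<notin> set I2" using dist by (auto simp: I)
  have F_meas: "F i : Bm borel" if "i : set I" for i using insert.prems(2) that by auto
  define R where "R \<xi> = (\<Prod>i\<in>set I - {j}. F i (p i \<xi>))" for \<xi>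
  have R_meas: "R : Bm ?Q"
   unfolding R_def
  proof (rule borel_measurable_prod_ennreal)
   show "(%\<xi>. F i (p i \<xi>)) : Bm ?Q" if "i : set I - {j}" for i
    by (rule measurable_compose[OF _ F_meas]) (use that in auto)
  qed
  have R_le: "R \<xi> <= 1" for \<xi>
   unfolding R_def using insert.prems(2) by (intro prod_le_1) auto
  let ?L1 = "map (%i. (\<rho> i, F i)) I1" and ?L2 = "map (%i. (\<rho> i, F i)) I2"
  define k where "k z = pinned_integral s x (\<rho> j) z ?L1 * pinned_integral (\<rho> j) z t x' ?L2" for z
  have k_meas: "k : Bm borel"
   unfolding k_def using F_meas by (intro borel_measurable_times_ennreal borel_measurable_pinned_integral) (auto simp: I)
  define M where "M = distr (density ?Q (%\<xi>. h * R \<xi>)) borel (p j)"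
  define N where "N = density lborel k"
  have intM: "(INT+z. f z d/M) = h * (INT+\<xi>. (\<Prod>i\<in>set I. (F(j := f)) i (p i \<xi>)) d/?Q)" if "f : Bm borel" for f
  proof -
   have [measurable]: "f : Bm borel" "R : Bm ?Q" by fact+
   have "(INT+z. f z d/M) = (INT+\<xi>. h * R \<xi> * f (p j \<xi>) d/?Q)"
    unfolding M_def by (simp add: nn_integral_distr nn_integral_density)
   also have "... = h * (INT+\<xi>. f (p j \<xi>) * R \<xi> d/?Q)"
    by (simp add: nn_integral_cmult mult.assoc mult.commute[of "R _"])
   also have "(%\<xi>. f (p j \<xi>) * R \<xi>) = (%\<xi>. \<Prod>i\<in>set I. (F(j := f)) i (p i \<xi>))"
   proof
    fix \<xi>
    have "(\<Prod>i\<in>set I. (F(j := f)) i (p i \<xi>)) = (F(j := f)) j (p j \<xi>) * (\<Prod>i\<in>set I - {j}. (F(j := f)) i (p i \<xi>))"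
     using j by (intro prod.remove) auto
    also have "(\<Prod>i\<in>set I - {j}. (F(j := f)) i (p i \<xi>)) = R \<xi>"
     unfolding R_def by (intro prod.cong) auto
    finally show "f (p j \<xi>) * R \<xi> = (\<Prod>i\<in>set I. (F(j := f)) i (p i \<xi>))" by simp
   qed
   finally show ?thesis .
  qed
  have intN: "(INT+z. f z d/N) = pinned_integral s x t x' (map (%i. (\<rho> i, (F(j := f)) i)) I)" if f: "f : Bm borel" for f
  proof -
   have "map (%i. (\<rho> i, (F(j := f)) i)) I = ?L1 @ (\<rho> j, f) # ?L2"
    unfolding I using jI by (auto intro!: map_cong)
   moreover have "pinned_integral s x t x' (?L1 @ (\<rho> j, f) # ?L2) = (INT+z. f z * k z d/lborel)"
    unfolding k_def using F_meas f by (intro pinned_integral_append) (auto simp: I)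
   ultimately show ?thesis
    unfolding N_def using f k_meas by (simp add: nn_integral_density mult.commute)
  qed
  have "M = N"
  proof (rule finite_measure_eqI_continuous)
   have "Em M (space M) = (INT+z. 1 d/M)" by simp
   also have "... = h * (INT+\<xi>. (\<Prod>i\<in>set I. (F(j := (%_. 1))) i (p i \<xi>)) d/?Q)"
    by (rule intM) simp
   also have "... <= h * (INT+\<xi>. 1 d/?Q)"
    using insert.prems(2) by (intro mult_left_mono nn_integral_mono prod_le_1) auto
   also have "... < \<infinity>" using h_fin emeasure_space_1 by simp
   finally show "finite_measure M" by (intro finite_measureI) simp
   fix f :: "'v => real" assume f: "continuous_on UNIV f" "!!z. 0 <= f z & f z <= 1"
   have fm: "f : Bm borel" using f(1) by (rule borel_measurable_continuous_onI)
   then have fm': "(%z. ennreal (f z)) : Bm borel" by measurable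
   show "(INT+z. ennreal (f z) d/M) = (INT+z. ennreal (f z) d/N)"
    unfolding intM[OF fm'] intN[OF fm']
   proof (rule insert.IH)
    show "\<exists>g. continuous_on UNIV g & (\<forall>z. 0 <= g z & g z <= 1) & (F(j := (%z. ennreal (f z)))) i = (%z. ennreal (g z))"
     if "i : set I - J" for i
     using that f insert.prems(3)[of i] by (cases "i = j") auto
   qed (use insert.prems fm' f in \<open>auto simp: ennreal_le_1\<close>)
  qed (simp_all add: M_def N_def)
  then show ?case
   using intM[OF F_meas[OF j]] intN[OF F_meas[OF j]] by simp
 qed
 from this[of "set I" F] show ?thesis
  using F by (simp add: h_def p_def \<rho>_def)
qed

section \<open>Bridge laws on path space\<close>

lemma space_path_space: "space (path_space s t :: (real => 'v::euclidean_space) measure) = {\<omega> : extensional {s..t}. continuous_on {s..t} \<omega>}"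
 by (auto simp: path_space_def space_restrict_space space_PiM PiE_def)

lemma measurable_path_space_eval[measurable (raw)]:
 assumes f: "f : measurable M (path_space s t)" and r: "r : {s..t}"
 shows "(%w. f w r) : measurable M (borel :: 'v::euclidean_space measure)"
proof -
 have "(%\<omega>. \<omega> r) : measurable (path_space s t) (borel :: 'v measure)"
  unfolding path_space_def using r by (intro measurable_restrict_space1 measurable_component_singleton)
 from measurable_compose[OF f this] show ?thesis .
qed

lemma measurable_path_spaceI:
 fixes f :: "'a => real => 'v::euclidean_space"
 assumes "!!w. w : space M ==> continuous_on {s..t} (f w)"
  and "!!r. r : {s..t} ==> (%w. f w r) : measurable M borel"
 shows "(%w. restrict (f w) {s..t}) : measurable M (path_space s t)"
 unfolding path_space_def
proof (rule measurable_restrict_space2)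
 show "(%w. restrict (f w) {s..t}) : measurable M (PiM {s..t} (%_. borel))"
  by (rule measurable_restrict) (rule assms(2))
 show "(%w. restrict (f w) {s..t}) : space M \<rightarrow> {\<omega>. continuous_on {s..t} \<omega>}"
 proof
  fix w assume "w : space M"
  then have "continuous_on {s..t} (restrict (f w) {s..t})"
   using assms(1) by (subst continuous_on_cong[OF refl, of _ _ "f w"]) auto
  then show "restrict (f w) {s..t} : {\<omega>. continuous_on {s..t} \<omega>}" by simp
 qed
qed

lemma measurable_path_space_eval_pair:
 assumes "s <= t"
 shows "(%w. (snd w) (max s (min t (fst w)))) : measurable (borel >< path_space s t) (borel :: 'v::euclidean_space measure)"
proof (rule borel_measurable_LIMSEQ_metric)
 let ?c = "%\<tau>. max s (min t \<tau>)"
 have c: "?c \<tau> : {s..t}" for \<tau> using assms by auto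
 show "(%w. (snd w) (?c (of_int \<lfloor>(2::real) ^ n * fst w\<rfloor> / 2 ^ n))) : measurable (borel >< path_space s t) (borel :: 'v measure)" for n :: nat
 proof (rule measurable_compose_countable[where f="%i w. (snd w) (?c (of_int i / 2 ^ n))" and g="%w. \<lfloor>(2::real) ^ n * fst w\<rfloor>"])
  show "(%w. (snd w) (?c (of_int i / 2 ^ n))) : measurable (borel >< path_space s t) (borel :: 'v measure)" for i
   by (rule measurable_path_space_eval[OF measurable_snd c])
 qed measurable
 fix w :: "real \<times> (real => 'v)" assume "w : space (borel >< path_space s t)"
 then have "continuous_on {s..t} (snd w)" by (auto simp: space_pair_measure space_path_space)
 moreover have "(%n. ?c (of_int \<lfloor>(2::real) ^ n * fst w\<rfloor> / 2 ^ n)) \<longlonglongrightarrow> ?c (fst w)"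
  by (intro tendsto_intros dyadic_floor_tendsto)
 ultimately show "(%n. (snd w) (?c (of_int \<lfloor>(2::real) ^ n * fst w\<rfloor> / 2 ^ n))) \<longlonglongrightarrow> (snd w) (?c (fst w))"
  by (rule continuous_on_tendsto_compose) (use c in auto)
qed

lemma path_measure_eqI:
 fixes B B' :: "(real => 'v::euclidean_space) measure"
 assumes st: "s < t" and sets: "sets B = sets (path_space s t)" "sets B' = sets (path_space s t)"
  and fin: "finite_measure B"
  and eq: "!!J A. finite J ==> J \<subseteq> {s<..<t} ==> (!!r. A r : sets borel) ==>
   Em B {\<omega> : space (path_space s t). \<omega> s : A s & \<omega> t : A t & (\<forall>r\<in>J. \<omega> r : A r)} =
   Em B' {\<omega> : space (path_space s t). \<omega> s : A s & \<omega> t : A t & (\<forall>r\<in>J. \<omega> r : A r)}"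
 shows "B = B'"
proof (rule measure_eqI)
 show "sets B = sets B'" by (simp add: sets)
 let ?P = "PiM {s..t} (%_. borel :: 'v measure)" and ?C = "{\<omega>. continuous_on {s..t} \<omega>} :: (real => 'v) set"
 note space = sets_eq_imp_space_eq[OF sets(1)] sets_eq_imp_space_eq[OF sets(2)]
 have incl: "(%\<omega>. \<omega>) : measurable (path_space s t) ?P"
  unfolding path_space_def by (rule measurable_restrict_space1) simp
 then have incl: "(%\<omega>. \<omega>) : measurable B ?P" "(%\<omega>. \<omega>) : measurable B' ?P"
  by (simp_all add: measurable_cong_sets[OF sets(1) refl] measurable_cong_sets[OF sets(2) refl])
 have "distr B ?P (%\<omega>. \<omega>) = distr B' ?P (%\<omega>. \<omega>)"
 proof (rule measure_eqI_PiM_infinite)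
  fix A and J assume J: "finite J" "J \<subseteq> {s..t}" and A: "!!r. r : J ==> A r : sets (borel :: 'v measure)"
  define A' where "A' r = (if r : J then A r else UNIV)" for r
  have A': "A' r : sets borel" for r using A by (simp add: A'_def)
  have "prod_emb {s..t} (%_. borel) J (Pi\<^sub>E J A) \<inter> space (path_space s t) =
   {\<omega> : space (path_space s t). \<omega> s : A' s & \<omega> t : A' t & (\<forall>r\<in>J \<inter> {s<..<t}. \<omega> r : A' r)}"
  proof -
   have e: "(\<forall>r\<in>J. \<omega> r : A r) \<longleftrightarrow> \<omega> s : A' s & \<omega> t : A' t & (\<forall>r\<in>J \<inter> {s<..<t}. \<omega> r : A' r)" for \<omega>
   proof safe
    fix r assume *: "\<omega> s : A' s" "\<omega> t : A' t" "\<forall>r\<in>J \<inter> {s<..<t}. \<omega> r : A' r" "r : J"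
    then show "\<omega> r : A r" using J(2) by (cases "r = s \<or> r = t") (auto simp: A'_def)
   qed (auto simp: A'_def)
   show ?thesis
    unfolding e[symmetric] using J(2) by (auto simp: prod_emb_def space_path_space PiE_def Pi_iff)
  qed
  then show "Em (distr B ?P (%\<omega>. \<omega>)) (prod_emb {s..t} (%_. borel) J (Pi\<^sub>E J A)) =
   Em (distr B' ?P (%\<omega>. \<omega>)) (prod_emb {s..t} (%_. borel) J (Pi\<^sub>E J A))"
   using eq[of "J \<inter> {s<..<t}" A'] J A A' incl
   by (subst (1 2) emeasure_distr) (auto simp: space intro!: sets_PiM_I)
 qed (auto intro: finite_measure.finite_measure_distr[OF fin] incl)
 then have eqP: "Em B (X \<inter> space (path_space s t)) = Em B' (X \<inter> space (path_space s t))" if "X : sets ?P" for X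
  using that emeasure_distr[OF incl(1) that] emeasure_distr[OF incl(2) that] by (simp add: space)
 fix S assume "S : sets B"
 then have "S : sets (path_space s t)" by (simp add: sets)
 then obtain X where "X : sets ?P" "S = ?C \<inter> X"
  unfolding path_space_def by (auto simp: sets_restrict_space)
 moreover have "?C \<inter> X = X \<inter> space (path_space s t)"
  using sets.sets_into_space[OF \<open>X : sets ?P\<close>] by (auto simp: space_path_space space_PiM PiE_def)
 ultimately show "Em B S = Em B' S" using eqP by simp
qed

lemma is_bridge_law_marginal:
 assumes "is_bridge_law \<alpha> s x t x' B" "sorted_wrt (<) (map fst L)"
  "\<forall>(r, A)\<in>set L. s < r & r < t & A : sets borel"
 shows "(hk (\<alpha> * (t - s)) x x') * Em B {\<omega>\<in>space B. \<forall>(r, A)\<in>set L. \<omega> r : A} = pinned_mass s \<alpha> x t x' L"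
 using assms unfolding is_bridge_law_def by (elim conjE allE[of _ L]) (erule mp, intro conjI)

lemma emeasure_bridge_cylinder:
 fixes x :: "'v::euclidean_space"
 assumes B: "is_bridge_law \<alpha> s x t x' B" and st: "s < t"
  and J: "finite J" "J \<subseteq> {s<..<t}" and A: "!!r. A r : sets borel"
 shows "(hk (\<alpha> * (t - s)) x x') *
   Em B {\<omega> : space (path_space s t). \<omega> s : A s & \<omega> t : A t & (\<forall>r\<in>J. \<omega> r : A r)} =
  Ind (A s) x * Ind (A t) x' * pinned_mass s \<alpha> x t x' (map (%r. (r, A r)) (sorted_list_of_set J))"
proof -
 have sets: "sets B = sets (path_space s t)" and AE: "AE \<omega> in B. \<omega> s = x & \<omega> t = x'"
  using B by (simp_all add: is_bridge_law_def)
 note space = sets_eq_imp_space_eq[OF sets]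
 note [measurable_cong] = sets
 have ev: "(%\<omega>. \<omega> r) : measurable B borel" if "r : {s..t}" for r
  using measurable_path_space_eval[OF measurable_ident_sets[OF sets] that] by simp
 have J_ev: "{\<omega> : space B. \<forall>r\<in>J. \<omega> r : A r} : sets B"
 proof (rule sets.sets_Collect_finite_All[OF _ J(1)])
  show "{\<omega> : space B. \<omega> r : A r} : sets B" if "r : J" for r
   using measurable_sets[OF ev[of r] A[of r]] that J(2) by (auto simp: vimage_def Int_def conj_commute)
 qed
 have s_ev: "{\<omega> : space B. \<omega> r : A r} : sets B" if "r : {s..t}" for r
  using measurable_sets[OF ev[OF that] A[of r]] by (auto simp: vimage_def Int_def conj_commute)
 let ?S = "{\<omega> : space (path_space s t). \<omega> s : A s & \<omega> t : A t & (\<forall>r\<in>J. \<omega> r : A r)}"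
 have S: "?S = {\<omega> : space B. \<omega> s : A s} \<inter> ({\<omega> : space B. \<omega> t : A t} \<inter> {\<omega> : space B. \<forall>r\<in>J. \<omega> r : A r})"
  by (auto simp: space)
 have S_sets: "?S : sets B"
  unfolding S using st by (intro sets.Int s_ev J_ev) auto
 show ?thesis
 proof (cases "x : A s & x' : A t")
  case True
  have "Em B ?S = Em B {\<omega> : space B. \<forall>r\<in>J. \<omega> r : A r}"
  proof (rule emeasure_eq_AE[OF _ S_sets J_ev])
   show "AE \<omega> in B. (\<omega> : ?S) = (\<omega> : {\<omega> : space B. \<forall>r\<in>J. \<omega> r : A r})"
    using AE by eventually_elim (use True in \<open>auto simp: space\<close>)
  qed
  also have "{\<omega> : space B. \<forall>r\<in>J. \<omega> r : A r} = {\<omega> : space B. \<forall>(r, C)\<in>set (map (%r. (r, A r)) (sorted_list_of_set J)). \<omega> r : C}"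
   using J(1) by auto
  also have "(hk (\<alpha> * (t - s)) x x') * Em B ... = pinned_mass s \<alpha> x t x' (map (%r. (r, A r)) (sorted_list_of_set J))"
  proof -
   have "sorted_wrt (<) (map fst (map (%r. (r, A r)) (sorted_list_of_set J)))"
    by (simp add: comp_def)
   moreover have "\<forall>(r, C)\<in>set (map (%r. (r, A r)) (sorted_list_of_set J)). s < r & r < t & C : sets borel"
    using J A by auto
   ultimately show ?thesis by (rule is_bridge_law_marginal[OF B])
  qed
  finally show ?thesis using True by simp
 next
  case False
  have "Em B ?S = Em B {}"
  proof (rule emeasure_eq_AE[OF _ S_sets])
   show "AE \<omega> in B. (\<omega> : ?S) = (\<omega> : {})"
    using AE by eventually_elim (use False in auto)
  qed simp
  then show ?thesis using False by auto
 qed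
qed

lemma is_bridge_law_unique:
 fixes x :: "'v::euclidean_space"
 assumes \<alpha>: "0 < \<alpha>" and st: "s < t" and B: "is_bridge_law \<alpha> s x t x' B" and B': "is_bridge_law \<alpha> s x t x' B'"
 shows "B = B'"
proof -
 have h: "0 < heat_kernel (\<alpha> * (t - s)) x x'" using \<alpha> st by (intro heat_kernel_pos) simp
 have cancel: "e = e'" if "(hk (\<alpha> * (t - s)) x x') * e = (hk (\<alpha> * (t - s)) x x') * e'" for e e' :: ennreal
  using that h by (simp add: ennreal_mult_cancel_left)
 have sets: "sets B = sets (path_space s t)" "sets B' = sets (path_space s t)"
  using B B' by (simp_all add: is_bridge_law_def)
 have "(hk (\<alpha> * (t - s)) x x') * Em B {\<omega>\<in>space B. \<forall>(r, A)\<in>set []. \<omega> r : A} = pinned_mass s \<alpha> x t x' []"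
  by (rule is_bridge_law_marginal[OF B]) simp_all
 then have "(hk (\<alpha> * (t - s)) x x') * Em B (space B) = (hk (\<alpha> * (t - s)) x x') * 1"
  by simp
 then have "Em B (space B) = 1" by (rule cancel)
 then have "finite_measure B" by (intro finite_measureI) simp
 then show ?thesis
 proof (rule path_measure_eqI[OF st sets])
  fix J :: "real set" and A :: "real => 'v set"
  assume *: "finite J" "J \<subseteq> {s<..<t}" "!!r. A r : sets borel"
  show "Em B {\<omega> : space (path_space s t). \<omega> s : A s & \<omega> t : A t & (\<forall>r\<in>J. \<omega> r : A r)} =
    Em B' {\<omega> : space (path_space s t). \<omega> s : A s & \<omega> t : A t & (\<forall>r\<in>J. \<omega> r : A r)}"
   by (rule cancel, rule trans[OF emeasure_bridge_cylinder[OF B st *] emeasure_bridge_cylinder[OF B' st *, symmetric]])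
 qed
qed

definition bridge_path ::
  "real => real => 'v::euclidean_space => real => 'v => (bool list => 'v) => real => 'v" where
 "bridge_path \<alpha> s x t x' \<xi> \<tau> = x + ((\<tau> - s) / (t - s)) *\<^sub>R (x' - x) + sqrt (\<alpha> * (t - s)) *\<^sub>R bridge \<xi> ((\<tau> - s) / (t - s))"

lemma measurable_bridge_path[measurable (raw)]:
 assumes [measurable]: "f1 : Bm M" "f2 : Bm M" "f3 : measurable M borel" "f4 : Bm M"
  "f5 : measurable M borel" "f6 : measurable M gaussian_tree" "f7 : Bm M"
 shows "(%w. bridge_path (f1 w) (f2 w) (f3 w) (f4 w) (f5 w) (f6 w) (f7 w)) : measurable M (borel :: 'v::euclidean_space measure)"
 unfolding bridge_path_def by measurable

lemma continuous_bridge_path: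
 assumes "s < t"
 shows "continuous_on {s..t} (bridge_path \<alpha> s x t x' \<xi>)"
 unfolding bridge_path_def[abs_def] using assms
 by (intro continuous_intros continuous_on_compose2[OF continuous_bridge]) (auto simp: field_simps)

lemma measurable_restrict_bridge_path[measurable (raw)]:
 assumes "s < t" and [measurable]: "f : measurable M borel" "g : measurable M borel" "h : measurable M gaussian_tree"
 shows "(%w. restrict (bridge_path \<alpha> s (f w) t (g w) (h w)) {s..t}) : measurable M (path_space s t :: (real => 'v::euclidean_space) measure)"
 using continuous_bridge_path[OF assms(1)] by (intro measurable_path_spaceI) auto

text \<open>An affine image of the standard bridge has the required ends, continuity and finite-dimensional
distributions. Having it as an explicit function of end points and noise gives measurability in the
end points.\<close>

lemma is_bridge_law_bridge_path:
 fixes x :: "'v::euclidean_space"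
 assumes \<alpha>: "0 < \<alpha>" and st: "s < t"
 shows "is_bridge_law \<alpha> s x t x' (distr gaussian_tree (path_space s t) (%\<xi>. restrict (bridge_path \<alpha> s x t x' \<xi>) {s..t}))"
  (is "is_bridge_law _ _ _ _ _ ?B")
 unfolding is_bridge_law_def
proof (intro conjI allI impI)
 let ?Q = "gaussian_tree :: (bool list => 'v) measure"
 have m: "(%\<xi>. restrict (bridge_path \<alpha> s x t x' \<xi>) {s..t}) : measurable ?Q (path_space s t)"
  using st by measurable
 have ev: "(%\<omega>. \<omega> r) : measurable (path_space s t) (borel :: 'v measure)" if "r : {s..t}" for r
  by (rule measurable_path_space_eval[OF measurable_ident_sets[OF refl] that])
 show "sets ?B = sets (path_space s t)" by simp
 have "AE \<xi> in ?Q. restrict (bridge_path \<alpha> s x t x' \<xi>) {s..t} s = x & restrict (bridge_path \<alpha> s x t x' \<xi>) {s..t} t = x'"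
  using st by (simp add: bridge_path_def)
 moreover have "{\<omega> : space (path_space s t). \<omega> s = x & \<omega> t = x'} : sets (path_space s t)"
 proof -
  have "{\<omega> : space (path_space s t). \<omega> s = x & \<omega> t = x'} =
   ((%\<omega>. \<omega> s) -` {x} \<inter> space (path_space s t)) \<inter> ((%\<omega>. \<omega> t) -` {x'} \<inter> space (path_space s t))"
   by auto
  then show ?thesis using st ev[of s] ev[of t] by (auto intro!: sets.Int measurable_sets)
 qed
 ultimately show "AE \<omega> in ?B. \<omega> s = x & \<omega> t = x'"
  using m by (subst AE_distr_iff) auto
 fix L :: "(real \<times> 'v set) list"
 assume L: "sorted_wrt (<) (map fst L) & (\<forall>(r, A)\<in>set L. s < r & r < t & A : sets borel)"
 then have L': "s < fst rA" "fst rA < t" "snd rA : sets borel" if "rA : set L" for rA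
  using that by auto
 define u where "u rA = (fst rA - s) / (t - s)" for rA :: "real \<times> 'v set"
 have \<alpha>st: "\<alpha> * s < \<alpha> * t" using \<alpha> st by simp
 have "sorted_wrt (<) (map u L)"
  using L st unfolding sorted_wrt_map u_def
  by (auto simp: sorted_wrt_map divide_strict_right_mono elim!: sorted_wrt_mono_rel[rotated])
 then have sorted: "sorted_wrt (<) (0 # map u L @ [1])"
  using L' st by (auto simp: sorted_wrt_append u_def)
 let ?S = "{\<omega> : space ?B. \<forall>(r, A)\<in>set L. \<omega> r : A}"
 have "{\<omega> : space (path_space s t). \<forall>rA\<in>set L. \<omega> (fst rA) : snd rA} : sets (path_space s t)"
 proof (rule sets.sets_Collect_finite_All)
  show "{\<omega> : space (path_space s t). \<omega> (fst rA) : snd rA} : sets (path_space s t)" if "rA : set L" for rA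
   using measurable_sets[OF ev[of "fst rA"] L'(3)[OF that]] L'[OF that] by (auto simp: vimage_def Int_def conj_commute)
 qed simp
 then have S: "?S : sets (path_space s t)" by (simp add: split_beta')
 have "Em ?B ?S = (INT+\<xi>. Ind ?S (restrict (bridge_path \<alpha> s x t x' \<xi>) {s..t}) d/?Q)"
  using S m by (subst nn_integral_indicator[symmetric], simp, subst nn_integral_distr) auto
 also have "... = (INT+\<xi>. (\<Prod>rA\<in>set L. Ind (snd rA) (x + u rA *\<^sub>R (x' - x) + sqrt (\<alpha> * t - \<alpha> * s) *\<^sub>R bridge \<xi> (u rA))) d/?Q)"
 proof (rule nn_integral_cong)
  fix \<xi> :: "bool list => 'v"
  have sp: "restrict (bridge_path \<alpha> s x t x' \<xi>) {s..t} : space (path_space s t)"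
   using measurable_space[OF m] by simp
  have "restrict (bridge_path \<alpha> s x t x' \<xi>) {s..t} (fst rA) = x + u rA *\<^sub>R (x' - x) + sqrt (\<alpha> * t - \<alpha> * s) *\<^sub>R bridge \<xi> (u rA)"
   if "rA : set L" for rA
   using L'[OF that] by (simp add: bridge_path_def u_def right_diff_distrib)
  then have "(\<Prod>rA\<in>set L. Ind (snd rA) (x + u rA *\<^sub>R (x' - x) + sqrt (\<alpha> * t - \<alpha> * s) *\<^sub>R bridge \<xi> (u rA)) :: ennreal)
   = (\<Prod>rA\<in>set L. Ind (snd rA) (restrict (bridge_path \<alpha> s x t x' \<xi>) {s..t} (fst rA)))"
   by (intro prod.cong) auto
  also have "... = Ind ?S (restrict (bridge_path \<alpha> s x t x' \<xi>) {s..t})"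
  proof (cases "\<forall>rA\<in>set L. restrict (bridge_path \<alpha> s x t x' \<xi>) {s..t} (fst rA) : snd rA")
   case True
   then show ?thesis using sp by (auto simp: split_beta' intro!: prod.neutral)
  next
   case False
   then obtain rA where rA: "rA : set L" "Ind (snd rA) (restrict (bridge_path \<alpha> s x t x' \<xi>) {s..t} (fst rA)) = (0::ennreal)"
    by (metis indicator_simps(2))
   have "(\<Prod>rA\<in>set L. Ind (snd rA) (restrict (bridge_path \<alpha> s x t x' \<xi>) {s..t} (fst rA)) :: ennreal) = 0"
   proof (rule prod_zero)
    show "\<exists>rA\<in>set L. Ind (snd rA) (restrict (bridge_path \<alpha> s x t x' \<xi>) {s..t} (fst rA)) = (0::ennreal)"
     using rA by blast
   qed simp
   moreover have "restrict (bridge_path \<alpha> s x t x' \<xi>) {s..t} \<notin> ?S" using False by (auto simp: split_beta')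
   then have "Ind ?S (restrict (bridge_path \<alpha> s x t x' \<xi>) {s..t}) = (0::ennreal)"
    by (rule indicator_simps(2))
   ultimately show ?thesis by (simp only:)
  qed
  finally show "Ind ?S (restrict (bridge_path \<alpha> s x t x' \<xi>) {s..t}) =
   (\<Prod>rA\<in>set L. Ind (snd rA) (x + u rA *\<^sub>R (x' - x) + sqrt (\<alpha> * t - \<alpha> * s) *\<^sub>R bridge \<xi> (u rA)) :: ennreal)" ..
 qed
 finally have "(hk (\<alpha> * t - \<alpha> * s) x x') * Em ?B ?S =
   pinned_integral (\<alpha> * s) x (\<alpha> * t) x' (map (%rA. (\<alpha> * s + (\<alpha> * t - \<alpha> * s) * u rA, Ind (snd rA))) L)"
 proof -
  have ind: "Ind (snd i) z <= (1::ennreal)" for i :: "real \<times> 'v set" and z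
   by (simp add: indicator_def)
  show "Em ?B ?S = (INT+\<xi>. (\<Prod>rA\<in>set L. Ind (snd rA) (x + u rA *\<^sub>R (x' - x) + sqrt (\<alpha> * t - \<alpha> * s) *\<^sub>R bridge \<xi> (u rA))) d/?Q) ==> ?thesis"
   using bridge_marginals[OF \<alpha>st sorted, of "%rA. Ind (snd rA)" x x', OF _ ind] L' by simp
 qed
 also have "map (%rA. (\<alpha> * s + (\<alpha> * t - \<alpha> * s) * u rA, Ind (snd rA))) L = map (%rA. (\<alpha> * fst rA, Ind (snd rA) :: 'v => ennreal)) L"
  using st by (auto simp: u_def right_diff_distrib[symmetric] intro!: map_cong) (simp add: field_simps)
 finally show "(hk (\<alpha> * (t - s)) x x') * Em ?B ?S = pinned_mass s \<alpha> x t x' L"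
  by (simp only: pinned_mass_eq_pinned_integral right_diff_distrib)
qed

lemma bridge_law_eq:
 fixes x :: "'v::euclidean_space"
 assumes "0 < \<alpha>" "s < t"
 shows "bridge_law \<alpha> s x t x' = distr gaussian_tree (path_space s t) (%\<xi>. restrict (bridge_path \<alpha> s x t x' \<xi>) {s..t})"
 unfolding bridge_law_def
 by (rule the_equality) (use is_bridge_law_bridge_path[OF assms] is_bridge_law_unique[OF assms] in blast)+

lemma is_bridge_law_bridge_law: "0 < \<alpha> ==> s < t ==> is_bridge_law \<alpha> s x t x' (bridge_law \<alpha> s x t x')"
 using is_bridge_law_bridge_path by (simp add: bridge_law_eq)

lemma nn_integral_bridge_law:
 fixes x :: "'v::euclidean_space"
 assumes "0 < \<alpha>" "s < t" "F : Bm (path_space s t)"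
 shows "(INT+\<omega>. F \<omega> d/bridge_law \<alpha> s x t x') = (INT+\<xi>. F (restrict (bridge_path \<alpha> s x t x' \<xi>) {s..t}) d/gaussian_tree)"
 unfolding bridge_law_eq[OF assms(1,2)] using assms(2,3) by (intro nn_integral_distr) measurable

lemma prob_space_bridge_law:
 fixes x :: "'v::euclidean_space"
 assumes "0 < \<alpha>" "s < t"
 shows "prob_space (bridge_law \<alpha> s x t x')"
 unfolding bridge_law_eq[OF assms] using assms(2)
 by (intro prob_space.prob_space_distr prob_space_gaussian_tree) measurable

text \<open>Both sides are integrals of \<open>F\<close> against measures on paths, so it suffices to compare cylinder sets,
where the identity only regroups the product of heat kernels.\<close>

lemma bridge_markov:
 fixes x :: "'v::euclidean_space"
 assumes \<alpha>: "0 < \<alpha>" and sr: "s < r" and rt: "r < t" and F[measurable]: "F : Bm (path_space s r)"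
 shows "(hk (\<alpha> * (t - s)) x x') * (INT+\<omega>. F (restrict \<omega> {s..r}) d/bridge_law \<alpha> s x t x') =
  (INT+z. (hk (\<alpha> * (r - s)) x z) * (hk (\<alpha> * (t - r)) z x') *
   (INT+\<omega>. F \<omega> d/bridge_law \<alpha> s x r z) d/lborel)"
proof -
 let ?Q = "gaussian_tree :: (bool list => 'v) measure"
 interpret Q: prob_space ?Q by (rule prob_space_gaussian_tree)
 have st: "s < t" using sr rt by simp
 let ?B = "bridge_law \<alpha> s x t x'"
 have B: "is_bridge_law \<alpha> s x t x' ?B" by (rule is_bridge_law_bridge_law[OF \<alpha> st])
 have sets_B: "sets ?B = sets (path_space s t)" using B by (simp add: is_bridge_law_def)
 note space_B = sets_eq_imp_space_eq[OF sets_B]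
 define h where "h = (hk (\<alpha> * (t - s)) x x')"
 define k where "k z = (hk (\<alpha> * (r - s)) x z) * (hk (\<alpha> * (t - r)) z x')" for z
 have [measurable]: "k : Bm borel" unfolding k_def by measurable
 have restr: "(%\<omega>. restrict \<omega> {s..r}) : measurable ?B (path_space s r)"
  unfolding measurable_cong_sets[OF sets_B refl]
 proof (rule measurable_path_spaceI)
  show "continuous_on {s..r} \<omega>" if "\<omega> : space (path_space s t)" for \<omega> :: "real => 'v"
   using that rt by (auto simp: space_path_space intro: continuous_on_subset)
  show "(%\<omega>. \<omega> \<tau>) : measurable (path_space s t) (borel :: 'v measure)" if "\<tau> : {s..r}" for \<tau>
   using that rt by (intro measurable_path_space_eval[OF measurable_ident_sets[OF refl]]) auto
 qed
 have path[measurable]: "(%w. restrict (bridge_path \<alpha> s x r (fst w) (snd w)) {s..r}) : measurable (lborel >< ?Q) (path_space s r)"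
  using sr by measurable
 define M1 where "M1 = density (distr ?B (path_space s r) (%\<omega>. restrict \<omega> {s..r})) (%_. h)"
 define M2 where "M2 = distr (density (lborel >< ?Q) (%w. k (fst w))) (path_space s r) (%w. restrict (bridge_path \<alpha> s x r (fst w) (snd w)) {s..r})"
 have intM1: "(INT+\<omega>. G \<omega> d/M1) = h * (INT+\<omega>. G (restrict \<omega> {s..r}) d/?B)" if [measurable]: "G : Bm (path_space s r)" for G
  unfolding M1_def using restr by (simp add: nn_integral_density nn_integral_distr nn_integral_cmult measurable_compose[OF restr that])
 have intM2: "(INT+\<omega>. G \<omega> d/M2) = (INT+z. k z * (INT+\<omega>. G \<omega> d/bridge_law \<alpha> s x r z) d/lborel)" if [measurable]: "G : Bm (path_space s r)" for G
 proof -
  have "(INT+\<omega>. G \<omega> d/M2) = (INT+w. k (fst w) * G (restrict (bridge_path \<alpha> s x r (fst w) (snd w)) {s..r}) d/(lborel >< ?Q))"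
   unfolding M2_def by (simp add: nn_integral_density nn_integral_distr)
  also have "... = (INT+z. INT+\<xi>. k z * G (restrict (bridge_path \<alpha> s x r z \<xi>) {s..r}) d/?Q d/lborel)"
   by (subst Q.nn_integral_fst[symmetric]) auto
  also have "... = (INT+z. k z * (INT+\<xi>. G (restrict (bridge_path \<alpha> s x r z \<xi>) {s..r}) d/?Q) d/lborel)"
   using sr by (intro nn_integral_cong nn_integral_cmult) measurable
  finally show ?thesis using nn_integral_bridge_law[OF \<alpha> sr that] by simp
 qed
 have "M1 = M2"
 proof (rule path_measure_eqI[OF sr])
  show "sets M1 = sets (path_space s r)" "sets M2 = sets (path_space s r)" by (simp_all add: M1_def M2_def)
  interpret B: prob_space ?B by (rule prob_space_bridge_law[OF \<alpha> st])
  have "(INT+\<omega>. 1 d/M1) = h" using intM1[of "%_. 1"] B.emeasure_space_1 by simp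
  then show "finite_measure M1" by (intro finite_measureI) (simp add: h_def)
  fix J :: "real set" and A :: "real => 'v set"
  assume J: "finite J" "J \<subseteq> {s<..<r}" and A: "!!\<tau>. A \<tau> : sets borel"
  let ?S = "{\<omega> : space (path_space s r). \<omega> s : A s & \<omega> r : A r & (\<forall>\<tau>\<in>J. \<omega> \<tau> : A \<tau>)}"
  have ev: "{\<omega> : space (path_space s r). \<omega> \<tau> : A \<tau>} : sets (path_space s r :: (real => 'v) measure)" if "\<tau> : {s..r}" for \<tau>
   using measurable_sets[OF measurable_path_space_eval[OF measurable_ident_sets[OF refl] that] A[of \<tau>]]
   by (auto simp: vimage_def Int_def conj_commute)
  have "?S = {\<omega> : space (path_space s r). \<omega> s : A s} \<inter> ({\<omega> : space (path_space s r). \<omega> r : A r} \<inter> {\<omega> : space (path_space s r). \<forall>\<tau>\<in>J. \<omega> \<tau> : A \<tau>})"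
   by auto
  moreover have "... : sets (path_space s r)"
   using sr J by (intro sets.Int ev sets.sets_Collect_finite_All) auto
  ultimately have S[measurable]: "?S : sets (path_space s r)" by simp
  define A' where "A' = A(t := UNIV)"
  have A': "A' \<tau> : sets borel" for \<tau> using A by (simp add: A'_def)
  let ?S' = "{\<omega> : space (path_space s t). \<omega> s : A' s & \<omega> t : A' t & (\<forall>\<tau>\<in>insert r J. \<omega> \<tau> : A' \<tau>)}"
  have A'_eq: "A' \<tau> = A \<tau>" if "\<tau> : {s..r}" for \<tau> using that rt by (auto simp: A'_def)
  have SS: "(restrict \<omega> {s..r} : ?S) = (\<omega> : ?S')" if "\<omega> : space ?B" for \<omega>
  proof -
   have "restrict \<omega> {s..r} : space (path_space s r)" using measurable_space[OF restr that] .
   moreover have "\<omega> t : A' t" by (simp add: A'_def)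
   moreover have "(\<forall>\<tau>\<in>J. restrict \<omega> {s..r} \<tau> : A \<tau>) = (\<forall>\<tau>\<in>J. \<omega> \<tau> : A' \<tau>)"
    using J(2) A'_eq by (intro ball_cong) auto
   ultimately show ?thesis
    using that sr A'_eq[of s] A'_eq[of r] by (auto simp: space_B)
  qed
  have list: "sorted_list_of_set (insert r J) = sorted_list_of_set J @ [r]"
  proof (rule strict_sorted_equal[symmetric])
   show "sorted_wrt (<) (sorted_list_of_set J @ [r])"
    using J by (auto simp: sorted_wrt_append)
   show "set (sorted_list_of_set J @ [r]) = set (sorted_list_of_set (insert r J))"
    using J(1) by (simp only: set_sorted_list_of_set set_append finite_insert) auto
  qed (rule strict_sorted_list_of_set)
  have "Em M1 ?S = h * Em ?B ?S'"
  proof -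
   have S'_sets: "?S' : sets ?B"
   proof -
    have "?S' \<subseteq> space ?B" by (auto simp: space_B)
    then have "?S' = (%\<omega>. restrict \<omega> {s..r}) -` ?S \<inter> space ?B" using SS by blast
    then show ?thesis using measurable_sets[OF restr S] by simp
   qed
   have "Em M1 ?S = (INT+\<omega>. Ind ?S \<omega> d/M1)" by (simp add: M1_def)
   also have "... = h * (INT+\<omega>. Ind ?S (restrict \<omega> {s..r}) d/?B)" by (rule intM1) measurable
   also have "(INT+\<omega>. Ind ?S (restrict \<omega> {s..r}) d/?B) = (INT+\<omega>. Ind ?S' \<omega> d/?B)"
    using SS by (intro nn_integral_cong) (simp add: indicator_def)
   finally show ?thesis using S'_sets by simp
  qed
  also have "... = Ind (A' s) x * Ind (A' t) x' * pinned_mass s \<alpha> x t x' (map (%\<tau>. (\<tau>, A' \<tau>)) (sorted_list_of_set (insert r J)))"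
   unfolding h_def using J sr rt by (intro emeasure_bridge_cylinder[OF B st _ _ A']) auto
  also have "... = Ind (A s) x * pinned_mass s \<alpha> x t x' (map (%\<tau>. (\<tau>, A \<tau>)) (sorted_list_of_set J) @ [(r, A r)])"
   unfolding list using A'_eq J sr by (auto simp: A'_def intro!: arg_cong2[where f="(*)"] arg_cong[where f="pinned_mass s \<alpha> x t x'"] map_cong)
  also have "... = Ind (A s) x * (INT+z. Ind (A r) z * (pinned_mass s \<alpha> x r z (map (%\<tau>. (\<tau>, A \<tau>)) (sorted_list_of_set J)) * (hk (\<alpha> * (t - r)) z x')) d/lborel)"
   unfolding pinned_mass_eq_pinned_integral map_append list.map fst_conv snd_conv
   by (subst pinned_integral_append) (use A in \<open>auto simp: right_diff_distrib\<close>)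
  also have "... = (INT+z. Ind (A s) x * (Ind (A r) z * (pinned_mass s \<alpha> x r z (map (%\<tau>. (\<tau>, A \<tau>)) (sorted_list_of_set J)) * (hk (\<alpha> * (t - r)) z x'))) d/lborel)"
   unfolding pinned_mass_eq_pinned_integral using A by (intro nn_integral_cmult[symmetric] borel_measurable_times_ennreal borel_measurable_pinned_integral) auto
  also have "... = (INT+z. k z * (INT+\<omega>. Ind ?S \<omega> d/bridge_law \<alpha> s x r z) d/lborel)"
  proof (rule nn_integral_cong)
   fix z :: 'v
   have Bz: "is_bridge_law \<alpha> s x r z (bridge_law \<alpha> s x r z)" by (rule is_bridge_law_bridge_law[OF \<alpha> sr])
   have "?S : sets (bridge_law \<alpha> s x r z)" using Bz S by (simp add: is_bridge_law_def)
   then have "(INT+\<omega>. Ind ?S \<omega> d/bridge_law \<alpha> s x r z) = Em (bridge_law \<alpha> s x r z) ?S" by simp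
   then have "k z * (INT+\<omega>. Ind ?S \<omega> d/bridge_law \<alpha> s x r z)
    = (hk (\<alpha> * (t - r)) z x') * ((hk (\<alpha> * (r - s)) x z) * Em (bridge_law \<alpha> s x r z) ?S)"
    by (simp only: k_def mult_ac)
   also have "(hk (\<alpha> * (r - s)) x z) * Em (bridge_law \<alpha> s x r z) ?S =
    Ind (A s) x * Ind (A r) z * pinned_mass s \<alpha> x r z (map (%\<tau>. (\<tau>, A \<tau>)) (sorted_list_of_set J))"
    by (rule emeasure_bridge_cylinder[OF Bz sr J]) (rule A)
   finally show "Ind (A s) x * (Ind (A r) z * (pinned_mass s \<alpha> x r z (map (%\<tau>. (\<tau>, A \<tau>)) (sorted_list_of_set J)) * (hk (\<alpha> * (t - r)) z x')))
    = k z * (INT+\<omega>. Ind ?S \<omega> d/bridge_law \<alpha> s x r z)"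
    by (simp only: mult_ac)
  qed
  also have "... = (INT+\<omega>. Ind ?S \<omega> d/M2)" by (rule intM2[symmetric]) measurable
  finally show "Em M1 ?S = Em M2 ?S" by (simp add: M2_def)
 qed
 then show ?thesis using intM1[OF F] intM2[OF F] by (simp add: h_def k_def)
qed

text \<open>At an interior time the law of the bridge has a density, so sets of Lebesgue measure zero are not
seen. This makes the choice of the fibres immaterial along paths.\<close>

lemma AE_bridge_law_eval:
 fixes x :: "'v::euclidean_space"
 assumes \<alpha>: "0 < \<alpha>" and r: "s < r" "r < t" and P: "AE z in lborel. P z"
 shows "AE \<omega> in bridge_law \<alpha> s x t x'. P (\<omega> r)"
proof -
 obtain N where N: "N : null_sets lborel" "{z. \<not> P z} \<subseteq> N"
  using P by (auto simp: eventually_ae_filter)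
 have st: "s < t" using r by simp
 let ?B = "bridge_law \<alpha> s x t x'"
 have B: "is_bridge_law \<alpha> s x t x' ?B" by (rule is_bridge_law_bridge_law[OF \<alpha> st])
 have "(hk (\<alpha> * (t - s)) x x') * Em ?B {\<omega>\<in>space ?B. \<forall>(\<tau>, A)\<in>set [(r, N)]. \<omega> \<tau> : A} = pinned_mass s \<alpha> x t x' [(r, N)]"
  using N r by (intro is_bridge_law_marginal[OF B]) auto
 also have "... = 0"
  using N(1) by (simp add: nn_integral_null_set)
 finally have "Em ?B {\<omega>\<in>space ?B. \<omega> r : N} = 0"
  using heat_kernel_pos[of "\<alpha> * (t - s)" x x'] \<alpha> st by simp
 moreover have "{\<omega>\<in>space ?B. \<omega> r : N} : sets ?B"
 proof -
  have s: "sets ?B = sets (path_space s t)" using B by (simp add: is_bridge_law_def)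
  have "(%\<omega>. \<omega> r) : measurable ?B borel"
   using measurable_path_space_eval[OF measurable_ident_sets[OF s], of r] r by simp
  from measurable_sets[OF this, of N] N(1) show ?thesis by (auto simp: vimage_def Int_def conj_commute)
 qed
 ultimately show ?thesis using N(2) by (intro AE_I[of _ _ "{\<omega>\<in>space ?B. \<omega> r : N}"]) auto
qed

section \<open>The Feynman-Kac identity\<close>

lemma measurable_exp_neg[measurable]: "exp_neg : Bm borel"
 unfolding exp_neg_def[abs_def] by measurable

lemma exp_neg_le_1: "exp_neg r <= 1"
 by (simp add: exp_neg_def ennreal_le_1)

text \<open>The fundamental theorem of calculus for \<open>exp (- C r)\<close> with \<open>C\<close> the primitive of \<open>l\<close>. As \<open>l\<close> is merely
integrable, the proof changes variables by \<open>C\<close>, a continuous distribution function.\<close>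

lemma exp_neg_integral:
 fixes l :: "real => ennreal"
 assumes [measurable]: "l : Bm borel" and fin: "(INT+r\<in>{s..t}. l r d/lborel) < \<infinity>" and st: "s <= t"
 shows "exp_neg (INT+r\<in>{s..t}. l r d/lborel) + (INT+r\<in>{s..t}. l r * exp_neg (INT+\<tau>\<in>{s..r}. l \<tau> d/lborel) d/lborel) = 1"
proof -
 define M where "M = density lborel (%r. l r * Ind {s..t} r)"
 have sets_M[simp, measurable_cong]: "sets M = sets borel" by (simp add: M_def)
 have emM: "Em M A = (INT+r\<in>{s..t}. l r * Ind A r d/lborel)" if "A : sets borel" for A
  using that by (simp add: M_def emeasure_density mult_ac)
 have int_M: "(INT+r. e r d/M) = (INT+r. (l r * Ind {s..t} r) * e r d/lborel)"
  if "e : Bm borel" for e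
  using that unfolding M_def by (simp add: nn_integral_density)
 have total: "Em M UNIV = (INT+r\<in>{s..t}. l r d/lborel)" by (simp add: emM)
 interpret fm: finite_measure M
  by (rule finite_measureI) (use fin total in \<open>simp add: M_def\<close>)
 interpret M: finite_borel_measure M
  by unfold_locales simp
 define C where "C = measure M UNIV"
 have C: "ennreal C = (INT+r\<in>{s..t}. l r d/lborel)" "0 <= C"
  using total by (simp_all add: C_def fm.emeasure_eq_measure)
 have cont: "isCont (cdf M) r" for r
 proof -
  have "Em M {r} = (INT+v. (l v * Ind {s..t} v) * Ind {r} v d/lborel)"
   by (simp add: M_def emeasure_density)
  also have "... = 0" by (rule nn_integral_null_set, rule null_setsI) simp_all
  finally have "Em M {r} = 0" .
  then show ?thesis by (simp add: M.isCont_cdf measure_def)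
 qed
 have cdf_e: "ennreal (cdf M r) = Em M {..r}" for r by (simp add: cdf_def fm.emeasure_eq_measure)
 have cdf_s: "cdf M s = 0"
 proof -
  have "Em M {..s} = (INT+r. (l r * Ind {s..t} r) * Ind {s} r d/lborel)"
   unfolding emM[OF atMost_borel] by (intro nn_integral_cong) (auto simp: indicator_def)
  also have "... = 0" by (rule nn_integral_null_set, rule null_setsI) simp_all
  finally show ?thesis using M.cdf_nonneg[of s] by (simp add: cdf_e[symmetric] ennreal_eq_0_iff)
 qed
 have cdf_t: "cdf M t = C"
 proof -
  have "Em M {..t} = Em M UNIV"
   by (subst (1 2) emM) (auto intro!: nn_integral_cong simp: indicator_def)
  then show ?thesis by (simp add: cdf_def C_def fm.emeasure_eq_measure)
 qed
 have [measurable]: "cdf M : Bm borel"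
  using cont by (intro borel_measurable_continuous_onI) (simp add: continuous_at_imp_continuous_on)
 then have cdf_M: "cdf M : Bm M"
  by (simp add: measurable_cong_sets[OF sets_M refl])
 define N where "N = distr M borel (cdf M)"
 have "N = density lborel (Ind {0..C})"
 proof (rule measure_eqI_generator_eq[where \<Omega>=UNIV and E="range (%a. {..a})" and A="%n. {..real n}"])
  have "Em N {..u} = Em (density lborel (Ind {0..C})) {..u}" for u
  proof -
   have "Em N {..u} = Em M {r. cdf M r <= u}"
    unfolding N_def by (subst emeasure_distr[OF cdf_M]) (auto simp: M.borel_UNIV vimage_def)
   also have "... = ennreal (max 0 (min u C))"
   proof (cases "0 <= u & u < C")
    case False
    have "cdf M r <= C" for r using M.cdf_bounded[of r] by (simp add: C_def M.borel_UNIV)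
    then have ge: "C <= u ==> {r. cdf M r <= u} = UNIV" using order_trans by auto
    from False consider "u < 0" | "0 <= u" "C <= u" by linarith
    then show ?thesis
    proof cases
     case 1
     have "{r. cdf M r <= u} = {}"
      using M.cdf_nonneg 1 by (auto simp: not_le intro: less_le_trans)
     then have "Em M {r. cdf M r <= u} = 0" by (simp only: emeasure_empty)
     then show ?thesis using 1 C(2) by (simp add: max_def min_def)
    next
     case 2
     then have "Em M {r. cdf M r <= u} = ennreal C" by (simp only: ge C_def fm.emeasure_eq_measure)
     then show ?thesis using 2 C(2) by (simp add: max_def min_def)
    qed
   next
    case True
    let ?S = "{r. cdf M r <= u}"
    have "closed ?S"
     using cont by (intro closed_Collect_le continuous_intros) (simp_all add: continuous_at_imp_continuous_on)
    moreover have bdd: "bdd_above ?S"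
    proof (rule bdd_aboveI[of _ t])
     fix r assume "r : ?S"
     then have "cdf M r < cdf M t" using True cdf_t by simp
     then show "r <= t" using M.cdf_nondecreasing[of t r] by (meson not_le order.strict_iff_order less_irrefl nle_le)
    qed
    moreover have "s : ?S" using cdf_s True by simp
    ultimately have R: "Sup ?S : ?S" by (intro closed_contains_Sup) auto
    have S: "?S = {..Sup ?S}"
    proof (intro set_eqI iffI)
     fix r assume "r : {..Sup ?S}"
     then have "cdf M r <= cdf M (Sup ?S)" by (intro M.cdf_nondecreasing) simp
     then show "r : ?S" using R by simp
    qed (use bdd in \<open>auto intro: cSup_upper\<close>)
    have "\<exists>r\<ge>s. r <= t & cdf M r = u"
     using True cdf_s cdf_t cont st by (intro IVT) auto
    then obtain r where r: "cdf M r = u" by blast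
    then have "r <= Sup ?S" using S by auto
    then have "u <= cdf M (Sup ?S)" using M.cdf_nondecreasing r by auto
    then have "cdf M (Sup ?S) = u" using R by simp
    then show ?thesis using True S cdf_e[of "Sup ?S"] by (simp add: max_def min_def)
   qed
   also have "... = Em lborel {0..min u C}" by (simp add: max_def)
   also have "... = Em (density lborel (Ind {0..C})) {..u}"
   proof -
    have "Em (density lborel (Ind {0..C})) {..u} = (INT+v. Ind {0..C} v * Ind {..u} v d/lborel)"
     by (simp add: emeasure_density)
    also have "... = (INT+v. Ind {0..min u C} v d/lborel)"
     by (intro nn_integral_cong) (auto simp: indicator_def)
    finally show ?thesis by simp
   qed
   finally show ?thesis .
  qed
  then show "!!X. X : range (%a. {..a}) ==> Em N X = Em (density lborel (Ind {0..C})) X" by auto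
  show "Em N {..real n} \<noteq> \<infinity>" for n
   unfolding N_def by (subst emeasure_distr[OF cdf_M]) (auto simp: fm.emeasure_eq_measure)
  show "(\<Union>n. {..real n}) = UNIV" using real_arch_simple by auto
  show "sets N = sigma_sets UNIV (range (%a. {..a}))" "sets (density lborel (Ind {0..C})) = sigma_sets UNIV (range (%a. {..a}))"
   unfolding N_def by (simp_all add: borel_eq_atMost)
 qed (auto simp: Int_stable_def)
 then have "(INT+v. ennreal (exp (- v)) d/N) = (INT+v. ennreal (exp (- v)) * Ind {0..C} v d/lborel)"
  by (simp add: nn_integral_density mult.commute)
 also have "... = ennreal (1 - exp (- C))"
 proof -
  have "(INT+v. ennreal (exp (- v)) * Ind {0..C} v d/lborel) = ennreal (- exp (- C) - - exp (- 0))"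
   using C(2) by (intro nn_integral_FTC_Icc) (auto intro!: derivative_eq_intros)
  then show ?thesis by simp
 qed
 finally have N_int: "(INT+v. ennreal (exp (- v)) d/N) = ennreal (1 - exp (- C))" .
 have "(INT+r\<in>{s..t}. l r * exp_neg (INT+\<tau>\<in>{s..r}. l \<tau> d/lborel) d/lborel) = (INT+r. ennreal (exp (- cdf M r)) d/M)"
 proof -
  have "exp_neg (INT+\<tau>\<in>{s..r}. l \<tau> d/lborel) = ennreal (exp (- cdf M r))" if "r : {s..t}" for r
  proof -
   have "(INT+\<tau>\<in>{s..r}. l \<tau> d/lborel) = Em M {..r}"
    unfolding emM[OF atMost_borel] using that by (intro nn_integral_cong) (auto simp: indicator_def)
   then show ?thesis using M.cdf_nonneg by (simp add: exp_neg_def cdf_e[symmetric])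
  qed
  then have "(INT+r\<in>{s..t}. l r * exp_neg (INT+\<tau>\<in>{s..r}. l \<tau> d/lborel) d/lborel) = (INT+r. (l r * Ind {s..t} r) * ennreal (exp (- cdf M r)) d/lborel)"
   by (intro nn_integral_cong) (auto simp: indicator_def)
  also have "... = (INT+r. ennreal (exp (- cdf M r)) d/M)"
   by (rule int_M[symmetric]) simp
  finally show ?thesis .
 qed
 also have "... = (INT+v. ennreal (exp (- v)) d/N)"
  unfolding N_def by (simp add: nn_integral_distr[OF cdf_M])
 finally have "(INT+r\<in>{s..t}. l r * exp_neg (INT+\<tau>\<in>{s..r}. l \<tau> d/lborel) d/lborel) = ennreal (1 - exp (- C))"
  by (simp add: N_int)
 moreover have "exp_neg (INT+r\<in>{s..t}. l r d/lborel) = ennreal (exp (- C))"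
  using C by (simp add: exp_neg_def C(1)[symmetric])
 ultimately show ?thesis
  using C(2) by (simp add: ennreal_plus[symmetric] del: ennreal_plus)
qed

definition killing :: "(real => 'v::euclidean_space => ennreal) => real => real => 'v => real => 'v => ennreal" where
 "killing c \<alpha> s x t x' = (INT+\<omega>. exp_neg (INT+\<tau>\<in>{s..t}. c \<tau> (\<omega> \<tau>) d/lborel) d/bridge_law \<alpha> s x t x')"

lemma measurable_path_eval_compose:
 fixes c :: "real => 'v::euclidean_space => ennreal"
 assumes c: "(%w. c (fst w) (snd w)) : Bm (borel >< borel)" and st: "s <= t"
 shows "(%w. c (fst w) (snd w (fst w)) * Ind {s..t} (fst w)) : Bm (borel >< path_space s t)"
proof -
 have "(%w. (fst w, snd w (max s (min t (fst w))))) : measurable (borel >< path_space s t) (borel >< (borel :: 'v measure))"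
  using measurable_path_space_eval_pair[OF st] by (intro measurable_Pair measurable_fst)
 from measurable_compose[OF this c]
 have "(%w. c (fst w) (snd w (max s (min t (fst w)))) * Ind {s..t} (fst w)) : Bm (borel >< path_space s t)"
  by simp
 moreover have "c (fst w) (snd w (max s (min t (fst w)))) * Ind {s..t} (fst w) = c (fst w) (snd w (fst w)) * Ind {s..t} (fst w)" for w :: "real \<times> (real => 'v)"
  by (auto simp: indicator_def max_def min_def)
 ultimately show ?thesis by simp
qed

lemma measurable_path_integral:
 fixes c :: "real => 'v::euclidean_space => ennreal"
 assumes c: "(%w. c (fst w) (snd w)) : Bm (borel >< borel)" and st: "s <= t"
 shows "(%w. exp_neg (INT+\<tau>\<in>{s..min t (fst w)}. c \<tau> (snd w \<tau>) d/lborel)) : Bm (borel >< path_space s t)"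
proof -
 have m: "(%p. (snd p, snd (fst p))) : measurable ((borel >< path_space s t) >< lborel) ((borel :: real measure) >< (path_space s t :: (real => 'v) measure))"
  by measurable
 have [measurable]: "(%p. c (snd p) (snd (fst p) (snd p)) * Ind {s..t} (snd p)) : Bm (((borel :: real measure) >< (path_space s t :: (real => 'v) measure)) >< lborel)"
  using measurable_compose[OF m measurable_path_eval_compose[OF c st]] by simp
 have eq: "(INT+\<tau>\<in>{s..min t (fst w)}. c \<tau> (snd w \<tau>) d/lborel) = (INT+\<tau>. (c \<tau> (snd w \<tau>) * Ind {s..t} \<tau>) * (if \<tau> <= fst w then 1 else 0) d/lborel)" for w :: "real \<times> (real => 'v)"
  by (intro nn_integral_cong) (auto simp: indicator_def)
 show ?thesis unfolding eq by measurable
qed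

lemma measurable_path_integral_at:
 fixes c :: "real => 'v::euclidean_space => ennreal"
 assumes c: "(%w. c (fst w) (snd w)) : Bm (borel >< borel)" and st: "s <= r" "r <= t"
 shows "(%\<omega>. exp_neg (INT+\<tau>\<in>{s..r}. c \<tau> (\<omega> \<tau>) d/lborel)) : Bm (path_space s t)"
 using measurable_compose[OF measurable_Pair1'[of r borel "path_space s t"] measurable_path_integral[of c s t]] assms
 by (simp add: min_absorb2)

lemma sets_bridge_law:
 "0 < \<alpha> ==> s < t ==> sets (bridge_law \<alpha> s x t x') = sets (path_space s t)"
 by (simp add: bridge_law_eq)

text \<open>The pathwise identity of the exponential is integrated over the bridge; the Markov property at the
time \<open>r\<close> of killing splits the path into a killed part before \<open>r\<close> and a free one after it.\<close>

lemma feynman_kac: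
 fixes x :: "'v::euclidean_space" and c :: "real => 'v => ennreal"
 assumes \<alpha>: "0 < \<alpha>" and st: "s < t"
  and c: "(%w. c (fst w) (snd w)) : Bm (borel >< borel)"
  and g: "(INT+\<tau>\<in>{s..t}. g \<tau> d/lborel) < \<infinity>" and g_meas[measurable]: "g : Bm borel"
  and bound: "AE \<tau> in lborel. \<tau> : {s..t} \<longrightarrow> (AE z in lborel. c \<tau> z <= g \<tau>)"
 shows "(hk (\<alpha> * (t - s)) x x') * killing c \<alpha> s x t x' +
  (INT+r\<in>{s..t}. (INT+z. (hk (\<alpha> * (r - s)) x z) * killing c \<alpha> s x r z *
   (c r z * (hk (\<alpha> * (t - r)) z x')) d/lborel) d/lborel) =
  (hk (\<alpha> * (t - s)) x x')"
proof -
 let ?B = "bridge_law \<alpha> s x t x'"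
 define h where "h = (hk (\<alpha> * (t - s)) x x')"
 interpret B: prob_space ?B by (rule prob_space_bridge_law[OF \<alpha> st])
 have sets_B: "sets ?B = sets (path_space s t)"
  by (rule sets_bridge_law[OF \<alpha> st])
 note [measurable_cong] = sets_B
 define L where "L \<omega> r = c r (\<omega> r) * Ind {s..t} r" for \<omega> r
 define D where "D \<omega> r = exp_neg (INT+\<tau>\<in>{s..min t r}. c \<tau> (\<omega> \<tau>) d/lborel)" for \<omega> r
 have L_meas[measurable]: "(%w. L (snd w) (fst w)) : Bm (borel >< ?B)"
  using measurable_path_eval_compose[OF c less_imp_le[OF st]] by (simp add: L_def cong: measurable_cong_sets)
 have D_meas[measurable]: "(%w. D (snd w) (fst w)) : Bm (borel >< ?B)"
  using measurable_path_integral[OF c less_imp_le[OF st]] by (simp add: D_def cong: measurable_cong_sets)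
 have L_\<omega>: "L \<omega> : Bm borel" if "\<omega> : space ?B" for \<omega>
  using measurable_compose[OF measurable_Pair2'[OF that, of borel] L_meas] by simp
 have AE_bound: "AE \<omega> in ?B. AE r in lborel. L \<omega> r <= g r"
 proof -
  interpret P: pair_sigma_finite lborel ?B ..
  have "AE r in lborel. AE \<omega> in ?B. L \<omega> r <= g r"
  proof -
   have "AE r in lborel. r \<noteq> s & r \<noteq> t"
    by (intro AE_conjI AE_lborel_singleton)
   with bound show ?thesis
   proof eventually_elim
    case (elim r)
    show ?case
    proof (cases "r : {s..t}")
     case True
     then have "AE \<omega> in ?B. c r (\<omega> r) <= g r"
      using elim by (intro AE_bridge_law_eval[OF \<alpha>, where P="%z. c r z <= g r"]) auto
     then show ?thesis by eventually_elim (simp add: L_def indicator_def)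
    qed (simp add: L_def)
   qed
  qed
  moreover have "{w : space (lborel >< ?B). L (snd w) (fst w) <= g (fst w)} : sets (lborel >< ?B)"
   by measurable
  ultimately show ?thesis
   using P.AE_commute[of "%r \<omega>. L \<omega> r <= g r"] by simp
 qed
 have AE_id: "AE \<omega> in ?B. D \<omega> t + (INT+r. L \<omega> r * D \<omega> r d/lborel) = 1"
  using AE_bound AE_space
 proof eventually_elim
  case (elim \<omega>)
  have "(INT+r\<in>{s..t}. L \<omega> r d/lborel) <= (INT+r\<in>{s..t}. g r d/lborel)"
   using elim(1) by (intro nn_integral_mono_AE) (auto simp: indicator_def)
  then have "(INT+r\<in>{s..t}. L \<omega> r d/lborel) < \<infinity>" using g by (rule le_less_trans)
  from exp_neg_integral[OF L_\<omega>[OF elim(2)] this less_imp_le[OF st]]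
  have "exp_neg (INT+r\<in>{s..t}. L \<omega> r d/lborel) + (INT+r\<in>{s..t}. L \<omega> r * exp_neg (INT+\<tau>\<in>{s..r}. L \<omega> \<tau> d/lborel) d/lborel) = 1" .
  moreover have e: "(INT+\<tau>\<in>{s..r}. L \<omega> \<tau> d/lborel) = (INT+\<tau>\<in>{s..min t r}. c \<tau> (\<omega> \<tau>) d/lborel)" for r
   by (intro nn_integral_cong) (auto simp: L_def indicator_def)
  moreover have "(INT+r\<in>{s..t}. L \<omega> r * exp_neg (INT+\<tau>\<in>{s..r}. L \<omega> \<tau> d/lborel) d/lborel) = (INT+r. L \<omega> r * D \<omega> r d/lborel)"
   unfolding D_def e[symmetric] by (intro nn_integral_cong) (auto simp: L_def indicator_def)
  ultimately show ?case by (simp add: D_def)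
 qed
 have Dt_meas: "(%\<omega>. D \<omega> t) : Bm ?B"
  using measurable_compose[OF measurable_Pair1'[of t borel ?B] D_meas] by simp
 have swap: "(%p. (snd p, fst p)) : measurable (?B >< lborel) (borel >< ?B)"
  by measurable
 have LD: "(%\<omega>. INT+r. L \<omega> r * D \<omega> r d/lborel) : Bm ?B"
  using measurable_compose[OF swap L_meas] measurable_compose[OF swap D_meas]
  by (intro lborel.borel_measurable_nn_integral) (simp add: split_beta')
 have G: "killing c \<alpha> s x t x' = (INT+\<omega>. D \<omega> t d/?B)"
  by (simp add: killing_def D_def)
 have "h = h * (INT+\<omega>. D \<omega> t + (INT+r. L \<omega> r * D \<omega> r d/lborel) d/?B)"
  using AE_id B.emeasure_space_1 by (simp add: nn_integral_cong_AE[OF AE_id])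
 also have "... = h * killing c \<alpha> s x t x' + h * (INT+\<omega>. INT+r. L \<omega> r * D \<omega> r d/lborel d/?B)"
  unfolding G using Dt_meas LD by (subst nn_integral_add) (auto simp: distrib_left)
 also have "(INT+\<omega>. INT+r. L \<omega> r * D \<omega> r d/lborel d/?B) = (INT+r. INT+\<omega>. L \<omega> r * D \<omega> r d/?B d/lborel)"
 proof -
  interpret P: pair_sigma_finite lborel ?B ..
  show ?thesis by (rule P.Fubini') simp
 qed
 also have "h * ... = (INT+r. h * (INT+\<omega>. L \<omega> r * D \<omega> r d/?B) d/lborel)"
  by (subst nn_integral_cmult) auto
 also have "... = (INT+r\<in>{s..t}. (INT+z. (hk (\<alpha> * (r - s)) x z) * killing c \<alpha> s x r z *
   (c r z * (hk (\<alpha> * (t - r)) z x')) d/lborel) d/lborel)"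
 proof (rule nn_integral_cong_AE)
  have "AE r in lborel. r \<noteq> s & r \<noteq> t"
   by (intro AE_conjI AE_lborel_singleton)
  then show "AE r in lborel. h * (INT+\<omega>. L \<omega> r * D \<omega> r d/?B) = (INT+z. (hk (\<alpha> * (r - s)) x z) * killing c \<alpha> s x r z *
   (c r z * (hk (\<alpha> * (t - r)) z x')) d/lborel) * Ind {s..t} r"
  proof eventually_elim
   case (elim r)
   show ?case
   proof (cases "r : {s..t}")
    case True
    then have r: "s < r" "r < t" using elim by auto
    define F where "F \<omega> = c r (\<omega> r) * exp_neg (INT+\<tau>\<in>{s..r}. c \<tau> (\<omega> \<tau>) d/lborel)" for \<omega>
    have cr: "c r : Bm borel"
     using measurable_compose[OF measurable_Pair1'[of r borel borel] c] by simp
    have ev: "(%\<omega>. \<omega> r) : measurable (path_space s r) (borel :: 'v measure)"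
     using r by (intro measurable_path_space_eval[OF measurable_ident_sets[OF refl]]) auto
    have E_meas: "(%\<omega>. exp_neg (INT+\<tau>\<in>{s..r}. c \<tau> (\<omega> \<tau>) d/lborel)) : Bm (path_space s r)"
     using r by (intro measurable_path_integral_at[OF c]) auto
    have F_meas: "F : Bm (path_space s r)"
     unfolding F_def using measurable_compose[OF ev cr] E_meas by simp
    have "(INT+\<omega>. L \<omega> r * D \<omega> r d/?B) = (INT+\<omega>. F (restrict \<omega> {s..r}) d/?B)"
    proof (rule nn_integral_cong)
     fix \<omega> :: "real => 'v"
     have "(INT+\<tau>\<in>{s..r}. c \<tau> (restrict \<omega> {s..r} \<tau>) d/lborel) = (INT+\<tau>\<in>{s..min t r}. c \<tau> (\<omega> \<tau>) d/lborel)"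
      using r by (intro nn_integral_cong) (auto simp: indicator_def)
     then show "L \<omega> r * D \<omega> r = F (restrict \<omega> {s..r})"
      using r by (simp add: L_def D_def F_def)
    qed
    then have "h * (INT+\<omega>. L \<omega> r * D \<omega> r d/?B) = (INT+z. (hk (\<alpha> * (r - s)) x z) * (hk (\<alpha> * (t - r)) z x') *
      (INT+\<omega>. F \<omega> d/bridge_law \<alpha> s x r z) d/lborel)"
     unfolding h_def using bridge_markov[OF \<alpha> r F_meas] by simp
    also have "... = (INT+z. (hk (\<alpha> * (r - s)) x z) * killing c \<alpha> s x r z *
      (c r z * (hk (\<alpha> * (t - r)) z x')) d/lborel)"
    proof (rule nn_integral_cong)
     fix z :: 'v
     have Bz: "is_bridge_law \<alpha> s x r z (bridge_law \<alpha> s x r z)" by (rule is_bridge_law_bridge_law[OF \<alpha> r(1)])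
     have sets_Bz: "sets (bridge_law \<alpha> s x r z) = sets (path_space s r)" using Bz by (simp add: is_bridge_law_def)
     have ends: "AE \<omega> in bridge_law \<alpha> s x r z. \<omega> s = x & \<omega> r = z" using Bz by (simp add: is_bridge_law_def)
     have "(INT+\<omega>. F \<omega> d/bridge_law \<alpha> s x r z) = (INT+\<omega>. c r z * exp_neg (INT+\<tau>\<in>{s..r}. c \<tau> (\<omega> \<tau>) d/lborel) d/bridge_law \<alpha> s x r z)"
      by (rule nn_integral_cong_AE) (use ends in \<open>eventually_elim, simp add: F_def\<close>)
     also have "... = c r z * killing c \<alpha> s x r z"
      unfolding killing_def using E_meas by (intro nn_integral_cmult) (simp add: measurable_cong_sets[OF sets_Bz refl])
     finally show "(hk (\<alpha> * (r - s)) x z) * (hk (\<alpha> * (t - r)) z x') * (INT+\<omega>. F \<omega> d/bridge_law \<alpha> s x r z) =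
      (hk (\<alpha> * (r - s)) x z) * killing c \<alpha> s x r z * (c r z * (hk (\<alpha> * (t - r)) z x'))"
      by (simp add: mult_ac)
    qed
    finally show ?thesis using True by simp
   qed (simp add: L_def)
  qed
 qed
 finally show ?thesis unfolding h_def by simp
qed

section \<open>The coagulation operator\<close>

context coagulation_diffusion
begin

lemma K_sets: "y : space E ==> y' : space E ==> sets (K y y') = sets E"
 using finite_kernel_sets[OF K_kernel, of "(y, y')"] by (simp add: space_pair_measure)

lemma K_space: "y : space E ==> y' : space E ==> space (K y y') = space E"
 by (rule sets_eq_imp_space_eq) (rule K_sets)

lemma K_finite: "y : space E ==> y' : space E ==> finite_measure (K y y')"
 using finite_kernel_finite[OF K_kernel, of "(y, y')"] by (simp add: space_pair_measure)

lemma measurable_K_integral: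
 assumes "g : measurable L E" "g' : measurable L E" "(%(w, z). f w z) : Bm (L >< E)"
 shows "(%w. INT+z. f w z d/K (g w) (g' w)) : Bm L"
 using measurable_kernel_integral[OF K_kernel measurable_Pair[OF assms(1,2)] assms(3)] by simp

text \<open>The integral of \<open>f\<close> against \<open>K\<^sup>+(\<mu>)\<close>, as a function of the fibres of \<open>\<mu>\<close>.\<close>

definition gain :: "('v => 'e measure) => ('v::euclidean_space \<times> 'e => ennreal) => ennreal" where
 "gain \<k> f = (1 / 2) * (INT+x. INT+y. INT+y'. INT+z. f (x, z) d/K y y' d/\<k> x d/\<k> x d/lborel)"

lemma measurable_gain_inner:
 fixes \<k> :: "'l => 'e measure"
 assumes \<k>: "finite_kernel L E \<k>" and f: "(%p. f (fst p) (snd p)) : Bm (L >< E)"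
 shows "(%w. INT+z. f (fst (fst w)) z d/K (snd (fst w)) (snd w)) : Bm ((L >< E) >< E)"
  and "(%w. INT+y'. INT+z. f (fst w) z d/K (snd w) y' d/\<k> (fst w)) : Bm (L >< E)"
  and "(%w. INT+y. INT+y'. INT+z. f w z d/K y y' d/\<k> w d/\<k> w) : Bm L"
proof -
 have m: "(%p. (fst (fst (fst p)), snd p)) : measurable (((L >< E) >< E) >< E) (L >< E)"
  by measurable
 show 1: "(%w. INT+z. f (fst (fst w)) z d/K (snd (fst w)) (snd w)) : Bm ((L >< E) >< E)"
  using measurable_compose[OF m f] by (intro measurable_K_integral) (simp_all add: split_beta')
 show 2: "(%w. INT+y'. INT+z. f (fst w) z d/K (snd w) y' d/\<k> (fst w)) : Bm (L >< E)"
  using 1 by (intro measurable_kernel_integral[OF \<k>]) (simp_all add: split_beta')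
 show "(%w. INT+y. INT+y'. INT+z. f w z d/K y y' d/\<k> w d/\<k> w) : Bm L"
  using 2 by (intro measurable_kernel_integral[OF \<k>, where g="%w. w"]) (simp_all add: split_beta')
qed

lemma measurable_gain:
 fixes \<k> :: "'l => 'v::euclidean_space => 'e measure"
 assumes \<k>: "finite_kernel (L >< borel) E (%(l, x). \<k> l x)"
  and f: "(%p. f (fst p) (snd p)) : Bm (L >< (borel >< E))"
 shows "(%l. gain (\<k> l) (f l)) : Bm L"
proof -
 have m: "(%p. (fst (fst p), (snd (fst p), snd p))) : measurable ((L >< borel) >< E) (L >< (borel >< E))"
  by measurable
 have "(%w. INT+y. INT+y'. INT+z. f (fst w) (snd w, z) d/K y y' d/(case w of (l, x) => \<k> l x) d/(case w of (l, x) => \<k> l x)) : Bm (L >< borel)"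
  using measurable_compose[OF m f] by (intro measurable_gain_inner(3)[where f="%w z. f (fst w) (snd w, z)", OF \<k>]) simp
 then show ?thesis
  unfolding gain_def by (intro borel_measurable_times_ennreal lborel.borel_measurable_nn_integral) (simp_all add: split_beta')
qed

lemma positive_functional_gain:
 fixes \<k> :: "'v::euclidean_space => 'e measure"
 assumes \<k>: "finite_kernel borel E \<k>"
 shows "positive_functional (borel >< E) (gain \<k>)"
proof -
 have f': "(%p. f (fst p, snd p)) : Bm (borel >< E)" if "f : Bm (borel >< E)" for f :: "'v \<times> 'e => ennreal"
  using that by simp
 have meas: "(%w. INT+z. f (fst (fst w), z) d/K (snd (fst w)) (snd w)) : Bm ((borel >< E) >< E)"
  "(%w. INT+y'. INT+z. f (fst w, z) d/K (snd w) y' d/\<k> (fst w)) : Bm (borel >< E)"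
  "(%w. INT+y. INT+y'. INT+z. f (w, z) d/K y y' d/\<k> w d/\<k> w) : Bm borel"
  if "f : Bm (borel >< E)" for f :: "'v \<times> 'e => ennreal"
  using measurable_gain_inner[where f="%x z. f (x, z)", OF \<k> f'[OF that]] by simp_all
 have sp: "space (\<k> x) = space E" for x by (rule finite_kernel_space[OF \<k>]) simp
 have s: "sets (\<k> x) = sets E" for x by (rule finite_kernel_sets[OF \<k>]) simp
 have 1: "positive_functional (borel >< E) (%f. INT+z. f (x, z) d/K y y')"
  if y: "y : space E" "y' : space E" for x :: 'v and y y'
  by (rule positive_functional_compose[OF positive_functional_nn_integral[OF K_sets[OF y]], of _ "%f z. f (x, z)"])
   (auto intro!: positive_functionalI simp: space_pair_measure)
 have 2: "positive_functional (borel >< E) (%f. INT+y'. INT+z. f (x, z) d/K y y' d/\<k> x)"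
  if y: "y : space E" for x :: 'v and y
 proof (rule positive_functional_integral)
  show "positive_functional (borel >< E) (%f. INT+z. f (x, z) d/K y y')" if "y' : space (\<k> x)" for y'
   using that y by (intro 1) (simp_all add: sp)
  show "(%y'. INT+z. f (x, z) d/K y y') : Bm (\<k> x)"
   if "f : Bm (borel >< E)" for f
  proof -
   have "(%y'. ((x, y), y')) : measurable E ((borel >< E) >< E)" using y by simp
   from measurable_compose[OF this meas(1)[OF that]] show ?thesis by (simp add: measurable_cong_sets[OF s refl])
  qed
 qed
 have 3: "positive_functional (borel >< E) (%f. INT+y. INT+y'. INT+z. f (x, z) d/K y y' d/\<k> x d/\<k> x)" for x :: 'v
 proof (rule positive_functional_integral)
  show "positive_functional (borel >< E) (%f. INT+y'. INT+z. f (x, z) d/K y y' d/\<k> x)" if "y : space (\<k> x)" for y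
   using that by (intro 2) (simp add: sp)
  show "(%y. INT+y'. INT+z. f (x, z) d/K y y' d/\<k> x) : Bm (\<k> x)"
   if "f : Bm (borel >< E)" for f
   using measurable_compose[OF measurable_Pair1'[of x borel E] meas(2)[OF that]] by (simp add: measurable_cong_sets[OF s refl])
 qed
 have "positive_functional (borel >< E) (%f. INT+x. INT+y. INT+y'. INT+z. f (x, z) d/K y y' d/\<k> x d/\<k> x d/lborel)"
  by (rule positive_functional_integral[OF 3]) (use meas(3) in simp)
 then show ?thesis
  unfolding gain_def[abs_def] by (rule positive_functional_scale)
qed

text \<open>Fubini has to be applied fibre by fibre, because \<open>K\<^sup>+(\<mu>)\<close> itself need not be \<open>\<sigma>\<close>-finite.\<close>

lemma gain_nn_integral:
 fixes \<k> :: "'v::euclidean_space => 'e measure"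
 assumes \<k>: "finite_kernel borel E \<k>" and R: "sigma_finite_measure R"
  and h: "(%p. h (fst p) (snd p)) : Bm (R >< (borel >< E))"
 shows "gain \<k> (%p. INT+r. h r p d/R) = (INT+r. gain \<k> (h r) d/R)"
proof -
 interpret R: sigma_finite_measure R by fact
 have \<k>R: "finite_kernel (R >< borel) E (%(r, x). \<k> x)"
  using finite_kernel_compose[OF \<k>, of snd "R >< borel"] by (simp add: split_beta')
 have swap: "(INT+y. INT+r. F r y d/R d/N) = (INT+r. INT+y. F r y d/N d/R)"
  if "sigma_finite_measure N" "sets N = sets N'" "(%p. F (fst p) (snd p)) : Bm (R >< N')" for N N' :: "'z measure" and F
 proof -
  interpret P: pair_sigma_finite R N by (intro pair_sigma_finite.intro R that)
  note [measurable_cong] = that(2)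
  show ?thesis
   using that(3) by (intro P.Fubini') (simp add: split_beta' cong: measurable_cong_sets)
 qed
 have m: "(%p. (fst (fst p), (snd (fst p), snd p))) : measurable ((R >< borel) >< E) (R >< ((borel :: 'v measure) >< E))"
  by measurable
 have h': "(%p. h (fst (fst p)) (snd (fst p), snd p)) : Bm ((R >< borel) >< E)"
  using measurable_compose[OF m h] by simp
 note meas = measurable_gain_inner[where f="%w z. h (fst w) (snd w, z)", OF \<k>R h', simplified split_beta' snd_conv fst_conv]
 have "(INT+x. INT+y. INT+y'. INT+z. INT+r. h r (x, z) d/R d/K y y' d/\<k> x d/\<k> x d/lborel)
   = (INT+x. INT+r. INT+y. INT+y'. INT+z. h r (x, z) d/K y y' d/\<k> x d/\<k> x d/R d/lborel)"
 proof (rule nn_integral_cong)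
  fix x :: 'v
  have sp: "space (\<k> x) = space E" by (rule finite_kernel_space[OF \<k>]) simp
  have s: "sets (\<k> x) = sets E" by (rule finite_kernel_sets[OF \<k>]) simp
  have sf: "sigma_finite_measure (\<k> x)"
   using finite_kernel_finite[OF \<k>, of x] by (simp add: finite_measure.axioms)
  have "(INT+y. INT+y'. INT+z. INT+r. h r (x, z) d/R d/K y y' d/\<k> x d/\<k> x) = (INT+y. INT+r. INT+y'. INT+z. h r (x, z) d/K y y' d/\<k> x d/R d/\<k> x)"
  proof (rule nn_integral_cong)
   fix y assume "y : space (\<k> x)"
   then have y: "y : space E" by (simp add: sp)
   have "(INT+y'. INT+z. INT+r. h r (x, z) d/R d/K y y' d/\<k> x) = (INT+y'. INT+r. INT+z. h r (x, z) d/K y y' d/R d/\<k> x)"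
   proof (rule nn_integral_cong)
    fix y' assume "y' : space (\<k> x)"
    then have y': "y' : space E" by (simp add: sp)
    have "(%p. (fst p, (x, snd p))) : measurable (R >< E) (R >< ((borel :: 'v measure) >< E))"
     by measurable
    from measurable_compose[OF this h]
    show "(INT+z. INT+r. h r (x, z) d/R d/K y y') = (INT+r. INT+z. h r (x, z) d/K y y' d/R)"
     using K_finite[OF y y'] by (intro swap[OF _ K_sets[OF y y']]) (simp_all add: finite_measure.axioms)
   qed
   also have "... = (INT+r. INT+y'. INT+z. h r (x, z) d/K y y' d/\<k> x d/R)"
   proof (rule swap[OF sf s])
    have "(%p. (((fst p, x), y), snd p)) : measurable (R >< E) (((R >< (borel :: 'v measure)) >< E) >< E)"
     using y by measurable
    from measurable_compose[OF this meas(1)]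
    show "(%p. INT+z. h (fst p) (x, z) d/K y (snd p)) : Bm (R >< E)" by simp
   qed
   finally show "(INT+y'. INT+z. INT+r. h r (x, z) d/R d/K y y' d/\<k> x) = (INT+r. INT+y'. INT+z. h r (x, z) d/K y y' d/\<k> x d/R)" .
  qed
  also have "... = (INT+r. INT+y. INT+y'. INT+z. h r (x, z) d/K y y' d/\<k> x d/\<k> x d/R)"
  proof (rule swap[OF sf s])
   have "(%p. ((fst p, x), snd p)) : measurable (R >< E) ((R >< (borel :: 'v measure)) >< E)"
    by measurable
   from measurable_compose[OF this meas(2)]
   show "(%p. INT+y'. INT+z. h (fst p) (x, z) d/K (snd p) y' d/\<k> x) : Bm (R >< E)" by simp
  qed
  finally show "(INT+y. INT+y'. INT+z. INT+r. h r (x, z) d/R d/K y y' d/\<k> x d/\<k> x) = (INT+r. INT+y. INT+y'. INT+z. h r (x, z) d/K y y' d/\<k> x d/\<k> x d/R)" .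
 qed
 also have "... = (INT+r. INT+x. INT+y. INT+y'. INT+z. h r (x, z) d/K y y' d/\<k> x d/\<k> x d/lborel d/R)"
  using meas(3) by (intro swap[OF sigma_finite_lborel sets_lborel]) simp
 finally have eq: "(INT+x. INT+y. INT+y'. INT+z. INT+r. h r (x, z) d/R d/K y y' d/\<k> x d/\<k> x d/lborel)
   = (INT+r. INT+x. INT+y. INT+y'. INT+z. h r (x, z) d/K y y' d/\<k> x d/\<k> x d/lborel d/R)" .
 have "(%r. INT+x. INT+y. INT+y'. INT+z. h r (x, z) d/K y y' d/\<k> x d/\<k> x d/lborel) : Bm R"
  using meas(3) by (intro lborel.borel_measurable_nn_integral) (simp add: split_beta')
 then show ?thesis
  unfolding gain_def eq by (rule nn_integral_cmult[symmetric])
qed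

lemma gain_cong_AE:
 fixes \<k> \<k>' :: "'v::euclidean_space => 'e measure"
 assumes k: "finite_kernel borel E \<k>" "finite_kernel borel E \<k>'"
  and AE: "AE x in lborel. \<forall>g\<in>Bm E. (INT+y. g y d/\<k> x) = (INT+y. g y d/\<k>' x)"
  and f: "f : Bm (borel >< E)"
 shows "gain \<k> f = gain \<k>' f"
proof -
 have f': "(%p. f (fst p, snd p)) : Bm (borel >< E)" using f by simp
 have "AE x in lborel. (INT+y. INT+y'. INT+z. f (x, z) d/K y y' d/\<k> x d/\<k> x) = (INT+y. INT+y'. INT+z. f (x, z) d/K y y' d/\<k>' x d/\<k>' x)"
  using AE
 proof eventually_elim
  case (elim x)
  have "(INT+y'. INT+z. f (x, z) d/K y y' d/\<k> x) = (INT+y'. INT+z. f (x, z) d/K y y' d/\<k>' x)" if y: "y : space E" for y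
  proof -
   have "(%y'. ((x, y), y')) : measurable E ((borel >< E) >< E)" using y by simp
   from measurable_compose[OF this measurable_gain_inner(1)[where f="%x z. f (x, z)", OF k(1) f']] show ?thesis using elim by simp
  qed
  then have "(INT+y. INT+y'. INT+z. f (x, z) d/K y y' d/\<k> x d/\<k> x) = (INT+y. INT+y'. INT+z. f (x, z) d/K y y' d/\<k>' x d/\<k> x)"
   by (intro nn_integral_cong) (simp add: finite_kernel_space[OF k(1)])
  also have "... = (INT+y. INT+y'. INT+z. f (x, z) d/K y y' d/\<k>' x d/\<k>' x)"
   using elim measurable_compose[OF measurable_Pair1'[of x borel E] measurable_gain_inner(2)[where f="%x z. f (x, z)", OF k(2) f']] by simp
  finally show ?case .
 qed
 then show ?thesis unfolding gain_def by (auto intro!: arg_cong2[where f="(*)"] nn_integral_cong_AE)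
qed

lemma AE_fibre_unique:
 fixes \<mu> :: "('v::euclidean_space \<times> 'e) measure"
 assumes "disintegrates E \<mu> \<k>" "disintegrates E \<mu> \<k>'" "finite_measure \<mu>"
 shows "AE x in lborel. \<forall>g\<in>Bm E. (INT+y. g y d/\<k> x) = (INT+y. g y d/\<k>' x)"
proof -
 have "disintegrates E (null_measure (borel >< E)) (%_ :: 'v. null_measure E)"
  by (auto simp: disintegrates_def finite_kernel_def kernel_def intro!: finite_measureI)
 from AE_fibre_add[OF standard assms(2) this assms(1,3)] show ?thesis
  by simp
qed

lemma K_plus_functional:
 fixes \<nu> :: "('v::euclidean_space \<times> 'e) measure"
 assumes \<nu>: "\<nu> : states E" and \<k>: "disintegrates E \<nu> \<k>"
 shows "sets (K_plus E K \<nu>) = sets (borel >< E)"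
  and "f : Bm (borel >< E) ==> (INT+p. f p d/K_plus E K \<nu>) = gain \<k> f"
proof -
 show "sets (K_plus E K \<nu>) = sets (borel >< E)" by (simp add: K_plus_def)
 have F: "disintegrates E \<nu> (fibre E \<nu>)" by (rule disintegrates_fibre[OF standard \<nu>])
 have k: "finite_kernel borel E (fibre E \<nu>)" "finite_kernel borel E \<k>" using F \<k> by (simp_all add: disintegrates_def)
 have AE: "AE x in lborel. \<forall>g\<in>Bm E. (INT+y. g y d/fibre E \<nu> x) = (INT+y. g y d/\<k> x)"
  by (rule AE_fibre_unique[OF F \<k> states_finite[OF \<nu>]])
 have "K_plus E K \<nu> = measure_by (borel >< E) (%S. gain (fibre E \<nu>) (Ind S))"
  unfolding K_plus_def gain_def
 proof (intro measure_by_cong arg_cong2[where f="(*)"] refl nn_integral_cong)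
  fix S :: "('v \<times> 'e) set" and x y y' assume S: "S : sets (borel >< E)" and "y : space (fibre E \<nu> x)" "y' : space (fibre E \<nu> x)"
  then have y: "y : space E" "y' : space E" by (simp_all add: finite_kernel_space[OF k(1)])
  have "(INT+z. Ind S (x, z) d/K y y') = (INT+z. Ind (Pair x -` S) z d/K y y')"
   by (simp add: indicator_def)
  also have "... = Em (K y y') (Pair x -` S)"
   using S by (intro nn_integral_indicator) (auto simp: K_sets[OF y] intro: sets_Pair1)
  finally show "Em (K y y') (Pair x -` S) = (INT+z. Ind S (x, z) d/K y y')" ..
 qed
 then show "(INT+p. f p d/K_plus E K \<nu>) = gain \<k> f" if "f : Bm (borel >< E)"
  using nn_integral_measure_by_functional[OF positive_functional_gain[OF k(1)] that] gain_cong_AE[OF k AE that] by simp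
qed

end

section \<open>Killed heat kernels along a strong solution\<close>

locale strong_coagulation = coagulation_diffusion "DIM('v::euclidean_space)" E m a K \<phi>
 for E :: "'e measure" and m a K \<phi> +
 fixes T :: ennreal and \<mu> :: "real => ('v::euclidean_space \<times> 'e) measure"
 assumes strong: "strong_solution E m a K \<phi> T \<mu>"
begin

abbreviation X :: "('v \<times> 'e) measure" where "X \<equiv> borel >< E"
abbreviation "fibs \<equiv> process_fibre E T"
abbreviation "rhs \<equiv> propagator_rhs E a K T \<mu> (\<mu> 0)"

definition W :: "'e => ennreal" where "W y = ennreal (weight DIM('v) m a \<phi> y)"
definition fib :: "real => 'v => 'e measure" where "fib = process_fibre E T \<mu>"
definition rate :: "real => 'v => 'e => ennreal" where "rate = coag_rate E K T \<mu>"
definition envelope :: "real => ennreal" where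
 "envelope \<tau> = esssup lborel (%x. INT+y. W y * W y d/fib \<tau> x)"

lemma process_\<mu>: "process E T \<mu>"
 using strong by (simp add: strong_solution_def)

lemma \<mu>_states: "t : lifetime T ==> \<mu> t : states E"
 using process_\<mu> by (simp add: process_def)

lemma zero_lifetime: "0 : lifetime T"
 using strong by (simp add: strong_solution_def lifetime_def)

lemma lifetime_le: "t : lifetime T ==> 0 <= s ==> s <= t ==> s : lifetime T"
 using le_less_trans[of "ennreal s" "ennreal t" T] by (auto simp: lifetime_def ennreal_leI)

lemma fib_kernel: "finite_kernel (borel >< borel) E (%(t, x). fib t x)"
 unfolding fib_def by (rule process_fibre(1)[OF standard process_\<mu>])

lemma fib_disintegrates: "t : lifetime T ==> disintegrates E (\<mu> t) (fib t)"
 unfolding fib_def by (rule process_fibre(2)[OF standard process_\<mu>])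

lemma fib_at: "finite_kernel borel E (fib t)"
 using finite_kernel_compose[OF fib_kernel, of "%x. (t, x)" borel] by simp

lemma fib_space: "space (fib t x) = space E" and fib_sets: "sets (fib t x) = sets E"
 using finite_kernel_space[OF fib_at] finite_kernel_sets[OF fib_at] by auto

declare a_measurable[measurable] m_measurable[measurable]

lemma W_measurable[measurable]: "W : Bm E"
proof -
 have "\<phi> : Bm (restrict_space borel {0<..})"
  using \<phi>_continuous by (intro borel_measurable_continuous_on_restrict)
 moreover have "m : measurable E (restrict_space borel {0<..})"
  using m_pos by (intro measurable_restrict_space2) auto
 ultimately have [measurable]: "(%y. \<phi> (m y)) : Bm E"
  by (rule measurable_compose[rotated])
 show ?thesis unfolding W_def[abs_def] weight_def by measurable
qed

lemma W_ge: "\<exists>c>0. \<forall>y\<in>space E. ennreal c <= W y"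
 using weight_uniformly_positive by (auto simp: W_def intro!: ennreal_leI)

lemma weight_pos: "y : space E ==> 0 < weight DIM('v) m a \<phi> y"
 using a_pos[of y] \<phi>_pos[OF m_pos, of y] by (simp add: weight_def)

lemma W_sq: "ennreal ((weight DIM('v) m a \<phi> y)\<^sup>2) = W y * W y" if "y : space E"
 using weight_pos[OF that] by (simp add: W_def power2_eq_square ennreal_mult')

lemma measurable_rate[measurable (raw)]:
 assumes [measurable]: "f1 : Bm M" "f2 : measurable M borel" "f3 : measurable M E"
 shows "(%w. rate (f1 w) (f2 w) (f3 w)) : Bm M"
proof -
 have K': "(%p. Em (K (fst p) (snd p)) (space E)) : Bm (E >< E)"
  using finite_kernel_emeasure[OF K_kernel sets.top] by (simp add: split_beta')
 have m: "(%p. (f3 (fst p), snd p)) : measurable (M >< E) (E >< E)" by measurable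
 have "(%w. INT+y'. Em (K (f3 w) y') (space E) d/(case (f1 w, f2 w) of (t, x) => fib t x)) : Bm M"
 proof (rule measurable_kernel_integral[OF fib_kernel])
  show "(%(w, y'). Em (K (f3 w) y') (space E)) : Bm (M >< E)"
   using measurable_compose[OF m K'] by (simp add: split_beta')
 qed measurable
 then show ?thesis by (simp add: rate_def coag_rate_def fib_def)
qed

lemma measurable_envelope[measurable]: "envelope : Bm borel"
proof (rule borel_measurableI_greater)
 fix z :: ennreal
 let ?f = "%\<tau> x. INT+y. W y * W y d/fib \<tau> x"
 have f2[measurable]: "(%w. ?f (fst w) (snd w)) : Bm (borel >< borel)"
  using measurable_kernel_integral[OF fib_kernel measurable_ident_sets[OF refl], of "%w y. W y * W y"]
  by (simp add: split_beta')
 have f: "?f \<tau> : Bm lborel" for \<tau>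
  using measurable_compose[OF measurable_Pair1'[of \<tau> borel borel] f2] by simp
 have "(z < envelope \<tau>) = (0 < Em lborel {x : space lborel. z < ?f \<tau> x})" for \<tau>
 proof
  assume "z < envelope \<tau>"
  then show "0 < Em lborel {x : space lborel. z < ?f \<tau> x}"
   unfolding envelope_def by (rule esssup_pos_measure[OF f])
 next
  assume pos: "0 < Em lborel {x : space lborel. z < ?f \<tau> x}"
  show "z < envelope \<tau>"
  proof (rule ccontr)
   assume "\<not> z < envelope \<tau>"
   then have "AE x in lborel. \<not> z < ?f \<tau> x"
    using esssup_AE[where M=lborel and f="?f \<tau>"] unfolding envelope_def by (auto elim!: eventually_mono)
   then have "Em lborel {x : space lborel. z < ?f \<tau> x} = 0"
    using f by (subst (asm) AE_iff_measurable[OF _ refl]) auto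
   with pos show False by simp
  qed
 qed
 moreover have "Em lborel {x : space lborel. z < ?f \<tau> x} = (INT+x. (if z < ?f \<tau> x then 1 else 0) d/lborel)" for \<tau>
 proof -
  have "(INT+x. (if z < ?f \<tau> x then 1 else 0) d/lborel) = (INT+x. Ind {x : space lborel. z < ?f \<tau> x} x d/lborel)"
   by (intro nn_integral_cong) (auto simp: indicator_def)
  also have "... = Em lborel {x : space lborel. z < ?f \<tau> x}"
   using measurable_sets[OF f, of "{z<..}" \<tau>] by (intro nn_integral_indicator) (simp add: vimage_def)
  finally show ?thesis ..
 qed
 ultimately have "{\<tau> : space borel. z < envelope \<tau>} = {\<tau> : space borel. 0 < (INT+x. (if z < ?f \<tau> x then 1 else 0 :: ennreal) d/lborel)}"
  by auto
 also have "... : sets borel" by measurable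
 finally show "{\<tau> : space borel. z < envelope \<tau>} : sets borel" .
qed

lemma bracket_eq:
 assumes t: "t : lifetime T" and f: "f : Bm E"
 shows "AE x in lborel. bracket E f (\<mu> t) x = (INT+y. f y d/fib t x)"
 using AE_fibre_unique[OF disintegrates_fibre[OF standard \<mu>_states[OF t]] fib_disintegrates[OF t] states_finite[OF \<mu>_states[OF t]]]
 by eventually_elim (use f in \<open>simp add: bracket_def\<close>)

lemma measurable_fib_integral:
 assumes "f : Bm E"
 shows "(%x. INT+y. f y d/fib t x) : Bm borel"
 using measurable_kernel_integral[OF fib_at measurable_ident_sets[OF refl], of "%w y. f y"] assms by simp

lemma measurable_bracket:
 assumes t: "t : lifetime T" and f: "f : Bm E"
 shows "bracket E f (\<mu> t) : Bm lborel"
proof -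
 have "finite_kernel borel E (fibre E (\<mu> t))"
  using disintegrates_fibre[OF standard \<mu>_states[OF t]] by (simp add: disintegrates_def)
 from measurable_kernel_integral[OF this measurable_ident_sets[OF refl], of "%w y. f y"] f
 show ?thesis by (simp add: bracket_def[abs_def])
qed

lemma envelope_eq:
 assumes t: "t : lifetime T"
 shows "envelope t = esssup lborel (bracket E (%y. ennreal ((weight DIM('v) m a \<phi> y)\<^sup>2)) (\<mu> t))"
proof -
 have eq: "(INT+y. ennreal ((weight DIM('v) m a \<phi> y)\<^sup>2) d/N) = (INT+y. W y * W y d/N)" if "space N = space E" for N :: "'e measure"
  using that by (intro nn_integral_cong) (simp add: W_sq)
 have sp: "space (fibre E (\<mu> t) x) = space E" for x
  using disintegrates_fibre[OF standard \<mu>_states[OF t]] by (intro finite_kernel_space[of borel E]) (auto simp: disintegrates_def)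
 have WW: "(%y. W y * W y) : Bm E" by measurable
 have "bracket E (%y. ennreal ((weight DIM('v) m a \<phi> y)\<^sup>2)) (\<mu> t) = bracket E (%y. W y * W y) (\<mu> t)"
  unfolding bracket_def[abs_def] by (intro ext eq sp)
 then show ?thesis
  unfolding envelope_def using bracket_eq[OF t WW] measurable_fib_integral[OF WW, of t] measurable_bracket[OF t WW]
  by (auto intro!: esssup_AE_cong[symmetric] elim!: eventually_mono)
qed

lemma envelope_integral:
 assumes t: "t : lifetime T"
 shows "(INT+s\<in>{0..t}. envelope s d/lborel) < \<infinity>"
proof -
 have "(INT+s\<in>{0..t}. envelope s d/lborel) =
  (INT+s\<in>{0..t}. esssup lborel (bracket E (%y. ennreal ((weight DIM('v) m a \<phi> y)\<^sup>2)) (\<mu> s)) d/lborel)"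
  by (intro nn_integral_cong) (auto simp: indicator_def intro!: envelope_eq lifetime_le[OF t])
 also have "... < \<infinity>" using strong t by (simp add: strong_solution_def)
 finally show ?thesis .
qed

lemma envelope_AE: "AE x in lborel. (INT+y. W y * W y d/fib t x) <= envelope t"
 unfolding envelope_def by (rule esssup_AE)

lemma total_weight:
 assumes t: "t : lifetime T"
 shows "(INT+p. W (snd p) d/\<mu> t) = (INT+x. INT+y. W y d/fib t x d/lborel)"
 by (subst disintegrates_nn_integral[OF fib_disintegrates[OF t] states_sets[OF \<mu>_states[OF t]] states_finite[OF \<mu>_states[OF t]]]) auto

lemma total_weight_bounded:
 assumes t: "t : lifetime T"
 shows "\<exists>M<\<infinity>. \<forall>s\<in>{0..t}. (INT+x. INT+y. W y d/fib s x d/lborel) <= M"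
proof (intro exI conjI ballI)
 let ?M = "SUP s\<in>{0..t}. INT+x. bracket E (%y. ennreal (weight DIM('v) m a \<phi> y)) (\<mu> s) x d/lborel"
 show "?M < \<infinity>" using strong t by (simp add: strong_solution_def)
 fix s assume s: "s : {0..t}"
 have "(INT+x. INT+y. W y d/fib s x d/lborel) = (INT+x. bracket E W (\<mu> s) x d/lborel)"
  using bracket_eq[OF lifetime_le[OF t] W_measurable, of s] s by (intro nn_integral_cong_AE) auto
 also have "... <= ?M" using s by (auto simp: W_def[abs_def] intro!: SUP_upper2[of s])
 finally show "(INT+x. INT+y. W y d/fib s x d/lborel) <= ?M" .
qed

text \<open>As \<open>w\<close> is bounded below, \<open>w\<close> is at most a multiple of \<open>w\<^sup>2\<close>.\<close>

lemma weight_bracket_bound: "\<exists>C<\<infinity>. \<forall>t. AE x in lborel. (INT+y. W y d/fib t x) <= C * envelope t"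
proof -
 obtain c where c: "0 < c" "!!y. y : space E ==> ennreal c <= W y" using W_ge by auto
 show ?thesis
 proof (intro exI conjI allI)
  show "ennreal (1 / c) < \<infinity>" by simp
  fix t
  show "AE x in lborel. (INT+y. W y d/fib t x) <= ennreal (1 / c) * envelope t"
   using envelope_AE[of t]
  proof eventually_elim
   case (elim x)
   have [measurable_cong]: "sets (fib t x) = sets E" by (rule fib_sets)
   have "(INT+y. W y d/fib t x) <= (INT+y. ennreal (1 / c) * (W y * W y) d/fib t x)"
   proof (rule nn_integral_mono)
    fix y assume "y : space (fib t x)"
    then have y: "ennreal c <= W y" by (simp add: c fib_space)
    have "W y = (ennreal (1 / c) * ennreal c) * W y" using c(1) by (simp add: ennreal_mult'[symmetric])
    also have "... <= (ennreal (1 / c) * W y) * W y" by (intro mult_right_mono mult_left_mono y) auto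
    finally show "W y <= ennreal (1 / c) * (W y * W y)" by (simp add: mult.assoc)
   qed
   also have "... = ennreal (1 / c) * (INT+y. W y * W y d/fib t x)"
    by (rule nn_integral_cmult) measurable
   also have "... <= ennreal (1 / c) * envelope t" using elim by (intro mult_left_mono) auto
   finally show ?case .
  qed
 qed
qed

lemma K_total_le: "y : space E ==> y' : space E ==> Em (K y y') (space E) <= W y * W y'"
 using K_bound[of y y'] weight_pos[of y] by (simp add: W_def ennreal_mult')

lemma rate_le: "y : space E ==> rate t x y <= W y * (INT+y'. W y' d/fib t x)"
proof -
 assume y: "y : space E"
 have [measurable_cong]: "sets (fib t x) = sets E" by (rule fib_sets)
 have "rate t x y = (INT+y'. Em (K y y') (space E) d/fib t x)" by (simp add: rate_def coag_rate_def fib_def)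
 also have "... <= (INT+y'. W y * W y' d/fib t x)"
  using y by (intro nn_integral_mono K_total_le) (auto simp: fib_space)
 also have "... = W y * (INT+y'. W y' d/fib t x)" by (rule nn_integral_cmult) measurable
 finally show ?thesis .
qed

definition rate_bound :: ennreal where
 "rate_bound = (SOME C. C < \<infinity> & (\<forall>t. AE x in lborel. (INT+y. W y d/fib t x) <= C * envelope t))"

lemma rate_bound: "rate_bound < \<infinity>" "AE x in lborel. (INT+y. W y d/fib t x) <= rate_bound * envelope t"
 using someI_ex[OF weight_bracket_bound] by (auto simp: rate_bound_def)

lemma rate_AE: "AE x in lborel. \<forall>y\<in>space E. rate t x y <= W y * (rate_bound * envelope t)"
 using rate_bound(2)[of t]
 by eventually_elim (auto intro!: order_trans[OF rate_le] mult_left_mono)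

definition heat_density :: "real => 'v => real => 'v => 'e => ennreal" where
 "heat_density s x t x' y = (if s < t then (hk (a y * (t - s)) x x') else 0)"

definition killed_density :: "real => 'v => real => 'v => 'e => ennreal" where
 "killed_density s x t x' y = (if s < t then (hk (a y * (t - s)) x x') *
  killing (%\<tau> z. rate \<tau> z y) (a y) s x t x' else 0)"

lemma measurable_heat_density[measurable (raw)]:
 assumes [measurable]: "f1 : Bm M" "f2 : measurable M borel" "f3 : Bm M" "f4 : measurable M borel" "f5 : measurable M E"
 shows "(%w. heat_density (f1 w) (f2 w) (f3 w) (f4 w) (f5 w)) : Bm M"
 unfolding heat_density_def by measurable

text \<open>The killing factor is written as an integral over the Gaussian noise, which carries no dependence on
the end points; the bridge laws themselves are only defined by a description.\<close>

lemma measurable_killed_density[measurable (raw)]: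
 assumes [measurable]: "f1 : Bm M" "f2 : measurable M borel" "f3 : Bm M" "f4 : measurable M borel" "f5 : measurable M E"
 shows "(%w. killed_density (f1 w) (f2 w) (f3 w) (f4 w) (f5 w)) : Bm M"
proof -
 let ?Q = "gaussian_tree :: (bool list => 'v) measure"
 interpret Q: prob_space ?Q by (rule prob_space_gaussian_tree)
 have eq: "killed_density s x t x' y = (if s < t then (hk (a y * (t - s)) x x') *
  (INT+\<xi>. exp_neg (INT+\<tau>. rate \<tau> (bridge_path (a y) s x t x' \<xi> \<tau>) y * (if s <= \<tau> & \<tau> <= t then 1 else 0) d/lborel) d/?Q) else 0)"
  if y: "y : space E" for s x t x' y
 proof (cases "s < t")
  case True
  have c: "(%w. rate (fst w) (snd w) y) : Bm (borel >< borel)"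
   using y by measurable
  have "killing (%\<tau> z. rate \<tau> z y) (a y) s x t x' =
   (INT+\<xi>. exp_neg (INT+\<tau>\<in>{s..t}. rate \<tau> (restrict (bridge_path (a y) s x t x' \<xi>) {s..t} \<tau>) y d/lborel) d/?Q)"
   unfolding killing_def using True a_pos[OF y] measurable_path_integral_at[OF c, of s t t]
   by (intro nn_integral_bridge_law) auto
  also have "... = (INT+\<xi>. exp_neg (INT+\<tau>. rate \<tau> (bridge_path (a y) s x t x' \<xi> \<tau>) y * (if s <= \<tau> & \<tau> <= t then 1 else 0) d/lborel) d/?Q)"
   by (intro nn_integral_cong arg_cong[where f=exp_neg]) (auto simp: indicator_def)
  finally show ?thesis using True by (simp add: killed_density_def)
 qed (simp add: killed_density_def)
 have "(%w. if f1 w < f3 w then (hk (a (f5 w) * (f3 w - f1 w)) (f2 w) (f4 w)) *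
  (INT+\<xi>. exp_neg (INT+\<tau>. rate \<tau> (bridge_path (a (f5 w)) (f1 w) (f2 w) (f3 w) (f4 w) \<xi> \<tau>) (f5 w) * (if f1 w <= \<tau> & \<tau> <= f3 w then 1 else 0) d/lborel) d/?Q) else 0)
  : Bm M"
  by measurable
 then show ?thesis
  by (rule measurable_cong[THEN iffD2, rotated]) (rule eq, rule measurable_space[OF assms(5)])
qed

definition heat_op :: "real => real => ('v \<times> 'e => ennreal) => 'v \<times> 'e => ennreal" where
 "heat_op t s f p = (INT+x'. heat_density s (fst p) t x' (snd p) * f (x', snd p) d/lborel)"

definition killed_op :: "real => real => ('v \<times> 'e => ennreal) => 'v \<times> 'e => ennreal" where
 "killed_op t s f p = (INT+x'. killed_density s (fst p) t x' (snd p) * f (x', snd p) d/lborel)"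

lemma measurable_ops[measurable (raw)]:
 assumes [measurable]: "t : Bm M" "s : Bm M" "p : measurable M X"
  and f: "(%z. f (fst z) (snd z)) : Bm (M >< X)"
 shows "(%w. killed_op (t w) (s w) (f w) (p w)) : Bm M"
  and "(%w. heat_op (t w) (s w) (f w) (p w)) : Bm M"
proof -
 have "(%z. (fst z, (snd z, snd (p (fst z))))) : measurable (M >< lborel) (M >< X)"
  by measurable
 from measurable_compose[OF this f]
 have [measurable]: "(%z. f (fst z) (snd z, snd (p (fst z)))) : Bm (M >< lborel)" by simp
 show "(%w. killed_op (t w) (s w) (f w) (p w)) : Bm M"
  unfolding killed_op_def by measurable
 show "(%w. heat_op (t w) (s w) (f w) (p w)) : Bm M"
  unfolding heat_op_def by measurable
qed

lemma killed_density_le: "y : space E ==> killed_density s x t x' y <= heat_density s x t x' y"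
proof -
 assume y: "y : space E"
 have "killing (%\<tau> z. rate \<tau> z y) (a y) s x t x' <= 1" if "s < t"
 proof -
  interpret prob_space "bridge_law (a y) s x t x'" by (rule prob_space_bridge_law[OF a_pos[OF y] that])
  have "killing (%\<tau> z. rate \<tau> z y) (a y) s x t x' <= (INT+\<omega>. 1 d/bridge_law (a y) s x t x')"
   unfolding killing_def by (intro nn_integral_mono exp_neg_le_1)
  also have "... = 1" using emeasure_space_1 by simp
  finally show ?thesis .
 qed
 then show ?thesis
  using mult_left_mono[of _ 1] by (fastforce simp: killed_density_def heat_density_def)
qed

lemma heat_density_integral: "y : space E ==> s < t ==> (INT+x'. heat_density s x t x' y d/lborel) = 1"
 using a_pos by (simp add: heat_density_def nn_integral_heat_kernel)

lemma heat_op_snd: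
 assumes "snd p : space E" "s < t"
 shows "heat_op t s (%p. f (snd p)) p = f (snd p)"
 using assms by (simp add: heat_op_def nn_integral_multc heat_density_integral)

text \<open>The Feynman-Kac identity applies because the rate at a fixed type \<open>y\<close> is bounded, for almost all
positions, by a function of time that is integrable.\<close>

lemma killed_density_duhamel:
 assumes s: "0 <= s" "s < t" and t: "t : lifetime T" and y: "y : space E"
 shows "killed_density s x t x' y +
  (INT+r\<in>{s..t}. (INT+z. killed_density s x r z y * (rate r z y * heat_density r z t x' y) d/lborel) d/lborel) =
  heat_density s x t x' y"
proof -
 let ?c = "%\<tau> z. rate \<tau> z y"
 have c: "(%w. ?c (fst w) (snd w)) : Bm (borel >< borel)" using y by measurable
 have "(INT+\<tau>\<in>{s..t}. W y * (rate_bound * envelope \<tau>) d/lborel) <= (INT+\<tau>. (W y * rate_bound) * (envelope \<tau> * Ind {0..t} \<tau>) d/lborel)"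
  using s by (intro nn_integral_mono) (auto simp: indicator_def mult_ac)
 also have "... = (W y * rate_bound) * (INT+\<tau>\<in>{0..t}. envelope \<tau> d/lborel)"
  using measurable_envelope by (intro nn_integral_cmult borel_measurable_times_ennreal) auto
 also have "... < \<infinity>"
  using envelope_integral[OF t] rate_bound(1) by (simp add: W_def ennreal_mult_less_top)
 finally have g: "(INT+\<tau>\<in>{s..t}. W y * (rate_bound * envelope \<tau>) d/lborel) < \<infinity>" .
 have "AE \<tau> in lborel. \<tau> : {s..t} \<longrightarrow> (AE z in lborel. ?c \<tau> z <= W y * (rate_bound * envelope \<tau>))"
 proof (rule AE_I2, rule impI)
  fix \<tau> show "AE z in lborel. ?c \<tau> z <= W y * (rate_bound * envelope \<tau>)"
   using rate_AE[of \<tau>] by eventually_elim (use y in auto)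
 qed
 moreover have "(%\<tau>. W y * (rate_bound * envelope \<tau>)) : Bm borel" by measurable
 ultimately have "(hk (a y * (t - s)) x x') * killing ?c (a y) s x t x' +
  (INT+r\<in>{s..t}. (INT+z. (hk (a y * (r - s)) x z) * killing ?c (a y) s x r z *
   (?c r z * (hk (a y * (t - r)) z x')) d/lborel) d/lborel) = (hk (a y * (t - s)) x x')"
  by (intro feynman_kac[OF a_pos[OF y] s(2) c g])
 then
 have "killed_density s x t x' y + (INT+r\<in>{s..t}. (INT+z. (hk (a y * (r - s)) x z) * killing ?c (a y) s x r z *
   (?c r z * (hk (a y * (t - r)) z x')) d/lborel) d/lborel) = heat_density s x t x' y"
  using s by (simp add: killed_density_def heat_density_def)
 moreover have "(INT+r\<in>{s..t}. (INT+z. (hk (a y * (r - s)) x z) * killing ?c (a y) s x r z *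
   (?c r z * (hk (a y * (t - r)) z x')) d/lborel) d/lborel) =
  (INT+r\<in>{s..t}. (INT+z. killed_density s x r z y * (rate r z y * heat_density r z t x' y) d/lborel) d/lborel)"
 proof (rule nn_integral_cong_AE)
  have "AE r in lborel. r \<noteq> s & r \<noteq> t" by (intro AE_conjI AE_lborel_singleton)
  then show "AE r in lborel. (INT+z. (hk (a y * (r - s)) x z) * killing ?c (a y) s x r z *
   (?c r z * (hk (a y * (t - r)) z x')) d/lborel) * Ind {s..t} r =
   (INT+z. killed_density s x r z y * (rate r z y * heat_density r z t x' y) d/lborel) * Ind {s..t} r"
   by eventually_elim (auto simp: killed_density_def heat_density_def indicator_def)
 qed
 ultimately show ?thesis by simp
qed

lemma killed_op_duhamel:
 assumes s: "0 <= s" "s < t" and t: "t : lifetime T" and p: "p : space X"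
  and f[measurable]: "f : Bm X"
 shows "killed_op t s f p + (INT+r\<in>{s..t}. killed_op r s (%p. rate r (fst p) (snd p) * heat_op t r f p) p d/lborel) = heat_op t s f p"
proof -
 obtain x y where xy: "p = (x, y)" by (cases p)
 have y[measurable]: "y : space E" using p by (simp add: xy space_pair_measure)
 let ?D = "%r x' z. killed_density s x r z y * (rate r z y * heat_density r z t x' y)"
 have "heat_op t s f p = (INT+x'. (killed_density s x t x' y + (INT+r\<in>{s..t}. (INT+z. ?D r x' z d/lborel) d/lborel)) * f (x', y) d/lborel)"
  unfolding heat_op_def xy by (simp add: killed_density_duhamel[OF s t y])
 also have "... = killed_op t s f p + (INT+x'. (INT+r\<in>{s..t}. (INT+z. ?D r x' z d/lborel) d/lborel) * f (x', y) d/lborel)"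
  unfolding distrib_right killed_op_def xy by (subst nn_integral_add) auto
 also have "(INT+x'. (INT+r\<in>{s..t}. (INT+z. ?D r x' z d/lborel) d/lborel) * f (x', y) d/lborel) =
  (INT+x'. INT+r. (INT+z. ?D r x' z * f (x', y) d/lborel) * Ind {s..t} r d/lborel d/lborel)"
 proof (rule nn_integral_cong)
  fix x' :: 'v
  have "(INT+r\<in>{s..t}. (INT+z. ?D r x' z d/lborel) d/lborel) * f (x', y) = (INT+r. (INT+z. ?D r x' z d/lborel) * Ind {s..t} r * f (x', y) d/lborel)"
   by (rule nn_integral_multc[symmetric]) measurable
  also have "... = (INT+r. (INT+z. ?D r x' z * f (x', y) d/lborel) * Ind {s..t} r d/lborel)"
  proof (rule nn_integral_cong)
   fix r :: real
   have "(INT+z. ?D r x' z * f (x', y) d/lborel) = (INT+z. ?D r x' z d/lborel) * f (x', y)"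
    using y by (intro nn_integral_multc borel_measurable_times_ennreal measurable_killed_density
      measurable_rate measurable_heat_density) auto
   then show "(INT+z. ?D r x' z d/lborel) * Ind {s..t} r * f (x', y) = (INT+z. ?D r x' z * f (x', y) d/lborel) * Ind {s..t} r"
    by (simp add: mult_ac)
  qed
  finally show "(INT+r\<in>{s..t}. (INT+z. ?D r x' z d/lborel) d/lborel) * f (x', y) = (INT+r. (INT+z. ?D r x' z * f (x', y) d/lborel) * Ind {s..t} r d/lborel)" .
 qed
 also have "... = (INT+r. INT+x'. (INT+z. ?D r x' z * f (x', y) d/lborel) * Ind {s..t} r d/lborel d/lborel)"
  by (rule lborel_pair.Fubini') measurable
 also have "... = (INT+r\<in>{s..t}. killed_op r s (%p. rate r (fst p) (snd p) * heat_op t r f p) p d/lborel)"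
 proof (rule nn_integral_cong)
  fix r :: real
  have "(INT+x'. (INT+z. ?D r x' z * f (x', y) d/lborel) * Ind {s..t} r d/lborel) = (INT+x'. INT+z. ?D r x' z * f (x', y) d/lborel d/lborel) * Ind {s..t} r"
   by (rule nn_integral_multc) measurable
  also have "(INT+x'. INT+z. ?D r x' z * f (x', y) d/lborel d/lborel) = (INT+z. INT+x'. ?D r x' z * f (x', y) d/lborel d/lborel)"
   by (rule lborel_pair.Fubini') measurable
  also have "... = (INT+z. INT+x'. (killed_density s x r z y * rate r z y) * (heat_density r z t x' y * f (x', y)) d/lborel d/lborel)"
   by (simp add: mult_ac)
  also have "... = (INT+z. (killed_density s x r z y * rate r z y) * (INT+x'. heat_density r z t x' y * f (x', y) d/lborel) d/lborel)"
   using y measurable_compose[OF measurable_Pair2'[OF y, of borel] f]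
   by (intro nn_integral_cong nn_integral_cmult borel_measurable_times_ennreal measurable_heat_density) auto
  also have "... = killed_op r s (%p. rate r (fst p) (snd p) * heat_op t r f p) p"
   by (simp add: killed_op_def heat_op_def xy mult_ac)
  finally show "(INT+x'. (INT+z. ?D r x' z * f (x', y) d/lborel) * Ind {s..t} r d/lborel) =
   killed_op r s (%p. rate r (fst p) (snd p) * heat_op t r f p) p * Ind {s..t} r" .
 qed
 finally show ?thesis ..
qed

end

section \<open>The propagator as a functional\<close>

context strong_coagulation
begin

lemma positive_functional_smoothing:
 fixes D :: "'v => ennreal"
 assumes D: "D : Bm lborel" and y: "y : space E"
 shows "positive_functional X (%f. INT+x'. D x' * f (x', y) d/lborel)"
proof (rule positive_functional_integral)
 have p: "(%x'. (x', y)) : measurable lborel X" using y by simp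
 show "positive_functional X (%f. D x' * f (x', y))" for x' :: 'v
  using y by (intro positive_functional_scale positive_functionalI) (auto simp: space_pair_measure)
 show "(%x'. D x' * f (x', y)) : Bm lborel"
  if "f : Bm X" for f
  by (rule borel_measurable_times_ennreal[OF D measurable_compose[OF p that]])
qed

text \<open>The measure is defined by integrating first over the starting and then over the end point; the
functional does it in the other order, where \<open>\<Phi>\<close> may be any source that satisfies Fubini.\<close>

lemma flow_measure:
 fixes \<Phi> :: "('v \<times> 'e => ennreal) => ennreal" and D :: "'v => 'v => 'e => ennreal"
 assumes \<Phi>: "positive_functional X \<Phi>"
  and D: "(%w. D (fst (snd w)) (fst w) (snd (snd w))) : Bm (lborel >< X)"
  and Fubini: "!!h. (%w. h (fst w) (snd w)) : Bm (lborel >< X) ==>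
   \<Phi> (%p. INT+x'. h x' p d/(lborel :: 'v measure)) = (INT+x'. \<Phi> (h x') d/lborel)"
  and f: "f : Bm X"
 shows "(INT+p. f p d/measure_by X (%S. INT+x'. \<Phi> (%p. D (fst p) x' (snd p) * Ind S (x', snd p)) d/lborel)) =
  \<Phi> (%p. INT+x'. D (fst p) x' (snd p) * f (x', snd p) d/lborel)"
proof -
 have h: "(%w. D (fst (snd w)) (fst w) (snd (snd w)) * f (fst w, snd (snd w))) : Bm (lborel >< X)"
  if "f : Bm X" for f
 proof (intro borel_measurable_times_ennreal D)
  have "(%w. (fst w, snd (snd w))) : measurable (lborel >< X) X"
   by measurable
  from measurable_compose[OF this that]
  show "(%w. f (fst w, snd (snd w))) : Bm (lborel >< X)" .
 qed
 have "(INT+x'. \<Phi> (%p. D (fst p) x' (snd p) * Ind S (x', snd p)) d/lborel) =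
  \<Phi> (%p. INT+x'. D (fst p) x' (snd p) * Ind S (x', snd p) d/lborel)" if "S : sets X" for S
  by (rule Fubini[symmetric]) (use h[of "Ind S"] that in simp)
 then have "measure_by X (%S. INT+x'. \<Phi> (%p. D (fst p) x' (snd p) * Ind S (x', snd p)) d/lborel) =
  measure_by X (%S. \<Phi> (%p. INT+x'. D (fst p) x' (snd p) * Ind S (x', snd p) d/lborel))"
  by (rule measure_by_cong)
 moreover have "positive_functional X (%f. \<Phi> (%p. INT+x'. D (fst p) x' (snd p) * f (x', snd p) d/lborel))"
 proof (rule positive_functional_compose[OF \<Phi>, of _ "%f p. INT+x'. D (fst p) x' (snd p) * f (x', snd p) d/lborel"])
  fix p :: "'v \<times> 'e" assume p: "p : space X"
  show "positive_functional X (%f. INT+x'. D (fst p) x' (snd p) * f (x', snd p) d/lborel)"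
   using p measurable_compose[OF measurable_Pair2'[OF p, of lborel] D]
   by (intro positive_functional_smoothing) (auto simp: space_pair_measure)
 next
  fix f :: "'v \<times> 'e => ennreal" assume f: "f : Bm X"
  have "(%w. (snd w, fst w)) : measurable (X >< lborel) (lborel >< X)"
   by measurable
  from measurable_compose[OF this h[OF f]]
  show "(%p. INT+x'. D (fst p) x' (snd p) * f (x', snd p) d/lborel) : Bm X"
   by (intro lborel.borel_measurable_nn_integral) (simp add: split_beta')
 qed
 ultimately show ?thesis using nn_integral_measure_by_functional[OF _ f] by simp
qed

lemma propagator_functional:
 fixes \<Phi> :: "('v \<times> 'e => ennreal) => ennreal"
 assumes \<Phi>: "positive_functional X \<Phi>"
  and Fubini: "!!h. (%w. h (fst w) (snd w)) : Bm (lborel >< X) ==>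
   \<Phi> (%p. INT+x'. h x' p d/(lborel :: 'v measure)) = (INT+x'. \<Phi> (h x') d/lborel)"
  and \<rho>: "!!f. f : Bm X ==> (INT+p. f p d/\<rho>) = \<Phi> f"
  and sets: "sets \<rho> = sets X"
  and st: "s < t" and f: "f : Bm X"
 shows "(INT+p. f p d/propagator E a K T \<mu> t s \<rho>) = \<Phi> (killed_op t s f)"
  and "(INT+p. f p d/heat_flow E a (t - s) \<rho>) = \<Phi> (heat_op t s f)"
proof -
 have D: "(%w. killed_density s (fst (snd w)) t (fst w) (snd (snd w))) : Bm (lborel >< X)"
  "(%w. heat_density s (fst (snd w)) t (fst w) (snd (snd w))) : Bm (lborel >< X)"
  by measurable
 have Dx: "(%p. killed_density s (fst p) t x' (snd p)) : Bm X"
  "(%p. heat_density s (fst p) t x' (snd p)) : Bm X" for x' :: 'v by measurable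
 have Sx: "(%p. Ind S (x', snd p) :: ennreal) : Bm X"
  if "S : sets X" for S and x' :: 'v
  using that by measurable
 have integrand: "(INT+(x, y). Ind S (x', y) * (hk (a y * (t - s)) x x') *
   (INT+\<omega>. exp_neg (INT+\<tau>\<in>{s..t}. coag_rate E K T \<mu> \<tau> (\<omega> \<tau>) y d/lborel) d/bridge_law (a y) s x t x') d/\<rho>) =
  \<Phi> (%p. killed_density s (fst p) t x' (snd p) * Ind S (x', snd p))"
  if S: "S : sets X" for S x'
 proof -
  have "(%(x, y). Ind S (x', y) * (hk (a y * (t - s)) x x') *
   (INT+\<omega>. exp_neg (INT+\<tau>\<in>{s..t}. coag_rate E K T \<mu> \<tau> (\<omega> \<tau>) y d/lborel) d/bridge_law (a y) s x t x')) =
   (%p. killed_density s (fst p) t x' (snd p) * Ind S (x', snd p))"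
   unfolding killed_density_def killing_def rate_def using st by (simp add: fun_eq_iff mult_ac)
  then show ?thesis
   using \<rho>[OF borel_measurable_times_ennreal[OF Dx(1) Sx[OF S]], of x' x'] by simp
 qed
 have "propagator E a K T \<mu> t s \<rho> = measure_by X (%S. INT+x'. \<Phi> (%p. killed_density s (fst p) t x' (snd p) * Ind S (x', snd p)) d/lborel)"
  unfolding propagator_def using st by (simp only: less_imp_neq if_False) (intro measure_by_cong nn_integral_cong integrand)
 then show "(INT+p. f p d/propagator E a K T \<mu> t s \<rho>) = \<Phi> (killed_op t s f)"
  unfolding killed_op_def using flow_measure[OF \<Phi> D(1) Fubini f] by simp
 have "Em (heat_fibre E a (t - s) \<rho> x') (Pair x' -` S) = \<Phi> (%p. heat_density s (fst p) t x' (snd p) * Ind S (x', snd p))"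
  if S: "S : sets X" for S and x' :: 'v
 proof -
  have sn: "snd : measurable \<rho> E" using measurable_snd[of borel E] by (simp add: measurable_cong_sets[OF sets refl])
  have d: "(%(x, y). (hk (a y * (t - s)) x x')) : Bm \<rho>"
   unfolding measurable_cong_sets[OF sets refl] by measurable
  have P: "Pair x' -` S : sets E" using S by (rule sets_Pair1)
  have I: "(%p. Ind (snd -` Pair x' -` S \<inter> space \<rho>) p :: ennreal) : Bm \<rho>"
   using measurable_sets[OF sn P] by simp
  have "Em (heat_fibre E a (t - s) \<rho> x') (Pair x' -` S) = Em (density \<rho> (%(x, y). (hk (a y * (t - s)) x x'))) (snd -` Pair x' -` S \<inter> space \<rho>)"
   unfolding heat_fibre_def using sn P by (subst emeasure_distr) auto
  also have "... = (INT+p. (case p of (x, y) => (hk (a y * (t - s)) x x')) * Ind (snd -` Pair x' -` S \<inter> space \<rho>) p d/\<rho>)"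
   using d measurable_sets[OF sn P] by (rule emeasure_density)
  also have "... = (INT+p. heat_density s (fst p) t x' (snd p) * Ind S (x', snd p) d/\<rho>)"
   using st by (intro nn_integral_cong) (auto simp: heat_density_def indicator_def split_beta')
  finally show ?thesis using \<rho>[OF borel_measurable_times_ennreal[OF Dx(2) Sx[OF S]], of x' x'] by simp
 qed
 then have "heat_flow E a (t - s) \<rho> = measure_by X (%S. INT+x'. \<Phi> (%p. heat_density s (fst p) t x' (snd p) * Ind S (x', snd p)) d/lborel)"
  unfolding heat_flow_def using st by (auto intro!: measure_by_cong nn_integral_cong)
 then show "(INT+p. f p d/heat_flow E a (t - s) \<rho>) = \<Phi> (heat_op t s f)"
  unfolding heat_op_def using flow_measure[OF \<Phi> D(2) Fubini f] by simp
qed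

lemma Fubini_weighted:
 fixes \<rho> :: "('v \<times> 'e) measure" and g :: "'v \<times> 'e => ennreal"
 assumes sets: "sets \<rho> = sets X" and fin: "finite_measure \<rho>" and R: "sigma_finite_measure R"
  and g: "g : Bm X"
  and h: "(%w. h (fst w) (snd w)) : Bm (R >< X)"
 shows "(INT+p. g p * (INT+r. h r p d/R) d/\<rho>) = (INT+r. INT+p. g p * h r p d/\<rho> d/R)"
proof -
 interpret P: pair_sigma_finite R \<rho>
  using R fin by (intro pair_sigma_finite.intro) (auto simp: finite_measure.axioms)
 note [measurable_cong] = sets
 have "(%w. g (snd w) * h (fst w) (snd w)) : Bm (R >< X)"
  using h g by (intro borel_measurable_times_ennreal measurable_compose[OF measurable_snd g])
 then have "(%w. g (snd w) * h (fst w) (snd w)) : Bm (R >< \<rho>)" by (simp cong: measurable_cong_sets)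
 from P.Fubini'[of "%r p. g p * h r p"] this
 have "(INT+p. INT+r. g p * h r p d/R d/\<rho>) = (INT+r. INT+p. g p * h r p d/\<rho> d/R)" by (simp add: split_beta')
 moreover have "(INT+p. INT+r. g p * h r p d/R d/\<rho>) = (INT+p. g p * (INT+r. h r p d/R) d/\<rho>)"
 proof (intro nn_integral_cong nn_integral_cmult)
  fix p assume "p : space \<rho>"
  then have "p : space X" using sets_eq_imp_space_eq[OF sets] by simp
  from measurable_compose[OF measurable_Pair2'[OF this, of R] h] show "(%r. h r p) : Bm R" by simp
 qed
 ultimately show ?thesis by simp
qed

text \<open>The integral of \<open>f\<close> at time \<open>t\<close> when the initial state and the coagulation products with
fibres \<open>\<k>\<close> are transported by \<open>op\<close>, which is either the killed or the free heat semigroup.\<close>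

definition evolve :: "(real => real => ('v \<times> 'e => ennreal) => 'v \<times> 'e => ennreal) => (real => 'v => 'e measure)
  => real => ('v \<times> 'e => ennreal) => ennreal" where
 "evolve op \<k> t f = (INT+p. op t 0 f p d/\<mu> 0) + (INT+s\<in>{0..t}. gain (\<k> s) (op t s f) d/lborel)"

lemma sets_\<mu>: "t : lifetime T ==> sets (\<mu> t) = sets X"
 and finite_\<mu>: "t : lifetime T ==> finite_measure (\<mu> t)"
 using \<mu>_states[of t] by (simp_all add: states_def)

lemma kernel_at:
 fixes \<k> :: "real => 'v => 'e measure"
 assumes "finite_kernel (borel >< borel) E (%(t, x). \<k> t x)"
 shows "finite_kernel borel E (\<k> s)"
 using finite_kernel_compose[OF assms, of "%x. (s, x)" borel] by simp

context
 fixes op :: "real => real => ('v \<times> 'e => ennreal) => 'v \<times> 'e => ennreal"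
 assumes op: "op = killed_op \<or> op = heat_op"
begin

lemma measurable_flow:
 assumes "t : Bm M" "s : Bm M" "p : measurable M X"
  and "(%z. f (fst z) (snd z)) : Bm (M >< X)"
 shows "(%w. op (t w) (s w) (f w) (p w)) : Bm M"
 using op measurable_ops[OF assms] by auto

lemma measurable_flow_const:
 assumes "f : Bm X"
 shows "op t s f : Bm X"
 by (rule measurable_flow[where p="%p. p" and t="%_. t" and s="%_. s" and f="%_. f"])
  (auto intro: measurable_compose[OF measurable_snd assms])

lemma positive_functional_flow: "p : space X ==> positive_functional X (%f. op t s f p)"
 using op unfolding killed_op_def heat_op_def
 by (auto intro!: positive_functional_smoothing measurable_killed_density measurable_heat_density simp: space_pair_measure)

context
 fixes \<k> :: "real => 'v => 'e measure"
 assumes \<k>: "finite_kernel (borel >< borel) E (%(t, x). \<k> t x)"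
begin

lemma measurable_gain_flow:
 assumes t: "t : Bm M" and s: "s : Bm M"
  and f: "(%z. f (fst z) (snd z)) : Bm (M >< X)"
 shows "(%w. gain (\<k> (s w)) (op (t w) (s w) (f w))) : Bm M"
proof (rule measurable_gain)
 have "(%w. (s (fst w), snd w)) : measurable (M >< borel) (borel >< borel)" using s by measurable
 from finite_kernel_compose[OF \<k> this]
 show "finite_kernel (M >< borel) E (%(w, x). \<k> (s w) x)" by (simp add: split_beta')
 have "(%z. (fst (fst z), snd z)) : measurable ((M >< X) >< X) (M >< X)"
  by measurable
 from measurable_compose[OF this f]
 show "(%z. op (t (fst z)) (s (fst z)) (f (fst z)) (snd z)) : Bm (M >< X)"
  by (intro measurable_flow measurable_compose[OF measurable_fst t] measurable_compose[OF measurable_fst s]) simp_all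
qed

lemma measurable_gain_flow_const:
 assumes f: "f : Bm X"
 shows "(%s. gain (\<k> s) (op t s f)) : Bm borel"
 using measurable_compose[OF measurable_snd f] by (intro measurable_gain_flow) auto

lemma measurable_evolve:
 assumes t: "t : Bm M"
  and f: "(%z. f (fst z) (snd z)) : Bm (M >< X)"
 shows "(%w. evolve op \<k> (t w) (f w)) : Bm M"
 unfolding evolve_def
proof (intro borel_measurable_add)
 interpret finite_measure "\<mu> 0" by (rule finite_\<mu>[OF zero_lifetime])
 note [measurable] = t
 have "(%z. (fst (fst z), snd z)) : measurable ((M >< X) >< X) (M >< X)"
  by measurable
 from measurable_compose[OF this f]
 have "(%z. op (t (fst z)) 0 (f (fst z)) (snd z)) : Bm (M >< X)"
  by (intro measurable_flow) simp_all
 also have "Bm (M >< X) = Bm (M >< \<mu> 0)"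
  by (intro measurable_cong_sets sets_pair_measure_cong refl sets_\<mu>[OF zero_lifetime, symmetric])
 finally show "(%w. INT+p. op (t w) 0 (f w) p d/\<mu> 0) : Bm M"
  by (intro borel_measurable_nn_integral) (simp add: split_beta')
 have "(%z. (fst (fst z), snd z)) : measurable ((M >< lborel) >< X) (M >< X)"
  by measurable
 from measurable_compose[OF this f]
 have "(%z. gain (\<k> (snd z)) (op (t (fst z)) (snd z) (f (fst z)))) : Bm (M >< lborel)"
  by (intro measurable_gain_flow) simp_all
 then have "(%z. gain (\<k> (snd z)) (op (t (fst z)) (snd z) (f (fst z))) * (if 0 <= snd z & snd z <= t (fst z) then 1 else 0)) : Bm (M >< lborel)"
  by measurable
 also have "(%z. gain (\<k> (snd z)) (op (t (fst z)) (snd z) (f (fst z))) * (if 0 <= snd z & snd z <= t (fst z) then 1 else 0)) =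
  (%z. gain (\<k> (snd z)) (op (t (fst z)) (snd z) (f (fst z))) * Ind {0..t (fst z)} (snd z))"
  by (auto simp: indicator_def)
 finally show "(%w. INT+s\<in>{0..t w}. gain (\<k> s) (op (t w) s (f w)) d/lborel) : Bm M"
  by (intro lborel.borel_measurable_nn_integral) (simp add: split_beta')
qed

lemma positive_functional_evolve: "positive_functional X (evolve op \<k> t)"
 unfolding evolve_def[abs_def]
proof (intro positive_functional_plus positive_functional_integral)
 have sp: "space (\<mu> 0) = space X" by (rule sets_eq_imp_space_eq[OF sets_\<mu>[OF zero_lifetime]])
 show "positive_functional X (%f. op t 0 f p)" if "p : space (\<mu> 0)" for p
  using that unfolding sp by (rule positive_functional_flow)
 show "op t 0 f : Bm (\<mu> 0)" if "f : Bm X" for f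
  using measurable_flow_const[OF that] by (simp add: measurable_cong_sets[OF sets_\<mu>[OF zero_lifetime] refl])
 show "(%s. gain (\<k> s) (op t s f) * Ind {0..t} s) : Bm lborel"
  if "f : Bm X" for f
  using measurable_gain_flow_const[OF that] by (intro borel_measurable_times_ennreal) auto
 show "positive_functional X (%f. gain (\<k> s) (op t s f) * Ind {0..t} s)" for s
  using positive_functional_scale[OF positive_functional_compose[OF positive_functional_gain[OF kernel_at[OF \<k>, of s]], where A="op t s", OF positive_functional_flow measurable_flow_const], of "Ind {0..t} s"]
  by (simp add: mult.commute)
qed

end
end

text \<open>The Duhamel formula of the semigroups, applied to each source; the two time integrals are
exchanged over the triangle \<open>0 \<le> s \<le> r \<le> t\<close>.\<close>

lemma evolve_duhamel:
 fixes \<k> :: "real => 'v => 'e measure"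
 assumes \<k>: "finite_kernel (borel >< borel) E (%(t, x). \<k> t x)"
  and t: "t : lifetime T" "0 < t" and f: "f : Bm X"
 shows "evolve killed_op \<k> t f +
  (INT+r\<in>{0..t}. evolve killed_op \<k> r (%p. rate r (fst p) (snd p) * heat_op t r f p) d/lborel) = evolve heat_op \<k> t f"
proof -
 define G where "G r p = rate r (fst p) (snd p) * heat_op t r f p" for r p
 have k: "killed_op = killed_op \<or> killed_op = heat_op" "heat_op = killed_op \<or> heat_op = heat_op" by simp_all
 have [measurable]: "f : Bm X" by fact
 have G: "(%w. G (fst w) (snd w)) : Bm (borel >< X)"
  unfolding G_def by (intro borel_measurable_times_ennreal measurable_rate measurable_flow[OF k(2)]) measurable
 have G3: "(%z. G (fst (fst z)) (snd z)) : Bm ((borel >< N) >< X)" for N :: "'n measure"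
 proof -
  have "(%z. (fst (fst z), snd z)) : measurable ((borel >< N) >< X) (borel >< X)" by measurable
  from measurable_compose[OF this G] show ?thesis by simp
 qed
 have UG: "(%w. killed_op (fst w) s (G (fst w)) (snd w)) : Bm (lborel >< X)" for s
  using measurable_flow[OF k(1) measurable_fst measurable_const measurable_snd G3, of s] by (simp cong: measurable_cong_sets)
 have UG': "(%w. killed_op (fst w) s (G (fst w)) (snd w) * Ind A (fst w)) : Bm (lborel >< X)"
  if [measurable]: "A : sets borel" for A s
  using UG[of s] by measurable
 have gG: "(%w. gain (\<k> (snd w)) (killed_op (fst w) (snd w) (G (fst w)))) : Bm (borel >< borel)"
  by (intro measurable_gain_flow[OF k(1) \<k>] G3) measurable
 have gfs: "(%s. gain (\<k> s) (killed_op t s f)) : Bm borel" by (rule measurable_gain_flow_const[OF k(1) \<k> f])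
 have duhamel: "killed_op t s f p + (INT+r. killed_op r s (G r) p * Ind {s..t} r d/lborel) = heat_op t s f p"
  if "0 <= s" "s < t" "p : space X" for s p
  unfolding G_def using that by (intro killed_op_duhamel t f)
 have sp0: "space (\<mu> 0) = space X" by (rule sets_eq_imp_space_eq[OF sets_\<mu>[OF zero_lifetime]])
 have I: "(%p. INT+r. killed_op r s (G r) p * Ind {s..t} r d/lborel) : Bm X" for s
 proof -
  have "(%w. (snd w, fst w)) : measurable (X >< lborel) (lborel >< X)" by measurable
  from measurable_compose[OF this UG'[of "{s..t}" s]] show ?thesis
   by (intro lborel.borel_measurable_nn_integral) (simp add: split_beta')
 qed
 have init: "(INT+p. killed_op t 0 f p d/\<mu> 0) + (INT+r. INT+p. killed_op r 0 (G r) p * Ind {0..t} r d/\<mu> 0 d/lborel) = (INT+p. heat_op t 0 f p d/\<mu> 0)"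
 proof -
  have "(INT+p. heat_op t 0 f p d/\<mu> 0) = (INT+p. killed_op t 0 f p + (INT+r. killed_op r 0 (G r) p * Ind {0..t} r d/lborel) d/\<mu> 0)"
   using t(2) by (intro nn_integral_cong) (simp add: duhamel sp0)
  also have "... = (INT+p. killed_op t 0 f p d/\<mu> 0) + (INT+p. (INT+r. killed_op r 0 (G r) p * Ind {0..t} r d/lborel) d/\<mu> 0)"
   using measurable_flow_const[OF k(1) f, of t 0] I[of 0]
   by (intro nn_integral_add) (simp_all add: measurable_cong_sets[OF sets_\<mu>[OF zero_lifetime] refl])
  also have "(INT+p. (INT+r. killed_op r 0 (G r) p * Ind {0..t} r d/lborel) d/\<mu> 0) = (INT+r. INT+p. killed_op r 0 (G r) p * Ind {0..t} r d/\<mu> 0 d/lborel)"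
   using Fubini_weighted[OF sets_\<mu>[OF zero_lifetime] finite_\<mu>[OF zero_lifetime] sigma_finite_lborel, of "%_. 1" "%r p. killed_op r 0 (G r) p * Ind {0..t} r"] UG'[of "{0..t}" 0]
   by simp
  finally show ?thesis by simp
 qed
 have src: "gain (\<k> s) (killed_op t s f) + (INT+r. gain (\<k> s) (killed_op r s (G r)) * Ind {s..t} r d/lborel) = gain (\<k> s) (heat_op t s f)"
  if s: "0 <= s" "s < t" for s
 proof -
  note pf = positive_functional_gain[OF kernel_at[OF \<k>], of s]
  have "gain (\<k> s) (heat_op t s f) = gain (\<k> s) (%p. killed_op t s f p + (INT+r. killed_op r s (G r) p * Ind {s..t} r d/lborel))"
   using s I[of s] measurable_flow_const[OF k(1) f, of t s] measurable_flow_const[OF k(2) f, of t s]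
   by (intro positive_functional_cong[OF pf]) (simp_all add: duhamel)
  also have "... = gain (\<k> s) (killed_op t s f) + gain (\<k> s) (%p. INT+r. killed_op r s (G r) p * Ind {s..t} r d/lborel)"
   by (rule positive_functional_add[OF pf measurable_flow_const[OF k(1) f] I])
  also have "gain (\<k> s) (%p. INT+r. killed_op r s (G r) p * Ind {s..t} r d/lborel) = (INT+r. gain (\<k> s) (%p. killed_op r s (G r) p * Ind {s..t} r) d/lborel)"
   by (rule gain_nn_integral[OF kernel_at[OF \<k>] sigma_finite_lborel]) (rule UG', simp)
  also have "... = (INT+r. gain (\<k> s) (killed_op r s (G r)) * Ind {s..t} r d/lborel)"
  proof (rule nn_integral_cong)
   fix r
   have "G r : Bm X" using measurable_compose[OF measurable_Pair1'[of r borel] G] by simp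
   from measurable_flow_const[OF k(1) this, of r s] show "gain (\<k> s) (%p. killed_op r s (G r) p * Ind {s..t} r) = gain (\<k> s) (killed_op r s (G r)) * Ind {s..t} r"
    using positive_functional_cmult[OF pf, of "killed_op r s (G r)" "Ind {s..t} r"] by (simp add: mult.commute)
  qed
  finally show ?thesis by simp
 qed
 have tri: "(%w. gain (\<k> (snd w)) (killed_op (fst w) (snd w) (G (fst w))) * (if 0 <= snd w & snd w <= fst w & fst w <= t then 1 else 0)) : Bm (lborel >< lborel)"
  using gG by measurable
 have tri_eq: "gain (\<k> s) (killed_op r s (G r)) * Ind {0..r} s * Ind {0..t} r = gain (\<k> s) (killed_op r s (G r)) * (if 0 <= s & s <= r & r <= t then 1 else 0)" for r s
  by (auto simp: indicator_def)
 have tri_eq': "gain (\<k> s) (killed_op r s (G r)) * Ind {s..t} r * Ind {0..t} s = gain (\<k> s) (killed_op r s (G r)) * (if 0 <= s & s <= r & r <= t then 1 else 0)" for r s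
  by (auto simp: indicator_def)
 have g1: "(%r. gain (\<k> s) (killed_op r s (G r))) : Bm borel" for s
  using measurable_compose[OF measurable_Pair2'[of s borel borel] gG] by simp
 have g2: "(%s. gain (\<k> s) (killed_op r s (G r))) : Bm borel" for r
  using measurable_compose[OF measurable_Pair1'[of r borel borel] gG] by simp
 have swap: "(INT+r. (INT+s\<in>{0..r}. gain (\<k> s) (killed_op r s (G r)) d/lborel) * Ind {0..t} r d/lborel) =
  (INT+s. (INT+r. gain (\<k> s) (killed_op r s (G r)) * Ind {s..t} r d/lborel) * Ind {0..t} s d/lborel)"
 proof -
  have "(INT+r. (INT+s\<in>{0..r}. gain (\<k> s) (killed_op r s (G r)) d/lborel) * Ind {0..t} r d/lborel) =
   (INT+r. INT+s. gain (\<k> s) (killed_op r s (G r)) * (if 0 <= s & s <= r & r <= t then 1 else 0) d/lborel d/lborel)"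
   unfolding tri_eq[symmetric] using g2 by (intro nn_integral_cong nn_integral_multc[symmetric] borel_measurable_times_ennreal) auto
  also have "... = (INT+s. INT+r. gain (\<k> s) (killed_op r s (G r)) * (if 0 <= s & s <= r & r <= t then 1 else 0) d/lborel d/lborel)"
   using tri by (intro lborel_pair.Fubini'[symmetric]) (simp add: split_beta')
  also have "... = (INT+s. (INT+r. gain (\<k> s) (killed_op r s (G r)) * Ind {s..t} r d/lborel) * Ind {0..t} s d/lborel)"
   unfolding tri_eq'[symmetric] using g1 by (intro nn_integral_cong nn_integral_multc borel_measurable_times_ennreal) auto
  finally show ?thesis .
 qed
 have m1: "(%r. (INT+p. killed_op r 0 (G r) p d/\<mu> 0) * Ind {0..t} r) : Bm lborel"
 proof -
  interpret finite_measure "\<mu> 0" by (rule finite_\<mu>[OF zero_lifetime])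
  have "(%w. killed_op (fst w) 0 (G (fst w)) (snd w)) : Bm (lborel >< \<mu> 0)"
   using UG[of 0] by (simp add: measurable_cong_sets[OF sets_pair_measure_cong[OF refl sets_\<mu>[OF zero_lifetime]] refl])
  then show ?thesis by (intro borel_measurable_times_ennreal borel_measurable_nn_integral) (simp_all add: split_beta')
 qed
 have m2: "(%r. (INT+s\<in>{0..r}. gain (\<k> s) (killed_op r s (G r)) d/lborel) * Ind {0..t} r) : Bm lborel"
 proof -
  have "(%w. gain (\<k> (snd w)) (killed_op (fst w) (snd w) (G (fst w))) * (if 0 <= snd w & snd w <= fst w then 1 else 0)) : Bm (lborel >< lborel)"
   using gG by measurable
  also have "(%w. gain (\<k> (snd w)) (killed_op (fst w) (snd w) (G (fst w))) * (if 0 <= snd w & snd w <= fst w then 1 else 0)) =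
   (%w. gain (\<k> (snd w)) (killed_op (fst w) (snd w) (G (fst w))) * Ind {0..fst w} (snd w))"
   by (auto simp: indicator_def)
  finally show ?thesis by (intro borel_measurable_times_ennreal lborel.borel_measurable_nn_integral) (simp_all add: split_beta')
 qed
 have m3: "(%s. (INT+r. gain (\<k> s) (killed_op r s (G r)) * Ind {s..t} r d/lborel) * Ind {0..t} s) : Bm lborel"
 proof -
  have "(%w. gain (\<k> (fst w)) (killed_op (snd w) (fst w) (G (snd w))) * (if fst w <= snd w & snd w <= t then 1 else 0)) : Bm (lborel >< lborel)"
  proof -
   have "(%w. (snd w, fst w)) : measurable (lborel >< lborel) (borel >< borel)" by measurable
   from measurable_compose[OF this gG]
   have [measurable]: "(%w. gain (\<k> (fst w)) (killed_op (snd w) (fst w) (G (snd w)))) : Bm (lborel >< lborel)" by simp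
   show ?thesis by measurable
  qed
  also have "(%w. gain (\<k> (fst w)) (killed_op (snd w) (fst w) (G (snd w))) * (if fst w <= snd w & snd w <= t then 1 else 0)) =
   (%w. gain (\<k> (fst w)) (killed_op (snd w) (fst w) (G (snd w))) * Ind {fst w..t} (snd w))"
   by (auto simp: indicator_def)
  finally show ?thesis by (intro borel_measurable_times_ennreal lborel.borel_measurable_nn_integral) (simp_all add: split_beta')
 qed
 have "(INT+r\<in>{0..t}. evolve killed_op \<k> r (G r) d/lborel) =
  (INT+r. (INT+p. killed_op r 0 (G r) p d/\<mu> 0) * Ind {0..t} r d/lborel) +
  (INT+s. (INT+r. gain (\<k> s) (killed_op r s (G r)) * Ind {s..t} r d/lborel) * Ind {0..t} s d/lborel)"
  unfolding evolve_def distrib_right swap[symmetric] by (rule nn_integral_add[OF m1 m2])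
 moreover have "(INT+r. (INT+p. killed_op r 0 (G r) p d/\<mu> 0) * Ind {0..t} r d/lborel) = (INT+r. INT+p. killed_op r 0 (G r) p * Ind {0..t} r d/\<mu> 0 d/lborel)"
  by (intro nn_integral_cong) (auto simp: indicator_def)
 moreover have "(INT+s\<in>{0..t}. gain (\<k> s) (heat_op t s f) d/lborel) = (INT+s. gain (\<k> s) (killed_op t s f) * Ind {0..t} s +
   (INT+r. gain (\<k> s) (killed_op r s (G r)) * Ind {s..t} r d/lborel) * Ind {0..t} s d/lborel)"
 proof (rule nn_integral_cong_AE)
  show "AE s in lborel. gain (\<k> s) (heat_op t s f) * Ind {0..t} s = gain (\<k> s) (killed_op t s f) * Ind {0..t} s +
   (INT+r. gain (\<k> s) (killed_op r s (G r)) * Ind {s..t} r d/lborel) * Ind {0..t} s"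
   using AE_lborel_singleton[of t]
  proof eventually_elim
   case (elim s)
   then show ?case using src[of s] by (cases "s : {0..t}") (auto simp: distrib_right[symmetric])
  qed
 qed
 moreover have "... = (INT+s. gain (\<k> s) (killed_op t s f) * Ind {0..t} s d/lborel) +
   (INT+s. (INT+r. gain (\<k> s) (killed_op r s (G r)) * Ind {s..t} r d/lborel) * Ind {0..t} s d/lborel)"
  using gfs by (intro nn_integral_add m3 borel_measurable_times_ennreal) auto
 ultimately show ?thesis
  unfolding G_def[symmetric] evolve_def[of heat_op] evolve_def[of killed_op \<k> t] init[symmetric] by (simp add: add_ac)
qed

lemma initial_functional:
 assumes "0 < t" "f : Bm X"
 shows "(INT+p. f p d/propagator E a K T \<mu> t 0 (\<mu> 0)) = (INT+p. killed_op t 0 f p d/\<mu> 0)"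
  and "(INT+p. f p d/heat_flow E a t (\<mu> 0)) = (INT+p. heat_op t 0 f p d/\<mu> 0)"
proof -
 note * = sets_\<mu>[OF zero_lifetime] and ** = finite_\<mu>[OF zero_lifetime]
 have Fub: "(%w. h (fst w) (snd w)) : Bm (lborel >< X) ==>
   (INT+p. (INT+x'. h x' p d/(lborel :: 'v measure)) d/\<mu> 0) = (INT+x'. INT+p. h x' p d/\<mu> 0 d/lborel)" for h
  using Fubini_weighted[OF * ** sigma_finite_lborel, of "%_. 1" h] by simp
 note pf = propagator_functional[OF positive_functional_nn_integral[OF *] Fub refl * assms]
 show "(INT+p. f p d/propagator E a K T \<mu> t 0 (\<mu> 0)) = (INT+p. killed_op t 0 f p d/\<mu> 0)" by (rule pf(1))
 show "(INT+p. f p d/heat_flow E a t (\<mu> 0)) = (INT+p. heat_op t 0 f p d/\<mu> 0)" using pf(2) by simp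
qed

lemma source_functional:
 fixes \<nu> :: "real => ('v \<times> 'e) measure"
 assumes \<nu>: "process E T \<nu>" and s: "s : lifetime T" and st: "s < t" and f: "f : Bm X"
 shows "(INT+p. f p d/propagator E a K T \<mu> t s (K_plus E K (\<nu> s))) = gain (fibs \<nu> s) (killed_op t s f)"
  and "(INT+p. f p d/heat_flow E a (t - s) (K_plus E K (\<nu> s))) = gain (fibs \<nu> s) (heat_op t s f)"
proof -
 have st': "\<nu> s : states E" using \<nu> s by (simp add: process_def)
 note \<k> = process_fibre(1)[OF standard \<nu>] and dis = process_fibre(2)[OF standard \<nu> s]
 note ks = kernel_at[OF \<k>, of s]
 note pf = propagator_functional[OF positive_functional_gain[OF ks] gain_nn_integral[OF ks sigma_finite_lborel] K_plus_functional(2)[OF st' dis] K_plus_functional(1)[OF st' dis] st f]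
 show "(INT+p. f p d/propagator E a K T \<mu> t s (K_plus E K (\<nu> s))) = gain (fibs \<nu> s) (killed_op t s f)"
  by (rule pf(1)) (simp_all cong: measurable_cong_sets)
 show "(INT+p. f p d/heat_flow E a (t - s) (K_plus E K (\<nu> s))) = gain (fibs \<nu> s) (heat_op t s f)"
  by (rule pf(2)) (simp_all cong: measurable_cong_sets)
qed

lemma sets_propagator: "s \<noteq> t ==> sets (propagator E a K T \<mu> t s \<rho>) = sets X"
 and sets_heat_flow: "u \<noteq> 0 ==> sets (heat_flow E a u \<rho>) = sets X"
 by (simp_all add: propagator_def heat_flow_def)

lemma emeasure_eq_integral: "sets N = sets M ==> S : sets M ==> Em N S = (INT+p. Ind S p d/N)"
 by simp

lemma rhs_functional:
 fixes \<nu> :: "real => ('v \<times> 'e) measure"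
 assumes \<nu>: "process E T \<nu>" and t: "t : lifetime T" "0 < t" and f: "f : Bm X"
 shows "(INT+p. f p d/rhs \<nu> t) = evolve killed_op (fibs \<nu>) t f"
proof -
 have "rhs \<nu> t = measure_by X (%S. evolve killed_op (fibs \<nu>) t (Ind S))"
  unfolding propagator_rhs_def evolve_def
 proof (intro measure_by_cong arg_cong2[where f="(+)"] nn_integral_cong_AE)
  fix S :: "('v \<times> 'e) set" assume S: "S : sets X"
  then have I: "(Ind S :: _ => ennreal) : Bm X" by simp
  show "Em (propagator E a K T \<mu> t 0 (\<mu> 0)) S = (INT+p. killed_op t 0 (Ind S) p d/\<mu> 0)"
   using emeasure_eq_integral[OF sets_propagator S] initial_functional(1)[OF t(2) I] t(2) by simp
  show "AE s in lborel. Em (propagator E a K T \<mu> t s (K_plus E K (\<nu> s))) S * Ind {0..t} s =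
    gain (fibs \<nu> s) (killed_op t s (Ind S)) * Ind {0..t} s"
   using AE_lborel_singleton[of t]
  proof eventually_elim
   case (elim s)
   show ?case
   proof (cases "s : {0..t}")
    case True
    then have "s < t" "s : lifetime T" using elim lifetime_le[OF t(1)] by auto
    then show ?thesis using emeasure_eq_integral[OF sets_propagator S] source_functional(1)[OF \<nu> _ _ I] elim by simp
   qed simp
  qed
 qed
 then show ?thesis
  using nn_integral_measure_by_functional[OF positive_functional_evolve[OF _ process_fibre(1)[OF standard \<nu>]] f] by simp
qed

lemma rhs_zero: "rhs \<nu> 0 = \<mu> 0"
proof -
 have "(INT+s\<in>{0..0}. g s d/lborel) = 0" for g :: "real => ennreal"
  by (rule nn_integral_null_set) (auto intro: null_setsI)
 then show ?thesis
  unfolding propagator_rhs_def using measure_by_emeasure[OF sets_\<mu>[OF zero_lifetime]] by (simp add: propagator_def)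
qed

lemma sets_rhs[simp]: "sets (propagator_rhs E a K T \<mu> \<rho> \<nu> t) = sets X"
 by (simp add: propagator_rhs_def)

definition loss :: "real => ('v \<times> 'e => ennreal) => ennreal" where
 "loss s f = (INT+x. INT+y. rate s x y * f (x, y) d/fib s x d/lborel)"

lemma loss_eq:
 assumes s: "s : lifetime T" and f: "f : Bm X"
 shows "loss s f = (INT+p. rate s (fst p) (snd p) * f p d/\<mu> s)"
 unfolding loss_def
proof (subst disintegrates_nn_integral[OF fib_disintegrates[OF s] sets_\<mu>[OF s] finite_\<mu>[OF s]])
 have "(%p. rate s (fst p) (snd p)) : Bm X" by measurable
 then show "(%p. rate s (fst p) (snd p) * f p) : Bm X" using f by simp
qed simp

lemma measurable_loss:
 assumes f: "(%z. f (fst z) (snd z)) : Bm (borel >< X)"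
 shows "(%s. loss s (f s)) : Bm borel"
proof -
 have "(%w. (fst (fst w), (snd (fst w), snd w))) : measurable ((borel >< borel) >< E) (borel >< X)"
  by measurable
 from measurable_compose[OF this f] have f': "(%w. f (fst (fst w)) (snd (fst w), snd w)) : Bm ((borel >< borel) >< E)" by simp
 have "(%w. INT+y. rate (fst w) (snd w) y * f (fst w) (snd w, y) d/(case w of (s, x) => fib s x)) : Bm (borel >< borel)"
 proof (rule measurable_kernel_integral[OF fib_kernel measurable_ident_sets[OF refl]])
  have "(%w. rate (fst (fst w)) (snd (fst w)) (snd w)) : Bm ((borel >< borel) >< E)" by measurable
  with f' show "(%(w, y). rate (fst w) (snd w) y * f (fst w) (snd w, y)) : Bm ((borel >< borel) >< E)"
   by (simp add: split_beta')
 qed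
 then show ?thesis unfolding loss_def by (intro lborel.borel_measurable_nn_integral) (simp add: split_beta' cong: measurable_cong_sets)
qed

lemma positive_functional_loss: "positive_functional X (loss s)"
 unfolding loss_def[abs_def]
proof (intro positive_functional_integral)
 have rs: "rate s x : Bm E" for x by measurable
 have fx: "(%y. f (x, y)) : Bm E" if "f : Bm X" for f :: "'v \<times> 'e => ennreal" and x
  using measurable_compose[OF measurable_Pair1'[of x borel E] that] by simp
 show "positive_functional X (%f. rate s x y * f (x, y))" if "y : space (fib s x)" for x y
  using that by (intro positive_functional_scale positive_functionalI) (auto simp: space_pair_measure fib_space)
 show "(%y. rate s x y * f (x, y)) : Bm (fib s x)" if "f : Bm X" for f x
  using rs[of x] fx[OF that, of x] by (simp add: measurable_cong_sets[OF fib_sets refl])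
 show "(%x. INT+y. rate s x y * f (x, y) d/fib s x) : Bm lborel" if "f : Bm X" for f
 proof -
  have "(%p. rate s (fst p) (snd p)) : Bm X" by measurable
  with that show ?thesis
   using measurable_kernel_integral[OF fib_at measurable_ident_sets[OF refl], of "%x y. rate s x y * f (x, y)" s] by (simp add: split_beta')
 qed
qed

lemma K_minus_functional:
 assumes s: "s : lifetime T"
 shows "K_minus E K (\<mu> s) = density (\<mu> s) (%p. rate s (fst p) (snd p))"
proof -
 have r: "(%p. rate s (fst p) (snd p)) : Bm X" by measurable
 have F: "disintegrates E (\<mu> s) (fibre E (\<mu> s))" by (rule disintegrates_fibre[OF standard \<mu>_states[OF s]])
 then have k: "finite_kernel borel E (fibre E (\<mu> s))" by (simp add: disintegrates_def)
 have [measurable_cong]: "sets (fibre E (\<mu> s) x) = sets E" for x by (rule finite_kernel_sets[OF k]) simp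
 have sp: "space (fibre E (\<mu> s) x) = space E" for x by (rule finite_kernel_space[OF k]) simp
 have K2: "(%y'. Em (K y y') (space E)) : Bm E" if "y : space E" for y
  using measurable_compose[OF measurable_Pair1'[OF that] finite_kernel_emeasure[OF K_kernel sets.top]] by simp
 have rs: "rate s x : Bm E" for x by measurable
 have "(INT+x. INT+y. INT+y'. Em (K y y') (space E) * Ind S (x, y) d/fibre E (\<mu> s) x d/fibre E (\<mu> s) x d/lborel) =
  Em (density (\<mu> s) (%p. rate s (fst p) (snd p))) S" if S: "S : sets X" for S
 proof -
  have IS: "(Ind S :: _ => ennreal) : Bm X" using S by simp
  have "(INT+x. INT+y. INT+y'. Em (K y y') (space E) * Ind S (x, y) d/fibre E (\<mu> s) x d/fibre E (\<mu> s) x d/lborel) = loss s (Ind S)"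
   unfolding loss_def
  proof (rule nn_integral_cong_AE)
   show "AE x in lborel. (INT+y. INT+y'. Em (K y y') (space E) * Ind S (x, y) d/fibre E (\<mu> s) x d/fibre E (\<mu> s) x) =
     (INT+y. rate s x y * Ind S (x, y) d/fib s x)"
    using AE_fibre_unique[OF F fib_disintegrates[OF s] finite_\<mu>[OF s]]
   proof eventually_elim
    case (elim x)
    have "(INT+y'. Em (K y y') (space E) * Ind S (x, y) d/fibre E (\<mu> s) x) = rate s x y * Ind S (x, y)" if y: "y : space E" for y
    proof -
     have "(INT+y'. Em (K y y') (space E) * Ind S (x, y) d/fibre E (\<mu> s) x) = (INT+y'. Em (K y y') (space E) d/fibre E (\<mu> s) x) * Ind S (x, y)"
      using K2[OF y] by (intro nn_integral_multc) simp
     also have "... = rate s x y * Ind S (x, y)" using elim K2[OF y] by (simp add: rate_def coag_rate_def fib_def)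
     finally show ?thesis .
    qed
    then have "(INT+y. INT+y'. Em (K y y') (space E) * Ind S (x, y) d/fibre E (\<mu> s) x d/fibre E (\<mu> s) x) = (INT+y. rate s x y * Ind S (x, y) d/fibre E (\<mu> s) x)"
     by (intro nn_integral_cong) (simp add: sp)
    also have "... = (INT+y. rate s x y * Ind S (x, y) d/fib s x)"
     using elim rs[of x] measurable_compose[OF measurable_Pair1'[of x borel E] IS] by simp
    finally show ?case .
   qed
  qed
  also have "... = (INT+p. rate s (fst p) (snd p) * Ind S p d/\<mu> s)" by (rule loss_eq[OF s]) (use S in simp)
  finally show ?thesis
   using r S by (simp add: emeasure_density measurable_cong_sets[OF sets_\<mu>[OF s] refl] sets_\<mu>[OF s])
 qed
 then have "K_minus E K (\<mu> s) = measure_by X (Em (density (\<mu> s) (%p. rate s (fst p) (snd p))))"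
  unfolding K_minus_def by (rule measure_by_cong)
 then show ?thesis using measure_by_emeasure[of "density (\<mu> s) (%p. rate s (fst p) (snd p))"] sets_\<mu>[OF s] by simp
qed

text \<open>The mild equation is stated on sets; both sides are positive functionals, so it extends to
functions, with \<open>K\<^sup>-(\<mu>)\<close> written as \<open>\<mu>\<close> with density the coagulation rate.\<close>

lemma mild_functional:
 assumes t: "t : lifetime T" "0 < t" and f: "f : Bm X"
 shows "(INT+p. f p d/\<mu> t) + (INT+s\<in>{0..t}. loss s (heat_op t s f) d/lborel) = evolve heat_op fib t f"
proof -
 have k: "heat_op = killed_op \<or> heat_op = heat_op" by simp
 have sub: "s : lifetime T" if "s : {0..t}" for s using that lifetime_le[OF t(1)] by simp
 have Hf: "(%s. loss s (heat_op t s f) * Ind {0..t} s) : Bm lborel"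
  if f: "f : Bm X" for f
 proof -
  have "(%z. f (snd z)) : Bm ((borel >< X) >< X)"
   by (rule measurable_compose[OF measurable_snd f])
  then have "(%z. heat_op t (fst z) f (snd z)) : Bm (borel >< X)"
   by (intro measurable_flow[OF k]) simp_all
  from measurable_loss[OF this] show ?thesis by (intro borel_measurable_times_ennreal) auto
 qed
 show ?thesis
 proof (rule positive_functional_eq_if_eq_on_sets[OF _ positive_functional_evolve[OF k fib_kernel] _ f])
  show "positive_functional X (%f. (INT+p. f p d/\<mu> t) + (INT+s\<in>{0..t}. loss s (heat_op t s f) d/lborel))"
  proof (intro positive_functional_plus positive_functional_nn_integral sets_\<mu> t(1) positive_functional_integral Hf)
   fix s
   show "positive_functional X (%f. loss s (heat_op t s f) * Ind {0..t} s)"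
    using positive_functional_scale[OF positive_functional_compose[OF positive_functional_loss[of s], where A="heat_op t s", OF positive_functional_flow[OF k] measurable_flow_const[OF k]], of "Ind {0..t} s"]
    by (simp add: mult.commute)
  qed
  fix S :: "('v \<times> 'e) set" assume S: "S : sets X"
  then have I: "(Ind S :: _ => ennreal) : Bm X" by simp
  have "Em (\<mu> t) S + (INT+s\<in>{0..t}. Em (heat_flow E a (t - s) (K_minus E K (\<mu> s))) S d/lborel) =
   Em (heat_flow E a t (\<mu> 0)) S + (INT+s\<in>{0..t}. Em (heat_flow E a (t - s) (K_plus E K (\<mu> s))) S d/lborel)"
   using strong t S unfolding strong_solution_def mild_equation_def by auto
  moreover have "Em (\<mu> t) S = (INT+p. Ind S p d/\<mu> t)" using S sets_\<mu>[OF t(1)] by simp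
  moreover have "Em (heat_flow E a t (\<mu> 0)) S = (INT+p. heat_op t 0 (Ind S) p d/\<mu> 0)"
   using emeasure_eq_integral[OF sets_heat_flow S, of t] initial_functional(2)[OF t(2) I] t(2) by simp
  moreover have "(INT+s\<in>{0..t}. Em (heat_flow E a (t - s) (K_minus E K (\<mu> s))) S d/lborel) = (INT+s\<in>{0..t}. loss s (heat_op t s (Ind S)) d/lborel)"
  proof (rule nn_integral_cong_AE)
   show "AE s in lborel. Em (heat_flow E a (t - s) (K_minus E K (\<mu> s))) S * Ind {0..t} s = loss s (heat_op t s (Ind S)) * Ind {0..t} s"
    using AE_lborel_singleton[of t]
   proof eventually_elim
    case (elim s)
    show ?case
    proof (cases "s : {0..t}")
     case True
     note s = sub[OF True]
     have st: "s < t" using True elim by auto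
     have r: "(%p. rate s (fst p) (snd p)) : Bm X" by measurable
     have sK: "sets (K_minus E K (\<mu> s)) = sets X" by (simp add: K_minus_functional[OF s] sets_\<mu>[OF s])
     have iK: "(INT+p. g p d/K_minus E K (\<mu> s)) = (INT+p. rate s (fst p) (snd p) * g p d/\<mu> s)" if "g : Bm X" for g
      using r that by (simp add: K_minus_functional[OF s] nn_integral_density measurable_cong_sets[OF sets_\<mu>[OF s] refl])
     have pK: "positive_functional X (%g. INT+p. rate s (fst p) (snd p) * g p d/\<mu> s)"
     proof (rule positive_functional_compose[OF positive_functional_nn_integral[OF sets_\<mu>[OF s]], of _ "%g p. rate s (fst p) (snd p) * g p"])
      show "positive_functional X (%g. rate s (fst p) (snd p) * g p)" if "p : space X" for p
       using that by (intro positive_functional_scale positive_functionalI) auto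
     qed (use r in simp)
     have "Em (heat_flow E a (t - s) (K_minus E K (\<mu> s))) S = (INT+p. Ind S p d/heat_flow E a (t - s) (K_minus E K (\<mu> s)))"
      using st by (intro emeasure_eq_integral[OF sets_heat_flow S]) simp
     also have "... = (INT+p. rate s (fst p) (snd p) * heat_op t s (Ind S) p d/\<mu> s)"
      by (rule propagator_functional(2)[OF pK Fubini_weighted[OF sets_\<mu>[OF s] finite_\<mu>[OF s] sigma_finite_lborel r] iK sK st I])
     also have "... = loss s (heat_op t s (Ind S))"
      by (rule loss_eq[OF s measurable_flow_const[OF k I], symmetric])
     finally show ?thesis by simp
    qed simp
   qed
  qed
  moreover have "(INT+s\<in>{0..t}. Em (heat_flow E a (t - s) (K_plus E K (\<mu> s))) S d/lborel) = (INT+s\<in>{0..t}. gain (fib s) (heat_op t s (Ind S)) d/lborel)"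
  proof (rule nn_integral_cong_AE)
   show "AE s in lborel. Em (heat_flow E a (t - s) (K_plus E K (\<mu> s))) S * Ind {0..t} s = gain (fib s) (heat_op t s (Ind S)) * Ind {0..t} s"
    using AE_lborel_singleton[of t]
   proof eventually_elim
    case (elim s)
    show ?case
    proof (cases "s : {0..t}")
     case True
     then have "s < t" using elim by auto
     then show ?thesis
      using emeasure_eq_integral[OF sets_heat_flow S, of "t - s"] source_functional(2)[OF process_\<mu> sub[OF True] _ I] by (simp add: fib_def)
    qed simp
   qed
  qed
  ultimately show "(INT+p. Ind S p d/\<mu> t) + (INT+s\<in>{0..t}. loss s (heat_op t s (Ind S)) d/lborel) = evolve heat_op fib t (Ind S)"
   by (simp only: evolve_def)
 qed
qed

end

section \<open>A strong solution solves the propagator equation\<close>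

lemma small_integral_near:
 fixes g :: "real => ennreal"
 assumes g[measurable]: "g : Bm borel" and fin: "(INT+r. g r d/lborel) < \<infinity>"
 shows "\<exists>\<epsilon>>0. (INT+r\<in>{\<tau>..\<tau> + \<epsilon>}. g r d/lborel) <= 1 / 2"
proof -
 define F where "F n r = g r * Ind {\<tau>..\<tau> + 1 / real (Suc n)} r" for n r
 have [measurable]: "F n : Bm lborel" for n unfolding F_def by simp
 have dec: "decseq F"
 proof (intro decseq_SucI le_funI)
  fix n r
  have "1 / real (Suc (Suc n)) <= 1 / real (Suc n)" by (intro divide_left_mono) auto
  then show "F (Suc n) r <= F n r" unfolding F_def by (intro mult_left_mono) (auto simp: indicator_def)
 qed
 have lim: "(INF n. F n r) <= g r * Ind {\<tau>} r" for r
 proof (cases "r = \<tau>")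
  case False
  have "\<exists>n. F n r = 0"
  proof (cases "\<tau> < r")
   case True
   then obtain n where "1 / real (Suc n) < r - \<tau>" using reals_Archimedean[of "r - \<tau>"] by (auto simp: inverse_eq_divide)
   then have "F n r = 0" by (simp add: F_def)
   then show ?thesis ..
  qed (use False in \<open>auto simp: F_def\<close>)
  then obtain n where "F n r = 0" ..
  then have "(INF n. F n r) <= 0" by (metis INF_lower UNIV_I)
  then show ?thesis by simp
 qed (auto simp: F_def intro!: INF_lower2[of 0])
 have "(INT+r. F 0 r d/lborel) <= (INT+r. g r d/lborel)" by (intro nn_integral_mono) (simp add: F_def indicator_def)
 then have "(INF n. integral\<^sup>N lborel (F n)) = (INT+r. (INF n. F n r) d/lborel)"
  using fin by (intro nn_integral_monotone_convergence_INF_decseq[symmetric, where i=0] dec) auto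
 also have "... <= (INT+r. g r * Ind {\<tau>} r d/lborel)" by (intro nn_integral_mono lim)
 also have "... = 0" by (rule nn_integral_null_set) (auto intro: null_setsI)
 finally have "(INF n. integral\<^sup>N lborel (F n)) < 1 / 2" by (simp add: ennreal_zero_less_divide)
 then obtain n where "integral\<^sup>N lborel (F n) < 1 / 2" by (auto simp: INF_less_iff)
 then show ?thesis by (intro exI[of _ "1 / real (Suc n)"]) (simp add: F_def[abs_def])
qed

text \<open>At the first time \<open>\<tau>\<close> where \<open>u\<close> fails to vanish, the integral of \<open>g\<close> over a short interval is below
one half, so \<open>u\<close> is at most half its supremum there. The hypothesis is phrased without an integral
of \<open>u\<close>, since \<open>u\<close> will be a supremum over functions and need not be measurable.\<close>

lemma gronwall_zero:
 fixes g u :: "real => ennreal"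
 assumes g[measurable]: "g : Bm borel" and fin: "(INT+r\<in>{0..t0}. g r d/lborel) < \<infinity>"
  and B: "B < \<infinity>" "!!s. s : {0..t0} ==> u s <= B"
  and step: "!!\<tau> t C. 0 <= \<tau> ==> \<tau> <= t ==> t <= t0 ==> (!!s. 0 <= s ==> s < \<tau> ==> u s = 0) ==>
   (!!s. \<tau> <= s ==> s <= t ==> u s <= C) ==> u t <= C * (INT+r\<in>{\<tau>..t}. g r d/lborel)"
  and t: "t : {0..t0}"
 shows "u t = 0"
proof (rule ccontr)
 assume "u t \<noteq> 0"
 define A where "A = {s : {0..t0}. u s \<noteq> 0}"
 define \<tau> where "\<tau> = Inf A"
 have A: "A \<noteq> {}" "bdd_below A" using t \<open>u t \<noteq> 0\<close> by (auto simp: A_def intro!: bdd_belowI[of _ 0])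
 have \<tau>: "0 <= \<tau>" "\<tau> <= t0"
  using t \<open>u t \<noteq> 0\<close> cInf_greatest[OF A(1), of 0] cInf_lower[OF _ A(2), of t] by (auto simp: \<tau>_def A_def)
 have before: "u s = 0" if "0 <= s" "s < \<tau>" for s
  using cInf_lower[OF _ A(2), of s] that \<tau> by (auto simp: \<tau>_def A_def)
 obtain \<epsilon> where \<epsilon>: "0 < \<epsilon>" "(INT+r\<in>{\<tau>..\<tau> + \<epsilon>}. g r * Ind {0..t0} r d/lborel) <= 1 / 2"
  using small_integral_near[of "%r. g r * Ind {0..t0} r" \<tau>] fin by auto
 define e where "e = min (\<tau> + \<epsilon>) t0"
 define C where "C = (SUP s\<in>{\<tau>..e}. u s)"
 have le: "C <= C * (1 / 2)" unfolding C_def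
 proof (rule SUP_least)
  fix s assume s: "s : {\<tau>..e}"
  have "u s <= C * (INT+r\<in>{\<tau>..s}. g r d/lborel)"
   using s \<tau> before by (intro step) (auto simp: e_def C_def intro!: SUP_upper)
  also have "... <= C * (1 / 2)"
   using s \<tau> by (intro mult_left_mono order_trans[OF nn_integral_mono \<epsilon>(2)]) (auto simp: e_def indicator_def)
  finally show "u s <= (SUP s\<in>{\<tau>..e}. u s) * (1 / 2)" by (simp add: C_def)
 qed
 have "C < \<infinity>"
 proof (rule le_less_trans[OF _ B(1)])
  show "C <= B" unfolding C_def using \<tau> by (intro SUP_least B(2)) (auto simp: e_def)
 qed
 then obtain c where c: "C = ennreal c" "0 <= c" by (cases C) auto
 have half: "1 / 2 = ennreal (1 / 2)" using divide_ennreal[of 1 2] by simp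
 have "ennreal c <= ennreal (c * (1 / 2))"
  using le unfolding c(1) half by (subst ennreal_mult'', simp)
 then have "C = 0" using c by simp
 obtain s where "s : A" "s < \<tau> + \<epsilon>" using cInf_lessD[OF A(1), of "\<tau> + \<epsilon>"] \<epsilon>(1) by (auto simp: \<tau>_def)
 moreover have "\<tau> <= s" using \<open>s : A\<close> A(2) by (auto simp: \<tau>_def intro: cInf_lower)
 ultimately have "u s <= C" unfolding C_def by (intro SUP_upper) (auto simp: e_def A_def)
 then show False using \<open>C = 0\<close> \<open>s : A\<close> by (simp add: A_def)
qed

context strong_coagulation
begin

lemma flow_instances: "killed_op = killed_op \<or> killed_op = heat_op" "heat_op = killed_op \<or> heat_op = heat_op"
 by simp_all

lemmas measurable_killed = measurable_flow[OF flow_instances(1)] measurable_flow_const[OF flow_instances(1)]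
lemmas measurable_heat = measurable_flow[OF flow_instances(2)] measurable_flow_const[OF flow_instances(2)]

lemma section_measurable: "f : Bm X ==> (%y. f (x, y)) : Bm E"
 using measurable_compose[OF measurable_Pair1'[of x borel E]] by simp

lemma space_\<mu>: "t : lifetime T ==> space (\<mu> t) = space X"
 by (rule sets_eq_imp_space_eq[OF sets_\<mu>])

lemma evolve_cong_AE:
 assumes \<k>: "finite_kernel (borel >< borel) E (%(t, x). \<k> t x)"
  and f: "f : Bm X" and g: "g : Bm X"
  and AE: "AE x in lborel. \<forall>y\<in>space E. f (x, y) = g (x, y)"
 shows "evolve killed_op \<k> t f = evolve killed_op \<k> t g"
proof -
 have eq: "killed_op t s f p = killed_op t s g p" if "p : space X" for s p
  unfolding killed_op_def using AE that by (intro nn_integral_cong_AE) (auto simp: space_pair_measure elim!: eventually_mono)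
 then show ?thesis
  unfolding evolve_def
  by (intro arg_cong2[where f="(+)"] nn_integral_cong arg_cong2[where f="(*)"] refl
    positive_functional_cong[OF positive_functional_gain[OF kernel_at[OF \<k>]]] measurable_killed f g)
   (simp_all add: space_\<mu>[OF zero_lifetime])
qed

lemma integral_\<mu>:
 "t : lifetime T ==> f : Bm X ==> (INT+p. f p d/\<mu> t) = (INT+x. INT+y. f (x, y) d/fib t x d/lborel)"
 by (rule disintegrates_nn_integral[OF fib_disintegrates sets_\<mu> finite_\<mu>])

lemma mass_bounded:
 assumes t: "t : lifetime T"
 shows "\<exists>M<\<infinity>. \<forall>s\<in>{0..t}. Em (\<mu> s) (space (\<mu> s)) <= M"
proof -
 obtain c where c: "0 < c" "!!y. y : space E ==> ennreal c <= W y" using W_ge by auto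
 obtain M where M: "M < \<infinity>" "!!s. s : {0..t} ==> (INT+x. INT+y. W y d/fib s x d/lborel) <= M"
  using total_weight_bounded[OF t] by auto
 have "Em (\<mu> s) (space (\<mu> s)) <= ennreal (1 / c) * M" if s: "s : {0..t}" for s
 proof -
  have l: "s : lifetime T" using s lifetime_le[OF t] by simp
  have "Em (\<mu> s) (space (\<mu> s)) = ennreal (1 / c) * (INT+p. ennreal c d/\<mu> s)"
   using c(1) by (simp add: mult.assoc[symmetric] ennreal_mult'[symmetric])
  also have "... <= ennreal (1 / c) * (INT+p. W (snd p) d/\<mu> s)"
   by (intro mult_left_mono nn_integral_mono c(2)) (auto simp: space_\<mu>[OF l] space_pair_measure)
  also have "... <= ennreal (1 / c) * M" using M(2)[OF s] total_weight[OF l] by (intro mult_left_mono) auto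
  finally show ?thesis .
 qed
 then show ?thesis using M(1) by (intro exI[of _ "ennreal (1 / c) * M"]) (simp add: ennreal_mult_less_top)
qed

lemma heat_op_le:
 assumes p: "p : space X" and le: "!!q. q : space X ==> f q <= b (snd q)"
 shows "heat_op t r f p <= b (snd p)"
proof (cases "r < t")
 case True
 have "heat_op t r f p <= heat_op t r (%q. b (snd q)) p"
  unfolding heat_op_def using p by (intro nn_integral_mono mult_left_mono order_trans[OF le]) (auto simp: space_pair_measure)
 also have "... = b (snd p)" using p True by (intro heat_op_snd) (auto simp: space_pair_measure)
 finally show ?thesis .
qed (simp add: heat_op_def heat_density_def)

lemma measurable_absorbed:
 assumes f: "f : Bm X"
 shows "(%z. rate (fst z) (fst (snd z)) (snd (snd z)) * heat_op t (fst z) f (snd z)) : Bm (borel >< X)"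
 by (intro borel_measurable_times_ennreal measurable_rate measurable_heat(1) measurable_compose[OF measurable_snd f]) measurable

context
 fixes n :: nat and t0 :: real
 assumes t0: "t0 : lifetime T"
begin

definition light :: "'v \<times> 'e => ennreal" where "light p = (if W (snd p) <= of_nat n then 1 else 0)"
definition tests :: "('v \<times> 'e => ennreal) set" where
 "tests = {f : Bm X. \<forall>p\<in>space X. f p <= light p}"
definition gap :: "real => ennreal" where
 "gap t = (if t = 0 then 0 else SUP f\<in>tests. max (evolve killed_op fib t f - (INT+p. f p d/\<mu> t)) ((INT+p. f p d/\<mu> t) - evolve killed_op fib t f))"
definition speed :: "real => ennreal" where "speed r = of_nat n * (rate_bound * envelope r)"

lemma measurable_light: "light : Bm X"
proof -
 have m: "(%p. W (snd p)) : Bm X" by (rule measurable_compose[OF measurable_snd W_measurable])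
 then have "(%p. if W (snd p) <= of_nat n then 1 else 0 :: ennreal) : Bm X"
  by (intro measurable_If measurable_const borel_measurable_le) simp_all
 then show ?thesis by (simp add: light_def[abs_def])
qed

lemma tests_le_1: "f : tests ==> p : space X ==> f p <= 1"
 by (rule order_trans[of _ "light p"]) (auto simp: tests_def light_def)

lemma measurable_speed[measurable]: "speed : Bm borel"
 unfolding speed_def[abs_def] by measurable

lemma speed_integral: "(INT+r\<in>{0..t0}. speed r d/lborel) < \<infinity>"
proof -
 have "(INT+r\<in>{0..t0}. speed r d/lborel) = (of_nat n * rate_bound) * (INT+r\<in>{0..t0}. envelope r d/lborel)"
  unfolding speed_def by (subst nn_integral_cmult[symmetric]) (auto simp: mult_ac)
 then show ?thesis using envelope_integral[OF t0] rate_bound(1) by (simp add: ennreal_mult_less_top of_nat_less_top)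
qed

lemma gap_le:
 assumes "0 < r" "f : tests"
 shows "evolve killed_op fib r f <= (INT+p. f p d/\<mu> r) + gap r" "(INT+p. f p d/\<mu> r) <= evolve killed_op fib r f + gap r"
proof -
 have "max (evolve killed_op fib r f - (INT+p. f p d/\<mu> r)) ((INT+p. f p d/\<mu> r) - evolve killed_op fib r f) <= gap r"
  unfolding gap_def using assms by (auto intro!: SUP_upper2[of f])
 then show "evolve killed_op fib r f <= (INT+p. f p d/\<mu> r) + gap r" "(INT+p. f p d/\<mu> r) <= evolve killed_op fib r f + gap r"
  by (auto simp: ennreal_minus_le_iff)
qed

text \<open>On particles of weight at most \<open>n\<close> the absorbed mass is a test function up to the factor \<open>speed\<close>,
so that it is controlled by the gap again. The rate bound holds for almost all positions only, whence
the truncation of \<open>q\<close> to \<open>q'\<close>.\<close>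

lemma gap_absorbed:
 fixes t :: real
 assumes r: "0 < r" "r <= t0" "speed r < \<infinity>" and f: "f : tests"
 defines "q \<equiv> %p. rate r (fst p) (snd p) * heat_op t r f p"
 shows "evolve killed_op fib r q <= loss r (heat_op t r f) + speed r * gap r"
  and "loss r (heat_op t r f) <= evolve killed_op fib r q + speed r * gap r"
  and "loss r (heat_op t r f) <= speed r * Em (\<mu> r) (space (\<mu> r))"
proof -
 have rl: "r : lifetime T" using r lifetime_le[OF t0] by simp
 have fm: "f : Bm X" and fl: "!!p. p : space X ==> f p <= light p" using f by (auto simp: tests_def)
 define q' where "q' p = min (q p) (speed r * light p)" for p
 have q: "q : Bm X"
  unfolding q_def using measurable_compose[OF measurable_Pair1'[of r borel X] measurable_absorbed[OF fm]] by simp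
 have q': "q' : Bm X" unfolding q'_def[abs_def] using q measurable_light by measurable
 have AE: "AE x in lborel. \<forall>y\<in>space E. q (x, y) = q' (x, y)"
  using rate_AE[of r]
 proof eventually_elim
  case (elim x)
  show ?case
  proof
   fix y assume y: "y : space E"
   then have xy: "(x, y) : space X" by (simp add: space_pair_measure)
   have "heat_op t r f (x, y) <= (if W (snd (x, y)) <= of_nat n then 1 else 0)"
    by (rule heat_op_le[OF xy]) (use fl in \<open>simp add: light_def\<close>)
   then have "q (x, y) <= (W y * (rate_bound * envelope r)) * (if W y <= of_nat n then 1 else 0)"
    unfolding q_def using elim y by (intro mult_mono) auto
   also have "... <= speed r * light (x, y)" by (auto simp: speed_def light_def intro!: mult_right_mono)
   finally show "q (x, y) = q' (x, y)" by (simp add: q'_def)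
  qed
 qed
 have loss: "loss r (heat_op t r f) = (INT+p. q' p d/\<mu> r)"
  unfolding loss_eq[OF rl measurable_heat(2)[OF fm]] q_def[symmetric] integral_\<mu>[OF rl q] integral_\<mu>[OF rl q']
  using AE by (intro nn_integral_cong_AE) (auto intro!: nn_integral_cong simp: fib_space elim!: eventually_mono)
 have ev: "evolve killed_op fib r q = evolve killed_op fib r q'" by (rule evolve_cong_AE[OF fib_kernel q q' AE])
 define \<psi> where "\<psi> p = q' p / speed r" for p
 have \<psi>: "\<psi> : tests"
  unfolding tests_def mem_Collect_eq \<psi>_def[abs_def]
 proof (intro conjI ballI)
  fix p show "q' p / speed r <= light p"
  proof (cases "speed r = 0")
   case False
   have "q' p / speed r <= light p * speed r / speed r"
    by (intro divide_right_mono_ennreal) (simp add: q'_def mult.commute)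
   then show ?thesis using False r(3) by (simp add: ennreal_mult_divide_eq less_top)
  qed (simp add: q'_def)
 qed (use q' in measurable)
 have \<psi>m: "\<psi> : Bm X" using \<psi> by (simp add: tests_def)
 have q'\<psi>: "q' p = speed r * \<psi> p" for p
  using r(3) by (cases "speed r = 0") (simp add: q'_def, simp add: \<psi>_def ennreal_times_divide ennreal_mult_divide_eq mult.commute[of "speed r"] less_top)
 have s1: "evolve killed_op fib r q' = speed r * evolve killed_op fib r \<psi>"
  unfolding q'\<psi>[abs_def] by (rule positive_functional_cmult[OF positive_functional_evolve[OF flow_instances(1) fib_kernel] \<psi>m])
 have s2: "(INT+p. q' p d/\<mu> r) = speed r * (INT+p. \<psi> p d/\<mu> r)"
  unfolding q'\<psi>[abs_def] by (rule positive_functional_cmult[OF positive_functional_nn_integral[OF sets_\<mu>[OF rl]] \<psi>m])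
 show "evolve killed_op fib r q <= loss r (heat_op t r f) + speed r * gap r" "loss r (heat_op t r f) <= evolve killed_op fib r q + speed r * gap r"
  unfolding ev loss s1 s2 distrib_left[symmetric] by (intro mult_left_mono gap_le r \<psi>; simp)+
 have "(INT+p. \<psi> p d/\<mu> r) <= (INT+p. 1 d/\<mu> r)"
  by (intro nn_integral_mono tests_le_1[OF \<psi>]) (simp add: space_\<mu>[OF rl])
 then show "loss r (heat_op t r f) <= speed r * Em (\<mu> r) (space (\<mu> r))" unfolding loss s2 by (intro mult_left_mono) auto
qed

lemma gap_zero: "t : {0..t0} ==> gap t = 0"
proof -
 obtain M where M: "M < \<infinity>" "!!s. s : {0..t0} ==> Em (\<mu> s) (space (\<mu> s)) <= M"
  using mass_bounded[OF t0] by auto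
 define S where "S = M * (INT+r\<in>{0..t0}. speed r d/lborel)"
 have S: "S < \<infinity>" using M(1) speed_integral by (simp add: S_def ennreal_mult_less_top)
 have finite_speed: "AE r in lborel. r : {0..t0} \<longrightarrow> speed r < \<infinity>"
  using nn_integral_noteq_infinite[of "%r. speed r * Ind {0..t0} r" lborel] speed_integral
  by (auto elim!: eventually_mono simp: indicator_def less_top split: if_splits)
 let ?q = "%t f r p. rate r (fst p) (snd p) * heat_op t r f p"
 let ?X = "%t f. INT+r\<in>{0..t}. loss r (heat_op t r f) d/lborel"
 let ?Y = "%t f. INT+r\<in>{0..t}. evolve killed_op fib r (?q t f r) d/lborel"
 have balance: "evolve killed_op fib t f + ?Y t f = (INT+p. f p d/\<mu> t) + ?X t f"
  if "0 < t" "t <= t0" "f : tests" for t f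
  using that evolve_duhamel[OF fib_kernel lifetime_le[OF t0], of t f] mild_functional[OF lifetime_le[OF t0], of t f] by (simp add: tests_def)
 have X: "?X t f <= S" if t: "0 < t" "t <= t0" and f: "f : tests" for t f
 proof -
  have "?X t f <= (INT+r. M * (speed r * Ind {0..t0} r) d/lborel)"
  proof (rule nn_integral_mono_AE)
   show "AE r in lborel. loss r (heat_op t r f) * Ind {0..t} r <= M * (speed r * Ind {0..t0} r)"
    using finite_speed AE_lborel_singleton[of 0]
   proof eventually_elim
    case (elim r)
    have "loss r (heat_op t r f) <= M * speed r" if "r : {0..t}"
    proof -
     have "loss r (heat_op t r f) <= speed r * Em (\<mu> r) (space (\<mu> r))"
      using that elim t f by (intro gap_absorbed(3)) auto
     also have "... <= speed r * M" using that t by (intro mult_left_mono M(2)) auto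
     finally show ?thesis by (simp add: mult.commute)
    qed
    then show ?case using t by (auto simp: indicator_def)
   qed
  qed
  also have "... = S" unfolding S_def using measurable_speed by (intro nn_integral_cmult borel_measurable_times_ennreal) auto
  finally show ?thesis .
 qed
 have mu: "(INT+p. f p d/\<mu> t) <= M" if "0 < t" "t <= t0" "f : tests" for t f
 proof -
  have "(INT+p. f p d/\<mu> t) <= (INT+p. 1 d/\<mu> t)"
   using that by (intro nn_integral_mono tests_le_1[of f]) (simp_all add: space_\<mu>[OF lifetime_le[OF t0]])
  then show ?thesis using M(2)[of t] that by simp
 qed
 have meas_X: "(%r. loss r (heat_op t r f)) : Bm borel" if "f : tests" for t f
 proof -
  have "(%z. f (snd z)) : Bm ((borel >< X) >< X)" using that measurable_compose[OF measurable_snd] by (auto simp: tests_def)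
  then show ?thesis by (intro measurable_loss measurable_heat) simp_all
 qed
 have meas_Y: "(%r. evolve killed_op fib r (?q t f r)) : Bm borel" if "f : tests" for t f
  using that measurable_absorbed[of f t] by (intro measurable_evolve[OF flow_instances(1) fib_kernel]) (auto simp: tests_def)
 assume t: "t : {0..t0}"
 show "gap t = 0"
 proof (rule gronwall_zero[OF measurable_speed speed_integral _ _ _ t])
  show "M + S < \<infinity>" using M(1) S by simp
  fix t assume t: "t : {0..t0}"
  show "gap t <= M + S"
  proof (cases "t = 0")
   case False
   have "max (evolve killed_op fib t f - (INT+p. f p d/\<mu> t)) ((INT+p. f p d/\<mu> t) - evolve killed_op fib t f) <= M + S" if f: "f : tests" for f
   proof -
    have t': "0 < t" "t <= t0" using t False by auto
    have "evolve killed_op fib t f <= evolve killed_op fib t f + ?Y t f" by simp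
    also have "... <= M + S" unfolding balance[OF t' f] by (intro add_mono mu X t' f)
    finally have "evolve killed_op fib t f <= M + S" .
    moreover have "(INT+p. f p d/\<mu> t) <= M + S" using mu[OF t' f] by (simp add: add_increasing2)
    ultimately show ?thesis by (auto intro: order_trans[OF diff_le_self_ennreal])
   qed
   then show ?thesis using False by (auto simp: gap_def intro!: SUP_least)
  qed (simp add: gap_def)
 next
  fix \<tau> t C assume t: "0 <= \<tau>" "\<tau> <= t" "t <= t0"
   and zero: "!!s. 0 <= s ==> s < \<tau> ==> gap s = 0" and C: "!!s. \<tau> <= s ==> s <= t ==> gap s <= C"
  let ?I = "INT+r\<in>{\<tau>..t}. speed r d/lborel"
  show "gap t <= C * ?I"
  proof (cases "t = 0")
   case False
   then have t': "0 < t" using t by simp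
   have pt: "AE r in lborel. (evolve killed_op fib r (?q t f r) * Ind {0..t} r <= loss r (heat_op t r f) * Ind {0..t} r + C * (speed r * Ind {\<tau>..t} r)) &
     (loss r (heat_op t r f) * Ind {0..t} r <= evolve killed_op fib r (?q t f r) * Ind {0..t} r + C * (speed r * Ind {\<tau>..t} r))" if f: "f : tests" for f
    using finite_speed AE_lborel_singleton[of 0]
   proof eventually_elim
    case (elim r)
    show ?case
    proof (cases "r : {0..t}")
     case True
     have "speed r * gap r <= C * (speed r * Ind {\<tau>..t} r)"
     proof (cases "r < \<tau>")
      case False
      have "speed r * gap r <= speed r * C" using True False C[of r] by (intro mult_left_mono) auto
      then show ?thesis using True False by (simp add: mult.commute)
     qed (use True zero[of r] in simp)
     moreover have r: "0 < r" "r <= t0" "speed r < \<infinity>" using True elim t by auto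
     ultimately show ?thesis
      using True gap_absorbed(1,2)[OF r f, of t] by (simp add: order_trans[OF _ add_left_mono])
    qed (use t in \<open>auto simp: indicator_def\<close>)
   qed
   have CI: "(INT+r. C * (speed r * Ind {\<tau>..t} r) d/lborel) = C * ?I"
    using measurable_speed by (intro nn_integral_cmult borel_measurable_times_ennreal) auto
   have XY: "?Y t f <= ?X t f + C * ?I" "?X t f <= ?Y t f + C * ?I" if f: "f : tests" for f
    unfolding CI[symmetric] using pt[OF f] meas_X[OF f, of t] meas_Y[OF f, of t]
    by (subst nn_integral_add[symmetric]; force intro!: nn_integral_mono_AE)+
   have "max (evolve killed_op fib t f - (INT+p. f p d/\<mu> t)) ((INT+p. f p d/\<mu> t) - evolve killed_op fib t f) <= C * ?I" if f: "f : tests" for f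
   proof -
    let ?e = "evolve killed_op fib t f" and ?m = "INT+p. f p d/\<mu> t"
    note b = balance[OF t' t(3) f]
    have Xf: "?X t f < \<infinity>" and mf: "?m < \<infinity>"
     using X[OF t' t(3) f] S mu[OF t' t(3) f] M(1) by (auto intro: le_less_trans)
    have ef: "?e < \<infinity>" "?Y t f < \<infinity>"
    proof -
     have "?e + ?Y t f < \<infinity>" using b Xf mf by simp
     then show "?e < \<infinity>" "?Y t f < \<infinity>" by simp_all
    qed
    have "?X t f + ?m <= ?X t f + (?e + C * ?I)"
     using b add_left_mono[OF XY(1)[OF f], of ?e] by (simp add: add_ac)
    then have 1: "?m <= ?e + C * ?I" using Xf by (auto simp: ennreal_add_left_cancel_le)
    have "?Y t f + ?e <= ?Y t f + (?m + C * ?I)"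
     using b add_left_mono[OF XY(2)[OF f], of ?m] by (simp add: add_ac)
    then have 2: "?e <= ?m + C * ?I" using ef by (auto simp: ennreal_add_left_cancel_le)
    show ?thesis using 1 2 ef mf by (auto simp: ennreal_minus_le_iff)
   qed
   then show ?thesis using False by (auto simp: gap_def intro!: SUP_least)
  qed (simp add: gap_def)
 qed
qed

end

text \<open>The gap is zero for each bound \<open>n\<close> on the weight, and every particle has finite weight.\<close>

theorem strong_solution_fixed_point:
 assumes t: "t : lifetime T"
 shows "rhs \<mu> t = \<mu> t"
proof (cases "t = 0")
 case False
 then have t': "0 < t" using t by (simp add: lifetime_def)
 show ?thesis
 proof (rule measure_eqI)
  fix S assume "S : sets (rhs \<mu> t)"
  then have S: "S : sets X" by simp
  define F where "F n p = Ind S p * light n p" for n p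
  have F: "F n : tests n" for n
   unfolding F_def[abs_def] tests_def[OF t] mem_Collect_eq
   using S by (auto intro!: borel_measurable_times_ennreal measurable_light[OF t] simp: indicator_def)
  have Fm: "F n : Bm X" for n using F by (simp add: tests_def[OF t])
  have inc: "incseq F"
   by (auto simp: F_def light_def[OF t] incseq_def le_fun_def indicator_def intro: order_trans)
  have sup: "(SUP n. F n p) = Ind S p" if "p : space X" for p
  proof (rule antisym)
   obtain n where "W (snd p) <= of_nat n"
    using ennreal_Ex_less_of_nat[of "W (snd p)"] less_imp_le by (metis W_def ennreal_less_top infinity_ennreal_def)
   then show "Ind S p <= (SUP n. F n p)" by (intro SUP_upper2[of n]) (auto simp: F_def light_def[OF t])
  qed (auto simp: F_def light_def[OF t] intro!: SUP_least)
  have SUPm: "(%p. SUP n. F n p) : Bm X" using Fm by measurable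
  have eq: "evolve killed_op fib t (F n) = (INT+p. F n p d/\<mu> t)" for n
   using gap_le[OF t t' F, of n] gap_zero[OF t, of t n] t' by simp
  have \<Phi>: "\<Psi> (Ind S) = (SUP n. \<Psi> (F n))" if "positive_functional X \<Psi>" for \<Psi>
   using positive_functional_cong[OF that _ SUPm, of "Ind S"] positive_functional_SUP[OF that Fm inc] sup S by simp
  have "Em (rhs \<mu> t) S = evolve killed_op fib t (Ind S)"
   using emeasure_eq_integral[OF sets_rhs S] rhs_functional[OF process_\<mu> t t', of "Ind S"] S by (simp add: fib_def)
  also have "... = (INT+p. Ind S p d/\<mu> t)"
   unfolding \<Phi>[OF positive_functional_evolve[OF flow_instances(1) fib_kernel]] \<Phi>[OF positive_functional_nn_integral[OF sets_\<mu>[OF t]]] eq ..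
  also have "... = Em (\<mu> t) S" using S sets_\<mu>[OF t] by simp
  finally show "Em (rhs \<mu> t) S = Em (\<mu> t) S" .
 qed (simp add: sets_\<mu>[OF t])
qed (simp add: rhs_zero)

end

section \<open>Comparison of processes\<close>

context coagulation_diffusion
begin

lemma states_le:
 fixes \<nu> :: "('v::euclidean_space \<times> 'e) measure"
 assumes \<nu>: "sets \<nu> = sets (borel >< E)" and \<nu>': "\<nu>' : states E"
  and le: "!!S. S : sets (borel >< E) ==> Em \<nu> S <= Em \<nu>' S"
 shows "\<nu> : states E"
proof -
 note sets' = states_sets[OF \<nu>']
 have sp: "space \<nu> = space \<nu>'" "space \<nu>' = space (borel >< E)" using \<nu> sets' by (auto dest: sets_eq_imp_space_eq)
 have "Em \<nu> (space \<nu>) <= Em \<nu>' (space \<nu>')" using le[of "space \<nu>"] sp by simp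
 then have "finite_measure \<nu>"
  using finite_measure.emeasure_finite[OF states_finite[OF \<nu>'], of "space \<nu>'"] by (intro finite_measureI) (auto simp: top_unique)
 moreover have "absolutely_continuous lborel (distr \<nu> borel fst)"
  unfolding absolutely_continuous_def
 proof
  fix N :: "'v set" assume N: "N : null_sets lborel"
  have f: "fst : measurable \<nu> (borel :: 'v measure)" "fst : measurable \<nu>' (borel :: 'v measure)"
   using measurable_fst[of borel E] by (simp_all add: measurable_cong_sets[OF \<nu> refl] measurable_cong_sets[OF sets' refl])
  have "N : null_sets (distr \<nu>' borel fst)" using \<nu>' N by (auto simp: states_def absolutely_continuous_def)
  then have "Em \<nu>' (fst -` N \<inter> space \<nu>') = 0" using emeasure_distr[OF f(2), of N] by (auto simp: null_sets_def)
  moreover have "Em \<nu> (fst -` N \<inter> space \<nu>') <= Em \<nu>' (fst -` N \<inter> space \<nu>')"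
   using measurable_sets[OF f(2), of N] N by (intro le) (auto simp: sets' null_sets_def)
  ultimately show "N : null_sets (distr \<nu> borel fst)"
   using N emeasure_distr[OF f(1), of N] by (auto simp: null_sets_def sp)
 qed
 ultimately show ?thesis using \<nu> by (simp add: states_def)
qed

text \<open>The difference of the two measures is itself a state, so it has fibres, and these
account for the difference of the given ones.\<close>

lemma AE_fibre_split:
 fixes \<nu> :: "('v::euclidean_space \<times> 'e) measure"
 assumes \<nu>: "\<nu> : states E" "disintegrates E \<nu> \<k>" and \<nu>': "\<nu>' : states E" "disintegrates E \<nu>' \<k>'"
  and le: "!!S. S : sets (borel >< E) ==> Em \<nu> S <= Em \<nu>' S"
 shows "\<exists>\<pi>. finite_kernel borel E \<pi> & (AE x in lborel. \<forall>g\<in>Bm E. (INT+y. g y d/\<k>' x) = (INT+y. g y d/\<k> x) + (INT+y. g y d/\<pi> x))"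
proof -
 note s = states_sets[OF \<nu>(1)] states_sets[OF \<nu>'(1)]
 let ?\<pi> = "diff_measure \<nu>' \<nu>"
 have em: "Em ?\<pi> S = Em \<nu>' S - Em \<nu> S" if "S : sets (borel >< E)" for S
  using that s le by (intro emeasure_diff_measure states_finite[OF \<nu>(1)] states_finite[OF \<nu>'(1)]) auto
 have "?\<pi> : states E"
  by (rule states_le[OF _ \<nu>'(1)]) (simp_all add: s em)
 note d = disintegrates_fibre[OF standard this]
 have "AE x in lborel. \<forall>g\<in>Bm E. (INT+y. g y d/\<k>' x) = (INT+y. g y d/\<k> x) + (INT+y. g y d/fibre E ?\<pi> x)"
 proof (rule AE_fibre_add[OF standard \<nu>(2) d \<nu>'(2) states_finite[OF \<nu>'(1)]])
  fix B :: "'v set" and A assume "B : sets borel" "A : sets E"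
  then have "B \<times> A : sets (borel >< E)" by simp
  then show "Em \<nu>' (B \<times> A) = Em \<nu> (B \<times> A) + Em ?\<pi> (B \<times> A)" using le by (simp add: em add_diff_inverse_ennreal)
 qed
 then show ?thesis using d by (auto simp: disintegrates_def)
qed

lemma gain_mono:
 fixes \<k> \<k>' :: "'v::euclidean_space => 'e measure"
 assumes k: "finite_kernel borel E \<k>" "finite_kernel borel E \<k>'"
  and AE: "AE x in lborel. \<forall>g\<in>Bm E. (INT+y. g y d/\<k> x) <= (INT+y. g y d/\<k>' x)"
  and f: "f : Bm (borel >< E)"
 shows "gain \<k> f <= gain \<k>' f"
proof -
 have f': "(%p. f (fst p, snd p)) : Bm (borel >< E)" using f by simp
 have "AE x in lborel. (INT+y. INT+y'. INT+z. f (x, z) d/K y y' d/\<k> x d/\<k> x) <= (INT+y. INT+y'. INT+z. f (x, z) d/K y y' d/\<k>' x d/\<k>' x)"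
  using AE
 proof eventually_elim
  case (elim x)
  have "(INT+y'. INT+z. f (x, z) d/K y y' d/\<k> x) <= (INT+y'. INT+z. f (x, z) d/K y y' d/\<k>' x)" if y: "y : space E" for y
  proof -
   have "(%y'. ((x, y), y')) : measurable E ((borel >< E) >< E)" using y by simp
   from measurable_compose[OF this measurable_gain_inner(1)[where f="%x z. f (x, z)", OF k(1) f']] show ?thesis using elim by simp
  qed
  then have "(INT+y. INT+y'. INT+z. f (x, z) d/K y y' d/\<k> x d/\<k> x) <= (INT+y. INT+y'. INT+z. f (x, z) d/K y y' d/\<k>' x d/\<k> x)"
   by (intro nn_integral_mono) (simp add: finite_kernel_space[OF k(1)])
  also have "... <= (INT+y. INT+y'. INT+z. f (x, z) d/K y y' d/\<k>' x d/\<k>' x)"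
   using elim measurable_compose[OF measurable_Pair1'[of x borel E] measurable_gain_inner(2)[where f="%x z. f (x, z)", OF k(2) f']] by simp
  finally show ?case .
 qed
 then show ?thesis unfolding gain_def by (intro mult_left_mono nn_integral_mono_AE) auto
qed

end

context strong_coagulation
begin

lemma process_at:
 fixes \<nu> :: "real => ('v \<times> 'e) measure"
 assumes "process E T \<nu>"
 shows "t : lifetime T ==> \<nu> t : states E" "finite_kernel borel E (fibs \<nu> t)"
  "t : lifetime T ==> disintegrates E (\<nu> t) (fibs \<nu> t)"
 using assms kernel_at[OF process_fibre(1)[OF standard assms]] process_fibre(2)[OF standard assms] by (auto simp: process_def)

lemma process_split:
 fixes \<nu> \<nu>' :: "real => ('v \<times> 'e) measure"
 assumes \<nu>: "process E T \<nu>" "process E T \<nu>'" and t: "t : lifetime T"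
  and le: "!!S. S : sets X ==> Em (\<nu> t) S <= Em (\<nu>' t) S"
 shows "\<exists>\<pi>. finite_kernel borel E \<pi> & (AE x in lborel. \<forall>g\<in>Bm E.
  (INT+y. g y d/fibs \<nu>' t x) = (INT+y. g y d/fibs \<nu> t x) + (INT+y. g y d/\<pi> x))"
 by (rule AE_fibre_split[OF process_at(1)[OF \<nu>(1) t] process_at(3)[OF \<nu>(1) t] process_at(1)[OF \<nu>(2) t] process_at(3)[OF \<nu>(2) t]])
  (rule le)

lemma rhs_mono:
 fixes \<nu> \<nu>' :: "real => ('v \<times> 'e) measure"
 assumes \<nu>: "process E T \<nu>" "process E T \<nu>'" and t: "t : lifetime T" and S: "S : sets X"
  and le: "!!s S. s : lifetime T ==> S : sets X ==> Em (\<nu> s) S <= Em (\<nu>' s) S"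
 shows "Em (rhs \<nu> t) S <= Em (rhs \<nu>' t) S"
proof (cases "t = 0")
 case False
 then have t': "0 < t" using t by (simp add: lifetime_def)
 have I: "(Ind S :: _ => ennreal) : Bm X" using S by simp
 have "evolve killed_op (fibs \<nu>) t (Ind S) <= evolve killed_op (fibs \<nu>') t (Ind S)"
  unfolding evolve_def
 proof (intro add_left_mono nn_integral_mono)
  fix s
  show "gain (fibs \<nu> s) (killed_op t s (Ind S)) * Ind {0..t} s <= gain (fibs \<nu>' s) (killed_op t s (Ind S)) * Ind {0..t} s"
  proof (cases "s : {0..t}")
   case True
   then have s: "s : lifetime T" using lifetime_le[OF t] by simp
   obtain \<pi> where "AE x in lborel. \<forall>g\<in>Bm E.
     (INT+y. g y d/fibs \<nu>' s x) = (INT+y. g y d/fibs \<nu> s x) + (INT+y. g y d/\<pi> x)"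
    using process_split[OF \<nu> s] le[OF s] by blast
   then have "AE x in lborel. \<forall>g\<in>Bm E. (INT+y. g y d/fibs \<nu> s x) <= (INT+y. g y d/fibs \<nu>' s x)"
    by eventually_elim simp
   then show ?thesis by (intro mult_right_mono gain_mono process_at \<nu> measurable_killed I) auto
  qed simp
 qed
 then show ?thesis
  using emeasure_eq_integral[OF sets_rhs S] rhs_functional[OF \<nu>(1) t t' I] rhs_functional[OF \<nu>(2) t t' I] by simp
qed (simp add: rhs_zero)

primrec approx :: "nat => real => ('v \<times> 'e) measure" where
 "approx 0 = (%t. null_measure X)"
| "approx (Suc k) = rhs (approx k)"

lemma process_rhs:
 fixes \<nu> :: "real => ('v \<times> 'e) measure"
 assumes \<nu>: "process E T \<nu>"
  and le: "!!s S. s : lifetime T ==> S : sets X ==> Em (\<nu> s) S <= Em (\<mu> s) S"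
 shows "t : lifetime T ==> S : sets X ==> Em (rhs \<nu> t) S <= Em (\<mu> t) S"
  and "process E T (rhs \<nu>)"
proof -
 show le': "Em (rhs \<nu> t) S <= Em (\<mu> t) S" if "t : lifetime T" "S : sets X" for t S
  by (subst strong_solution_fixed_point[OF that(1), symmetric]) (rule rhs_mono[OF \<nu> process_\<mu> that], rule le)
 show "process E T (rhs \<nu>)"
  unfolding process_def
 proof (intro conjI ballI)
  show "rhs \<nu> t : states E" if "t : lifetime T" for t
   using le'[OF that] by (intro states_le[OF _ \<mu>_states[OF that]]) simp_all
  fix B :: "'v set" and A assume "B : sets borel" "A : sets E"
  then have BA: "B \<times> A : sets X" by simp
  then have I: "(Ind (B \<times> A) :: _ => ennreal) : Bm X" by simp
  have "(%t. if t = 0 then Em (\<mu> 0) (B \<times> A) else evolve killed_op (fibs \<nu>) t (Ind (B \<times> A))) : Bm borel"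
   by (intro measurable_If measurable_evolve[OF flow_instances(1) process_fibre(1)[OF standard \<nu>]]
     measurable_compose[OF measurable_snd I]) simp_all
  then have "(%t. if t = 0 then Em (\<mu> 0) (B \<times> A) else evolve killed_op (fibs \<nu>) t (Ind (B \<times> A))) : Bm (restrict_space borel (lifetime T))"
   by (rule measurable_restrict_space1)
  moreover have "Em (rhs \<nu> t) (B \<times> A) =
    (if t = 0 then Em (\<mu> 0) (B \<times> A) else evolve killed_op (fibs \<nu>) t (Ind (B \<times> A)))" if "t : lifetime T" for t
   using that emeasure_eq_integral[OF sets_rhs BA] rhs_functional[OF \<nu> that _ I]
   by (cases "t = 0") (auto simp: lifetime_def rhs_zero)
  ultimately show "(%t. Em (rhs \<nu> t) (B \<times> A)) : Bm (restrict_space borel (lifetime T))"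
   by (subst measurable_cong) (auto simp: space_restrict_space)
 qed
qed

lemma approx_process: "process E T (approx k)"
 and approx_le: "t : lifetime T ==> S : sets X ==> Em (approx k t) S <= Em (\<mu> t) S"
proof -
 have "process E T (approx k) & (\<forall>t\<in>lifetime T. \<forall>S\<in>sets X. Em (approx k t) S <= Em (\<mu> t) S)"
 proof (induction k)
  case 0
  have "null_measure X : states E" if "t : lifetime T" for t
   by (rule states_le[OF _ \<mu>_states[OF that]]) simp_all
  then show ?case by (simp add: process_def)
 next
  case (Suc k)
  then have k: "process E T (approx k)" "!!t S. t : lifetime T ==> S : sets X ==> Em (approx k t) S <= Em (\<mu> t) S" by auto
  show ?case unfolding approx.simps by (intro conjI ballI process_rhs(2)[OF k] process_rhs(1)[OF k])
 qed
 then show "process E T (approx k)" "t : lifetime T ==> S : sets X ==> Em (approx k t) S <= Em (\<mu> t) S" by blast+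
qed

lemma approx_mono: "t : lifetime T ==> S : sets X ==> Em (approx k t) S <= Em (approx (Suc k) t) S"
proof (induction k arbitrary: t S)
 case (Suc k)
 have "Em (rhs (approx k) t) S <= Em (rhs (approx (Suc k)) t) S"
  by (rule rhs_mono[OF approx_process approx_process Suc.prems]) (rule Suc.IH)
 then show ?case by simp
qed simp

lemma approx_le_solution:
 assumes \<nu>: "propagator_solution E a K T \<mu> (\<mu> 0) \<nu>" and "t : lifetime T" "S : sets X"
 shows "Em (approx k t) S <= Em (\<nu> t) S"
 using assms(2,3)
proof (induction k arbitrary: t S)
 case (Suc k)
 have \<nu>p: "process E T \<nu>" "\<nu> t = rhs \<nu> t" using \<nu> Suc.prems by (auto simp: propagator_solution_def)
 have "Em (rhs (approx k) t) S <= Em (rhs \<nu> t) S"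
  by (rule rhs_mono[OF approx_process \<nu>p(1) Suc.prems]) (rule Suc.IH)
 then show ?case using \<nu>p(2) by simp
qed simp

lemma iterate_eq_approx: "t : lifetime T ==> propagator_iterate E a K T \<mu> (\<mu> 0) k t = approx (Suc k) t"
proof (induction k arbitrary: t)
 case 0
 show ?case
 proof (cases "t = 0")
  case False
  then have t': "0 < t" using 0 by (simp add: lifetime_def)
  have P: "process E T (%_. null_measure X)" using approx_process[of 0] by simp
  have null: "gain (fibs (%_. null_measure X) s) f = 0" if s: "s : lifetime T" and f: "f : Bm X" for s f
  proof -
   have d: "disintegrates E (null_measure X) (%_ :: 'v. null_measure E)"
    by (auto simp: disintegrates_def finite_kernel_def kernel_def intro!: finite_measureI)
   have "gain (fibs (%_. null_measure X) s) f = gain (%_ :: 'v. null_measure E) f"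
    using d by (intro gain_cong_AE f process_at(2)[OF P] AE_fibre_unique[OF process_at(3)[OF P s] d]) (auto simp: disintegrates_def intro!: finite_measureI)
   then show ?thesis by (simp add: gain_def)
  qed
  show ?thesis
  proof (rule measure_eqI)
   show "sets (propagator_iterate E a K T \<mu> (\<mu> 0) 0 t) = sets (approx (Suc 0) t)" using False by (simp add: sets_propagator)
   fix S assume "S : sets (propagator_iterate E a K T \<mu> (\<mu> 0) 0 t)"
   then have S: "S : sets X" using False by (simp add: sets_propagator)
   then have I: "(Ind S :: _ => ennreal) : Bm X" by simp
   have "(INT+s\<in>{0..t}. gain (fibs (%_. null_measure X) s) (killed_op t s (Ind S)) d/lborel) = (INT+s. 0 d/(lborel :: real measure))"
    using lifetime_le[OF 0] by (intro nn_integral_cong) (auto simp: indicator_def null measurable_killed I)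
   then show "Em (propagator_iterate E a K T \<mu> (\<mu> 0) 0 t) S = Em (approx (Suc 0) t) S"
    using emeasure_eq_integral[OF sets_propagator S] emeasure_eq_integral[OF sets_rhs S] initial_functional(1)[OF t' I] rhs_functional[OF P 0 t' I] False
    by (simp add: evolve_def)
  qed
 qed (simp add: rhs_zero propagator_def)
next
 case (Suc k)
 have "rhs (propagator_iterate E a K T \<mu> (\<mu> 0) k) t = rhs (approx (Suc k)) t"
  unfolding propagator_rhs_def
 proof (intro measure_by_cong arg_cong2[where f="(+)"] refl nn_integral_cong)
  fix S s
  show "Em (propagator E a K T \<mu> t s (K_plus E K (propagator_iterate E a K T \<mu> (\<mu> 0) k s))) S * Ind {0..t} s =
    Em (propagator E a K T \<mu> t s (K_plus E K (approx (Suc k) s))) S * Ind {0..t} s"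
   using Suc.IH[of s] lifetime_le[OF Suc.prems, of s] by (cases "s : {0..t}") auto
 qed
 then show ?case by simp
qed

section \<open>No weight is lost in the limit of the iterates\<close>

text \<open>Sublinearity means that \<open>\<phi> r / r\<close> decreases, which makes \<open>\<phi>\<close> subadditive; the factor \<open>a\<close> only
decreases in a coagulation, and by symmetry it does so with respect to both partners.\<close>

lemma weight_subadditive:
 assumes y: "y : space E" "y' : space E"
 shows "AE z in K y y'. W z <= W y + W y'"
proof -
 have \<phi>: "\<phi> (u + v) <= \<phi> u + \<phi> v" if uv: "0 < u" "0 < v" for u v
 proof -
  have *: "u / (u + v) * \<phi> (u + v) <= \<phi> u" if "0 < u" "0 < v" for u v
  proof -
   have "\<phi> (u + v) <= (u + v) / u * \<phi> u" using \<phi>_sublinear[of "(u + v) / u" u] that by simp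
   then have "u / (u + v) * \<phi> (u + v) <= u / (u + v) * ((u + v) / u * \<phi> u)" using that by (intro mult_left_mono) auto
   moreover have "u + v \<noteq> 0" using that by linarith
   ultimately show ?thesis using that by simp
  qed
  have "\<phi> (u + v) = u / (u + v) * \<phi> (u + v) + v / (v + u) * \<phi> (v + u)"
   using uv by (simp add: add.commute[of v] distrib_right[symmetric] add_divide_distrib[symmetric])
  also have "... <= \<phi> u + \<phi> v" using uv by (intro add_mono *)
  finally show ?thesis .
 qed
 have "AE z in K y y'. a z <= a y" "AE z in K y y'. a z <= a y'"
  using a_decreasing y K_symmetric[OF y] unfolding K_decreasing_def by metis+
 moreover have "AE z in K y y'. z : space E" by (rule AE_I2) (simp add: K_space[OF y])
 ultimately show ?thesis using K_mass_preserving[OF y]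
 proof eventually_elim
  case (elim z)
  let ?d = "real DIM('v) / 2"
  have "a z powr ?d * \<phi> (m z) <= a z powr ?d * (\<phi> (m y) + \<phi> (m y'))"
   using elim(4) \<phi> m_pos y by (intro mult_left_mono) auto
  also have "... <= a y powr ?d * \<phi> (m y) + a y' powr ?d * \<phi> (m y')"
   unfolding distrib_left using elim a_pos[OF elim(3)] \<phi>_pos[OF m_pos[OF y(1)]] \<phi>_pos[OF m_pos[OF y(2)]]
   by (intro add_mono mult_right_mono powr_mono2) auto
  finally show ?case using weight_pos[OF y(1)] weight_pos[OF y(2)] by (simp add: W_def weight_def ennreal_plus[symmetric] del: ennreal_plus)
 qed
qed

definition produced :: "'e => 'e => ennreal" where "produced y y' = (INT+z. W z d/K y y')"
definition consumed :: "'e => 'e => ennreal" where "consumed y y' = W y * Em (K y y') (space E)"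
definition pairing :: "'e measure => 'e measure => ('e => 'e => ennreal) => ennreal" where
 "pairing M N f = (INT+y. INT+y'. f y y' d/N d/M)"

lemma measurable_produced: "(%p. produced (fst p) (snd p)) : Bm (E >< E)"
 unfolding produced_def by (intro measurable_K_integral) (auto simp: split_beta' intro: measurable_compose[OF measurable_snd])

lemma measurable_consumed: "(%p. consumed (fst p) (snd p)) : Bm (E >< E)"
 unfolding consumed_def using finite_kernel_emeasure[OF K_kernel sets.top]
 by (intro borel_measurable_times_ennreal measurable_compose[OF measurable_fst W_measurable]) (simp add: split_beta')

lemma produced_le: "y : space E ==> y' : space E ==> produced y y' <= consumed y y' + consumed y' y"
proof -
 assume y: "y : space E" "y' : space E"
 have "produced y y' <= (INT+z. W y + W y' d/K y y')"
  unfolding produced_def by (intro nn_integral_mono_AE weight_subadditive y)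
 then show ?thesis using K_symmetric[OF y] K_space[OF y] by (simp add: consumed_def distrib_right)
qed

lemma produced_sym: "y : space E ==> y' : space E ==> produced y y' = produced y' y"
 using K_symmetric[of y y'] by (simp add: produced_def)

lemma consumed_le: "y : space E ==> y' : space E ==> consumed y y' <= (W y * W y) * W y'"
 using mult_left_mono[OF K_total_le[of y y'], of "W y"] by (simp add: consumed_def mult.assoc)

lemma half_double: "(1 / 2 :: ennreal) * (x + x) = x"
proof -
 have "(1 / 2 :: ennreal) * 2 = 1" by (simp add: ennreal_divide_times)
 then show ?thesis by (simp add: mult_2[symmetric] mult.assoc[symmetric])
qed

text \<open>With \<open>N' = N + P\<close>, expand both quadratic forms. The new pairs produce at most as much weight as
they consume, and the rate at which the missing particles \<open>P\<close> would consume \<open>N\<close> is bounded by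
\<open>consumed_le\<close>.\<close>

lemma pairing_inequality:
 assumes s: "sets N = sets E" "sets N' = sets E" "sets P = sets E"
  and fin: "finite_measure N" "finite_measure N'" "finite_measure P"
  and split: "!!g. g : Bm E ==> (INT+y. g y d/N') = (INT+y. g y d/N) + (INT+y. g y d/P)"
 shows "(1 / 2) * pairing N' N' produced + pairing N N' consumed <=
  (1 / 2) * pairing N N produced + pairing N' N' consumed + (INT+y. W y * W y d/N') * (INT+y. W y d/P)"
proof -
 define ok where "ok M \<longleftrightarrow> M : {N, N', P}" for M
 have ok: "ok N" "ok N'" "ok P" by (auto simp: ok_def)
 have okD: "sets M = sets E" "space M = space E" "sigma_finite_measure M" if "ok M" for M
  using that s fin by (auto simp: ok_def finite_measure.axioms dest: sets_eq_imp_space_eq)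
 have inner: "(%y. INT+y'. f y y' d/M) : Bm E" "!!y. y : space E ==> f y : Bm E"
  if M: "ok M" and f: "(%p. f (fst p) (snd p)) : Bm (E >< E)" for M f
 proof -
  have "(%p. f (fst p) (snd p)) : Bm (E >< M)"
   using f by (simp add: measurable_cong_sets[OF sets_pair_measure_cong[OF refl okD(1)[OF M]] refl])
  then show "(%y. INT+y'. f y y' d/M) : Bm E"
   by (intro sigma_finite_measure.borel_measurable_nn_integral okD(3) M) (simp add: split_beta')
  show "f y : Bm E" if "y : space E" for y
   using measurable_compose[OF measurable_Pair1'[OF that] f] by simp
 qed
 have add1: "pairing N' M f = pairing N M f + pairing P M f"
  if "ok M" "(%p. f (fst p) (snd p)) : Bm (E >< E)" for M f
  unfolding pairing_def by (rule split[OF inner(1)[OF that]])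
 have add2: "pairing M N' f = pairing M N f + pairing M P f"
  if M: "ok M" and f: "(%p. f (fst p) (snd p)) : Bm (E >< E)" for M f
 proof -
  have "pairing M N' f = (INT+y. (INT+y'. f y y' d/N) + (INT+y'. f y y' d/P) d/M)"
   unfolding pairing_def using okD[OF M] inner(2)[OF M f] by (intro nn_integral_cong split) auto
  also have "... = pairing M N f + pairing M P f"
   unfolding pairing_def using inner(1)[OF ok(1) f] inner(1)[OF ok(3) f] by (intro nn_integral_add) (simp_all add: measurable_cong_sets[OF okD(1)[OF M] refl])
  finally show ?thesis .
 qed
 have swap: "pairing M M' f = pairing M' M (%y y'. f y' y)"
  if M: "ok M" "ok M'" and f: "(%p. f (fst p) (snd p)) : Bm (E >< E)" for M M' f
 proof -
  interpret pair_sigma_finite M M' using okD(3) M by (simp add: pair_sigma_finite_def)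
  have "(%p. f (fst p) (snd p)) : Bm (M >< M')"
   using f by (simp add: measurable_cong_sets[OF sets_pair_measure_cong[OF okD(1)[OF M(1)] okD(1)[OF M(2)]] refl])
  then show ?thesis unfolding pairing_def using Fubini'[of f] by (simp add: split_beta')
 qed
 have le: "pairing M M' produced <= pairing M M' consumed + pairing M' M consumed" if M: "ok M" "ok M'" for M M'
 proof -
  have c': "(%p. consumed (snd p) (fst p)) : Bm (E >< E)"
   using measurable_compose[OF measurable_Pair[OF measurable_snd measurable_fst] measurable_consumed] by simp
  have "pairing M M' produced <= pairing M M' (%y y'. consumed y y' + consumed y' y)"
   unfolding pairing_def using okD(2) M by (intro nn_integral_mono produced_le) auto
  also have "... = pairing M M' consumed + pairing M M' (%y y'. consumed y' y)"
  proof -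
   have "pairing M M' (%y y'. consumed y y' + consumed y' y) = (INT+y. (INT+y'. consumed y y' d/M') + (INT+y'. consumed y' y d/M') d/M)"
    unfolding pairing_def using okD(1,2) M inner(2)[OF M(2) measurable_consumed] inner(2)[OF M(2), of "%y y'. consumed y' y"] c'
    by (intro nn_integral_cong nn_integral_add) (simp_all add: measurable_cong_sets[OF okD(1)[OF M(2)] refl])
   then show ?thesis
    unfolding pairing_def using inner(1)[OF M(2) measurable_consumed] inner(1)[OF M(2), of "%y y'. consumed y' y"] c'
    by (simp add: nn_integral_add measurable_cong_sets[OF okD(1)[OF M(1)] refl])
  qed
  also have "pairing M M' (%y y'. consumed y' y) = pairing M' M consumed" by (rule swap[OF M(2,1) measurable_consumed, symmetric])
  finally show ?thesis .
 qed
 have "pairing P N produced = pairing N P (%y y'. produced y' y)" by (rule swap[OF ok(3,1) measurable_produced])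
 also have "... = pairing N P produced"
  unfolding pairing_def using okD(2) ok by (intro nn_integral_cong produced_sym) auto
 finally have sym: "pairing P N produced = pairing N P produced" .
 note p = measurable_produced and c = measurable_consumed
 have quad: "(1 / 2) * pairing N' N' produced = (1 / 2) * pairing N N produced + (pairing N P produced + (1 / 2) * pairing P P produced)"
 proof -
  have "(1 / 2) * ((u + v) + (v + w)) = (1 / 2) * u + ((1 / 2) * (v + v) + (1 / 2) * w)" for u v w :: ennreal
   by (simp only: distrib_left add_ac)
  then show ?thesis unfolding add1[OF ok(2) p] add2[OF ok(1) p] add2[OF ok(3) p] sym half_double by simp
 qed
 have "pairing N P produced + (1 / 2) * pairing P P produced <= (pairing N P consumed + pairing P N consumed) + (1 / 2) * (pairing P P consumed + pairing P P consumed)"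
  by (intro add_mono mult_left_mono le ok) auto
 then have 1: "pairing N P produced + (1 / 2) * pairing P P produced <= pairing N P consumed + pairing P N consumed + pairing P P consumed"
  unfolding half_double .
 have 2: "pairing N P consumed <= (INT+y. W y * W y d/N') * (INT+y. W y d/P)"
 proof -
  have "pairing N P consumed <= (INT+y. INT+y'. (W y * W y) * W y' d/P d/N)"
   unfolding pairing_def using okD(2) ok by (intro nn_integral_mono consumed_le) auto
  also have "... = (INT+y. W y * W y d/N) * (INT+y. W y d/P)"
   by (simp add: nn_integral_cmult nn_integral_multc measurable_cong_sets[OF s(1) refl] measurable_cong_sets[OF s(3) refl] borel_measurable_times_ennreal W_measurable)
  also have "... <= (INT+y. W y * W y d/N') * (INT+y. W y d/P)"
   by (intro mult_right_mono) (simp_all add: split borel_measurable_times_ennreal W_measurable)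
  finally show ?thesis .
 qed
 have "(1 / 2) * pairing N' N' produced + pairing N N' consumed <=
  ((1 / 2) * pairing N N produced + (pairing N P consumed + pairing P N consumed + pairing P P consumed)) + (pairing N N consumed + pairing N P consumed)"
  unfolding quad add2[OF ok(1) c] by (intro add_mono order_refl 1)
 also have "... = (1 / 2) * pairing N N produced + pairing N' N' consumed + pairing N P consumed"
  unfolding add1[OF ok(2) c] add2[OF ok(1) c] add2[OF ok(3) c] by (simp add: add_ac)
 also have "... <= (1 / 2) * pairing N N produced + pairing N' N' consumed + (INT+y. W y * W y d/N') * (INT+y. W y d/P)"
  by (intro add_left_mono 2)
 finally show ?thesis .
qed

end

context strong_coagulation
begin

definition weight_of :: "(real => ('v \<times> 'e) measure) => real => ennreal" where
 "weight_of \<nu> t = (INT+x. INT+y. W y d/fibs \<nu> t x d/lborel)"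
definition absorbed :: "(real => ('v \<times> 'e) measure) => real => ennreal" where
 "absorbed \<nu> t = (INT+x. INT+y. rate t x y * W y d/fibs \<nu> t x d/lborel)"
definition gained :: "(real => ('v \<times> 'e) measure) => real => ennreal" where
 "gained \<nu> t = gain (fibs \<nu> t) (%p. W (snd p))"

lemma measurable_weight: "(%p. W (snd p)) : Bm X" "(%p. rate t (fst p) (snd p) * W (snd p)) : Bm X"
proof -
 show 1: "(%p. W (snd p)) : Bm X" by (rule measurable_compose[OF measurable_snd W_measurable])
 have "(%p. rate t (fst p) (snd p)) : Bm X" by measurable
 with 1 show "(%p. rate t (fst p) (snd p) * W (snd p)) : Bm X" by simp
qed

lemma measurable_functionals:
 assumes \<nu>: "process E T \<nu>"
 shows "weight_of \<nu> : Bm borel" "absorbed \<nu> : Bm borel" "gained \<nu> : Bm borel"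
proof -
 note \<k> = process_fibre(1)[OF standard \<nu>]
 have I: "(%t. INT+x. INT+y. h (t, x) y d/fibs \<nu> t x d/(lborel :: 'v measure)) : Bm borel"
  if "(%(w, y). h w y) : Bm ((borel >< borel) >< E)" for h
  using measurable_kernel_integral[OF \<k> measurable_ident_sets[OF refl] that]
  by (intro lborel.borel_measurable_nn_integral) (simp add: split_beta' cong: measurable_cong_sets)
 have W: "(%w. W (snd w)) : Bm ((borel >< (borel :: 'v measure)) >< E)"
  by (rule measurable_compose[OF measurable_snd W_measurable])
 have R: "(%w. rate (fst (fst w)) (snd (fst w)) (snd w)) : Bm ((borel >< borel) >< E)" by measurable
 show "weight_of \<nu> : Bm borel" using I[of "%w y. W y"] W by (simp add: weight_of_def[abs_def] split_beta')
 show "absorbed \<nu> : Bm borel" using I[of "%w y. rate (fst w) (snd w) y * W y"] W R by (simp add: absorbed_def[abs_def] split_beta')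
 show "gained \<nu> : Bm borel"
  unfolding gained_def[abs_def] by (intro measurable_gain[OF \<k>] measurable_compose[OF measurable_snd measurable_weight(1)])
qed

lemma process_integral:
 fixes \<nu> :: "real => ('v \<times> 'e) measure"
 assumes \<nu>: "process E T \<nu>" and t: "t : lifetime T"
 shows "f : Bm X ==> (INT+p. f p d/\<nu> t) = (INT+x. INT+y. f (x, y) d/fibs \<nu> t x d/lborel)"
  and "weight_of \<nu> t = (INT+p. W (snd p) d/\<nu> t)" "absorbed \<nu> t = (INT+p. rate t (fst p) (snd p) * W (snd p) d/\<nu> t)"
proof -
 note st = process_at(1)[OF \<nu> t]
 show *: "(INT+p. f p d/\<nu> t) = (INT+x. INT+y. f (x, y) d/fibs \<nu> t x d/lborel)" if "f : Bm X" for f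
  by (rule disintegrates_nn_integral[OF process_at(3)[OF \<nu> t] states_sets[OF st] states_finite[OF st] that])
 show "weight_of \<nu> t = (INT+p. W (snd p) d/\<nu> t)" "absorbed \<nu> t = (INT+p. rate t (fst p) (snd p) * W (snd p) d/\<nu> t)"
  using *[OF measurable_weight(1)] *[OF measurable_weight(2)] by (simp_all add: weight_of_def absorbed_def)
qed

text \<open>Heat flow preserves the integral of a function of the type, so that the Duhamel formula tested with
\<open>w\<close> only retains gains and losses.\<close>

lemma weight_balance:
 assumes \<nu>: "process E T \<nu>" "process E T \<nu>'" and eq: "!!s. s : lifetime T ==> \<nu>' s = rhs \<nu> s"
  and t: "t : lifetime T" "0 < t"
 shows "weight_of \<nu>' t + (INT+r\<in>{0..t}. absorbed \<nu>' r d/lborel) = (INT+p. W (snd p) d/\<mu> 0) + (INT+r\<in>{0..t}. gained \<nu> r d/lborel)"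
proof -
 let ?f = "%p :: 'v \<times> 'e. W (snd p)"
 note \<k> = process_fibre(1)[OF standard \<nu>(1)] and f = measurable_weight(1)
 have H: "heat_op t r ?f p = W (snd p)" if "r < t" "p : space X" for r p
  using that by (intro heat_op_snd) (auto simp: space_pair_measure)
 have ev: "evolve killed_op (fibs \<nu>) r g = (INT+p. g p d/\<nu>' r)" if "r : lifetime T" "0 < r" "g : Bm X" for r g
  using rhs_functional[OF \<nu>(1) that] eq[OF that(1)] by simp
 have "(INT+r\<in>{0..t}. evolve killed_op (fibs \<nu>) r (%p. rate r (fst p) (snd p) * heat_op t r ?f p) d/lborel) =
  (INT+r\<in>{0..t}. absorbed \<nu>' r d/lborel)"
 proof (rule nn_integral_cong_AE)
  show "AE r in lborel. evolve killed_op (fibs \<nu>) r (%p. rate r (fst p) (snd p) * heat_op t r ?f p) * Ind {0..t} r = absorbed \<nu>' r * Ind {0..t} r"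
   using AE_lborel_singleton[of 0] AE_lborel_singleton[of t]
  proof eventually_elim
   case (elim r)
   show ?case
   proof (cases "r : {0..t}")
    case True
    then have r: "r : lifetime T" "0 < r" "r < t" using elim lifetime_le[OF t(1)] by auto
    have "evolve killed_op (fibs \<nu>) r (%p. rate r (fst p) (snd p) * heat_op t r ?f p) =
     evolve killed_op (fibs \<nu>) r (%p. rate r (fst p) (snd p) * W (snd p))"
     using measurable_compose[OF measurable_Pair1'[of r borel X] measurable_absorbed[OF f]] H[OF r(3)]
     by (intro positive_functional_cong[OF positive_functional_evolve[OF flow_instances(1) \<k>]] measurable_weight) simp_all
    then show ?thesis using ev[OF r(1,2) measurable_weight(2)] process_integral(3)[OF \<nu>(2) r(1)] by simp
   qed simp
  qed
 qed
 moreover have "evolve heat_op (fibs \<nu>) t ?f = (INT+p. W (snd p) d/\<mu> 0) + (INT+r\<in>{0..t}. gained \<nu> r d/lborel)"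
  unfolding evolve_def
 proof (rule arg_cong2[where f="(+)"], rule nn_integral_cong)
  show "heat_op t 0 ?f p = W (snd p)" if "p : space (\<mu> 0)" for p
   using that t(2) by (intro H) (simp_all add: space_\<mu>[OF zero_lifetime])
 next
  show "(INT+r\<in>{0..t}. gain (fibs \<nu> r) (heat_op t r ?f) d/lborel) = (INT+r\<in>{0..t}. gained \<nu> r d/lborel)"
  proof (rule nn_integral_cong_AE)
  show "AE r in lborel. gain (fibs \<nu> r) (heat_op t r ?f) * Ind {0..t} r = gained \<nu> r * Ind {0..t} r"
   using AE_lborel_singleton[of t]
  proof eventually_elim
   case (elim r)
   then show ?case
    using positive_functional_cong[OF positive_functional_gain[OF process_at(2)[OF \<nu>(1), of r]] measurable_heat(2)[OF f, of t r] f H]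
    by (auto simp: gained_def indicator_def)
  qed
  qed
 qed
 ultimately show ?thesis
  using evolve_duhamel[OF \<k> t f] ev[OF t f] process_integral(2)[OF \<nu>(2) t(1)] by simp
qed

lemma gained_inequality:
 assumes \<nu>: "process E T \<nu>" and t: "t : lifetime T" and fin: "weight_of \<nu> t < \<infinity>"
  and le: "!!S. S : sets X ==> Em (\<nu> t) S <= Em (\<mu> t) S"
 shows "gained \<mu> t + absorbed \<nu> t <= gained \<nu> t + absorbed \<mu> t + envelope t * (weight_of \<mu> t - weight_of \<nu> t)"
proof -
 obtain \<pi> where \<pi>: "finite_kernel borel E \<pi>" and split: "AE x in lborel. \<forall>g\<in>Bm E.
   (INT+y. g y d/fib t x) = (INT+y. g y d/fibs \<nu> t x) + (INT+y. g y d/\<pi> x)"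
  using process_split[OF \<nu> process_\<mu> t le] by (auto simp: fib_def)
 let ?N = "fibs \<nu> t"
 note k = process_at(2)[OF \<nu>, of t] fib_at[of t] \<pi>
 have prod: "(%x. pairing (\<k> x) (\<k> x) produced) : Bm lborel" "gain \<k> (%p. W (snd p)) = (INT+x. (1 / 2) * pairing (\<k> x) (\<k> x) produced d/lborel)"
  if \<k>: "finite_kernel borel E \<k>" for \<k> :: "'v => 'e measure"
 proof -
  show 1: "(%x. pairing (\<k> x) (\<k> x) produced) : Bm lborel"
   using measurable_gain_inner(3)[OF \<k>, of "%x z. W z"] measurable_weight(1) by (simp add: pairing_def produced_def)
  show "gain \<k> (%p. W (snd p)) = (INT+x. (1 / 2) * pairing (\<k> x) (\<k> x) produced d/lborel)"
   unfolding nn_integral_cmult[OF 1] by (simp add: gain_def pairing_def produced_def)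
 qed
 have fibre_meas: "(%x. INT+y. g (x, y) d/\<k> x) : Bm lborel" if "finite_kernel borel E \<k>" "g : Bm X" for \<k> g
  using measurable_kernel_integral[OF that(1) measurable_ident_sets[OF refl], of "%x y. g (x, y)"] that(2) by simp
 have cons: "pairing M (fib t x) consumed = (INT+y. rate t x y * W y d/M)" if "space M = space E" for M x
  unfolding pairing_def
 proof (rule nn_integral_cong)
  fix y assume "y : space M"
  then have y: "y : space E" using that by simp
  have "(%y'. Em (K y y') (space E)) : Bm (fib t x)"
   using measurable_compose[OF measurable_Pair1'[OF y] finite_kernel_emeasure[OF K_kernel sets.top]] by (simp add: measurable_cong_sets[OF fib_sets refl])
  then show "(INT+y'. consumed y y' d/fib t x) = rate t x y * W y"
   unfolding consumed_def rate_def coag_rate_def fib_def[symmetric] by (subst nn_integral_cmult) (simp_all add: mult.commute)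
 qed
 let ?C = "%\<k> x. INT+y. rate t x y * W y d/\<k> x" and ?P = "%\<k> x. (1 / 2) * pairing (\<k> x) (\<k> x) produced"
 have C: "?C \<k> : Bm lborel" if "finite_kernel borel E \<k>" for \<k> :: "'v => 'e measure"
  using fibre_meas[OF that measurable_weight(2)] by simp
 have P: "?P \<k> : Bm lborel" if "finite_kernel borel E \<k>" for \<k> :: "'v => 'e measure"
  using prod(1)[OF that] by simp
 have Wp: "(%x. INT+y. W y d/\<k> x) : Bm lborel" if "finite_kernel borel E \<k>" for \<k> :: "'v => 'e measure"
  using fibre_meas[OF that measurable_weight(1)] by simp
 have "AE x in lborel. ?P (fib t) x + ?C ?N x <= ?P ?N x + ?C (fib t) x + envelope t * (INT+y. W y d/\<pi> x)"
  using split envelope_AE[of t]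
 proof eventually_elim
  case (elim x)
  note s = finite_kernel_sets[OF k(1), of x] finite_kernel_sets[OF k(2), of x] finite_kernel_sets[OF k(3), of x]
  note f = finite_kernel_finite[OF k(1), of x] finite_kernel_finite[OF k(2), of x] finite_kernel_finite[OF k(3), of x]
  have "?P (fib t) x + pairing (?N x) (fib t x) consumed <= ?P ?N x + pairing (fib t x) (fib t x) consumed + (INT+y. W y * W y d/fib t x) * (INT+y. W y d/\<pi> x)"
   using elim(1) s f by (intro pairing_inequality) simp_all
  also have "... <= ?P ?N x + pairing (fib t x) (fib t x) consumed + envelope t * (INT+y. W y d/\<pi> x)"
   using elim(2) by (intro add_left_mono mult_right_mono) simp_all
  finally show ?case using cons[of "?N x" x] cons[of "fib t x" x] finite_kernel_space[OF k(1), of x] by (simp add: fib_space)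
 qed
 then have "(INT+x. ?P (fib t) x + ?C ?N x d/lborel) <= (INT+x. ?P ?N x + ?C (fib t) x + envelope t * (INT+y. W y d/\<pi> x) d/lborel)"
  by (rule nn_integral_mono_AE)
 then have "gained \<mu> t + absorbed \<nu> t <= gained \<nu> t + absorbed \<mu> t + envelope t * (INT+x. INT+y. W y d/\<pi> x d/lborel)"
  unfolding gained_def absorbed_def fib_def[symmetric] prod(2)[OF k(1)] prod(2)[OF k(2)]
  using P[OF k(1)] P[OF k(2)] C[OF k(1)] C[OF k(2)] Wp[OF k(3)] by (simp add: nn_integral_add nn_integral_cmult)
 moreover have "weight_of \<mu> t = weight_of \<nu> t + (INT+x. INT+y. W y d/\<pi> x d/lborel)"
 proof -
  have "weight_of \<mu> t = (INT+x. (INT+y. W y d/?N x) + (INT+y. W y d/\<pi> x) d/lborel)"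
   unfolding weight_of_def fib_def[symmetric] using split by (intro nn_integral_cong_AE) (auto elim!: eventually_mono)
  then show ?thesis using Wp[OF k(1)] Wp[OF k(3)] by (simp add: weight_of_def nn_integral_add)
 qed
 ultimately show ?thesis using fin by (simp add: less_top)
qed

lemma absorbed_le: "absorbed \<mu> t <= envelope t * weight_of \<mu> t"
proof -
 have "absorbed \<mu> t <= (INT+x. envelope t * (INT+y. W y d/fib t x) d/lborel)"
  unfolding absorbed_def fib_def[symmetric]
 proof (rule nn_integral_mono_AE)
  show "AE x in lborel. (INT+y. rate t x y * W y d/fib t x) <= envelope t * (INT+y. W y d/fib t x)"
   using envelope_AE[of t]
  proof eventually_elim
   case (elim x)
   have "(INT+y. rate t x y * W y d/fib t x) <= (INT+y. (W y * W y) * (INT+y. W y d/fib t x) d/fib t x)"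
   proof (rule nn_integral_mono)
    fix y assume "y : space (fib t x)"
    then have "rate t x y * W y <= (W y * (INT+y. W y d/fib t x)) * W y" by (intro mult_right_mono rate_le) (simp_all add: fib_space)
    then show "rate t x y * W y <= (W y * W y) * (INT+y. W y d/fib t x)" by (simp only: mult_ac)
   qed
   also have "... = (INT+y. W y * W y d/fib t x) * (INT+y. W y d/fib t x)"
    by (rule nn_integral_multc) (simp add: measurable_cong_sets[OF fib_sets refl] W_measurable)
   also have "... <= envelope t * (INT+y. W y d/fib t x)" using elim by (intro mult_right_mono) auto
   finally show ?case .
  qed
 qed
 also have "... = envelope t * weight_of \<mu> t"
  unfolding weight_of_def fib_def[symmetric] using measurable_fib_integral[OF W_measurable] by (intro nn_integral_cmult) simp
 finally show ?thesis .
qed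

lemma integral_le:
 assumes "sets \<nu> = sets X" "sets \<nu>' = sets X" "!!S. S : sets X ==> Em \<nu> S <= Em \<nu>' S" "f : Bm X"
 shows "(INT+p. f p d/\<nu>) <= (INT+p. f p d/\<nu>')"
 by (rule positive_functional_le_if_le_on_sets[OF positive_functional_nn_integral[OF assms(1)] positive_functional_nn_integral[OF assms(2)] _ assms(4)])
  (simp add: assms(1-3))

lemma approx_integral_mono:
 assumes t: "t : lifetime T" and f: "f : Bm X"
 shows "(INT+p. f p d/approx k t) <= (INT+p. f p d/approx (Suc k) t)" "(INT+p. f p d/approx k t) <= (INT+p. f p d/\<mu> t)"
proof -
 have s: "sets (approx k t) = sets X" for k by (rule states_sets[OF process_at(1)[OF approx_process t]])
 show "(INT+p. f p d/approx k t) <= (INT+p. f p d/approx (Suc k) t)" by (rule integral_le[OF s s approx_mono[OF t] f])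
 show "(INT+p. f p d/approx k t) <= (INT+p. f p d/\<mu> t)" by (rule integral_le[OF s sets_\<mu>[OF t] approx_le[OF t] f])
qed

lemma weight_of_finite: "t : lifetime T ==> \<exists>M<\<infinity>. \<forall>s\<in>{0..t}. weight_of \<mu> s <= M"
 unfolding weight_of_def fib_def[symmetric] by (rule total_weight_bounded)

definition deficit :: "nat => real => ennreal" where "deficit k t = weight_of \<mu> t - weight_of (approx k) t"

text \<open>The balances of \<open>\<mu>\<close> and of the iterates are subtracted. The loss terms involve two consecutive
iterates and cancel in the limit, as they are increasing and bounded.\<close>

lemma deficit_step:
 assumes t: "t : lifetime T" "0 < t"
 shows "(INF j. deficit j t) <= (INT+r\<in>{0..t}. envelope r * deficit k r d/lborel)"
proof -
 obtain M where M: "M < \<infinity>" "!!s. s : {0..t} ==> weight_of \<mu> s <= M" using weight_of_finite[OF t(1)] by auto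
 have sub: "r : {0..t} ==> r : lifetime T" for r using lifetime_le[OF t(1)] by simp
 let ?I = "%f. INT+r\<in>{0..t}. f r d/lborel" and ?D = "%k r. envelope r * deficit k r"
 note meas = measurable_functionals[OF process_\<mu>] and measa = measurable_functionals[OF approx_process]
 have w_le: "weight_of (approx k) r <= weight_of \<mu> r" "weight_of (approx k) r <= weight_of (approx (Suc k)) r"
  "absorbed (approx k) r <= absorbed \<mu> r" "absorbed (approx k) r <= absorbed (approx (Suc k)) r" if "r : lifetime T" for k r
  using that process_integral(2,3)[OF approx_process that] process_integral(2,3)[OF process_\<mu> that]
   approx_integral_mono[OF that measurable_weight(1)] approx_integral_mono[OF that measurable_weight(2)]
  by (simp_all del: approx.simps)
 have Dm: "?D k : Bm borel" for k unfolding deficit_def using meas(1) measa(1) by measurable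
 have A_fin: "?I (absorbed \<mu>) < \<infinity>"
 proof -
  have "?I (absorbed \<mu>) <= (INT+r. M * (envelope r * Ind {0..t} r) d/lborel)"
   using order_trans[OF absorbed_le mult_left_mono[OF M(2)]] by (intro nn_integral_mono) (auto simp: indicator_def mult.commute)
  also have "... = M * ?I envelope" using measurable_envelope by (intro nn_integral_cmult borel_measurable_times_ennreal) auto
  also have "... < \<infinity>" using M(1) envelope_integral[OF t(1)] by (simp add: ennreal_mult_less_top)
  finally show ?thesis .
 qed
 have A_le: "?I (absorbed (approx k)) <= ?I (absorbed \<mu>)" "?I (absorbed (approx k)) <= ?I (absorbed (approx (Suc k)))" for k
  using w_le(3,4)[OF sub] by (auto intro!: nn_integral_mono simp: indicator_def)
 define V v A where "V = weight_of \<mu> t" and "v k = weight_of (approx k) t" and "A k = ?I (absorbed (approx k))" for k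
 have step: "V + A k <= v (Suc k) + A (Suc k) + ?I (?D k)" for k
 proof -
  have b: "V + ?I (absorbed \<mu>) = (INT+p. W (snd p) d/\<mu> 0) + ?I (gained \<mu>)"
   unfolding V_def by (intro weight_balance process_\<mu> strong_solution_fixed_point[symmetric] t)
  have bk: "v (Suc k) + A (Suc k) = (INT+p. W (snd p) d/\<mu> 0) + ?I (gained (approx k))"
   unfolding v_def A_def by (intro weight_balance approx_process t) simp
  have "?I (gained \<mu>) + A k = ?I (%r. gained \<mu> r + absorbed (approx k) r)"
   unfolding A_def distrib_right using meas measa by (intro nn_integral_add[symmetric]) auto
  also have "... <= ?I (%r. gained (approx k) r + absorbed \<mu> r + ?D k r)"
  proof (rule nn_integral_mono)
   fix r
   show "(gained \<mu> r + absorbed (approx k) r) * Ind {0..t} r <= (gained (approx k) r + absorbed \<mu> r + ?D k r) * Ind {0..t} r"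
   proof (cases "r : {0..t}")
    case True
    have "weight_of (approx k) r < \<infinity>" using w_le(1)[OF sub[OF True], of k] M True by (auto intro: le_less_trans)
    from gained_inequality[OF approx_process sub[OF True] this approx_le[OF sub[OF True]]] True show ?thesis by (simp add: deficit_def)
   qed simp
  qed
  also have "... = ?I (gained (approx k)) + ?I (absorbed \<mu>) + ?I (?D k)"
   unfolding distrib_right using meas measa Dm by (subst nn_integral_add; (subst nn_integral_add)?) auto
  finally have le: "?I (gained \<mu>) + A k <= ?I (gained (approx k)) + ?I (absorbed \<mu>) + ?I (?D k)" .
  have "?I (absorbed \<mu>) + (V + A k) = (V + ?I (absorbed \<mu>)) + A k" by (simp only: add_ac)
  also have "... <= (INT+p. W (snd p) d/\<mu> 0) + (?I (gained (approx k)) + ?I (absorbed \<mu>) + ?I (?D k))"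
   unfolding b add.assoc[of _ "?I (gained \<mu>)"] by (intro add_left_mono le)
  also have "... = ((INT+p. W (snd p) d/\<mu> 0) + ?I (gained (approx k))) + (?I (absorbed \<mu>) + ?I (?D k))" by (simp only: add.assoc)
  also have "... = ?I (absorbed \<mu>) + (v (Suc k) + A (Suc k) + ?I (?D k))" unfolding bk[symmetric] by (simp only: add_ac)
  finally have "?I (absorbed \<mu>) + (V + A k) <= ?I (absorbed \<mu>) + (v (Suc k) + A (Suc k) + ?I (?D k))" .
  then show ?thesis using A_fin by (auto simp: ennreal_add_left_cancel_le)
 qed
 have inc: "incseq A" "incseq v"
  using A_le(2) w_le(2)[OF t(1)] by (auto intro!: incseq_SucI simp: A_def v_def)
 have Dec: "?I (?D j) <= ?I (?D k)" if "k <= j" for j k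
 proof (rule nn_integral_mono)
  fix r
  have "weight_of (approx k) r <= weight_of (approx j) r" if "r : {0..t}"
   using lift_Suc_mono_le[where f="%k. weight_of (approx k) r", OF w_le(2)[OF sub[OF that]] \<open>k <= j\<close>] .
  then show "?D j r * Ind {0..t} r <= ?D k r * Ind {0..t} r"
   by (auto simp: indicator_def deficit_def intro!: mult_left_mono ennreal_minus_mono)
 qed
 define L vs where "L = (SUP k. A k)" and "vs = (SUP k. v k)"
 have L: "L < \<infinity>" using A_fin A_le(1) unfolding L_def A_def by (intro le_less_trans[OF SUP_least A_fin])
 have vs: "vs <= V" unfolding vs_def v_def V_def using w_le(1)[OF t(1)] by (intro SUP_least)
 have "V + A j <= (vs + ?I (?D k)) + L" for j
 proof -
  have "V + A j <= V + A (max j k)" using inc(1) by (intro add_left_mono) (simp add: incseq_def)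
  also have "... <= v (Suc (max j k)) + A (Suc (max j k)) + ?I (?D (max j k))" by (rule step)
  also have "... <= vs + L + ?I (?D k)" unfolding vs_def L_def by (intro add_mono SUP_upper Dec) auto
  finally show ?thesis by (simp add: add_ac)
 qed
 then have "L + V <= L + (vs + ?I (?D k))"
  using ennreal_SUP_add_right[of UNIV V A] by (auto simp: L_def add.commute intro!: SUP_least)
 then have V: "V <= vs + ?I (?D k)" using L by (auto simp: ennreal_add_left_cancel_le)
 have "(INF j. deficit j t) + v j <= V" for j
 proof -
  have "(INF j. deficit j t) + v j <= (V - v j) + v j" unfolding V_def v_def by (intro add_right_mono INF_lower2[of j]) (auto simp: deficit_def)
  also have "... = V" using w_le(1)[OF t(1)] by (simp add: V_def v_def diff_add_cancel_ennreal)
  finally show ?thesis .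
 qed
 then have le: "(INF j. deficit j t) + vs <= V"
  using ennreal_SUP_add_right[of UNIV "INF j. deficit j t" v] by (auto simp: vs_def intro!: SUP_least)
 have "vs + (INF j. deficit j t) <= vs + ?I (?D k)"
  using order_trans[OF le V] unfolding add.commute[of vs "INF j. deficit j t"] .
 moreover have "vs < \<infinity>"
  using t(2) by (intro le_less_trans[OF order_trans[OF vs] M(1)]) (auto simp: V_def intro: M(2))
 ultimately show ?thesis by (auto simp: ennreal_add_left_cancel_le)
qed

lemma deficit_decreasing: "t : lifetime T ==> decseq (%k. deficit k t)"
 using approx_integral_mono(1)[OF _ measurable_weight(1)] process_integral(2)[OF approx_process]
 by (intro decseq_SucI) (auto simp: deficit_def simp del: approx.simps intro!: ennreal_minus_mono)

text \<open>The infimum over the iterates passes through the time integral by monotone convergence, which turns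
the previous bound into the hypothesis of Gronwall's lemma.\<close>

lemma deficit_zero:
 assumes t: "t : lifetime T"
 shows "(INF k. deficit k t) = 0"
proof -
 obtain M where M: "M < \<infinity>" "!!s. s : {0..t} ==> weight_of \<mu> s <= M" using weight_of_finite[OF t] by auto
 note sub = lifetime_le[OF t]
 have "0 <= t" using t by (simp add: lifetime_def)
 have fin: "AE r in lborel. r : {0..t} \<longrightarrow> envelope r < \<infinity>"
  using nn_integral_noteq_infinite[of "%r. envelope r * Ind {0..t} r" lborel] envelope_integral[OF t]
  by (auto elim!: eventually_mono simp: indicator_def less_top split: if_splits)
 show ?thesis
 proof (rule gronwall_zero[OF measurable_envelope envelope_integral[OF t] M(1), where u="%t. INF k. deficit k t" and t=t])
  fix s assume "s : {0..t}"
  then show "(INF k. deficit k s) <= M"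
   using M(2)[of s] by (intro INF_lower2[of 0]) (auto simp: deficit_def intro: order_trans[OF diff_le_self_ennreal])
 next
  fix \<tau> t' C assume t': "0 <= \<tau>" "\<tau> <= t'" "t' <= t" and zero: "!!s. 0 <= s ==> s < \<tau> ==> (INF k. deficit k s) = 0"
   and C: "!!s. \<tau> <= s ==> s <= t' ==> (INF k. deficit k s) <= C"
  show "(INF k. deficit k t') <= C * (INT+r\<in>{\<tau>..t'}. envelope r d/lborel)"
  proof (cases "t' = 0")
   case True
   have "weight_of (approx 1) 0 = weight_of \<mu> 0"
    using process_integral(2)[OF approx_process[of 1] zero_lifetime] process_integral(2)[OF process_\<mu> zero_lifetime] by (simp add: rhs_zero)
   then have "deficit 1 0 = 0" using M(2)[of 0] M(1) \<open>0 <= t\<close> by (simp add: deficit_def diff_eq_0_iff_ennreal le_less_trans)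
   then have "(INF k. deficit k 0) <= 0" by (intro INF_lower2[of 1]) auto
   then show ?thesis using True by simp
  next
   case False
   then have l: "t' : lifetime T" "0 < t'" using t' sub by auto
   let ?F = "%k r. envelope r * deficit k r * Ind {0..t'} r"
   have Dm: "(%r. envelope r * deficit k r) : Bm borel" for k
    unfolding deficit_def using measurable_functionals(1)[OF process_\<mu>] measurable_functionals(1)[OF approx_process[of k]] by measurable
   have Fm: "?F k : Bm lborel" for k
    by (rule borel_measurable_times_ennreal) (use Dm[of k] in simp_all)
   have dec: "decseq ?F"
   proof (intro decseq_SucI le_funI)
    fix k r
    show "?F (Suc k) r <= ?F k r"
     using decseq_SucD[OF deficit_decreasing[OF sub, of r], of k] t'(3) by (auto simp: indicator_def intro!: mult_left_mono)
   qed
   have "(INT+r. ?F 0 r d/lborel) <= (INT+r. M * (envelope r * Ind {0..t} r) d/lborel)"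
   proof (rule nn_integral_mono)
    fix r
    have "envelope r * deficit 0 r <= envelope r * M" if "r : {0..t}"
     unfolding deficit_def by (intro mult_left_mono order_trans[OF diff_le_self_ennreal M(2)[OF that]]) simp
    then show "?F 0 r <= M * (envelope r * Ind {0..t} r)" using t'(3) by (auto simp: indicator_def mult.commute[of M])
   qed
   also have "... = M * (INT+r\<in>{0..t}. envelope r d/lborel)" using measurable_envelope by (intro nn_integral_cmult borel_measurable_times_ennreal) auto
   also have "... < \<infinity>" using M(1) envelope_integral[OF t] by (simp add: ennreal_mult_less_top)
   finally have "(INF k. integral\<^sup>N lborel (?F k)) = (INT+r. (INF k. ?F k r) d/lborel)"
    by (intro nn_integral_monotone_convergence_INF_decseq[symmetric, where i=0] dec Fm)
   moreover have "(INF k. deficit k t') <= (INF k. integral\<^sup>N lborel (?F k))"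
    by (intro INF_greatest deficit_step l)
   moreover have "(INT+r. (INF k. ?F k r) d/lborel) <= (INT+r. C * (envelope r * Ind {\<tau>..t'} r) d/lborel)"
   proof (rule nn_integral_mono_AE)
    show "AE r in lborel. (INF k. ?F k r) <= C * (envelope r * Ind {\<tau>..t'} r)"
     using fin
    proof eventually_elim
     case (elim r)
     show ?case
     proof (cases "r : {0..t'}")
      case True
      have "(%k. deficit k r) \<longlonglongrightarrow> (INF k. deficit k r)"
       using True t' by (intro LIMSEQ_INF deficit_decreasing sub) auto
      then have "(%k. envelope r * deficit k r) \<longlonglongrightarrow> envelope r * (INF k. deficit k r)"
       using True elim t' by (intro ennreal_tendsto_cmult) auto
      then have "(INF k. envelope r * deficit k r) <= envelope r * (INF k. deficit k r)"
       by (rule LIMSEQ_le_const) (auto intro!: INF_lower)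
      also have "... <= C * (envelope r * Ind {\<tau>..t'} r)"
       using True zero[of r] C[of r] by (cases "r < \<tau>") (auto simp: mult.commute[of C] intro!: mult_left_mono)
      finally show ?thesis using True by simp
     qed simp
    qed
   qed
   moreover have "... = C * (INT+r\<in>{\<tau>..t'}. envelope r d/lborel)"
    using measurable_envelope by (intro nn_integral_cmult borel_measurable_times_ennreal) auto
   ultimately show ?thesis by simp
  qed
 qed (use \<open>0 <= t\<close> in simp)
qed

text \<open>A set missed by the iterates with mass \<open>\<delta>\<close> would carry missing weight at least \<open>c \<delta>\<close>.\<close>

lemma approx_limit:
 assumes t: "t : lifetime T" and S: "S : sets X"
 shows "(SUP k. Em (approx k t) S) = Em (\<mu> t) S"
proof (rule antisym)
 show "(SUP k. Em (approx k t) S) <= Em (\<mu> t) S" by (intro SUP_least approx_le t S)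
 obtain c where c: "0 < c" "!!y. y : space E ==> ennreal c <= W y" using W_ge by auto
 let ?g = "%p. W (snd p) - ennreal c * Ind S p"
 have g: "?g : Bm X" using S measurable_weight(1) by measurable
 have dec: "(INT+p. W (snd p) d/\<nu>) = ennreal c * Em \<nu> S + (INT+p. ?g p d/\<nu>)" if s: "sets \<nu> = sets X" for \<nu> :: "('v \<times> 'e) measure"
 proof -
  have "(INT+p. W (snd p) d/\<nu>) = (INT+p. ennreal c * Ind S p + ?g p d/\<nu>)"
  proof (rule nn_integral_cong)
   fix p assume "p : space \<nu>"
   then have "snd p : space E" unfolding sets_eq_imp_space_eq[OF s] by (auto simp: space_pair_measure)
   then have "ennreal c * Ind S p <= W (snd p)" using c(2)[of "snd p"] by (simp add: indicator_def)
   then show "W (snd p) = ennreal c * Ind S p + ?g p" by (simp add: add_diff_inverse_ennreal)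
  qed
  also have "... = ennreal c * Em \<nu> S + (INT+p. ?g p d/\<nu>)"
   using S g s by (subst nn_integral_add) (auto simp: nn_integral_cmult measurable_cong_sets[OF s refl] intro!: borel_measurable_times_ennreal)
  finally show ?thesis .
 qed
 let ?s = "SUP k. Em (approx k t) S"
 have "ennreal c * Em (\<mu> t) S <= ennreal c * ?s + deficit k t" for k
 proof -
  have sk: "sets (approx k t) = sets X" by (rule states_sets[OF process_at(1)[OF approx_process t]])
  let ?V = "INT+p. W (snd p) d/\<mu> t" and ?v = "INT+p. W (snd p) d/approx k t" and ?gk = "INT+p. ?g p d/approx k t"
  obtain M where M: "M < \<infinity>" "\<forall>s\<in>{0..t}. weight_of \<mu> s <= M" using weight_of_finite[OF t] by auto
  have "?v <= weight_of \<mu> t" unfolding process_integral(2)[OF process_\<mu> t] by (rule approx_integral_mono(2)[OF t measurable_weight(1)])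
  also have "... <= M" using M(2) t by (simp add: lifetime_def)
  finally have "?v < \<infinity>" using M(1) by (rule le_less_trans)
  have "?gk + ennreal c * Em (\<mu> t) S <= ?V"
   unfolding dec[OF sets_\<mu>[OF t]] using approx_integral_mono(2)[OF t g, of k] by (simp add: add.commute add_left_mono)
  also have "?V = ?v + deficit k t"
   using approx_integral_mono(2)[OF t measurable_weight(1), of k] process_integral(2)[OF process_\<mu> t] process_integral(2)[OF approx_process t]
   by (simp add: deficit_def add_diff_inverse_ennreal)
  also have "... = ?gk + (ennreal c * Em (approx k t) S + deficit k t)" unfolding dec[OF sk] by (simp add: add_ac)
  finally have "ennreal c * Em (\<mu> t) S <= ennreal c * Em (approx k t) S + deficit k t"
   using \<open>?v < \<infinity>\<close> unfolding dec[OF sk] by (auto simp: ennreal_add_left_cancel_le)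
  also have "... <= ennreal c * ?s + deficit k t" by (intro add_right_mono mult_left_mono SUP_upper) auto
  finally show ?thesis .
 qed
 then have "ennreal c * Em (\<mu> t) S - ennreal c * ?s <= (INF k. deficit k t)"
  using approx_le[OF t S] finite_measure.emeasure_finite[OF finite_\<mu>[OF t], of S]
  by (intro INF_greatest) (auto simp: ennreal_minus_le_iff ennreal_mult_eq_top_iff)
 then have "ennreal c * Em (\<mu> t) S <= ennreal c * ?s"
  using finite_measure.emeasure_finite[OF finite_\<mu>[OF t], of S]
  by (simp add: deficit_zero[OF t] diff_eq_0_iff_ennreal ennreal_mult_less_top less_top)
 then show "Em (\<mu> t) S <= ?s"
  using c(1) by (simp add: ennreal_mult_le_mult_iff)
qed

theorem minimal_solution: "minimal_propagator_solution E a K T \<mu> (\<mu> 0) \<mu>"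
 unfolding minimal_propagator_solution_def
proof (intro conjI allI impI ballI)
 show "propagator_solution E a K T \<mu> (\<mu> 0) \<mu>"
  using process_\<mu> strong_solution_fixed_point by (simp add: propagator_solution_def)
 fix t and S :: "('v \<times> 'e) set" assume t: "t : lifetime T" and S: "S : sets X"
 show "Em (\<mu> t) S <= Em (\<nu>' t) S" if "propagator_solution E a K T \<mu> (\<mu> 0) \<nu>'" for \<nu>'
  unfolding approx_limit[OF t S, symmetric] by (intro SUP_least approx_le_solution that t S)
 have inc: "incseq (%k. Em (approx (Suc k) t) S)" by (intro incseq_SucI approx_mono t S)
 then show "incseq (%k. Em (propagator_iterate E a K T \<mu> (\<mu> 0) k t) S)" unfolding iterate_eq_approx[OF t] .
 have "(%k. Em (approx k t) S) \<longlonglongrightarrow> (SUP k. Em (approx k t) S)"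
  by (intro LIMSEQ_SUP incseq_SucI approx_mono t S)
 then show "(%k. Em (propagator_iterate E a K T \<mu> (\<mu> 0) k t) S) \<longlonglongrightarrow> Em (\<mu> t) S"
  unfolding iterate_eq_approx[OF t] approx_limit[OF t S] by (rule LIMSEQ_Suc)
qed

end

section \<open>Mass distributions\<close>

context strong_coagulation
begin

lemma borel_projections:
 "fst : measurable (borel :: ('v \<times> real) measure) borel" "snd : Bm (borel :: ('v \<times> real) measure)"
 using measurable_fst[of "borel :: 'v measure" "borel :: real measure"] measurable_snd[of "borel :: 'v measure" "borel :: real measure"]
 by (simp_all add: borel_prod)

lemma measurable_mass: "(%p. m (snd p)) : Bm X" "(%p. (fst p, m (snd p))) : measurable X borel"
proof -
 show *: "(%p. m (snd p)) : Bm X" by (rule measurable_compose[OF measurable_snd m_measurable])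
 then show "(%p. (fst p, m (snd p))) : measurable X borel" by (intro borel_measurable_Pair) simp_all
qed

definition in_mass :: "real set => 'v \<times> 'e => ennreal" where "in_mass D p = Ind D (m (snd p))"
definition over :: "('v \<times> real) set => ('v \<times> 'e) set" where "over N = {p : space X. (fst p, m (snd p)) : N}"

lemma measurable_in_mass: "D : sets borel ==> in_mass D : Bm X"
 unfolding in_mass_def[abs_def] by (rule measurable_compose[OF measurable_mass(1) borel_measurable_indicator])

lemma sets_over: "N : sets borel ==> over N : sets X"
 using measurable_sets[OF measurable_mass(2), of N] by (simp add: over_def vimage_def Int_def conj_commute)

text \<open>By conservation of mass, the coagulation of \<open>y\<close> and \<open>y'\<close> produces mass \<open>m y + m y'\<close> only.\<close>

lemma gain_null:
 assumes \<k>: "finite_kernel borel E \<k>" and AE: "AE x in lborel. AE y in \<k> x. AE y' in \<k> x. m y + m y' \<notin> D"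
 shows "gain \<k> (in_mass D) = 0"
proof -
 have "AE x in lborel. (INT+y. INT+y'. INT+z. in_mass D (x, z) d/K y y' d/\<k> x d/\<k> x) = 0"
  using AE
 proof eventually_elim
  case (elim x)
  have sp: "space (\<k> x) = space E" by (rule finite_kernel_space[OF \<k>]) simp
  show ?case
  proof (rule nn_integral_zero')
   show "AE y in \<k> x. (INT+y'. INT+z. in_mass D (x, z) d/K y y' d/\<k> x) = 0"
    using elim AE_space
   proof eventually_elim
    case (elim y)
    then have y: "y : space E" by (simp add: sp)
    show ?case
    proof (rule nn_integral_zero')
     show "AE y' in \<k> x. (INT+z. in_mass D (x, z) d/K y y') = 0"
      using elim(1) AE_space
     proof eventually_elim
      case (elim y')
      then have y': "y' : space E" by (simp add: sp)
      show ?case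
       by (rule nn_integral_zero', use K_mass_preserving[OF y y'] in eventually_elim) (use elim(1) in \<open>simp add: in_mass_def\<close>)
     qed
    qed
   qed
  qed
 qed
 then have "(INT+x. INT+y. INT+y'. INT+z. in_mass D (x, z) d/K y y' d/\<k> x d/\<k> x d/lborel) = 0" by (rule nn_integral_zero')
 then show ?thesis by (simp add: gain_def)
qed

lemma rhs_null:
 fixes \<nu> :: "real => ('v \<times> 'e) measure"
 assumes \<nu>: "process E T \<nu>" and t: "t : lifetime T" "0 < t" and A: "A : sets X" and D: "D : sets borel"
  and le: "!!s p. p : space X ==> killed_op t s (Ind A) p <= in_mass D p"
  and init: "(INT+p. in_mass D p d/\<mu> 0) = 0"
  and gain: "!!s. 0 < s ==> s < t ==> gain (fibs \<nu> s) (in_mass D) = 0"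
 shows "Em (rhs \<nu> t) A = 0"
proof -
 have I: "(Ind A :: _ => ennreal) : Bm X" using A by simp
 have "(INT+p. killed_op t 0 (Ind A) p d/\<mu> 0) <= (INT+p. in_mass D p d/\<mu> 0)"
  by (intro nn_integral_mono le) (simp add: space_\<mu>[OF zero_lifetime])
 moreover have "(INT+s\<in>{0..t}. gain (fibs \<nu> s) (killed_op t s (Ind A)) d/lborel) = 0"
 proof (rule nn_integral_zero')
  show "AE s in lborel. gain (fibs \<nu> s) (killed_op t s (Ind A)) * Ind {0..t} s = 0"
   using AE_lborel_singleton[of 0] AE_lborel_singleton[of t]
  proof eventually_elim
   case (elim s)
   have "gain (fibs \<nu> s) (killed_op t s (Ind A)) <= gain (fibs \<nu> s) (in_mass D)"
    by (intro positive_functional_mono[OF positive_functional_gain[OF process_at(2)[OF \<nu>]]] measurable_killed I measurable_in_mass D le)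
   then show ?case using gain[of s] elim by (auto simp: indicator_def)
  qed
 qed
 ultimately show ?thesis
  using emeasure_eq_integral[OF sets_rhs A] rhs_functional[OF \<nu> t I] init by (simp add: evolve_def)
qed

lemma killed_op_le_1:
 assumes p: "p : space X"
 shows "killed_op t s (Ind A) p <= 1"
proof -
 have "killed_op t s (Ind A) p <= heat_op t s (Ind A) p"
  unfolding killed_op_def heat_op_def using p by (intro nn_integral_mono mult_right_mono killed_density_le) (auto simp: space_pair_measure)
 also have "... <= 1" using heat_op_le[OF p, of "Ind A" "%_. 1"] by (simp add: indicator_def)
 finally show ?thesis .
qed

lemma limit_null:
 assumes "t : lifetime T" "A : sets X" "!!k. Em (approx k t) A = 0"
 shows "Em (\<mu> t) A = 0"
 using approx_limit[OF assms(1,2)] assms(3) by simp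

theorem integer_masses:
 assumes 0: "integer_mass_distribution m (\<mu> 0)" and t: "t : lifetime T"
 shows "integer_mass_distribution m (\<mu> t)"
proof -
 let ?D = "- \<nat> :: real set" and ?A = "{p : space X. m (snd p) \<notin> \<nat>}"
 have "closed (\<nat> :: real set)" by simp
 then have D: "?D : sets borel" by (intro borel_open) (simp add: open_Compl)
 have A: "?A : sets X" using measurable_sets[OF measurable_mass(1) D] by (simp add: vimage_def Int_def conj_commute)
 have AE: "(AE p in \<nu>. m (snd p) : \<nat>) \<longleftrightarrow> Em \<nu> ?A = 0" if "sets \<nu> = sets X" for \<nu> :: "('v \<times> 'e) measure"
  using A that sets_eq_imp_space_eq[OF that] by (subst AE_iff_measurable[of ?A]) auto
 have "Em (approx k t) ?A = 0" if "t : lifetime T" for k t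
  using that
 proof (induction k arbitrary: t)
  case (Suc k)
  show ?case
  proof (cases "t = 0")
   case True
   then show ?thesis using 0 AE[OF sets_\<mu>[OF zero_lifetime]] by (simp add: rhs_zero integer_mass_distribution_def)
  next
   case False
   then have t: "0 < t" using Suc.prems by (simp add: lifetime_def)
   note P = approx_process[of k]
   show ?thesis unfolding approx.simps
   proof (rule rhs_null[OF P Suc.prems t A D])
    show "killed_op t s (Ind ?A) p <= in_mass ?D p" if "p : space X" for s p
    proof (cases "m (snd p) : \<nat>")
     case False
     then show ?thesis using killed_op_le_1[OF that] by (simp add: in_mass_def)
    qed (simp add: killed_op_def)
    have "AE p in \<mu> 0. in_mass ?D p = 0"
     using 0 unfolding integer_mass_distribution_def by eventually_elim (simp add: in_mass_def)
    then show "(INT+p. in_mass ?D p d/\<mu> 0) = 0" by (rule nn_integral_zero')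
    fix s assume s: "0 < s" "s < t"
    then have sl: "s : lifetime T" using lifetime_le[OF Suc.prems] by simp
    let ?\<k> = "fibs (approx k) s"
    have \<k>: "finite_kernel borel E ?\<k>" by (rule process_at(2)[OF P])
    note sk = finite_kernel_sets[OF \<k>]
    have "(INT+p. in_mass ?D p d/approx k s) = (INT+p. Ind ?A p d/approx k s)"
     using sets_eq_imp_space_eq[OF states_sets[OF process_at(1)[OF P sl]]] by (intro nn_integral_cong) (auto simp: in_mass_def indicator_def)
    also have "... = 0" using Suc.IH[OF sl] A states_sets[OF process_at(1)[OF P sl]] by simp
    finally have "(INT+x. INT+y. in_mass ?D (x, y) d/?\<k> x d/lborel) = 0"
     unfolding process_integral(1)[OF P sl measurable_in_mass[OF D]] .
    moreover have "(%x. INT+y. in_mass ?D (x, y) d/?\<k> x) : Bm lborel"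
     using measurable_kernel_integral[OF \<k> measurable_ident_sets[OF refl], of "%x y. in_mass ?D (x, y)"] measurable_in_mass[OF D] by simp
    ultimately have "AE x in lborel. (INT+y. in_mass ?D (x, y) d/?\<k> x) = 0" by (simp add: nn_integral_0_iff_AE)
    then have "AE x in lborel. AE y in ?\<k> x. AE y' in ?\<k> x. m y + m y' \<notin> ?D"
    proof eventually_elim
     case (elim x)
     have "(%y. in_mass ?D (x, y)) : Bm (?\<k> x)"
      using section_measurable[OF measurable_in_mass[OF D], of x] sk[of x] by (simp add: measurable_cong_sets[OF sk refl])
     then have N: "AE y in ?\<k> x. m y : \<nat>"
      using elim by (simp add: nn_integral_0_iff_AE) (auto elim!: eventually_mono simp: in_mass_def indicator_def split: if_splits)
     show ?case using N
     proof eventually_elim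
      case (elim y)
      show ?case using N by eventually_elim (use elim in \<open>simp add: Nats_add\<close>)
     qed
    qed
    then show "gain ?\<k> (in_mass ?D) = 0" by (rule gain_null[OF \<k>])
   qed
  qed
 qed simp
 from limit_null[OF t A this[OF t]] show ?thesis using AE[OF sets_\<mu>[OF t]] by (simp add: integer_mass_distribution_def)
qed

lemma nn_integral_lborel_pair:
 assumes h: "h : Bm (borel :: ('v \<times> real) measure)"
 shows "(INT+q. h q d/lborel) = (INT+x. INT+r. h (x, r) d/lborel d/lborel)"
  and "(INT+q. h q d/lborel) = (INT+r. INT+x. h (x, r) d/lborel d/lborel)"
proof -
 have h': "h : Bm (lborel >< lborel)" 
  unfolding measurable_cong_sets[OF sets_pair_measure_cong[OF sets_lborel sets_lborel] refl] borel_prod by (rule h)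
 show "(INT+q. h q d/lborel) = (INT+x. INT+r. h (x, r) d/lborel d/lborel)"
  using lborel.nn_integral_fst[OF h'] by (simp add: lborel_prod)
 show "(INT+q. h q d/lborel) = (INT+r. INT+x. h (x, r) d/lborel d/lborel)"
  using lborel_pair.nn_integral_snd[OF h'] by (simp add: lborel_prod)
qed

text \<open>The joint law of position and mass has a density. That the law of the mass alone has one would
not be inherited: two particles at the same place could have dependent masses.\<close>

definition ac_law :: "('v \<times> 'e) measure => bool" where
 "ac_law \<nu> \<longleftrightarrow> (\<forall>N\<in>null_sets (lborel :: ('v \<times> real) measure). Em \<nu> (over N) = 0)"

text \<open>For fixed \<open>x\<close>, the set of \<open>r\<close> such that \<open>r + m y'\<close> lies in \<open>D\<close> for a non-negligible set of \<open>y'\<close> is null by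
Tonelli and translation invariance. The joint law does not charge the pairs \<open>(x, r)\<close> obtained.\<close>

lemma ac_law_gain:
 assumes P: "process E T \<nu>" and s: "s : lifetime T" and ac: "ac_law (\<nu> s)" and D: "D : null_sets lborel"
 shows "gain (fibs \<nu> s) (in_mass D) = 0"
proof (rule gain_null)
 let ?\<k> = "fibs \<nu> s"
 show \<k>: "finite_kernel borel E ?\<k>" by (rule process_at(2)[OF P])
 have sk: "sets (?\<k> x) = sets E" "space (?\<k> x) = space E" for x
  using finite_kernel_sets[OF \<k>, of x] finite_kernel_space[OF \<k>, of x] by simp_all
 have Db: "D : sets borel" using D by (simp add: null_sets_def)
 have ID: "(Ind D :: real => ennreal) : Bm borel" using Db by simp
 define h where "h q = (INT+y'. Ind D (m y' + snd q) d/?\<k> (fst q))" for q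
 have ind: "(%w. Ind D (m (snd w) + snd (fst w)) :: ennreal) : Bm ((borel :: ('v \<times> real) measure) >< E)"
 proof -
  have "(%w. m (snd w) + snd (fst w)) : Bm ((borel :: ('v \<times> real) measure) >< E)"
   by (intro borel_measurable_add measurable_compose[OF measurable_snd m_measurable] measurable_compose[OF measurable_fst borel_projections(2)])
  from measurable_compose[OF this ID] show ?thesis .
 qed
 have h: "h : Bm borel"
  unfolding h_def using measurable_kernel_integral[OF \<k> borel_projections(1), of "%q y'. Ind D (m y' + snd q)"] ind by (simp add: split_beta')
 have "(INT+r. h (x, r) d/lborel) = 0" for x
 proof -
  interpret pair_sigma_finite lborel "?\<k> x"
   using finite_kernel_finite[OF \<k>, of x] by (intro pair_sigma_finite.intro) (auto simp: finite_measure.axioms sigma_finite_lborel)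
  have "(%w. ((x, fst w), snd w)) : measurable (lborel >< E) ((borel :: ('v \<times> real) measure) >< E)"
   by (intro measurable_Pair borel_measurable_Pair) simp_all
  from measurable_compose[OF this ind]
  have "(%w. Ind D (m (snd w) + fst w) :: ennreal) : Bm (lborel >< ?\<k> x)"
   by (simp add: measurable_cong_sets[OF sets_pair_measure_cong[OF refl sk(1)] refl])
  then have "(INT+r. h (x, r) d/lborel) = (INT+y'. INT+r. Ind D (m y' + 1 * r) d/lborel d/?\<k> x)"
   unfolding h_def using Fubini'[of "%r y'. Ind D (m y' + r)"] by (simp add: split_beta')
  also have "... = 0"
   using nn_integral_real_affine[of "Ind D" 1] D Db by (simp add: null_sets_def)
  finally show ?thesis .
 qed
 then have "(INT+q. h q d/lborel) = 0" by (simp add: nn_integral_lborel_pair(1)[OF h])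
 then have AEh: "AE q in lborel. h q = 0" using h by (simp add: nn_integral_0_iff_AE)
 define N where "N = {q. h q \<noteq> 0}"
 have "N = h -` (- {0}) \<inter> space borel" by (auto simp: N_def)
 also have "... : sets borel" using h by (rule measurable_sets) simp
 finally have Nb: "N : sets borel" .
 have N0: "N : null_sets lborel" using AE_iff_null_sets[of N lborel] AEh Nb by (auto simp: N_def)
 let ?f = "%p. Ind N (fst p, m (snd p)) :: ennreal"
 have f: "?f : Bm X" by (rule measurable_compose[OF measurable_mass(2) borel_measurable_indicator]) (rule Nb)
 note st = states_sets[OF process_at(1)[OF P s]]
 have "(INT+p. ?f p d/\<nu> s) = (INT+p. Ind (over N) p d/\<nu> s)"
  using sets_eq_imp_space_eq[OF st] by (intro nn_integral_cong) (auto simp: over_def indicator_def)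
 also have "... = 0" using ac N0 sets_over[OF Nb] st by (simp add: ac_law_def)
 finally have "(INT+x. INT+y. ?f (x, y) d/?\<k> x d/lborel) = 0" unfolding process_integral(1)[OF P s f] .
 moreover have "(%x. INT+y. ?f (x, y) d/?\<k> x) : Bm lborel"
  using measurable_kernel_integral[OF \<k> measurable_ident_sets[OF refl], of "%x y. ?f (x, y)"] f by (simp add: split_beta')
 ultimately have "AE x in lborel. (INT+y. ?f (x, y) d/?\<k> x) = 0" by (simp only: nn_integral_0_iff_AE)
 then show "AE x in lborel. AE y in ?\<k> x. AE y' in ?\<k> x. m y + m y' \<notin> D"
 proof eventually_elim
  case (elim x)
  have "(%y. ?f (x, y)) : Bm (?\<k> x)"
   using section_measurable[OF f, of x] unfolding measurable_cong_sets[OF sk(1) refl] .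
  then have "AE y in ?\<k> x. ?f (x, y) = 0" using elim by (simp only: nn_integral_0_iff_AE)
  then show ?case
   using AE_space
  proof eventually_elim
   case (elim y)
   then have "h (x, m y) = 0" by (auto simp: N_def indicator_def split: if_splits)
   moreover have "(%y'. Ind D (m y' + m y) :: ennreal) : Bm (?\<k> x)"
    unfolding measurable_cong_sets[OF sk(1) refl] by (rule measurable_compose[OF borel_measurable_add[OF m_measurable borel_measurable_const] ID])
   ultimately have "AE y' in ?\<k> x. Ind D (m y' + m y) = (0 :: ennreal)" unfolding h_def fst_conv snd_conv by (simp only: nn_integral_0_iff_AE)
   then show ?case by (auto elim!: eventually_mono simp: indicator_def add.commute split: if_splits)
  qed
 qed
qed

text \<open>The transition density of the position makes the joint law absolutely continuous as soon as the
initial masses and those of the coagulation products avoid null sets.\<close>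

lemma ac_law_\<mu>:
 assumes 0: "ac_mass_distribution E m (\<mu> 0)" and t: "t : lifetime T" "0 < t"
 shows "ac_law (\<mu> t)"
proof -
 have init: "(INT+p. in_mass D p d/\<mu> 0) = 0" if D: "D : null_sets lborel" for D
 proof -
  have Db: "D : sets borel" using D by (simp add: null_sets_def)
  let ?A = "{p : space X. m (snd p) : D}"
  have A: "?A : sets X" using measurable_sets[OF measurable_mass(1) Db] by (simp add: vimage_def Int_def conj_commute)
  obtain \<rho> where \<rho>: "kernel (restrict_space borel {0<..}) X \<rho>" "!!r. 0 < r ==> AE z in \<rho> r. m (snd z) = r"
   "!!S. S : sets X ==> Em (\<mu> 0) S = (INT+r\<in>{0<..}. Em (\<rho> r) S d/lborel)"
   using 0 unfolding ac_mass_distribution_def by auto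
  have "(INT+p. in_mass D p d/\<mu> 0) = (INT+p. Ind ?A p d/\<mu> 0)"
   by (intro nn_integral_cong) (auto simp: space_\<mu>[OF zero_lifetime] in_mass_def indicator_def)
  also have "... = (INT+r\<in>{0<..}. Em (\<rho> r) ?A d/lborel)" using A \<rho>(3)[OF A] sets_\<mu>[OF zero_lifetime] by simp
  also have "... = 0"
  proof (rule nn_integral_zero')
   show "AE r in lborel. Em (\<rho> r) ?A * Ind {0<..} r = 0"
    using AE_not_in[OF D]
   proof eventually_elim
    case (elim r)
    show ?case
    proof (cases "0 < r")
     case True
     then have "sets (\<rho> r) = sets X" using \<rho>(1) by (simp add: kernel_def space_restrict_space)
     moreover have "AE z in \<rho> r. z \<notin> ?A" using \<rho>(2)[OF True] by eventually_elim (use elim in auto)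
     ultimately have "Em (\<rho> r) ?A = 0" using A AE_iff_null_sets[of ?A "\<rho> r"] by (simp add: null_sets_def)
     then show ?thesis by simp
    qed simp
   qed
  qed
  finally show ?thesis .
 qed
 have "ac_law (approx k t)" if "t : lifetime T" "0 < t" for k t
  using that
 proof (induction k arbitrary: t)
  case (Suc k)
  note P = approx_process[of k]
  show ?case unfolding ac_law_def
  proof
   fix N :: "('v \<times> real) set" assume N: "N : null_sets lborel"
   then have Nb: "N : sets borel" by (simp add: null_sets_def)
   define h where "h r = (INT+x. Ind N (x, r) d/(lborel :: 'v measure))" for r
   define D where "D = {r. h r \<noteq> 0}"
   have I: "(Ind N :: 'v \<times> real => ennreal) : Bm borel" using Nb by simp
   have Nx: "(%w. Ind N (snd w, fst w) :: ennreal) : Bm (lborel >< lborel)"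
    by (rule measurable_compose[OF _ I], intro borel_measurable_Pair) simp_all
   have h: "h : Bm lborel"
    unfolding h_def using Nx by (intro lborel.borel_measurable_nn_integral) (simp add: split_beta')
   have "D = h -` (- {0}) \<inter> space lborel" by (auto simp: D_def)
   also have "... : sets lborel" using h by (rule measurable_sets) simp
   finally have Db: "D : sets borel" by simp
   have "(INT+r. h r d/lborel) = (INT+q. Ind N q d/lborel)"
    unfolding h_def by (rule nn_integral_lborel_pair(2)[OF I, symmetric])
   also have "... = 0" using N Nb by (simp add: null_sets_def)
   finally have "AE r in lborel. h r = 0" using h by (simp add: nn_integral_0_iff_AE)
   then have D0: "D : null_sets lborel" using AE_iff_null_sets[of D lborel] Db by (auto simp: D_def)
   show "Em (approx (Suc k) t) (over N) = 0" unfolding approx.simps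
   proof (rule rhs_null[OF P Suc.prems sets_over[OF Nb] Db _ init[OF D0]])
    show "killed_op t s (Ind (over N)) p <= in_mass D p" if p: "p : space X" for s p
    proof (cases "m (snd p) : D")
     case False
     have "(%x. (x, m (snd p))) : measurable lborel (borel :: ('v \<times> real) measure)"
      by (intro borel_measurable_Pair) simp_all
     from measurable_compose[OF this I] have "AE x in lborel. Ind N (x, m (snd p)) = (0 :: ennreal)"
      using False by (simp add: D_def h_def nn_integral_0_iff_AE)
     then have "killed_op t s (Ind (over N)) p = 0"
      unfolding killed_op_def by (intro nn_integral_zero') (auto elim!: eventually_mono simp: over_def indicator_def split: if_splits)
     then show ?thesis by simp
    qed (use killed_op_le_1[OF p] in \<open>simp add: in_mass_def\<close>)
    show "gain (fibs (approx k) s) (in_mass D) = 0" if "0 < s" "s < t" for s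
     using that Suc.IH[of s] lifetime_le[OF Suc.prems(1), of s] by (intro ac_law_gain[OF P _ _ D0]) auto
   qed
  qed
 qed (simp add: ac_law_def)
 note ac = this
 show ?thesis unfolding ac_law_def
 proof
  fix N :: "('v \<times> real) set" assume N: "N : null_sets lborel"
  then have "over N : sets X" by (intro sets_over) (simp add: null_sets_def)
  then show "Em (\<mu> t) (over N) = 0" using ac[OF t] N by (intro limit_null[OF t(1)]) (simp_all add: ac_law_def)
 qed
qed

theorem ac_masses:
 assumes 0: "ac_mass_distribution E m (\<mu> 0)" and t: "t : lifetime T"
 shows "ac_mass_distribution E m (\<mu> t)"
proof (cases "t = 0")
 case False
 then have ac: "ac_law (\<mu> t)" using t by (intro ac_law_\<mu>[OF 0]) (auto simp: lifetime_def)
 let ?Y = "(borel :: ('v \<times> real) measure) >< E"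
 let ?g = "%p. ((fst p, m (snd p)), snd p)"
 have gX: "?g : measurable X ?Y" by (intro measurable_Pair measurable_mass) simp
 then have g: "?g : measurable (\<mu> t) ?Y" by (simp add: measurable_cong_sets[OF sets_\<mu>[OF t] refl])
 define h where "h = distr (\<mu> t) ?Y ?g"
 have sh: "sets h = sets ?Y" by (simp add: h_def)
 have fh: "finite_measure h" unfolding h_def by (rule finite_measure.finite_measure_distr[OF finite_\<mu>[OF t] g])
 have "h : states E"
  unfolding states_def absolutely_continuous_def
 proof (intro CollectI conjI sh fh subsetI)
  fix N :: "('v \<times> real) set" assume N: "N : null_sets lborel"
  then have Nb: "N : sets borel" by (simp add: null_sets_def)
  have fm: "fst : measurable h borel" using measurable_fst by (simp add: measurable_cong_sets[OF sh refl])
  have "distr h borel fst = distr (\<mu> t) borel (fst \<circ> ?g)" unfolding h_def by (rule distr_distr[OF measurable_fst g])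
  also have "Em ... N = Em (\<mu> t) ((fst \<circ> ?g) -` N \<inter> space (\<mu> t))"
   by (rule emeasure_distr[OF measurable_comp[OF g measurable_fst] Nb])
  also have "... = Em (\<mu> t) (over N)" by (intro arg_cong[where f="Em (\<mu> t)"]) (auto simp: over_def space_\<mu>[OF t])
  also have "... = 0" using ac N by (simp add: ac_law_def)
  finally show "N : null_sets (distr h borel fst)" using Nb by (simp add: null_sets_def)
 qed
 note dis = disintegrates_fibre[OF standard this]
 let ?\<k> = "fibre E h"
 have \<k>: "finite_kernel borel E ?\<k>" using dis by (simp add: disintegrates_def)
 have sk: "sets (?\<k> q) = sets E" "space (?\<k> q) = space E" for q
  using finite_kernel_sets[OF \<k>, of q] finite_kernel_space[OF \<k>, of q] by simp_all
 \<comment> \<open>restricting the fibre over \<open>(x, r)\<close> to mass \<open>r\<close> changes it for almost no \<open>(x, r)\<close>\<close>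
 define F where "F f q y = (f (fst q, y) * (if m y = snd q & 0 < snd q then 1 else 0) :: ennreal)" for f :: "'v \<times> 'e => ennreal" and q :: "'v \<times> real" and y
 define \<Phi> where "\<Phi> r f = (INT+x. INT+y. F f (x, r) y d/?\<k> (x, r) d/lborel)" for r f
 have Fm: "(%w. F f (fst w) (snd w)) : Bm ?Y" if f: "f : Bm X" for f
 proof -
  have q: "(%w. fst (fst w)) : measurable ?Y borel" "(%w. snd (fst w)) : Bm ?Y" "(%w. m (snd w)) : Bm ?Y"
   by (rule measurable_compose[OF measurable_fst borel_projections(1)] measurable_compose[OF measurable_fst borel_projections(2)]
     measurable_compose[OF measurable_snd m_measurable])+
  have 1: "(%w. f (fst (fst w), snd w)) : Bm ?Y"
   by (rule measurable_compose[OF measurable_Pair[OF q(1) measurable_snd] f])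
  have 2: "(%w. if m (snd w) = snd (fst w) & 0 < snd (fst w) then 1 else 0 :: ennreal) : Bm ?Y"
   using q(2,3) by measurable
  show ?thesis unfolding F_def by (rule borel_measurable_times_ennreal[OF 1 2])
 qed
 have inner: "(%q. INT+y. F f q y d/?\<k> q) : Bm borel" if "f : Bm X" for f
  using measurable_kernel_integral[OF \<k> measurable_ident_sets[OF refl], of "F f"] Fm[OF that] by (simp add: split_beta')
 have pf: "positive_functional X (\<Phi> r)" for r
  unfolding \<Phi>_def[abs_def]
 proof (intro positive_functional_integral)
  show "positive_functional X (%f. F f (x, r) y)" if "y : space (?\<k> (x, r))" for x y
  proof -
   have "positive_functional X (%f. (if m y = r & 0 < r then 1 else 0) * f (x, y))"
    by (intro positive_functional_scale positive_functionalI) (use that in \<open>auto simp: sk space_pair_measure\<close>)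
   then show ?thesis by (simp only: F_def fst_conv snd_conv mult.commute)
  qed
  show "(%y. F f (x, r) y) : Bm (?\<k> (x, r))" if "f : Bm X" for f x
   using measurable_compose[OF measurable_Pair1'[of "(x, r)" borel E] Fm[OF that]] by (simp add: measurable_cong_sets[OF sk(1) refl])
  show "(%x. INT+y. F f (x, r) y d/?\<k> (x, r)) : Bm lborel" if "f : Bm X" for f
   by (rule measurable_compose[OF _ inner[OF that]], intro borel_measurable_Pair) simp_all
 qed
 define \<rho> where "\<rho> r = measure_by X (%S. \<Phi> r (Ind S))" for r
 have em: "Em (\<rho> r) S = \<Phi> r (Ind S)" if "S : sets X" for r S
  unfolding \<rho>_def by (rule emeasure_measure_by_functional[OF pf that])
 have \<Phi>m: "(%r. \<Phi> r f) : Bm lborel" if "f : Bm X" for f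
 proof -
  have "(%w. INT+y. F f (snd w, fst w) y d/?\<k> (snd w, fst w)) : Bm (lborel >< lborel)"
   by (rule measurable_compose[OF _ inner[OF that]], intro borel_measurable_Pair) simp_all
  then show ?thesis unfolding \<Phi>_def by (intro lborel.borel_measurable_nn_integral) (simp add: split_beta')
 qed
 show ?thesis
  unfolding ac_mass_distribution_def
 proof (intro exI conjI allI impI ballI)
  show "kernel (restrict_space borel {0<..}) X \<rho>"
   unfolding kernel_def
  proof (intro conjI ballI)
   fix S assume S: "S : sets X"
   then have "(%r. Em (\<rho> r) S) : Bm borel" using \<Phi>m[of "Ind S"] by (simp add: em)
   then show "(%r. Em (\<rho> r) S) : Bm (restrict_space borel {0<..})" by (rule measurable_restrict_space1)
  qed (simp add: \<rho>_def)
  fix r :: real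
  let ?A = "{p : space X. m (snd p) \<noteq> r}"
  have A: "?A : sets X" using measurable_sets[OF measurable_mass(1), of "- {r}"] by (simp add: vimage_def Int_def conj_commute)
  have F0: "F (Ind ?A) (x, r) y = 0" for x y by (auto simp: F_def indicator_def)
  have "\<Phi> r (Ind ?A) = 0" unfolding \<Phi>_def F0 by simp
  then show "AE z in \<rho> r. m (snd z) = r"
   using A em[OF A] by (intro AE_I[of _ _ ?A]) (auto simp: \<rho>_def sets_eq_imp_space_eq[OF sets_measure_by])
 next
  fix S :: "('v \<times> 'e) set" assume S: "S : sets X"
  then have I: "(Ind S :: _ => ennreal) : Bm X" by simp
  have "(INT+r\<in>{0<..}. Em (\<rho> r) S d/lborel) = (INT+r. \<Phi> r (Ind S) d/lborel)"
   by (intro nn_integral_cong) (auto simp: em[OF S] \<Phi>_def F_def indicator_def)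
  also have "... = (INT+q. INT+y. F (Ind S) q y d/?\<k> q d/lborel)"
   unfolding \<Phi>_def by (rule nn_integral_lborel_pair(2)[OF inner[OF I], symmetric])
  also have "... = (INT+w. F (Ind S) (fst w) (snd w) d/h)"
   using disintegrates_nn_integral[OF dis sh fh Fm[OF I]] by simp
  also have "... = (INT+p. F (Ind S) (fst p, m (snd p)) (snd p) d/\<mu> t)"
   unfolding h_def using Fm[OF I] by (subst nn_integral_distr[OF g]) simp_all
  also have "... = (INT+p. Ind S p d/\<mu> t)"
   by (intro nn_integral_cong) (auto simp: F_def space_\<mu>[OF t] space_pair_measure m_pos)
  also have "... = Em (\<mu> t) S" using S sets_\<mu>[OF t] by simp
  finally show "Em (\<mu> t) S = (INT+r\<in>{0<..}. Em (\<rho> r) S d/lborel)" ..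
 qed
qed (use 0 in simp)

end

section \<open>Conclusion\<close>

theorem theorem6p4:
  fixes E :: "'e measure"
    and m a :: "'e \<Rightarrow> real"
    and K :: "'e \<Rightarrow> 'e \<Rightarrow> 'e measure"
    and \<phi> :: "real \<Rightarrow> real"
    and \<mu>0 :: "('v::euclidean_space \<times> 'e) measure"
    and T :: ennreal
    and \<mu> :: "real \<Rightarrow> ('v \<times> 'e) measure"
  assumes "coagulation_diffusion DIM('v) E m a K \<phi>"
    and "\<mu>0 \<in> states E"
    and "initial_condition E (weight DIM('v) m a \<phi>) \<mu>0"
    and "maximal_strong_solution E m a K \<phi> \<mu>0 T \<mu>"
  shows "minimal_propagator_solution E a K T \<mu> \<mu>0 \<mu> \<and>
    (integer_mass_distribution m \<mu>0 \<longrightarrow>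
       (\<forall>t\<in>lifetime T. integer_mass_distribution m (\<mu> t))) \<and>
    (ac_mass_distribution E m \<mu>0 \<longrightarrow>
       (\<forall>t\<in>lifetime T. ac_mass_distribution E m (\<mu> t)))"
proof (cases "T = 0")
  case True
  then have empty: "lifetime T = {}" by (simp add: lifetime_def)
  have "process E T \<mu>" by (simp add: process_def empty space_restrict_space measurable_def)
  then show ?thesis by (simp add: empty minimal_propagator_solution_def propagator_solution_def)
next
  case False
  then have \<mu>: "strong_solution E m a K \<phi> T \<mu>" "\<mu> 0 = \<mu>0"
    using assms(4) by (auto simp: maximal_strong_solution_def zero_less_iff_neq_zero)
  interpret coagulation_diffusion "DIM('v)" E m a K \<phi> by (rule assms(1))
  interpret strong_coagulation E m a K \<phi> T \<mu> by unfold_locales (rule \<mu>(1))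
  show ?thesis
    using minimal_solution integer_masses ac_masses unfolding \<mu>(2) by auto
qed

end
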